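(* Let $p=p_n$ with $p/n\to y\in(0,\infty)$, let $t_0\in(0,1]$ and $y_t=y/t$ for $t\in[t_0,1]$. For each $n$ let $x_{ij}=x^{(n)}_{ij}$ ($1\le i\le p$, $1\le j\le n$) be independent real random variables with $\mathbb E x_{ij}=0$, $\mathbb E x_{ij}^2=1$, $\mathbb E x_{ij}^4=3$ and $\sup_{i,j,n}\mathbb E|x_{ij}|^{12}<\infty$, and let $\mathbf x_j=(x_{1j},\dots,x_{pj})^\top$. Let $\mathbf y_i=\mathbf\Sigma_i^{1/2}\mathbf x_i$ for symmetric non-negative definite $\mathbf\Sigma_1,\dots,\mathbf\Sigma_n\in\mathbb R^{p\times p}$, and define $$\hat{\mathbf\Sigma}_{n,t}=\frac1n\sum_{i=1}^{\lfloor nt\rfloor}\mathbf y_i\mathbf y_i^\top,\qquad U_{n,t}=\frac{\frac1p\operatorname{tr}(\hat{\mathbf\Sigma}_{n,t}^2)}{\big(\frac1p\operatorname{tr}\hat{\mathbf\Sigma}_{n,t}\big)^2}.$$ Under the null hypothesis $\mathbf\Sigma_1=\dots=\mathbf\Sigma_n=\sigma^2\mathbf I_p$ for some $\sigma^2>0$, $$\Big(p\Big(U_{n,t}-1-\frac{p}{\lfloor nt\rfloor}\Big)\Big)_{t\in[t_0,1]}\ \rightsquigarrow\ (U_t)_{t\in[t_0,1]}\quad\text{in }\ell^\infty([t_0,1])$$ as $n\to\infty$, where $(U_t)_{t\in[t_0,1]}$ is a Gaussian process with mean function $\mathbb E[U_t]=y_t$ and covariance kernel $$\operatorname{cov}(U_{t_1},U_{t_2})=4\,y_{\max(t_1,t_2)}^2,\qquad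 t_1,t_2\in[t_0,1].$$
   Context: $\rightsquigarrow$ denotes weak convergence in the space $\ell^\infty([t_0,1])$ of bounded functions on $[t_0,1]$ with the sup-norm, in the sense of Hoffmann-Jørgensen (van der Vaart–Wellner). When $\operatorname{tr}\hat{\mathbf\Sigma}_{n,t}=0$, $U_{n,t}$ is assigned an arbitrary finite value. *)

theory Defs
  imports
    "HOL-Probability.Probability"
    "Jordan_Normal_Form.Matrix"
begin

unbundle no vec_syntax
no_notation inner (infix "\<bullet>" 70)

section \<open>Matrices\<close>

text \<open>The dimension p depends on n, so matrices are those of Jordan_Normal_Form, with rows and
  columns indexed from 0.\<close>

definition mat_trace :: "real mat \<Rightarrow> real" where
  "mat_trace A = (\<Sum>i<dim_row A. A $$ (i, i))"

definition outer_prod :: "real vec \<Rightarrow> real vec \<Rightarrow> real mat" where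
  "outer_prod v w = mat (dim_vec v) (dim_vec w) (\<lambda>(i, j). v $ i * w $ j)"

definition sym_nonneg_def :: "nat \<Rightarrow> real mat \<Rightarrow> bool" where
  "sym_nonneg_def p A \<longleftrightarrow>
     A \<in> carrier_mat p p \<and> transpose_mat A = A \<and>
     (\<forall>v\<in>carrier_vec p. 0 \<le> v \<bullet> (A *\<^sub>v v))"

definition mat_sqrt :: "nat \<Rightarrow> real mat \<Rightarrow> real mat" where
  "mat_sqrt p A = (THE B. sym_nonneg_def p B \<and> B * B = A)"


section \<open>The sequential statistic\<close>

text \<open>Observations are numbered from 0, so the first m of them are those with i < m.\<close>

definition seq_cov :: "nat \<Rightarrow> nat \<Rightarrow> (nat \<Rightarrow> real vec) \<Rightarrow> real \<Rightarrow> real mat" where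
  "seq_cov p n ys t =
     mat p p (\<lambda>kl. (1 / real n) * (\<Sum>i<nat \<lfloor>real n * t\<rfloor>. outer_prod (ys i) (ys i) $$ kl))"

text \<open>The argument c is the value assigned when the trace vanishes.\<close>

definition U_stat :: "nat \<Rightarrow> nat \<Rightarrow> (nat \<Rightarrow> real vec) \<Rightarrow> real \<Rightarrow> real \<Rightarrow> real" where
  "U_stat p n ys c t =
     (let S = seq_cov p n ys t in
      if mat_trace S = 0 then c
      else (1 / real p * mat_trace (S * S)) / (1 / real p * mat_trace S)\<^sup>2)"


section \<open>Gaussian processes\<close>

text \<open>The normal distribution with variance 0 is the point mass at the mean.\<close>

definition normal_rv :: "'a measure \<Rightarrow> ('a \<Rightarrow> real) \<Rightarrow> bool" where
  "normal_rv M Z \<longleftrightarrow> Z \<in> borel_measurable M \<and>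
     (\<exists>\<mu> \<sigma>. (\<sigma> = 0 \<and> (AE \<omega> in M. Z \<omega> = \<mu>)) \<or>
            (\<sigma> > 0 \<and> distributed M lborel Z (\<lambda>z. ennreal (normal_density \<mu> \<sigma> z))))"

text \<open>A random vector is (possibly degenerate) multivariate normal if all linear combinations of
  its components are normal.\<close>

definition gaussian_process :: "'a measure \<Rightarrow> 't set \<Rightarrow> ('t \<Rightarrow> 'a \<Rightarrow> real) \<Rightarrow> bool" where
  "gaussian_process M T X \<longleftrightarrow> prob_space M \<and>
     (\<forall>F c. finite F \<and> F \<subseteq> T \<longrightarrow> normal_rv M (\<lambda>\<omega>. \<Sum>t\<in>F. c t * X t \<omega>))"

definition covariance :: "'a measure \<Rightarrow> ('a \<Rightarrow> real) \<Rightarrow> ('a \<Rightarrow> real) \<Rightarrow> real" where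
  "covariance M X Y =
     (LINT \<omega>|M. (X \<omega> - (LINT \<eta>|M. X \<eta>)) * (Y \<omega> - (LINT \<eta>|M. Y \<eta>)))"


section \<open>Weak convergence in the sense of Hoffmann-J\o rgensen\<close>

text \<open>\<open>e2ennreal\<close> truncates at 0, so the two integrals are the expectations of the positive and
  negative parts; the expectation exists if at least one of them is finite.\<close>

definition ereal_expectation :: "'a measure \<Rightarrow> ('a \<Rightarrow> ereal) \<Rightarrow> ereal" where
  "ereal_expectation M V =
     enn2ereal (\<integral>\<^sup>+\<omega>. e2ennreal (V \<omega>) \<partial>M) - enn2ereal (\<integral>\<^sup>+\<omega>. e2ennreal (- V \<omega>) \<partial>M)"

definition ereal_expectation_exists :: "'a measure \<Rightarrow> ('a \<Rightarrow> ereal) \<Rightarrow> bool" where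
  "ereal_expectation_exists M V \<longleftrightarrow>
     (\<integral>\<^sup>+\<omega>. e2ennreal (V \<omega>) \<partial>M) < \<infinity> \<or> (\<integral>\<^sup>+\<omega>. e2ennreal (- V \<omega>) \<partial>M) < \<infinity>"

definition outer_expectation :: "'a measure \<Rightarrow> ('a \<Rightarrow> real) \<Rightarrow> ereal" where
  "outer_expectation M Z =
     Inf {ereal_expectation M V | V.
       V \<in> borel_measurable M \<and> ereal_expectation_exists M V \<and>
       (\<forall>\<omega>\<in>space M. ereal (Z \<omega>) \<le> V \<omega>)}"

definition metric_borel :: "'b metric \<Rightarrow> 'b measure" where
  "metric_borel D = sigma (mspace D) {V. openin (mtopology_of D) V}"

text \<open>The maps \<open>X n\<close> need not be measurable; the limit is a Borel random element.\<close>

definition weakly_converges ::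
  "'b metric \<Rightarrow> (nat \<Rightarrow> 'a measure) \<Rightarrow> (nat \<Rightarrow> 'a \<Rightarrow> 'b) \<Rightarrow> 'c measure \<Rightarrow> ('c \<Rightarrow> 'b) \<Rightarrow> bool" where
  "weakly_converges D M X N L \<longleftrightarrow>
     (\<forall>n. prob_space (M n) \<and> X n \<in> space (M n) \<rightarrow> mspace D) \<and>
     prob_space N \<and> L \<in> measurable N (metric_borel D) \<and>
     (\<forall>f. continuous_map (mtopology_of D) euclideanreal f \<and> bounded (f ` mspace D) \<longrightarrow>
        (\<lambda>n. outer_expectation (M n) (\<lambda>\<omega>. f (X n \<omega>)))
          \<longlonglongrightarrow> ereal (LINT \<omega>|N. f (L \<omega>)))"

text \<open>Elements of \<open>funspace T m\<close> are extensional, i.e. \<open>undefined\<close> outside T; processes are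
  therefore restricted to T when regarded as random elements.\<close>

definition linf :: "'t set \<Rightarrow> ('t \<Rightarrow> real) metric" where
  "linf T = funspace T euclidean_metric"

end

theory Submission
  imports Defs
begin

text \<open>Put \<open>m = \<lfloor>nt\<rfloor>\<close>. The scale \<open>\<sigma>\<^sup>2\<close> cancels in \<open>U\<close>, and the two traces are expressed through
  \<open>H m\<close>, the sum over \<open>i < j < m\<close> of \<open>(x\<^sub>i \<bullet> x\<^sub>j)\<^sup>2 - \<bar>x\<^sub>i\<bar>\<^sup>2 - \<bar>x\<^sub>j\<bar>\<^sup>2 + p\<close>, the linear statistic
  \<open>aa m\<close>, which sums \<open>\<bar>x\<^sub>j\<bar>\<^sup>2 - p\<close> over \<open>j < m\<close>, and the centred sum \<open>BB m\<close> of the squares of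
  \<open>\<bar>x\<^sub>j\<bar>\<^sup>2 - p\<close>. The normalisation of \<open>U\<close> cancels the leading contribution
  of \<open>aa m\<close>, so that \<open>p (U - 1 - p / m) = 2 H m / m\<^sup>2 + y / t + o(1)\<close> uniformly in \<open>t\<close>.

  The process \<open>H\<close> is a martingale in m whose increments have conditional variances concentrated at
  \<open>2 j (p\<^sup>2 + p)\<close>; replacing the increments one by one in \<open>E cos\<close> by their Gaussian counterparts shows
  that linear combinations of \<open>2 H \<lfloor>nt\<rfloor> / m\<^sup>2\<close> converge to those of \<open>2 y / t\<^sup>2\<close> times Brownian motion at
  time \<open>t\<^sup>2\<close>. Fourth moments and Doob's inequality on blocks of length \<open>n / K\<close> bound the oscillation of
  \<open>H\<close> between the points of a grid of mesh \<open>1 / K\<close>, with total probability of order \<open>1 / K\<close>. On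
  \<open>\<ell>\<^sup>\<infinity>\<close> a bounded continuous function is squeezed between Lipschitz functions up to small expected
  error under the limit, whose paths are continuous; a Lipschitz function of the grid interpolation
  is a continuous function of finitely many coordinates.\<close>

section \<open>Fourth moments and maximal inequalities\<close>

text \<open>Write A_i for x_i x_i^T minus the identity. The summand of \<open>H\<close> is the
  Frobenius product of A_i and A_j, hence linear in A_j once the past is fixed; this is the
  martingale property. Fourth moments equal to 3 give the entries of A_j the covariances of the
  Gaussian case, so the conditional variance of an increment is twice the squared Frobenius norm of
  A_0 + ... + A_(j-1). Expanding that norm gives back \<open>H\<close>, \<open>aa\<close> and
  \<open>BB\<close>: the bounds that linearise the statistic also show the conditional variances to
  concentrate. Summed over j < m these variances grow like m^2 p^2, whence the clock t^2, and
  min(s^2, t^2) / (s t)^2 = 1 / max(s, t)^2 produces the covariance of the limit. The union over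
  blocks calls for fourth moments: each of about K blocks fails with probability of order K^-2,
  where second moments would give K^-1 and no decay in total. They come from a calculus of bounds on
  squared L4 norms, additive up to a constant along martingale differences and multiplicative for
  independent factors, applied to coordinates, then to i, then to j. Since l^infinity is not
  separable, Borel measurability of the limit is derived from the continuity of its paths.\<close>

lemma abs_prod4_le:
  fixes a b c d :: real
  shows "\<bar>a * b * c * d\<bar> \<le> a^4 + b^4 + c^4 + d^4"
proof -
  have *: "\<bar>u * v\<bar> \<le> (u\<^sup>2 + v\<^sup>2)" for u v :: real
  proof -
    have "0 \<le> (\<bar>u\<bar> - \<bar>v\<bar>)\<^sup>2" by simp
    then have "2 * (\<bar>u\<bar> * \<bar>v\<bar>) \<le> u\<^sup>2 + v\<^sup>2" by (simp add: power2_diff)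
    moreover have "0 \<le> \<bar>u\<bar> * \<bar>v\<bar>" by simp
    ultimately show ?thesis unfolding abs_mult by linarith
  qed
  have "\<bar>a * b * c * d\<bar> = \<bar>(a*b) * (c*d)\<bar>" by (simp add: mult.assoc)
  also have "\<dots> \<le> (a*b)\<^sup>2 + (c*d)\<^sup>2" by (rule *)
  also have "\<dots> = \<bar>a\<^sup>2 * b\<^sup>2\<bar> + \<bar>c\<^sup>2 * d\<^sup>2\<bar>" by (simp add: power_mult_distrib)
  also have "\<dots> \<le> ((a\<^sup>2)\<^sup>2 + (b\<^sup>2)\<^sup>2) + ((c\<^sup>2)\<^sup>2 + (d\<^sup>2)\<^sup>2)" by (intro add_mono *)
  finally show ?thesis by simp
qed

text \<open>The tangent to the fourth power lies below its graph; this is the form in which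
  \<open>maximal_ineq\<close> takes convexity as a hypothesis.\<close>

lemma convex_power4: "y^4 + 4 * y^3 * (x - y) \<le> x^4" for x y :: real
proof -
  have "x^4 - (y^4 + 4 * y^3 * (x - y)) = (x - y)\<^sup>2 * ((x + y)\<^sup>2 + 2 * y\<^sup>2)"
    by (simp add: algebra_simps power2_eq_square power3_eq_cube power4_eq_xxxx)
  then show ?thesis by (smt (verit) mult_nonneg_nonneg zero_le_power2)
qed

lemma convex_power2: "y^2 + 2 * y * (x - y) \<le> x^2" for x y :: real
  using zero_le_power2[of "x - y"] by (simp add: power2_eq_square algebra_simps)

text \<open>If E x^2 is at most A^2 and E y^2 at most B^2, integrating this inequality gives the
  bound A B of Cauchy-Schwarz.\<close>

lemma weighted_am_gm:
  fixes A B :: real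
  assumes "0 < A" "0 < B"
  shows "x * y \<le> (B / A * x\<^sup>2 + A / B * y\<^sup>2) / 2"
proof -
  have "0 \<le> (B * x - A * y)\<^sup>2 / (2 * A * B)" using assms by simp
  also have "\<dots> = (B / A * x\<^sup>2 + A / B * y\<^sup>2) / 2 - x * y"
    using assms by (simp add: field_simps power2_eq_square)
  finally show ?thesis by simp
qed

lemma abs_cube_le:
  fixes s x :: real
  assumes "0 < s"
  shows "\<bar>x\<bar> ^ 3 \<le> (s * x\<^sup>2 + x ^ 4 / s) / 2"
  using weighted_am_gm[of 1 s "\<bar>x\<bar>" "\<bar>x\<bar>\<^sup>2"] assms
  by (simp add: power2_eq_square power3_eq_cube power4_eq_xxxx)

lemma le_power2_mono: "x \<le> a\<^sup>2 \<Longrightarrow> a \<le> b \<Longrightarrow> 0 \<le> a \<Longrightarrow> x \<le> b\<^sup>2" for x a b :: real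
  by (rule order_trans) (auto intro: power_mono)

context prob_space
begin

definition L4 :: "('a \<Rightarrow> real) \<Rightarrow> bool" where
  "L4 f \<longleftrightarrow> f \<in> borel_measurable M \<and> integrable M (\<lambda>\<omega>. f \<omega> ^ 4)"

lemma L4_measurable[measurable_dest]: "L4 f \<Longrightarrow> f \<in> borel_measurable M"
  by (simp add: L4_def)

text \<open>With this every product of at most four factors in \<open>L4\<close> is integrable,
  which settles the integrability conditions of the moment computations.\<close>

lemma L4_prod4:
  assumes [measurable]: "L4 a" "L4 b" "L4 c" "L4 d"
  shows "integrable M (\<lambda>\<omega>. a \<omega> * b \<omega> * c \<omega> * d \<omega>)"
proof (rule Bochner_Integration.integrable_bound)
  show "integrable M (\<lambda>\<omega>. a \<omega> ^ 4 + b \<omega> ^ 4 + c \<omega> ^ 4 + d \<omega> ^ 4)"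
    using assms by (simp add: L4_def)
  show "AE \<omega> in M. norm (a \<omega> * b \<omega> * c \<omega> * d \<omega>) \<le> norm (a \<omega> ^ 4 + b \<omega> ^ 4 + c \<omega> ^ 4 + d \<omega> ^ 4)"
    using abs_prod4_le by (auto intro!: AE_I2 order_trans[OF abs_prod4_le])
qed measurable

lemma L4_const[simp, intro]: "L4 (\<lambda>_. c)"
  by (simp add: L4_def)

lemma L4_prod3: "L4 a \<Longrightarrow> L4 b \<Longrightarrow> L4 c \<Longrightarrow> integrable M (\<lambda>\<omega>. a \<omega> * b \<omega> * c \<omega>)"
  using L4_prod4[of a b c "\<lambda>_. 1"] by simp

lemma L4_prod2: "L4 a \<Longrightarrow> L4 b \<Longrightarrow> integrable M (\<lambda>\<omega>. a \<omega> * b \<omega>)"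
  using L4_prod3[of a b "\<lambda>_. 1"] by simp

lemma L4_integrable: "L4 a \<Longrightarrow> integrable M a"
  using L4_prod2[of a "\<lambda>_. 1"] by simp

lemma L4_power:
  assumes "L4 a" "k \<le> 4" shows "integrable M (\<lambda>\<omega>. a \<omega> ^ k)"
proof -
  consider "k = 0" | "k = 1" | "k = 2" | "k = 3" | "k = 4" using assms(2) by linarith
  then show ?thesis
  proof cases
    case 3 then show ?thesis using L4_prod2[of a a] assms(1) by (simp add: power2_eq_square)
  next
    case 4 then show ?thesis using L4_prod3[of a a a] assms(1) by (simp add: power3_eq_cube)
  next
    case 5 then show ?thesis using assms(1) by (simp add: L4_def)
  qed (use L4_integrable[of a] assms(1) in simp_all)
qed

lemma L4_add[intro]:
  assumes [measurable]: "L4 f" "L4 g"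
  shows "L4 (\<lambda>\<omega>. f \<omega> + g \<omega>)"
  unfolding L4_def
proof
  have "(\<lambda>\<omega>. (f \<omega> + g \<omega>) ^ 4) = (\<lambda>\<omega>. f \<omega> * f \<omega> * f \<omega> * f \<omega> + 4 * (f \<omega> * f \<omega> * f \<omega> * g \<omega>)
      + 6 * (f \<omega> * f \<omega> * g \<omega> * g \<omega>) + 4 * (f \<omega> * g \<omega> * g \<omega> * g \<omega>) + g \<omega> * g \<omega> * g \<omega> * g \<omega>)"
    by (simp add: fun_eq_iff power4_eq_xxxx algebra_simps)
  then show "integrable M (\<lambda>\<omega>. (f \<omega> + g \<omega>) ^ 4)"
    using assms by (simp add: L4_prod4)
qed measurable

lemma L4_cmult[intro]: "L4 f \<Longrightarrow> L4 (\<lambda>\<omega>. c * f \<omega>)"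
  by (auto simp: L4_def power_mult_distrib)

lemma L4_diff[intro]: "L4 f \<Longrightarrow> L4 g \<Longrightarrow> L4 (\<lambda>\<omega>. f \<omega> - g \<omega>)"
  using L4_add[of f "\<lambda>\<omega>. -1 * g \<omega>"] L4_cmult[of g "-1"] by simp

lemma L4_sum[intro]: "(\<And>i. i \<in> I \<Longrightarrow> L4 (f i)) \<Longrightarrow> L4 (\<lambda>\<omega>. \<Sum>i\<in>I. f i \<omega>)"
  by (induction I rule: infinite_finite_induct) auto

lemma L4_mult_bounded:
  assumes [measurable]: "Z \<in> borel_measurable M" "L4 f" and "\<And>\<omega>. \<bar>Z \<omega>\<bar> \<le> 1"
  shows "L4 (\<lambda>\<omega>. Z \<omega> * f \<omega>)"
  unfolding L4_def
proof
  show "integrable M (\<lambda>\<omega>. (Z \<omega> * f \<omega>) ^ 4)"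
  proof (rule Bochner_Integration.integrable_bound)
    show "integrable M (\<lambda>\<omega>. f \<omega> ^ 4)" using assms by (simp add: L4_def)
    show "AE \<omega> in M. norm ((Z \<omega> * f \<omega>) ^ 4) \<le> norm (f \<omega> ^ 4)"
    proof (rule AE_I2)
      show "norm ((Z \<omega> * f \<omega>) ^ 4) \<le> norm (f \<omega> ^ 4)" for \<omega>
        using power_mono[OF assms(3)[of \<omega>], of 4] by (simp add: power_mult_distrib mult_left_le_one_le)
    qed
  qed measurable
qed measurable

text \<open>The bound says that the \<open>L\<^sup>4\<close> norm of f is at most the square root of a.\<close>

definition L4_bd :: "('a \<Rightarrow> real) \<Rightarrow> real \<Rightarrow> bool" where
  "L4_bd f a \<longleftrightarrow> L4 f \<and> 0 \<le> a \<and> expectation (\<lambda>\<omega>. f \<omega> ^ 4) \<le> a\<^sup>2"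

text \<open>Cauchy-Schwarz for the squares, by integrating \<open>weighted_am_gm\<close> with the
  bounds themselves as weights. As a or b may vanish, both are first raised by a small d.\<close>

lemma expectation_sq_mult_le:
  assumes f: "L4_bd f a" and g: "L4_bd g b"
  shows "expectation (\<lambda>\<omega>. (f \<omega>)\<^sup>2 * (g \<omega>)\<^sup>2) \<le> a * b"
proof (rule field_le_epsilon)
  fix e :: real assume e: "0 < e"
  have fL[measurable]: "L4 f" and gL[measurable]: "L4 g" and ab: "0 \<le> a" "0 \<le> b" using f g by (auto simp: L4_bd_def)
  \<comment> \<open>The product of the raised bounds exceeds a * b by d * (a + b + d). Since d is at
    most 1 this is at most d * (a + b + 1), hence at most e.\<close>
  define d where "d = min 1 (e / (a + b + 1))"
  have d: "0 < d" "d \<le> 1" using e ab by (auto simp: d_def)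
  have d2: "d * (a + b + 1) \<le> e" unfolding d_def using ab by (simp add: min.coboundedI2 flip: pos_le_divide_eq)
  let ?A = "a + d" and ?B = "b + d"
  have AB: "0 < ?A" "0 < ?B" using d ab by auto
  have int: "integrable M (\<lambda>\<omega>. (f \<omega>)\<^sup>2 * (g \<omega>)\<^sup>2)"
    using L4_prod4[OF fL fL gL gL] by (simp add: power2_eq_square mult.assoc)
  have pt: "(f \<omega>)\<^sup>2 * (g \<omega>)\<^sup>2 \<le> (?B / ?A * f \<omega> ^ 4 + ?A / ?B * g \<omega> ^ 4) / 2" for \<omega>
  proof -
    have "(f \<omega>)\<^sup>2 * (g \<omega>)\<^sup>2 \<le> (?B / ?A * ((f \<omega>)\<^sup>2)\<^sup>2 + ?A / ?B * ((g \<omega>)\<^sup>2)\<^sup>2) / 2"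
      by (rule weighted_am_gm[OF AB])
    then show ?thesis by simp
  qed
  have "expectation (\<lambda>\<omega>. (f \<omega>)\<^sup>2 * (g \<omega>)\<^sup>2)
      \<le> expectation (\<lambda>\<omega>. (?B / ?A * f \<omega> ^ 4 + ?A / ?B * g \<omega> ^ 4) / 2)"
    using fL gL by (intro integral_mono int pt) (auto simp: L4_def)
  also have "\<dots> = (?B / ?A * expectation (\<lambda>\<omega>. f \<omega> ^ 4) + ?A / ?B * expectation (\<lambda>\<omega>. g \<omega> ^ 4)) / 2"
    using fL gL by (simp add: L4_def)
  also have "\<dots> \<le> (?B / ?A * ?A\<^sup>2 + ?A / ?B * ?B\<^sup>2) / 2"
  proof -
    have "expectation (\<lambda>\<omega>. f \<omega> ^ 4) \<le> ?A\<^sup>2" "expectation (\<lambda>\<omega>. g \<omega> ^ 4) \<le> ?B\<^sup>2"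
      using f g ab d le_power2_mono[of _ a ?A] le_power2_mono[of _ b ?B] by (auto simp: L4_bd_def)
    then show ?thesis using AB by (intro divide_right_mono add_mono mult_left_mono) auto
  qed
  also have "\<dots> = ?A * ?B" using AB by (simp add: power2_eq_square)
  also have "\<dots> = a * b + d * (a + b + d)" by (simp add: algebra_simps)
  also have "\<dots> \<le> a * b + d * (a + b + 1)" using d by simp
  also have "\<dots> \<le> a * b + e" using d2 by simp
  finally show "expectation (\<lambda>\<omega>. (f \<omega>)\<^sup>2 * (g \<omega>)\<^sup>2) \<le> a * b + e" .
qed

lemma L4_bd_const:
  assumes "c\<^sup>2 \<le> a" shows "L4_bd (\<lambda>_. c) a"
proof -
  have "0 \<le> a" using assms zero_le_power2[of c] by linarith
  then show ?thesis using power_mono[OF assms, of 2] by (simp add: L4_bd_def prob_space)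
qed

lemma expectation_sq_le: "L4_bd f a \<Longrightarrow> expectation (\<lambda>\<omega>. (f \<omega>)\<^sup>2) \<le> a"
  using expectation_sq_mult_le[OF _ L4_bd_const[of 1 1], of f a] by simp

text \<open>The variance of |f| is nonnegative.\<close>

lemma expectation_abs_le:
  fixes f :: "'a \<Rightarrow> real"
  assumes [measurable]: "f \<in> borel_measurable M" and int: "integrable M (\<lambda>\<omega>. (f \<omega>)\<^sup>2)"
    and le: "expectation (\<lambda>\<omega>. (f \<omega>)\<^sup>2) \<le> s\<^sup>2" and s: "0 \<le> s"
  shows "integrable M f" "expectation (\<lambda>\<omega>. \<bar>f \<omega>\<bar>) \<le> s"
proof -
  show f: "integrable M f" using square_integrable_imp_integrable[OF assms(1)] int by simp
  have "0 \<le> variance (\<lambda>\<omega>. \<bar>f \<omega>\<bar>)" by simp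
  also have "\<dots> = expectation (\<lambda>\<omega>. \<bar>f \<omega>\<bar>\<^sup>2) - (expectation (\<lambda>\<omega>. \<bar>f \<omega>\<bar>))\<^sup>2"
    using f int by (intro variance_eq) auto
  finally have "(expectation (\<lambda>\<omega>. \<bar>f \<omega>\<bar>))\<^sup>2 \<le> s\<^sup>2" using le by simp
  then show "expectation (\<lambda>\<omega>. \<bar>f \<omega>\<bar>) \<le> s" using s by (rule power2_le_imp_le)
qed

text \<open>Lyapunov's inequality, by integrating \<open>abs_cube_le\<close> at the scale s = sqrt
  b. The scale must be positive, so a = 0 is reached by letting b tend to 0.\<close>

lemma expectation_cube_le:
  assumes f: "L4_bd f a"
  shows "integrable M (\<lambda>\<omega>. \<bar>f \<omega>\<bar> ^ 3)" "expectation (\<lambda>\<omega>. \<bar>f \<omega>\<bar> ^ 3) \<le> a * sqrt a"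
proof -
  have fL[measurable]: "L4 f" and a: "0 \<le> a" using f by (auto simp: L4_bd_def)
  show i: "integrable M (\<lambda>\<omega>. \<bar>f \<omega>\<bar> ^ 3)"
    using integrable_abs[OF L4_power[OF fL, of 3]] by (simp add: power_abs)
  have *: "expectation (\<lambda>\<omega>. \<bar>f \<omega>\<bar> ^ 3) \<le> b * sqrt b" if b: "a \<le> b" "0 < b" for b
  proof -
    let ?s = "sqrt b"
    have s: "0 < ?s" using b by simp
    have "expectation (\<lambda>\<omega>. \<bar>f \<omega>\<bar> ^ 3) \<le> expectation (\<lambda>\<omega>. (?s * (f \<omega>)\<^sup>2 + f \<omega> ^ 4 / ?s) / 2)"
    proof (intro integral_mono i)
      show "integrable M (\<lambda>\<omega>. (?s * (f \<omega>)\<^sup>2 + f \<omega> ^ 4 / ?s) / 2)"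
        using L4_power[OF fL, of 2] L4_power[OF fL, of 4] by auto
      show "\<bar>f \<omega>\<bar> ^ 3 \<le> (?s * (f \<omega>)\<^sup>2 + f \<omega> ^ 4 / ?s) / 2" for \<omega>
        by (rule abs_cube_le[OF s])
    qed
    also have "\<dots> = (?s * expectation (\<lambda>\<omega>. (f \<omega>)\<^sup>2) + expectation (\<lambda>\<omega>. f \<omega> ^ 4) / ?s) / 2"
      using L4_power[OF fL, of 2] L4_power[OF fL, of 4] by simp
    also have "\<dots> \<le> (?s * b + b\<^sup>2 / ?s) / 2"
    proof -
      have "expectation (\<lambda>\<omega>. (f \<omega>)\<^sup>2) \<le> b" "expectation (\<lambda>\<omega>. f \<omega> ^ 4) \<le> b\<^sup>2"
        using expectation_sq_le[OF f] f b a le_power2_mono[of _ a b] by (auto simp: L4_bd_def)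
      then show ?thesis using s by (intro divide_right_mono add_mono mult_left_mono) auto
    qed
    also have "\<dots> = b * ?s" using b by (simp add: field_simps power2_eq_square)
    finally show ?thesis .
  qed
  show "expectation (\<lambda>\<omega>. \<bar>f \<omega>\<bar> ^ 3) \<le> a * sqrt a"
  proof (cases "a = 0")
    case False then show ?thesis using * a by simp
  next
    case True
    have "((\<lambda>b. b * sqrt b) \<longlongrightarrow> 0 * sqrt 0) (at_right 0)" by (intro tendsto_intros)
    then have "expectation (\<lambda>\<omega>. \<bar>f \<omega>\<bar> ^ 3) \<le> 0 * sqrt 0"
      by (rule tendsto_lowerbound) (use * True in \<open>auto simp: eventually_at_right_field intro: exI[of _ 1]\<close>)
    then show ?thesis using True by simp
  qed
qed

lemma L4_bd_mono: "L4_bd f a \<Longrightarrow> a \<le> b \<Longrightarrow> L4_bd f b"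
  by (simp add: L4_bd_def le_power2_mono[of _ a b])

lemma L4_bd_cmult: "L4_bd f a \<Longrightarrow> L4_bd (\<lambda>\<omega>. c * f \<omega>) (c\<^sup>2 * a)"
  by (auto simp: L4_bd_def power_mult_distrib intro!: mult_left_mono)

text \<open>The bounds behave like squared norms, so adding two functions costs a factor. It is 3
  because (f + g)^4 is at most 8 f^4 + 8 g^4 and 8 < 3^2.\<close>

lemma L4_bd_add:
  assumes f: "L4_bd f a" and g: "L4_bd g b"
  shows "L4_bd (\<lambda>\<omega>. f \<omega> + g \<omega>) (3 * a + 3 * b)"
proof -
  have fL[measurable]: "L4 f" and gL[measurable]: "L4 g" and ab: "0 \<le> a" "0 \<le> b" using f g by (auto simp: L4_bd_def)
  have "expectation (\<lambda>\<omega>. (f \<omega> + g \<omega>)^4) \<le> expectation (\<lambda>\<omega>. 8 * (f \<omega>)^4 + 8 * (g \<omega>)^4)"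
  proof (intro integral_mono)
    show "(f \<omega> + g \<omega>)^4 \<le> 8 * (f \<omega>)^4 + 8 * (g \<omega>)^4" for \<omega>
    proof -
      have *: "(u + v)\<^sup>2 \<le> 2 * u\<^sup>2 + 2 * v\<^sup>2" for u v :: real
        using zero_le_power2[of "u - v"] by (simp add: power2_eq_square algebra_simps)
      have "((f \<omega> + g \<omega>)\<^sup>2)\<^sup>2 \<le> (2 * (f \<omega>)\<^sup>2 + 2 * (g \<omega>)\<^sup>2)\<^sup>2" by (intro power_mono *) simp
      also have "\<dots> \<le> 2 * (2 * (f \<omega>)\<^sup>2)\<^sup>2 + 2 * (2 * (g \<omega>)\<^sup>2)\<^sup>2" by (rule *)
      finally show ?thesis by (simp add: power_mult_distrib flip: power_mult)
    qed
    show "integrable M (\<lambda>\<omega>. (f \<omega> + g \<omega>)^4)" using L4_add[OF fL gL] by (simp add: L4_def)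
  qed (use fL gL in \<open>auto simp: L4_def\<close>)
  also have "\<dots> = 8 * expectation (\<lambda>\<omega>. f \<omega>^4) + 8 * expectation (\<lambda>\<omega>. g \<omega>^4)"
    using fL gL by (simp add: L4_def)
  also have "\<dots> \<le> 8 * a\<^sup>2 + 8 * b\<^sup>2" using f g by (auto simp: L4_bd_def)
  also have "\<dots> \<le> (3 * a + 3 * b)\<^sup>2" using ab by (simp add: power2_eq_square algebra_simps)
  finally show ?thesis using fL gL ab by (auto simp: L4_bd_def)
qed

text \<open>A fourth-moment substitute for orthogonality: the squares of the \<open>L\<^sup>4\<close> norms of martingale
  differences add up to within a factor 4.\<close>

lemma L4_bd_add_orth:
  assumes f: "L4_bd f a" and g: "L4_bd g b" and orth: "expectation (\<lambda>\<omega>. f \<omega> ^ 3 * g \<omega>) = 0"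
  shows "L4_bd (\<lambda>\<omega>. f \<omega> + g \<omega>) (a + 4 * b)"
proof -
  have fL[measurable]: "L4 f" and gL[measurable]: "L4 g" and ab: "0 \<le> a" "0 \<le> b" using f g by (auto simp: L4_bd_def)
  have i1: "integrable M (\<lambda>\<omega>. f \<omega> ^ 4)" "integrable M (\<lambda>\<omega>. g \<omega> ^ 4)" using fL gL by (auto simp: L4_def)
  have i2: "integrable M (\<lambda>\<omega>. f \<omega> ^ 3 * g \<omega>)"
    using L4_prod4[OF fL fL fL gL] by (simp add: power3_eq_cube mult.assoc)
  have i3: "integrable M (\<lambda>\<omega>. (f \<omega>)\<^sup>2 * (g \<omega>)\<^sup>2)"
    using L4_prod4[OF fL fL gL gL] by (simp add: power2_eq_square mult.assoc)
  have "expectation (\<lambda>\<omega>. (f \<omega> + g \<omega>)^4)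
      \<le> expectation (\<lambda>\<omega>. f \<omega> ^ 4 + 4 * (f \<omega> ^ 3 * g \<omega>) + 8 * ((f \<omega>)\<^sup>2 * (g \<omega>)\<^sup>2) + 3 * g \<omega> ^ 4)"
  proof (intro integral_mono)
    show "integrable M (\<lambda>\<omega>. (f \<omega> + g \<omega>)^4)" using L4_add[OF fL gL] by (simp add: L4_def)
    fix \<omega>
    \<comment> \<open>This disposes of 4 f g^3, whose expectation need not vanish: it is at most 2
      f^2 g^2 + 2 g^4.\<close>
    have "0 \<le> 2 * (g \<omega>)\<^sup>2 * (f \<omega> - g \<omega>)\<^sup>2" by simp
    then show "(f \<omega> + g \<omega>)^4 \<le> f \<omega> ^ 4 + 4 * (f \<omega> ^ 3 * g \<omega>) + 8 * ((f \<omega>)\<^sup>2 * (g \<omega>)\<^sup>2) + 3 * g \<omega> ^ 4"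
      by (simp add: power2_eq_square power3_eq_cube power4_eq_xxxx algebra_simps)
  qed (use i1 i2 i3 in auto)
  also have "\<dots> = expectation (\<lambda>\<omega>. f \<omega> ^ 4) + 8 * expectation (\<lambda>\<omega>. (f \<omega>)\<^sup>2 * (g \<omega>)\<^sup>2) + 3 * expectation (\<lambda>\<omega>. g \<omega> ^ 4)"
    using i1 i2 i3 orth by simp
  also have "\<dots> \<le> a\<^sup>2 + 8 * (a * b) + 3 * b\<^sup>2"
    using f g expectation_sq_mult_le[OF f g] by (intro add_mono mult_left_mono) (auto simp: L4_bd_def)
  also have "\<dots> \<le> (a + 4 * b)\<^sup>2" by (simp add: power2_eq_square algebra_simps)
  finally show ?thesis using fL gL ab by (auto simp: L4_bd_def)
qed

text \<open>In \<open>L4_bd_add_orth\<close> the factor 4 falls on the added summand only, so it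
  does not compound along the induction.\<close>

lemma L4_bd_sum_orth:
  fixes g :: "nat \<Rightarrow> 'a \<Rightarrow> real"
  assumes g: "\<And>k. k < N \<Longrightarrow> L4_bd (g k) (b k)"
    and orth: "\<And>k. k < N \<Longrightarrow> expectation (\<lambda>\<omega>. (\<Sum>i<k. g i \<omega>) ^ 3 * g k \<omega>) = 0"
  shows "L4_bd (\<lambda>\<omega>. \<Sum>i<N. g i \<omega>) (4 * (\<Sum>i<N. b i))"
  using assms
proof (induction N)
  case 0
  then show ?case using L4_bd_const[of 0 0] by simp
next
  case (Suc N)
  have "L4_bd (\<lambda>\<omega>. (\<Sum>i<N. g i \<omega>) + g N \<omega>) (4 * (\<Sum>i<N. b i) + 4 * b N)"
    using Suc by (intro L4_bd_add_orth) auto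
  then show ?case by (simp add: algebra_simps)
qed

lemma indep_mult_expectation:
  assumes "indep_var borel X borel Y" "integrable M X" "integrable M (Y :: 'a \<Rightarrow> real)"
  shows "integrable M (\<lambda>\<omega>. X \<omega> * Y \<omega>)" "expectation (\<lambda>\<omega>. X \<omega> * Y \<omega>) = expectation X * expectation Y"
  using indep_var_integrable[OF assms] indep_var_lebesgue_integral[OF assms] by auto

end

section \<open>Sigma-algebras generated by parts of an independent family\<close>

definition gen_alg :: "'a measure \<Rightarrow> ('i \<Rightarrow> 'a \<Rightarrow> real) \<Rightarrow> 'i set \<Rightarrow> 'a measure" where
  "gen_alg M X J = vimage_algebra (space M) (\<lambda>\<omega>. \<lambda>i\<in>J. X i \<omega>) (PiM J (\<lambda>_. borel))"

lemma space_gen_alg[simp]: "space (gen_alg M X J) = space M"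
  by (simp add: gen_alg_def)

lemma measurable_gen_alg:
  assumes "i \<in> J" shows "X i \<in> borel_measurable (gen_alg M X J)"
proof -
  have [measurable]: "(\<lambda>\<omega>. \<lambda>i\<in>J. X i \<omega>) \<in> gen_alg M X J \<rightarrow>\<^sub>M PiM J (\<lambda>_. borel)"
    unfolding gen_alg_def by (intro measurable_vimage_algebra1) (auto simp: space_PiM)
  have "(\<lambda>\<omega>. (\<lambda>i\<in>J. X i \<omega>) i) \<in> borel_measurable (gen_alg M X J)"
    using assms by measurable
  then show ?thesis using assms by simp
qed

lemma gen_alg_subset:
  assumes "\<And>i. i \<in> J \<Longrightarrow> X i \<in> borel_measurable N" "space N = space M"
  shows "sets (gen_alg M X J) \<subseteq> sets N"
  unfolding gen_alg_def
  by (intro sets_image_in_sets) (use assms in \<open>auto intro!: measurable_restrict\<close>)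

lemma gen_alg_mono: "J \<subseteq> J' \<Longrightarrow> sets (gen_alg M X J) \<subseteq> sets (gen_alg M X J')"
  by (intro gen_alg_subset) (auto intro: measurable_gen_alg)

lemma gen_alg_measurable_mono:
  assumes "f \<in> borel_measurable (gen_alg M X J)" "J \<subseteq> J'"
  shows "f \<in> borel_measurable (gen_alg M X J')"
  using measurable_mono[of borel borel "gen_alg M X J" "gen_alg M X J'"] gen_alg_mono[OF assms(2)] assms(1) by auto

context prob_space
begin

lemma gen_alg_measurable:
  assumes "indep_vars (\<lambda>_. borel) X I" "f \<in> borel_measurable (gen_alg M X J)" "J \<subseteq> I"
  shows "f \<in> borel_measurable M"
proof -
  have "sets (gen_alg M X J) \<subseteq> sets M"
    using assms by (intro gen_alg_subset) (auto simp: indep_vars_def)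
  then show ?thesis using measurable_mono[of borel borel "gen_alg M X J" M] assms(2) by auto
qed

text \<open>The two restricted families are independent, and f and g generate sub-sigma-algebras of
  the ones that these families generate.\<close>

lemma gen_alg_indep:
  fixes f g :: "'a \<Rightarrow> real"
  assumes X: "indep_vars (\<lambda>_. borel) X I" and f: "f \<in> borel_measurable (gen_alg M X A)"
    and g: "g \<in> borel_measurable (gen_alg M X B)" and AB: "A \<subseteq> I" "B \<subseteq> I" "A \<inter> B = {}"
  shows "indep_var borel f borel g"
proof -
  note ind = indep_var_restrict[OF X AB(3,1,2)]
  have *: "sigma_sets (space M) {(\<lambda>\<omega>. \<lambda>i\<in>J. X i \<omega>) -` E \<inter> space M |E. E \<in> sets (PiM J (\<lambda>_. borel))}
      = sets (gen_alg M X J)" for J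
    by (simp add: gen_alg_def sets_vimage_algebra)
  have sub: "sigma_sets (space M) {h -` E \<inter> space M |E. E \<in> sets borel} \<subseteq> sets (gen_alg M X J)"
    if "h \<in> borel_measurable (gen_alg M X J)" for h :: "'a \<Rightarrow> real" and J
    using sets.sigma_sets_subset[of "{h -` E \<inter> space M |E. E \<in> sets borel}" "gen_alg M X J"]
      measurable_sets[OF that] by auto
  have "indep_set (sets (gen_alg M X A)) (sets (gen_alg M X B))"
    using ind unfolding indep_var_eq * by simp
  then have "indep_set (sigma_sets (space M) {f -` E \<inter> space M |E. E \<in> sets borel})
                       (sigma_sets (space M) {g -` E \<inter> space M |E. E \<in> sets borel})"
    using sub[of f A] sub[of g B] f g unfolding indep_sets2_eq by blast
  then show ?thesis
    unfolding indep_var_eq using gen_alg_measurable[OF X] f g AB by auto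
qed

text \<open>Here W is a test weight and u a coefficient, both determined by the variables in A,
  while v is a fresh factor determined by those in B.\<close>

lemma gen_alg_orth:
  fixes W u v :: "'a \<Rightarrow> real"
  assumes X: "indep_vars (\<lambda>_. borel) X I" and AB: "A \<subseteq> I" "B \<subseteq> I" "A \<inter> B = {}"
    and W: "W \<in> borel_measurable (gen_alg M X A)" "u \<in> borel_measurable (gen_alg M X A)"
      "integrable M (\<lambda>\<omega>. W \<omega> * u \<omega>)"
    and v: "v \<in> borel_measurable (gen_alg M X B)" "integrable M v"
  shows "integrable M (\<lambda>\<omega>. W \<omega> * (u \<omega> * v \<omega>))"
    "expectation (\<lambda>\<omega>. W \<omega> * (u \<omega> * v \<omega>)) = expectation (\<lambda>\<omega>. W \<omega> * u \<omega>) * expectation v"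
proof -
  have "indep_var borel (\<lambda>\<omega>. W \<omega> * u \<omega>) borel v"
    using W by (intro gen_alg_indep[OF X _ v(1) AB] borel_measurable_times)
  from indep_mult_expectation[OF this W(3) v(2)]
  show "integrable M (\<lambda>\<omega>. W \<omega> * (u \<omega> * v \<omega>))"
    "expectation (\<lambda>\<omega>. W \<omega> * (u \<omega> * v \<omega>)) = expectation (\<lambda>\<omega>. W \<omega> * u \<omega>) * expectation v"
    by (auto simp: mult.assoc)
qed

text \<open>Doob's inequality, by decomposition according to the first passage time.\<close>

lemma maximal_ineq:
  fixes S :: "nat \<Rightarrow> 'a \<Rightarrow> real" and F :: "nat \<Rightarrow> 'a measure"
  assumes lam: "0 < l" and q: "even q" "\<And>x y :: real. y^q + real q * y^(q-1) * (x - y) \<le> x^q"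
    and F: "\<And>k. k \<le> N \<Longrightarrow> sets (F k) \<subseteq> sets M" "\<And>k. space (F k) = space M"
    and S: "\<And>i k. i \<le> k \<Longrightarrow> k \<le> N \<Longrightarrow> S i \<in> borel_measurable (F k)"
    and int: "\<And>k. k \<le> N \<Longrightarrow> integrable M (\<lambda>\<omega>. S k \<omega> ^ q)"
      "\<And>k. k \<le> N \<Longrightarrow> integrable M (\<lambda>\<omega>. S k \<omega> ^ (q-1) * (S N \<omega> - S k \<omega>))"
    and mart: "\<And>k A. k \<le> N \<Longrightarrow> A \<in> sets (F k) \<Longrightarrow>
      expectation (\<lambda>\<omega>. indicator A \<omega> * (S k \<omega> ^ (q-1) * (S N \<omega> - S k \<omega>))) = 0"
  shows "{\<omega>\<in>space M. \<exists>k\<le>N. l \<le> \<bar>S k \<omega>\<bar>} \<in> events \<and>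
    l^q * prob {\<omega>\<in>space M. \<exists>k\<le>N. l \<le> \<bar>S k \<omega>\<bar>} \<le> expectation (\<lambda>\<omega>. S N \<omega> ^ q)"
proof -
  define A where "A k = {\<omega>\<in>space M. l \<le> \<bar>S k \<omega>\<bar> \<and> (\<forall>i<k. \<bar>S i \<omega>\<bar> < l)}" for k :: nat
  have AF: "A k \<in> sets (F k)" if "k \<le> N" for k
  proof -
    have [measurable]: "S i \<in> borel_measurable (F k)" if "i \<le> k" for i using S that \<open>k \<le> N\<close> by auto
    have "A k = {\<omega>\<in>space (F k). l \<le> \<bar>S k \<omega>\<bar>} \<inter> {\<omega>\<in>space (F k). \<forall>i\<in>{..<k}. \<bar>S i \<omega>\<bar> < l}"
      unfolding A_def F(2) by auto
    also have "\<dots> \<in> sets (F k)"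
      by (intro sets.Int sets.sets_Collect_finite_All) (auto intro!: borel_measurable_less borel_measurable_le)
    finally show ?thesis .
  qed
  have AM[measurable]: "A k \<in> events" if "k \<le> N" for k using AF F that by blast
  have disj: "disjoint_family_on A {..N}"
  proof (unfold disjoint_family_on_def, intro ballI impI)
    fix i j :: nat assume "i \<noteq> j"
    then consider "i < j" | "j < i" by linarith
    then show "A i \<inter> A j = {}" by cases (auto simp: A_def dest: leD)
  qed
  have eq: "{\<omega>\<in>space M. \<exists>k\<le>N. l \<le> \<bar>S k \<omega>\<bar>} = (\<Union>k\<in>{..N}. A k)" (is "?L = ?R")
  proof
    show "?R \<subseteq> ?L" by (auto simp: A_def)
    show "?L \<subseteq> ?R"
    proof
      fix \<omega> assume "\<omega> \<in> ?L"
      then obtain k where k: "\<omega> \<in> space M" "k \<le> N" "l \<le> \<bar>S k \<omega>\<bar>" by auto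
      define j where "j = (LEAST j. l \<le> \<bar>S j \<omega>\<bar>)"
      have "l \<le> \<bar>S j \<omega>\<bar>" "j \<le> k" "\<forall>i<j. \<bar>S i \<omega>\<bar> < l"
        unfolding j_def using k(3) by (auto intro: LeastI Least_le dest!: not_less_Least)
      then show "\<omega> \<in> ?R" using k by (auto simp: A_def)
    qed
  qed
  have ev: "?L \<in> events" unfolding eq by auto
  have intN: "integrable M (\<lambda>\<omega>. indicator (A k) \<omega> * S N \<omega> ^ q)" if "k \<le> N" for k
    using integrable_mult_indicator[OF AM[OF that] int(1)[OF order_refl]] by (simp add: mult.commute)
  have step: "l^q * prob (A k) \<le> expectation (\<lambda>\<omega>. indicator (A k) \<omega> * S N \<omega> ^ q)" if k: "k \<le> N" for k
  proof -
    have i1: "integrable M (\<lambda>\<omega>. indicator (A k) \<omega> * S k \<omega> ^ q)"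
      using integrable_mult_indicator[OF AM[OF k] int(1)[OF k]] by (simp add: mult.commute)
    have i2: "integrable M (\<lambda>\<omega>. indicator (A k) \<omega> * (S k \<omega> ^ (q-1) * (S N \<omega> - S k \<omega>)))"
      using integrable_mult_indicator[OF AM[OF k] int(2)[OF k]] by simp
    have "l^q * prob (A k) = expectation (\<lambda>\<omega>. indicator (A k) \<omega> * l^q)"
      using AM[OF k] by simp
    \<comment> \<open>The term added here has expectation zero by \<open>mart\<close>. It completes
      the tangent at S_k, so that convexity bounds the integrand by the q-th power of S_N in the
      next step.\<close>
    also have "\<dots> \<le> expectation (\<lambda>\<omega>. indicator (A k) \<omega> * S k \<omega> ^ q
        + real q * (indicator (A k) \<omega> * (S k \<omega> ^ (q-1) * (S N \<omega> - S k \<omega>))))" (is "?a \<le> ?b")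
    proof -
      have "?a \<le> expectation (\<lambda>\<omega>. indicator (A k) \<omega> * S k \<omega> ^ q)"
      proof (intro integral_mono i1)
        show "integrable M (\<lambda>\<omega>. indicator (A k) \<omega> * l^q)" using AM[OF k] by (auto simp: emeasure_eq_measure)
        fix \<omega> assume "\<omega> \<in> space M"
        show "indicator (A k) \<omega> * l^q \<le> indicator (A k) \<omega> * S k \<omega> ^ q"
        proof (cases "\<omega> \<in> A k")
          case True
          then have "l^q \<le> \<bar>S k \<omega>\<bar>^q" using lam by (intro power_mono) (auto simp: A_def)
          then show ?thesis using True q(1) by (simp add: power_even_abs)
        qed simp
      qed
      also have "\<dots> = ?b" using i1 i2 mart[OF k AF[OF k]] by simp
      finally show ?thesis .
    qed
    also have "\<dots> \<le> expectation (\<lambda>\<omega>. indicator (A k) \<omega> * S N \<omega> ^ q)"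
    proof (intro integral_mono intN k)
      show "integrable M (\<lambda>\<omega>. indicator (A k) \<omega> * S k \<omega> ^ q
        + real q * (indicator (A k) \<omega> * (S k \<omega> ^ (q-1) * (S N \<omega> - S k \<omega>))))"
        using i1 i2 by auto
      show "indicator (A k) \<omega> * S k \<omega> ^ q + real q * (indicator (A k) \<omega> * (S k \<omega> ^ (q-1) * (S N \<omega> - S k \<omega>)))
          \<le> indicator (A k) \<omega> * S N \<omega> ^ q" for \<omega>
        using q(2)[of "S k \<omega>" "S N \<omega>"] by (cases "\<omega> \<in> A k") (auto simp: mult.assoc)
    qed
    finally show ?thesis .
  qed
  have "l^q * prob ?L = l^q * (\<Sum>k\<le>N. prob (A k))"
    unfolding eq by (subst finite_measure_finite_Union[OF _ _ disj]) (use AM in \<open>simp_all add: image_subset_iff\<close>)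
  also have "\<dots> \<le> (\<Sum>k\<le>N. expectation (\<lambda>\<omega>. indicator (A k) \<omega> * S N \<omega> ^ q))"
    unfolding sum_distrib_left using step by (intro sum_mono) auto
  also have "\<dots> = expectation (\<lambda>\<omega>. \<Sum>k\<le>N. indicator (A k) \<omega> * S N \<omega> ^ q)"
    by (rule Bochner_Integration.integral_sum[symmetric]) (use intN in simp)
  also have "\<dots> \<le> expectation (\<lambda>\<omega>. S N \<omega> ^ q)"
  proof (intro integral_mono int)
    show "integrable M (\<lambda>\<omega>. \<Sum>k\<le>N. indicator (A k) \<omega> * S N \<omega> ^ q)"
      by (intro Bochner_Integration.integrable_sum intN) simp
    fix \<omega>
    have "(\<Sum>k\<in>{..N}. indicator (A k) \<omega> :: real) = indicator (\<Union>k\<in>{..N}. A k) \<omega>"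
      by (rule indicator_UN_disjoint[symmetric, OF _ disj]) simp
    then have "(\<Sum>k\<le>N. indicator (A k) \<omega> * S N \<omega> ^ q) = indicator (\<Union>k\<in>{..N}. A k) \<omega> * S N \<omega> ^ q"
      by (simp only: sum_distrib_right[symmetric])
    also have "\<dots> \<le> 1 * S N \<omega> ^ q"
      using q(1) by (intro mult_right_mono) (auto simp: indicator_def zero_le_even_power)
    finally show "(\<Sum>k\<le>N. indicator (A k) \<omega> * S N \<omega> ^ q) \<le> S N \<omega> ^ q" by simp
  qed simp
  finally have "l^q * prob ?L \<le> expectation (\<lambda>\<omega>. S N \<omega> ^ q)" .
  with ev show ?thesis by (rule conjI)
qed

end

lemma sum_square_symmetric:
  fixes g :: "nat \<Rightarrow> nat \<Rightarrow> real"
  assumes "\<And>k l. g k l = g l k"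
  shows "(\<Sum>(k, l)\<in>{..<m}\<times>{..<m}. g k l) = (\<Sum>k<m. g k k) + 2 * (\<Sum>l<m. \<Sum>k<l. g k l)"
proof -
  have "(\<Sum>k<m. \<Sum>l<m. g k l) = (\<Sum>k<m. g k k) + 2 * (\<Sum>l<m. \<Sum>k<l. g k l)"
  proof (induction m)
    case (Suc m)
    then show ?case using sum.cong[of "{..<m}" "{..<m}" "\<lambda>l. g m l" "\<lambda>k. g k m"] assms by (simp add: sum.distrib)
  qed simp
  then show ?thesis by (simp add: sum.cartesian_product)
qed

section \<open>Quadratic forms of a standardised array\<close>

text \<open>One stage of the triangular array, with n fixed. The derived moment constants depend on
  \<kappa> alone, which makes the estimates uniform in n. Eighth moments appear because fourth
  moments of squared coordinates are needed.\<close>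

locale std_array = prob_space M for M :: "'a measure" +
  fixes x :: "nat \<Rightarrow> nat \<Rightarrow> 'a \<Rightarrow> real" and p n :: nat and \<kappa> :: real
  assumes indep: "indep_vars (\<lambda>_. borel) (\<lambda>(i, j). x i j) ({..<p} \<times> {..<n})"
    and mean: "\<And>i j. i < p \<Longrightarrow> j < n \<Longrightarrow> expectation (x i j) = 0"
    and second_moment: "\<And>i j. i < p \<Longrightarrow> j < n \<Longrightarrow> expectation (\<lambda>\<omega>. (x i j \<omega>)\<^sup>2) = 1"
    and fourth_moment: "\<And>i j. i < p \<Longrightarrow> j < n \<Longrightarrow> expectation (\<lambda>\<omega>. x i j \<omega> ^ 4) = 3"
    and eighth_moment: "\<And>i j. i < p \<Longrightarrow> j < n \<Longrightarrow> integrable M (\<lambda>\<omega>. x i j \<omega> ^ 8)"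
      "\<And>i j. i < p \<Longrightarrow> j < n \<Longrightarrow> expectation (\<lambda>\<omega>. x i j \<omega> ^ 8) \<le> \<kappa>"
    and kappa_nonneg: "0 \<le> \<kappa>"
begin

definition G :: "(nat \<times> nat) set \<Rightarrow> 'a measure" where
  "G J = gen_alg M (\<lambda>(i, j). x i j) J"

text \<open>All coordinates of the observations numbered in J: \<open>G (rows {..<j})\<close> is the
  past of observation j, and \<open>G (rows {j})\<close> belongs to that observation alone.\<close>

definition rows :: "nat set \<Rightarrow> (nat \<times> nat) set" where
  "rows J = {..<p} \<times> J"

lemma space_G[simp]: "space (G J) = space M"
  by (simp add: G_def)

lemma rows_subset: "J \<subseteq> {..<n} \<Longrightarrow> rows J \<subseteq> {..<p} \<times> {..<n}"
  by (auto simp: rows_def)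

lemma x_G: "(i, j) \<in> J \<Longrightarrow> x i j \<in> borel_measurable (G J)"
  using measurable_gen_alg[of "(i, j)" J "\<lambda>(i, j). x i j" M] by (simp add: G_def)

lemma G_mono: "f \<in> borel_measurable (G J) \<Longrightarrow> J \<subseteq> J' \<Longrightarrow> f \<in> borel_measurable (G J')"
  unfolding G_def by (rule gen_alg_measurable_mono)

lemma G_M: "f \<in> borel_measurable (G J) \<Longrightarrow> J \<subseteq> {..<p} \<times> {..<n} \<Longrightarrow> f \<in> borel_measurable M"
  for f :: "'a \<Rightarrow> real"
  unfolding G_def by (rule gen_alg_measurable[OF indep])

lemma G_sets: "J \<subseteq> {..<p} \<times> {..<n} \<Longrightarrow> sets (G J) \<subseteq> sets M"
  unfolding G_def using indep by (intro gen_alg_subset) (auto simp: indep_vars_def)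

lemma G_indep:
  fixes f g :: "'a \<Rightarrow> real"
  assumes "f \<in> borel_measurable (G A)" "g \<in> borel_measurable (G B)"
    "A \<subseteq> {..<p} \<times> {..<n}" "B \<subseteq> {..<p} \<times> {..<n}" "A \<inter> B = {}"
  shows "indep_var borel f borel g"
  using assms gen_alg_indep[OF indep, of f A g B] by (simp add: G_def)

lemma x_M[measurable]: "i < p \<Longrightarrow> j < n \<Longrightarrow> x i j \<in> borel_measurable M"
  using G_M[OF x_G[of i j "{(i, j)}"]] by auto

lemma x_L4: assumes "i < p" "j < n" shows "L4 (x i j)"
  unfolding L4_def
proof
  show [measurable]: "x i j \<in> borel_measurable M" using assms by simp
  show "integrable M (\<lambda>\<omega>. x i j \<omega> ^ 4)"
  proof (rule Bochner_Integration.integrable_bound)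
    show "integrable M (\<lambda>\<omega>. 1 + x i j \<omega> ^ 8)" using eighth_moment(1)[OF assms] by simp
    show "AE \<omega> in M. norm (x i j \<omega> ^ 4) \<le> norm (1 + x i j \<omega> ^ 8)"
    proof (rule AE_I2)
      fix \<omega>
      have "2 * x i j \<omega> ^ 4 \<le> 1 + (x i j \<omega> ^ 4)\<^sup>2" using sum_squares_bound[of 1 "x i j \<omega> ^ 4"] by simp
      moreover have "0 \<le> x i j \<omega> ^ 4" "0 \<le> x i j \<omega> ^ 8" by (auto intro: zero_le_even_power)
      moreover have "(x i j \<omega> ^ 4)\<^sup>2 = x i j \<omega> ^ 8" by simp
      ultimately have "x i j \<omega> ^ 4 \<le> 1 + x i j \<omega> ^ 8" by linarith
      then show "norm (x i j \<omega> ^ 4) \<le> norm (1 + x i j \<omega> ^ 8)" by simp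
    qed
  qed measurable
qed

lemma L4_bd_mult_indep:
  assumes f: "f \<in> borel_measurable (G A)" "L4_bd f a" and g: "g \<in> borel_measurable (G B)" "L4_bd g b"
    and AB: "A \<subseteq> {..<p} \<times> {..<n}" "B \<subseteq> {..<p} \<times> {..<n}" "A \<inter> B = {}"
  shows "L4_bd (\<lambda>\<omega>. f \<omega> * g \<omega>) (a * b)"
proof -
  have [measurable]: "f \<in> borel_measurable M" "g \<in> borel_measurable M"
    using f g AB by (auto intro: G_M)
  have i: "integrable M (\<lambda>\<omega>. f \<omega> ^ 4)" "integrable M (\<lambda>\<omega>. g \<omega> ^ 4)" using f g by (auto simp: L4_bd_def L4_def)
  have "indep_var borel (\<lambda>\<omega>. f \<omega> ^ 4) borel (\<lambda>\<omega>. g \<omega> ^ 4)"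
    using f g by (intro G_indep[OF _ _ AB] borel_measurable_power)
  note ind = indep_mult_expectation[OF this i]
  have "expectation (\<lambda>\<omega>. (f \<omega> * g \<omega>) ^ 4) = expectation (\<lambda>\<omega>. f \<omega> ^ 4) * expectation (\<lambda>\<omega>. g \<omega> ^ 4)"
    using ind(2) by (simp add: power_mult_distrib)
  also have "\<dots> \<le> a\<^sup>2 * b\<^sup>2" using f g by (intro mult_mono) (auto simp: L4_bd_def intro!: integral_nonneg_AE)
  finally show ?thesis using ind(1) f g by (auto simp: L4_bd_def L4_def power_mult_distrib)
qed

text \<open>The orthogonality relation behind all moment computations: W and the \<open>u s\<close> do not involve the
  coordinates on which the centred factors \<open>v s\<close> depend.\<close>

lemma orth:
  fixes W :: "'a \<Rightarrow> real" and u v :: "'s \<Rightarrow> 'a \<Rightarrow> real"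
  assumes AB: "A \<subseteq> {..<p} \<times> {..<n}" "B \<subseteq> {..<p} \<times> {..<n}" "A \<inter> B = {}"
    and W: "W \<in> borel_measurable (G A)"
    and u: "\<And>s. s \<in> S \<Longrightarrow> u s \<in> borel_measurable (G A)" "\<And>s. s \<in> S \<Longrightarrow> integrable M (\<lambda>\<omega>. W \<omega> * u s \<omega>)"
    and v: "\<And>s. s \<in> S \<Longrightarrow> v s \<in> borel_measurable (G B)" "\<And>s. s \<in> S \<Longrightarrow> integrable M (v s)"
      "\<And>s. s \<in> S \<Longrightarrow> expectation (v s) = 0"
  shows "integrable M (\<lambda>\<omega>. W \<omega> * (\<Sum>s\<in>S. u s \<omega> * v s \<omega>))"
    "expectation (\<lambda>\<omega>. W \<omega> * (\<Sum>s\<in>S. u s \<omega> * v s \<omega>)) = 0"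
proof -
  have *: "integrable M (\<lambda>\<omega>. W \<omega> * (u s \<omega> * v s \<omega>))" "expectation (\<lambda>\<omega>. W \<omega> * (u s \<omega> * v s \<omega>)) = 0"
    if "s \<in> S" for s
    using gen_alg_orth[OF indep AB, of W "u s" "v s"] W u[OF that] v[OF that] by (auto simp: G_def)
  then show "integrable M (\<lambda>\<omega>. W \<omega> * (\<Sum>s\<in>S. u s \<omega> * v s \<omega>))"
    "expectation (\<lambda>\<omega>. W \<omega> * (\<Sum>s\<in>S. u s \<omega> * v s \<omega>)) = 0"
    by (auto simp: sum_distrib_left Bochner_Integration.integral_sum)
qed

text \<open>The instance of \<open>orth\<close> with weight \<open>indicator E\<close> times f^3.
  The first conclusion serves Doob's inequality, the second the recursion for fourth moments; where
  only the second is wanted, \<open>E\<close> is set to the empty set to meet the shared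
  hypothesis.\<close>

lemma orth_cube:
  fixes f :: "'a \<Rightarrow> real" and u v :: "'s \<Rightarrow> 'a \<Rightarrow> real"
  assumes AB: "A \<subseteq> {..<p} \<times> {..<n}" "B \<subseteq> {..<p} \<times> {..<n}" "A \<inter> B = {}"
    and f: "f \<in> borel_measurable (G A)" "L4 f"
    and u: "\<And>s. s \<in> S \<Longrightarrow> u s \<in> borel_measurable (G A)" "\<And>s. s \<in> S \<Longrightarrow> L4 (u s)"
    and v: "\<And>s. s \<in> S \<Longrightarrow> v s \<in> borel_measurable (G B)" "\<And>s. s \<in> S \<Longrightarrow> L4 (v s)"
      "\<And>s. s \<in> S \<Longrightarrow> expectation (v s) = 0"
    and A: "E \<in> sets (G A)"
  shows "expectation (\<lambda>\<omega>. indicator E \<omega> * (f \<omega> ^ 3 * (\<Sum>s\<in>S. u s \<omega> * v s \<omega>))) = 0"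
    "expectation (\<lambda>\<omega>. f \<omega> ^ 3 * (\<Sum>s\<in>S. u s \<omega> * v s \<omega>)) = 0"
proof -
  have *: "expectation (\<lambda>\<omega>. indicator E \<omega> * (f \<omega> ^ 3 * (\<Sum>s\<in>S. u s \<omega> * v s \<omega>))) = 0"
    if E: "E \<in> sets (G A)" for E
  proof -
    have E': "E \<in> events" using G_sets[OF AB(1)] E by auto
    have "expectation (\<lambda>\<omega>. (indicator E \<omega> * f \<omega> ^ 3) * (\<Sum>s\<in>S. u s \<omega> * v s \<omega>)) = 0"
    proof (rule orth(2)[OF AB])
      show "(\<lambda>\<omega>. indicator E \<omega> * f \<omega> ^ 3) \<in> borel_measurable (G A)"
        using f E by (intro borel_measurable_times borel_measurable_indicator borel_measurable_power)
      show "integrable M (\<lambda>\<omega>. indicator E \<omega> * f \<omega> ^ 3 * u s \<omega>)" if "s \<in> S" for s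
        using integrable_mult_indicator[OF E' L4_prod4[OF f(2) f(2) f(2) u(2)[OF that]]]
        by (simp add: power3_eq_cube mult.assoc)
    qed (use u v L4_integrable in auto)
    then show ?thesis by (simp add: mult.assoc)
  qed
  show "expectation (\<lambda>\<omega>. indicator E \<omega> * (f \<omega> ^ 3 * (\<Sum>s\<in>S. u s \<omega> * v s \<omega>))) = 0"
    using *[OF A] .
  have "expectation (\<lambda>\<omega>. indicator (space M) \<omega> * (f \<omega> ^ 3 * (\<Sum>s\<in>S. u s \<omega> * v s \<omega>))) = 0"
    using *[of "space M"] sets.top[of "G A"] by simp
  moreover have "expectation (\<lambda>\<omega>. indicator (space M) \<omega> * (f \<omega> ^ 3 * (\<Sum>s\<in>S. u s \<omega> * v s \<omega>)))
     = expectation (\<lambda>\<omega>. f \<omega> ^ 3 * (\<Sum>s\<in>S. u s \<omega> * v s \<omega>))"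
    by (intro Bochner_Integration.integral_cong) auto
  ultimately show "expectation (\<lambda>\<omega>. f \<omega> ^ 3 * (\<Sum>s\<in>S. u s \<omega> * v s \<omega>)) = 0" by simp
qed

text \<open>An index that occurs only once contributes an independent factor of mean zero.\<close>

lemma fourth_mixed_single:
  assumes "a < p" "b < p" "c < p" "d < p" "j < n" "a \<notin> {b, c, d}"
  shows "expectation (\<lambda>\<omega>. x a j \<omega> * (x b j \<omega> * x c j \<omega> * x d j \<omega>)) = 0"
proof -
  \<comment> \<open>A sum over one element brings a single product into the form that
    \<open>orth\<close> expects; the same device recurs below.\<close>
  have "expectation (\<lambda>\<omega>. (x b j \<omega> * x c j \<omega> * x d j \<omega>) * (\<Sum>s\<in>{()}. 1 * x a j \<omega>)) = 0"
    by (rule orth(2)[of "{b, c, d} \<times> {j}" "{(a, j)}"])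
      (use assms L4_prod3[of "x b j" "x c j" "x d j"] x_L4 mean in
        \<open>auto intro!: x_G L4_integrable borel_measurable_times\<close>)
  then show ?thesis by (simp add: mult.commute)
qed

lemma fourth_mixed_pair:
  assumes "a < p" "b < p" "a \<noteq> b" "j < n"
  shows "expectation (\<lambda>\<omega>. x a j \<omega> * (x a j \<omega> * x b j \<omega> * x b j \<omega>)) = 1"
proof -
  have "indep_var borel (\<lambda>\<omega>. (x a j \<omega>)\<^sup>2) borel (\<lambda>\<omega>. (x b j \<omega>)\<^sup>2)"
    by (rule G_indep[of _ "{(a, j)}" _ "{(b, j)}"]) (use assms in \<open>auto intro!: x_G borel_measurable_power\<close>)
  from indep_mult_expectation(2)[OF this] show ?thesis
    using assms L4_power[OF x_L4, of _ _ 2] second_moment by (simp add: power2_eq_square mult.assoc)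
qed

text \<open>Wick's formula. When all four indices agree, each of the three pairings contributes 1,
  which is where the fourth moment 3 enters.\<close>

lemma fourth_mixed:
  assumes "a < p" "b < p" "c < p" "d < p" "j < n"
  shows "expectation (\<lambda>\<omega>. x a j \<omega> * x b j \<omega> * (x c j \<omega> * x d j \<omega>))
    = of_bool (a = b \<and> c = d) + of_bool (a = c \<and> b = d) + of_bool (a = d \<and> b = c)"
proof -
  let ?E = "expectation (\<lambda>\<omega>. x a j \<omega> * x b j \<omega> * (x c j \<omega> * x d j \<omega>))"
  consider "a \<notin> {b, c, d}" | "b \<notin> {a, c, d}" | "c \<notin> {a, b, d}" | "d \<notin> {a, b, c}"
    | "a = b" "c = d" "a \<noteq> c" | "a = c" "b = d" "a \<noteq> b" | "a = d" "b = c" "a \<noteq> b" | "a = b" "c = a" "d = a"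
    by auto
  then show ?thesis
  proof cases
    case 1 then show ?thesis using fourth_mixed_single[of a b c d j] assms by (auto simp: mult_ac)
  next
    case 2 then show ?thesis using fourth_mixed_single[of b a c d j] assms by (auto simp: mult_ac)
  next
    case 3 then show ?thesis using fourth_mixed_single[of c a b d j] assms by (auto simp: mult_ac)
  next
    case 4 then show ?thesis using fourth_mixed_single[of d a b c j] assms by (auto simp: mult_ac)
  next
    case 5 then show ?thesis using fourth_mixed_pair[of a c j] assms by (auto simp: mult_ac)
  next
    case 6 then show ?thesis using fourth_mixed_pair[of a b j] assms by (auto simp: mult_ac)
  next
    case 7 then show ?thesis using fourth_mixed_pair[of a b j] assms by (auto simp: mult_ac)
  next
    case 8 then show ?thesis using fourth_moment[of a j] assms by (auto simp: power4_eq_xxxx mult_ac)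
  qed
qed

lemma second_mixed:
  assumes "a < p" "b < p" "j < n"
  shows "expectation (\<lambda>\<omega>. x a j \<omega> * x b j \<omega>) = of_bool (a = b)"
proof (cases "a = b")
  case True then show ?thesis using second_moment[of a j] assms by (simp add: power2_eq_square)
next
  case False
  have "indep_var borel (x a j) borel (x b j)"
    by (rule G_indep[of _ "{(a, j)}" _ "{(b, j)}"]) (use assms False in \<open>auto intro!: x_G\<close>)
  from indep_mult_expectation(2)[OF this] show ?thesis
    using assms L4_integrable[OF x_L4] mean False by simp
qed

section \<open>The entries of x_j x_j^T minus the identity, and their Frobenius products\<close>

definition al :: "nat \<times> nat \<Rightarrow> nat \<Rightarrow> 'a \<Rightarrow> real" where
  "al q j \<omega> = x (fst q) j \<omega> * x (snd q) j \<omega> - of_bool (fst q = snd q)"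

definition Q :: "(nat \<times> nat) set" where "Q = {..<p} \<times> {..<p}"

text \<open>The radicand adds the fourth-moment bounds of the two cases in \<open>al_bd\<close>: 8
  \<kappa> + 8 for diagonal entries and 9 for the others.\<close>

definition k1 :: real where "k1 = sqrt (8 * \<kappa> + 17)"

lemma k1: "0 \<le> k1" "k1\<^sup>2 = 8 * \<kappa> + 17"
  using kappa_nonneg by (auto simp: k1_def)

lemma al_G: "(fst q, j) \<in> J \<Longrightarrow> (snd q, j) \<in> J \<Longrightarrow> al q j \<in> borel_measurable (G J)"
  unfolding al_def[abs_def] by (intro borel_measurable_diff borel_measurable_times x_G) auto

lemma al_rows: "q \<in> Q \<Longrightarrow> j \<in> J \<Longrightarrow> al q j \<in> borel_measurable (G (rows J))"
  by (intro al_G) (auto simp: Q_def rows_def)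

lemma al_bd: assumes "q \<in> Q" "j < n" shows "L4_bd (al q j) k1"
proof -
  obtain k l where q: "q = (k, l)" "k < p" "l < p" using assms by (auto simp: Q_def)
  have meas[measurable]: "al q j \<in> borel_measurable M"
    using al_rows[OF assms(1), of j "{j}"] G_M rows_subset assms by blast
  show ?thesis
  proof (cases "k = l")
    case True
    have le: "(al q j \<omega>)^4 \<le> 8 * x k j \<omega> ^ 8 + 8" for \<omega>
    proof -
      have *: "(u - v)\<^sup>2 \<le> 2 * u\<^sup>2 + 2 * v\<^sup>2" for u v :: real
        using zero_le_power2[of "u + v"] by (simp add: power2_eq_square algebra_simps)
      have **: "(u + v)\<^sup>2 \<le> 2 * u\<^sup>2 + 2 * v\<^sup>2" for u v :: real
        using zero_le_power2[of "u - v"] by (simp add: power2_eq_square algebra_simps)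
      have "(((x k j \<omega>)\<^sup>2 - 1)\<^sup>2)\<^sup>2 \<le> (2 * ((x k j \<omega>)\<^sup>2)\<^sup>2 + 2 * 1\<^sup>2)\<^sup>2" by (intro power_mono *) simp
      also have "\<dots> \<le> 2 * (2 * ((x k j \<omega>)\<^sup>2)\<^sup>2)\<^sup>2 + 2 * (2 * 1\<^sup>2)\<^sup>2" by (rule **)
      also have "\<dots> = 8 * x k j \<omega> ^ 8 + 8" by (simp add: power_mult_distrib flip: power_mult)
      finally have "(((x k j \<omega>)\<^sup>2 - 1)\<^sup>2)\<^sup>2 \<le> 8 * x k j \<omega> ^ 8 + 8" .
      moreover have "al q j \<omega> = (x k j \<omega>)\<^sup>2 - 1" using True q by (simp add: al_def power2_eq_square)
      ultimately show ?thesis by (simp flip: power_mult)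
    qed
    have i8: "integrable M (\<lambda>\<omega>. 8 * x k j \<omega> ^ 8 + 8)" using eighth_moment(1) q assms by simp
    have i: "integrable M (\<lambda>\<omega>. (al q j \<omega>)^4)"
    proof (rule Bochner_Integration.integrable_bound[OF i8])
      show "AE \<omega> in M. norm (al q j \<omega> ^ 4) \<le> norm (8 * x k j \<omega> ^ 8 + 8)"
      proof (rule AE_I2)
        fix \<omega>
        have "0 \<le> al q j \<omega> ^ 4" by simp
        then show "norm (al q j \<omega> ^ 4) \<le> norm (8 * x k j \<omega> ^ 8 + 8)" using le[of \<omega>] by simp
      qed
    qed measurable
    have "expectation (\<lambda>\<omega>. (al q j \<omega>)^4) \<le> expectation (\<lambda>\<omega>. 8 * x k j \<omega> ^ 8 + 8)"
      by (intro integral_mono i i8 le)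
    also have "\<dots> \<le> 8 * \<kappa> + 8" using eighth_moment[of k j] q assms by (simp add: prob_space)
    finally show ?thesis using i k1 by (simp add: L4_bd_def L4_def)
  next
    case False
    have "L4_bd (x i j) (sqrt 3)" if "i < p" for i
      using x_L4[OF that assms(2)] fourth_moment[OF that assms(2)] by (simp add: L4_bd_def)
    then have "L4_bd (\<lambda>\<omega>. x k j \<omega> * x l j \<omega>) (sqrt 3 * sqrt 3)"
      by (intro L4_bd_mult_indep[of _ "{(k, j)}" _ _ "{(l, j)}"]) (use q False assms in \<open>auto intro!: x_G\<close>)
    then have "L4_bd (al q j) 3" using False q by (simp add: al_def[abs_def])
    moreover have "3 \<le> k1" unfolding k1_def using kappa_nonneg by (intro real_le_rsqrt) simp
    ultimately show ?thesis by (rule L4_bd_mono)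
  qed
qed

lemma al_L4: "q \<in> Q \<Longrightarrow> j < n \<Longrightarrow> L4 (al q j)"
  using al_bd by (auto simp: L4_bd_def)

lemma al_mean: assumes "q \<in> Q" "j < n" shows "expectation (al q j) = 0"
proof -
  have "expectation (al q j) = expectation (\<lambda>\<omega>. x (fst q) j \<omega> * x (snd q) j \<omega>) - of_bool (fst q = snd q)"
    unfolding al_def[abs_def]
    by (subst Bochner_Integration.integral_diff) (use assms in \<open>auto simp: Q_def prob_space intro!: L4_prod2 x_L4\<close>)
  then show ?thesis using second_mixed assms by (auto simp: Q_def)
qed

text \<open>Subtracting the product of the means from Wick's formula leaves two of the three
  pairings. An entry is thus correlated only with itself and its transpose, and a diagonal entry has
  variance 2.\<close>

lemma al_cov:
  assumes "q \<in> Q" "q' \<in> Q" "j < n"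
  shows "expectation (\<lambda>\<omega>. al q j \<omega> * al q' j \<omega>) = of_bool (q = q') + of_bool (q = prod.swap q')"
proof -
  obtain k l k' l' where q: "q = (k, l)" "q' = (k', l')" and lt: "k < p" "l < p" "k' < p" "l' < p"
    using assms by (auto simp: Q_def)
  have i4: "integrable M (\<lambda>\<omega>. x k j \<omega> * x l j \<omega> * (x k' j \<omega> * x l' j \<omega>))"
    using L4_prod4[of "x k j" "x l j" "x k' j" "x l' j"] x_L4 lt assms by (simp add: mult.assoc)
  have i2: "integrable M (\<lambda>\<omega>. x k j \<omega> * x l j \<omega>)" "integrable M (\<lambda>\<omega>. x k' j \<omega> * x l' j \<omega>)"
    using L4_prod2 x_L4 lt assms by auto
  have "expectation (\<lambda>\<omega>. al q j \<omega> * al q' j \<omega>) =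
    expectation (\<lambda>\<omega>. x k j \<omega> * x l j \<omega> * (x k' j \<omega> * x l' j \<omega>) - of_bool (k = l) * (x k' j \<omega> * x l' j \<omega>)
      - of_bool (k' = l') * (x k j \<omega> * x l j \<omega>) + of_bool (k = l) * of_bool (k' = l'))"
    by (simp add: al_def q algebra_simps del: of_bool_eq_iff)
  also have "\<dots> = expectation (\<lambda>\<omega>. x k j \<omega> * x l j \<omega> * (x k' j \<omega> * x l' j \<omega>))
     - of_bool (k = l) * expectation (\<lambda>\<omega>. x k' j \<omega> * x l' j \<omega>)
     - of_bool (k' = l') * expectation (\<lambda>\<omega>. x k j \<omega> * x l j \<omega>) + of_bool (k = l) * of_bool (k' = l')"
    using i4 i2 by (simp add: prob_space)
  also have "\<dots> = of_bool (k = k' \<and> l = l') + of_bool (k = l' \<and> l = k')"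
    unfolding fourth_mixed[OF lt assms(3)] second_mixed[OF lt(1,2) assms(3)] second_mixed[OF lt(3,4) assms(3)]
    by auto
  also have "\<dots> = of_bool (q = q') + of_bool (q = prod.swap q')" by (simp add: q)
  finally show ?thesis .
qed

text \<open>Multiplied out, this is the kernel (x_i . x_j)^2 - |x_i|^2 - |x_j|^2 + p; the sum over
  entries shows it to be bilinear in centred matrices.\<close>

definition h :: "nat \<Rightarrow> nat \<Rightarrow> 'a \<Rightarrow> real" where
  "h i j \<omega> = (\<Sum>q\<in>Q. al q i \<omega> * al q j \<omega>)"

text \<open>Read off from \<open>h_bd\<close>: 12 = 3 * 4 for the diagonal part, and 1728 = 3 * 2^2
  * 4 * 36 for the part below the diagonal, whose summands have bounds 12 l * 3.\<close>

definition Ch :: real where "Ch = 12 * k1\<^sup>2 + 1728"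

lemma Ch_nonneg: "0 \<le> Ch" by (simp add: Ch_def)

lemma h_sym: "h i j = h j i" by (simp add: h_def fun_eq_iff mult.commute)

lemma h_rows: "i \<in> J \<Longrightarrow> j \<in> J \<Longrightarrow> h i j \<in> borel_measurable (G (rows J))"
  unfolding h_def[abs_def] by (intro borel_measurable_sum borel_measurable_times al_rows)

text \<open>The triangle inequality over the p^2 entries would give order p^4 for the squared norm;
  orthogonality gives p^2. Off the diagonal the entry products are z_k z_l with z_k = x_ki x_kj, so
  the lower triangle is the sum of Z_l z_l with Z_l = z_0 + ... + z_(l-1). Both Z_l and this sum are
  martingales in the coordinates.\<close>

lemma h_bd:
  assumes ij: "i < n" "j < n" "i \<noteq> j"
  shows "L4_bd (h i j) (Ch * (real p)\<^sup>2)"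
proof -
  let ?z = "\<lambda>k \<omega>. x k i \<omega> * x k j \<omega>"
  let ?Z = "\<lambda>l \<omega>. \<Sum>k<l. ?z k \<omega>"
  have h_eq: "h i j \<omega> = (\<Sum>k<p. al (k, k) i \<omega> * al (k, k) j \<omega>) + 2 * (\<Sum>l<p. ?Z l \<omega> * ?z l \<omega>)" for \<omega>
  proof -
    have "h i j \<omega> = (\<Sum>(k, l)\<in>{..<p}\<times>{..<p}. al (k, l) i \<omega> * al (k, l) j \<omega>)"
      by (simp add: h_def Q_def case_prod_unfold)
    also have "\<dots> = (\<Sum>k<p. al (k, k) i \<omega> * al (k, k) j \<omega>) + 2 * (\<Sum>l<p. \<Sum>k<l. al (k, l) i \<omega> * al (k, l) j \<omega>)"
      by (rule sum_square_symmetric) (simp add: al_def mult_ac eq_commute)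
    also have "(\<Sum>l<p. \<Sum>k<l. al (k, l) i \<omega> * al (k, l) j \<omega>) = (\<Sum>l<p. ?Z l \<omega> * ?z l \<omega>)"
      unfolding sum_distrib_right by (intro sum.cong) (auto simp: al_def mult_ac)
    finally show ?thesis .
  qed
  have diagG: "al (k, k) j' \<in> borel_measurable (G J)" if "(k, j') \<in> J" for k j' J
    using al_G[of "(k, k)" j' J] that by simp
  have 1: "L4_bd (\<lambda>\<omega>. \<Sum>k<p. al (k, k) i \<omega> * al (k, k) j \<omega>) (4 * (\<Sum>k<p. k1 * k1))"
  proof (rule L4_bd_sum_orth)
    fix k assume k: "k < p"
    show "L4_bd (\<lambda>\<omega>. al (k, k) i \<omega> * al (k, k) j \<omega>) (k1 * k1)"
      by (rule L4_bd_mult_indep[of _ "{(k, i)}" _ _ "{(k, j)}"])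
        (use k ij in \<open>auto intro!: diagG al_bd simp: Q_def\<close>)
  next
    fix k assume k: "k < p"
    have "expectation (\<lambda>\<omega>. (\<Sum>i'<k. al (i', i') i \<omega> * al (i', i') j \<omega>) ^ 3 *
        (\<Sum>s\<in>{()}. al (k, k) i \<omega> * al (k, k) j \<omega>)) = 0"
    \<comment> \<open>Coordinate (k, i) is counted with the past: the entry from observation i is
      the coefficient, and the one from observation j the centred factor.\<close>
    proof (rule orth_cube(2)[where A = "{..<k} \<times> {i, j} \<union> {(k, i)}" and B = "{(k, j)}" and E = "{}"])
      show "L4 (\<lambda>\<omega>. \<Sum>i'<k. al (i', i') i \<omega> * al (i', i') j \<omega>)"
      proof (rule L4_sum)
        fix i' assume "i' \<in> {..<k}"
        then have "L4_bd (\<lambda>\<omega>. al (i', i') i \<omega> * al (i', i') j \<omega>) (k1 * k1)"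
          by (intro L4_bd_mult_indep[of _ "{(i', i)}" _ _ "{(i', j)}"])
            (use k ij in \<open>auto intro!: diagG al_bd simp: Q_def\<close>)
        then show "L4 (\<lambda>\<omega>. al (i', i') i \<omega> * al (i', i') j \<omega>)" by (simp add: L4_bd_def)
      qed
    qed (use k ij in \<open>auto intro!: diagG al_L4 al_mean borel_measurable_sum borel_measurable_times simp: Q_def\<close>)
    then show "expectation (\<lambda>\<omega>. (\<Sum>i'<k. al (i', i') i \<omega> * al (i', i') j \<omega>) ^ 3 * (al (k, k) i \<omega> * al (k, k) j \<omega>)) = 0"
      by simp
  qed
  have z_bd: "L4_bd (?z k) 3" if "k < p" for k
  proof -
    have "L4_bd (x k j') (sqrt 3)" if "j' < n" for j'
      using x_L4[of k j'] fourth_moment[of k j'] that \<open>k < p\<close> by (simp add: L4_bd_def)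
    then have "L4_bd (?z k) (sqrt 3 * sqrt 3)"
      by (intro L4_bd_mult_indep[of _ "{(k, i)}" _ _ "{(k, j)}"]) (use that ij in \<open>auto intro!: x_G\<close>)
    then show ?thesis by simp
  qed
  have z_L4: "L4 (?z k)" if "k < p" for k using z_bd[OF that] by (simp add: L4_bd_def)
  have z_mean: "expectation (?z k) = 0" if "k < p" for k
  proof -
    have "expectation (\<lambda>\<omega>. 1 * (\<Sum>s\<in>{()}. x k i \<omega> * x k j \<omega>)) = 0"
      by (rule orth(2)[of "{(k, i)}" "{(k, j)}"]) (use that ij mean in \<open>auto intro!: x_G L4_integrable x_L4\<close>)
    then show ?thesis by simp
  qed
  have z_G: "?z k \<in> borel_measurable (G J)" if "(k, i) \<in> J" "(k, j) \<in> J" for k J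
    using that by (intro borel_measurable_times x_G)
  have Z_G: "?Z l \<in> borel_measurable (G J)" if "{..<l} \<times> {i, j} \<subseteq> J" for l J
    using that by (intro borel_measurable_sum z_G) auto
  have Z_bd: "L4_bd (?Z l) (4 * (\<Sum>k<l. 3))" if "l \<le> p" for l
  proof (rule L4_bd_sum_orth)
    fix k assume k: "k < l"
    show "L4_bd (?z k) 3" using z_bd k that by simp
    have "expectation (\<lambda>\<omega>. ?Z k \<omega> ^ 3 * (\<Sum>s\<in>{()}. 1 * ?z k \<omega>)) = 0"
      by (rule orth_cube(2)[where A = "{..<k} \<times> {i, j}" and B = "{k} \<times> {i, j}" and E = "{}"])
        (use k that ij z_mean z_L4 in \<open>auto intro!: z_G Z_G L4_sum\<close>)
    then show "expectation (\<lambda>\<omega>. ?Z k \<omega> ^ 3 * ?z k \<omega>) = 0" by simp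
  qed
  have Z_bd': "L4_bd (?Z l) (12 * real l)" if "l \<le> p" for l using Z_bd[OF that] by simp
  have 2: "L4_bd (\<lambda>\<omega>. \<Sum>l<p. ?Z l \<omega> * ?z l \<omega>) (4 * (\<Sum>l<p. 12 * real l * 3))"
  proof (rule L4_bd_sum_orth)
    fix l assume l: "l < p"
    have prod: "L4_bd (\<lambda>\<omega>. ?Z l' \<omega> * ?z l' \<omega>) (12 * real l' * 3)" if "l' < p" for l'
      by (rule L4_bd_mult_indep[where A = "{..<l'} \<times> {i, j}" and B = "{l'} \<times> {i, j}"])
        (use that ij in \<open>auto intro!: z_G Z_G Z_bd' z_bd\<close>)
    show "L4_bd (\<lambda>\<omega>. ?Z l \<omega> * ?z l \<omega>) (12 * real l * 3)" by (rule prod[OF l])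
    have "expectation (\<lambda>\<omega>. (\<Sum>i'<l. ?Z i' \<omega> * ?z i' \<omega>) ^ 3 * (\<Sum>s\<in>{()}. ?Z l \<omega> * ?z l \<omega>)) = 0"
    proof (rule orth_cube(2)[where A = "{..<l} \<times> {i, j}" and B = "{l} \<times> {i, j}" and E = "{}"])
      show "L4 (\<lambda>\<omega>. \<Sum>i'<l. ?Z i' \<omega> * ?z i' \<omega>)" using prod l by (intro L4_sum) (simp add: L4_bd_def)
      show "(\<lambda>\<omega>. \<Sum>i'<l. ?Z i' \<omega> * ?z i' \<omega>) \<in> borel_measurable (G ({..<l} \<times> {i, j}))"
        by (intro borel_measurable_sum borel_measurable_times z_G Z_G) auto
      show "L4 (?Z l)" using Z_bd l by (simp add: L4_bd_def)
    qed (use l ij z_mean z_L4 in \<open>auto intro!: z_G Z_G\<close>)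
    then show "expectation (\<lambda>\<omega>. (\<Sum>i'<l. ?Z i' \<omega> * ?z i' \<omega>) ^ 3 * (?Z l \<omega> * ?z l \<omega>)) = 0" by simp
  qed
  have "L4_bd (h i j) (3 * (4 * (\<Sum>k<p. k1 * k1)) + 3 * (2\<^sup>2 * (4 * (\<Sum>l<p. 12 * real l * 3))))"
    unfolding h_eq[abs_def] by (intro L4_bd_add L4_bd_cmult 1 2)
  moreover have "3 * (4 * (\<Sum>k<p. k1 * k1)) + 3 * (2\<^sup>2 * (4 * (\<Sum>l<p. 12 * real l * 3))) \<le> Ch * (real p)\<^sup>2"
  proof -
    have "(\<Sum>l<p. 12 * real l * 3) \<le> (\<Sum>l<p. 36 * real p)" by (intro sum_mono) simp
    moreover have "real p \<le> (real p)\<^sup>2" by (cases p) (simp_all add: power2_eq_square)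
    moreover have "12 * k1\<^sup>2 * real p \<le> 12 * k1\<^sup>2 * (real p)\<^sup>2"
      using \<open>real p \<le> (real p)\<^sup>2\<close> by (intro mult_left_mono) auto
    ultimately show ?thesis by (simp add: Ch_def power2_eq_square algebra_simps)
  qed
  ultimately show ?thesis by (rule L4_bd_mono)
qed

section \<open>The martingale H and its companion sums\<close>

definition xi :: "nat \<Rightarrow> 'a \<Rightarrow> real" where "xi j \<omega> = (\<Sum>i<j. h i j \<omega>)"
definition H :: "nat \<Rightarrow> 'a \<Rightarrow> real" where "H m \<omega> = (\<Sum>j<m. xi j \<omega>)"
definition bb :: "nat \<Rightarrow> 'a \<Rightarrow> real" where "bb j \<omega> = (\<Sum>k<p. (x k j \<omega>)\<^sup>2) - real p"
definition aa :: "nat \<Rightarrow> 'a \<Rightarrow> real" where "aa m \<omega> = (\<Sum>j<m. bb j \<omega>)"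
text \<open>The centring 2 p is the mean of the square, see \<open>bb_second_moment\<close>.\<close>

definition BB :: "nat \<Rightarrow> 'a \<Rightarrow> real" where "BB m \<omega> = (\<Sum>j<m. (bb j \<omega>)\<^sup>2 - 2 * real p)"
definition AA :: "nat \<times> nat \<Rightarrow> nat \<Rightarrow> 'a \<Rightarrow> real" where "AA q j \<omega> = (\<Sum>i<j. al q i \<omega>)"
text \<open>The conditional variance of \<open>xi j\<close> given the first j observations, in the
  sense of \<open>expectation_xi_sq\<close>: twice the squared Frobenius norm of the matrix with
  entries \<open>AA\<close>.\<close>

definition V :: "nat \<Rightarrow> 'a \<Rightarrow> real" where "V j \<omega> = 2 * (\<Sum>q\<in>Q. (AA q j \<omega>)\<^sup>2)"

text \<open>Bilinearity of \<open>h\<close> makes the increment a linear form in the centred entries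
  of observation j, with coefficients from the past.\<close>

lemma xi_eq: "xi j \<omega> = (\<Sum>q\<in>Q. AA q j \<omega> * al q j \<omega>)"
  unfolding xi_def h_def AA_def sum_distrib_right by (rule sum.swap)

lemma bb_eq: "bb j \<omega> = (\<Sum>k<p. 1 * al (k, k) j \<omega>)"
  by (simp add: bb_def al_def sum_subtractf power2_eq_square)

lemma xi_rows: "j \<in> J \<Longrightarrow> {..<j} \<subseteq> J \<Longrightarrow> xi j \<in> borel_measurable (G (rows J))"
  unfolding xi_def[abs_def] by (intro borel_measurable_sum h_rows) auto

lemma H_rows: "{..<m} \<subseteq> J \<Longrightarrow> H m \<in> borel_measurable (G (rows J))"
  unfolding H_def[abs_def] by (intro borel_measurable_sum xi_rows) auto

lemma bb_rows: "j \<in> J \<Longrightarrow> bb j \<in> borel_measurable (G (rows J))"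
  unfolding bb_eq[abs_def] by (intro borel_measurable_sum borel_measurable_times al_rows) (auto simp: Q_def)

lemma aa_rows: "{..<m} \<subseteq> J \<Longrightarrow> aa m \<in> borel_measurable (G (rows J))"
  unfolding aa_def[abs_def] by (intro borel_measurable_sum bb_rows) auto

lemma BB_rows: "{..<m} \<subseteq> J \<Longrightarrow> BB m \<in> borel_measurable (G (rows J))"
  unfolding BB_def[abs_def] by (intro borel_measurable_sum borel_measurable_diff borel_measurable_power bb_rows) auto

lemma AA_rows: "q \<in> Q \<Longrightarrow> {..<j} \<subseteq> J \<Longrightarrow> AA q j \<in> borel_measurable (G (rows J))"
  unfolding AA_def[abs_def] by (intro borel_measurable_sum al_rows) auto

lemma rows_disjoint: "J \<inter> J' = {} \<Longrightarrow> rows J \<inter> rows J' = {}"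
  by (auto simp: rows_def)

lemma AA_L4: "q \<in> Q \<Longrightarrow> j \<le> n \<Longrightarrow> L4 (AA q j)"
  unfolding AA_def[abs_def] by (intro L4_sum al_L4) auto

text \<open>Observation j now counts as past, and the observations i < j are added one at a time:
  given observation j, each \<open>h i j\<close> is linear in the centred entries of observation
  i.\<close>

lemma xi_bd:
  assumes "j < n"
  shows "L4_bd (xi j) (4 * (real j * (Ch * (real p)\<^sup>2)))"
proof -
  have "L4_bd (xi j) (4 * (\<Sum>i<j. Ch * (real p)\<^sup>2))"
    unfolding xi_def[abs_def]
  proof (rule L4_bd_sum_orth)
    fix i assume i: "i < j"
    show "L4_bd (h i j) (Ch * (real p)\<^sup>2)" using i assms by (intro h_bd) auto
    have "expectation (\<lambda>\<omega>. (\<Sum>i'<i. h i' j \<omega>) ^ 3 * (\<Sum>q\<in>Q. al q j \<omega> * al q i \<omega>)) = 0"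
    proof (rule orth_cube(2)[where A = "rows ({..<i} \<union> {j})" and B = "rows {i}" and E = "{}"])
      show "L4 (\<lambda>\<omega>. \<Sum>i'<i. h i' j \<omega>)"
      proof (rule L4_sum)
        fix i' assume "i' \<in> {..<i}"
        then show "L4 (h i' j)" using h_bd[of i' j] i assms by (auto simp: L4_bd_def)
      qed
    qed (use i assms in \<open>auto intro!: rows_subset rows_disjoint borel_measurable_sum h_rows al_rows al_L4 al_mean\<close>)
    then show "expectation (\<lambda>\<omega>. (\<Sum>i'<i. h i' j \<omega>) ^ 3 * h i j \<omega>) = 0" by (simp add: h_def mult.commute)
  qed
  then show ?thesis by simp
qed

lemma xi_L4: "j < n \<Longrightarrow> L4 (xi j)"
  using xi_bd by (auto simp: L4_bd_def)

lemma H_diff: "H (m1 + k) \<omega> - H m1 \<omega> = (\<Sum>i<k. xi (m1 + i) \<omega>)"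
  by (induction k) (simp_all add: H_def)

lemma xi_orth:
  assumes f: "f \<in> borel_measurable (G (rows {..<j}))" "L4 f" and E: "E \<in> sets (G (rows {..<j}))" and j: "j < n"
  shows "expectation (\<lambda>\<omega>. indicator E \<omega> * (f \<omega> ^ 3 * xi j \<omega>)) = 0"
    "expectation (\<lambda>\<omega>. f \<omega> ^ 3 * xi j \<omega>) = 0"
  unfolding xi_eq
  by (rule orth_cube[where A = "rows {..<j}" and B = "rows {j}"];
      use assms in \<open>auto intro!: rows_subset rows_disjoint AA_rows al_rows AA_L4 al_L4 al_mean\<close>)+

lemma bb_orth:
  assumes f: "f \<in> borel_measurable (G (rows {..<j}))" "L4 f" and E: "E \<in> sets (G (rows {..<j}))" and j: "j < n"
  shows "expectation (\<lambda>\<omega>. indicator E \<omega> * (f \<omega> ^ 3 * bb j \<omega>)) = 0"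
    "expectation (\<lambda>\<omega>. f \<omega> ^ 3 * bb j \<omega>) = 0"
  unfolding bb_eq
  by (rule orth_cube[where A = "rows {..<j}" and B = "rows {j}"];
      use assms in \<open>auto intro!: rows_subset rows_disjoint al_rows al_L4 al_mean simp: Q_def\<close>)+

text \<open>One factor 4 of the constant 16 comes from \<open>xi_bd\<close>, the other from the sum
  over increments. The bound is linear in the length k of the block, so fourth moments are quadratic
  in k.\<close>

lemma H_incr_bd:
  assumes "m1 + k \<le> n"
  shows "L4_bd (\<lambda>\<omega>. \<Sum>i<k. xi (m1 + i) \<omega>) (16 * (real k * (real n * (Ch * (real p)\<^sup>2))))"
proof -
  have "L4_bd (\<lambda>\<omega>. \<Sum>i<k. xi (m1 + i) \<omega>) (4 * (\<Sum>i<k. 4 * (real n * (Ch * (real p)\<^sup>2))))"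
  proof (rule L4_bd_sum_orth)
    fix i assume i: "i < k"
    have "4 * (real (m1 + i) * (Ch * (real p)\<^sup>2)) \<le> 4 * (real n * (Ch * (real p)\<^sup>2))"
      using i assms Ch_nonneg by (intro mult_left_mono mult_right_mono) auto
    then show "L4_bd (xi (m1 + i)) (4 * (real n * (Ch * (real p)\<^sup>2)))"
      using i assms by (intro L4_bd_mono[OF xi_bd]) auto
    show "expectation (\<lambda>\<omega>. (\<Sum>i'<i. xi (m1 + i') \<omega>) ^ 3 * xi (m1 + i) \<omega>) = 0"
      by (rule xi_orth(2)[where E = "{}"])
        (use i assms in \<open>auto intro!: borel_measurable_sum xi_rows L4_sum xi_L4\<close>)
  qed
  then show ?thesis by simp
qed

lemma bb_bd: assumes "j < n" shows "L4_bd (bb j) (4 * (real p * k1))"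
proof -
  have "L4_bd (bb j) (4 * (\<Sum>k<p. k1))"
    unfolding bb_eq[abs_def] mult_1
  proof (rule L4_bd_sum_orth)
    fix k assume k: "k < p"
    show "L4_bd (al (k, k) j) k1" using k assms by (intro al_bd) (auto simp: Q_def)
    have diagG: "al (k, k) j' \<in> borel_measurable (G J)" if "(k, j') \<in> J" for k j' J
      using al_G[of "(k, k)" j' J] that by simp
    have "expectation (\<lambda>\<omega>. (\<Sum>i<k. al (i, i) j \<omega>) ^ 3 * (\<Sum>s\<in>{()}. 1 * al (k, k) j \<omega>)) = 0"
      by (rule orth_cube(2)[where A = "{..<k} \<times> {j}" and B = "{(k, j)}" and E = "{}"])
        (use k assms in \<open>auto intro!: diagG borel_measurable_sum L4_sum al_L4 al_mean simp: Q_def\<close>)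
    then show "expectation (\<lambda>\<omega>. (\<Sum>i<k. al (i, i) j \<omega>) ^ 3 * al (k, k) j \<omega>) = 0" by simp
  qed
  then show ?thesis by simp
qed

lemma bb_L4: "j < n \<Longrightarrow> L4 (bb j)"
  using bb_bd by (auto simp: L4_bd_def)

lemma aa_bd:
  assumes "m \<le> n"
  shows "L4_bd (aa m) (16 * (real m * (real p * k1)))"
proof -
  have "L4_bd (aa m) (4 * (\<Sum>j<m. 4 * (real p * k1)))"
    unfolding aa_def[abs_def]
  proof (rule L4_bd_sum_orth)
    fix j assume j: "j < m"
    then show "L4_bd (bb j) (4 * (real p * k1))" using assms by (intro bb_bd) auto
    show "expectation (\<lambda>\<omega>. (\<Sum>i<j. bb i \<omega>) ^ 3 * bb j \<omega>) = 0"
      by (rule bb_orth(2)[where E = "{}"]) (use j assms in \<open>auto intro!: borel_measurable_sum bb_rows L4_sum bb_L4\<close>)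
  qed
  then show ?thesis by simp
qed

end

section \<open>Elementary approximations of cosine and exponential\<close>

lemma cos_taylor: "\<bar>cos (u + d) - (cos u - d * sin u - d\<^sup>2 / 2 * cos u)\<bar> \<le> \<bar>d\<bar> ^ 3 / 6" for u d :: real
proof -
  let ?z = "iexp d - (\<Sum>k\<le>2. (\<i> * d)^k / fact k)"
  have "Re (iexp u * ?z) = cos (u + d) - (cos u - d * sin u - d\<^sup>2 / 2 * cos u)"
    by (simp add: numeral_2_eq_2 exp_eq_polar cos_add Re_exp Im_exp cis.ctr power2_eq_square algebra_simps)
  then have "\<bar>cos (u + d) - (cos u - d * sin u - d\<^sup>2 / 2 * cos u)\<bar> = \<bar>Re (iexp u * ?z)\<bar>" by simp
  also have "\<dots> \<le> cmod (iexp u * ?z)" by (rule abs_Re_le_cmod)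
  also have "\<dots> = cmod ?z" by (simp add: norm_mult)
  also have "\<dots> \<le> \<bar>d\<bar> ^ Suc 2 / fact (Suc 2)" by (rule iexp_approx1)
  finally show ?thesis by (simp add: numeral_3_eq_3 fact_numeral)
qed

text \<open>The upper bound rests on (1 - y + y^2) (1 + y) = 1 + y^3 together with 1 + y \<le> exp
  y.\<close>

lemma exp_minus_approx:
  fixes y :: real
  assumes "0 \<le> y" shows "\<bar>exp (- y) - (1 - y)\<bar> \<le> y\<^sup>2"
proof -
  have "1 - y \<le> exp (- y)" using exp_ge_add_one_self[of "- y"] by simp
  moreover have "exp (- y) \<le> 1 - y + y\<^sup>2"
  proof -
    have "1 \<le> (1 - y + y\<^sup>2) * (1 + y)"
      using zero_le_power[OF assms, of 3] by (simp add: algebra_simps power2_eq_square power3_eq_cube)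
    also have "\<dots> \<le> (1 - y + y\<^sup>2) * exp y"
    proof (rule mult_left_mono)
      have "0 \<le> (1 - y / 2)\<^sup>2 + 3 / 4 * y\<^sup>2" by simp
      then show "0 \<le> 1 - y + y\<^sup>2" by (simp add: power2_eq_square algebra_simps)
    qed simp
    finally show ?thesis by (simp add: exp_minus field_simps)
  qed
  ultimately show ?thesis by simp
qed

lemma integral_sum_sum:
  fixes f :: "'i \<Rightarrow> 'j \<Rightarrow> 'a \<Rightarrow> real"
  assumes "\<And>i j. i \<in> I \<Longrightarrow> j \<in> J \<Longrightarrow> integrable M (f i j)"
  shows "(LINT \<omega>|M. (\<Sum>i\<in>I. \<Sum>j\<in>J. f i j \<omega>)) = (\<Sum>i\<in>I. \<Sum>j\<in>J. LINT \<omega>|M. f i j \<omega>)"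
proof -
  have "(LINT \<omega>|M. (\<Sum>i\<in>I. \<Sum>j\<in>J. f i j \<omega>)) = (\<Sum>i\<in>I. LINT \<omega>|M. (\<Sum>j\<in>J. f i j \<omega>))"
    by (rule Bochner_Integration.integral_sum) (use assms in auto)
  also have "\<dots> = (\<Sum>i\<in>I. \<Sum>j\<in>J. LINT \<omega>|M. f i j \<omega>)"
    by (intro sum.cong refl Bochner_Integration.integral_sum assms)
  finally show ?thesis .
qed

context std_array
begin

section \<open>Conditional variances of the increments\<close>

lemma swap_Q: "prod.swap q \<in> Q \<longleftrightarrow> q \<in> Q" by (cases q) (auto simp: Q_def)
lemma finite_Q[simp]: "finite Q" by (simp add: Q_def)
lemma AA_swap: "AA (prod.swap q) j \<omega> = AA q j \<omega>" by (auto simp: AA_def al_def mult.commute intro!: sum.cong)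

lemma expectation_xi_zero:
  assumes Z: "Z \<in> borel_measurable (G (rows {..<j}))" "\<And>\<omega>. \<bar>Z \<omega>\<bar> \<le> 1" and j: "j < n"
  shows "integrable M (\<lambda>\<omega>. Z \<omega> * xi j \<omega>)" "expectation (\<lambda>\<omega>. Z \<omega> * xi j \<omega>) = 0"
proof -
  have ZM: "Z \<in> borel_measurable M" by (rule G_M[OF Z(1) rows_subset]) (use j in auto)
  have *: "integrable M (\<lambda>\<omega>. Z \<omega> * (\<Sum>q\<in>Q. AA q j \<omega> * al q j \<omega>)) \<and>
        expectation (\<lambda>\<omega>. Z \<omega> * (\<Sum>q\<in>Q. AA q j \<omega> * al q j \<omega>)) = 0"
    by (intro conjI orth[where A = "rows {..<j}" and B = "rows {j}"])
      (use j Z in \<open>auto intro!: rows_subset rows_disjoint AA_rows al_rows L4_integrable al_L4 al_mean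
        L4_mult_bounded[OF ZM] AA_L4\<close>)
  then show "integrable M (\<lambda>\<omega>. Z \<omega> * xi j \<omega>)" "expectation (\<lambda>\<omega>. Z \<omega> * xi j \<omega>) = 0"
    by (auto simp: xi_eq)
qed

lemma V_integrable:
  assumes "j < n" and Z: "Z \<in> borel_measurable M" "\<And>\<omega>. \<bar>Z \<omega>\<bar> \<le> 1"
  shows "integrable M (\<lambda>\<omega>. Z \<omega> * V j \<omega>)"
  unfolding V_def sum_distrib_left
proof (rule Bochner_Integration.integrable_sum)
  fix q assume q: "q \<in> Q"
  have "integrable M (\<lambda>\<omega>. Z \<omega> * AA q j \<omega> * (2 * AA q j \<omega>))"
    by (intro L4_prod2 L4_mult_bounded Z L4_cmult AA_L4 q) (use assms in auto)
  then show "integrable M (\<lambda>\<omega>. Z \<omega> * (2 * (AA q j \<omega>)\<^sup>2))"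
    by (simp add: power2_eq_square mult_ac)
qed

text \<open>In the expanded square \<open>al_cov\<close> retains the pairs with q' equal to q or to
  its transpose. The coefficients \<open>AA\<close> are symmetric, so both contribute the same,
  whence the factor 2 in \<open>V\<close>.\<close>

lemma expectation_xi_sq:
  assumes Z: "Z \<in> borel_measurable (G (rows {..<j}))" "\<And>\<omega>. \<bar>Z \<omega>\<bar> \<le> 1" and j: "j < n"
  shows "expectation (\<lambda>\<omega>. Z \<omega> * (xi j \<omega>)\<^sup>2) = expectation (\<lambda>\<omega>. Z \<omega> * V j \<omega>)"
proof -
  have ZM: "Z \<in> borel_measurable M" by (rule G_M[OF Z(1) rows_subset]) (use j in auto)
  let ?E = "\<lambda>q q'. expectation (\<lambda>\<omega>. Z \<omega> * (AA q j \<omega> * AA q' j \<omega>))"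
  have iZ: "integrable M (\<lambda>\<omega>. Z \<omega> * (AA q j \<omega> * AA q' j \<omega>))" if "q \<in> Q" "q' \<in> Q" for q q'
  proof -
    have "integrable M (\<lambda>\<omega>. Z \<omega> * AA q j \<omega> * AA q' j \<omega>)"
      by (intro L4_prod2 L4_mult_bounded ZM Z AA_L4 that) (use j in auto)
    then show ?thesis by (simp add: mult.assoc)
  qed
  have *: "integrable M (\<lambda>\<omega>. Z \<omega> * ((AA q j \<omega> * AA q' j \<omega>) * (al q j \<omega> * al q' j \<omega>)))"
    "expectation (\<lambda>\<omega>. Z \<omega> * ((AA q j \<omega> * AA q' j \<omega>) * (al q j \<omega> * al q' j \<omega>)))
      = ?E q q' * (of_bool (q = q') + of_bool (q = prod.swap q'))"
    if q: "q \<in> Q" "q' \<in> Q" for q q'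
  proof -
    have mA: "(\<lambda>\<omega>. AA q j \<omega> * AA q' j \<omega>) \<in> borel_measurable (G (rows {..<j}))"
      using q by (intro borel_measurable_times AA_rows) auto
    have ma: "(\<lambda>\<omega>. al q j \<omega> * al q' j \<omega>) \<in> borel_measurable (G (rows {j}))"
      using q by (intro borel_measurable_times al_rows) auto
    have ia: "integrable M (\<lambda>\<omega>. al q j \<omega> * al q' j \<omega>)" using q j by (intro L4_prod2 al_L4)
    have sub: "rows {..<j} \<subseteq> {..<p} \<times> {..<n}" "rows {j} \<subseteq> {..<p} \<times> {..<n}" "rows {..<j} \<inter> rows {j} = {}"
      using j by (auto simp: rows_def)
    note o = gen_alg_orth[OF indep sub Z(1)[unfolded G_def] mA[unfolded G_def] iZ[OF q] ma[unfolded G_def] ia]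
    show "integrable M (\<lambda>\<omega>. Z \<omega> * ((AA q j \<omega> * AA q' j \<omega>) * (al q j \<omega> * al q' j \<omega>)))" by (rule o(1))
    show "expectation (\<lambda>\<omega>. Z \<omega> * ((AA q j \<omega> * AA q' j \<omega>) * (al q j \<omega> * al q' j \<omega>)))
      = ?E q q' * (of_bool (q = q') + of_bool (q = prod.swap q'))" unfolding o(2) al_cov[OF q j] ..
  qed
  have pt: "Z \<omega> * (xi j \<omega>)\<^sup>2
      = (\<Sum>q\<in>Q. \<Sum>q'\<in>Q. Z \<omega> * ((AA q j \<omega> * AA q' j \<omega>) * (al q j \<omega> * al q' j \<omega>)))" for \<omega>
  proof -
    have "(xi j \<omega>)\<^sup>2 = (\<Sum>q\<in>Q. \<Sum>q'\<in>Q. (AA q j \<omega> * al q j \<omega>) * (AA q' j \<omega> * al q' j \<omega>))"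
      unfolding xi_eq power2_eq_square by (rule sum_product)
    then show ?thesis unfolding sum_distrib_left by (simp add: sum_distrib_left mult_ac)
  qed
  have "expectation (\<lambda>\<omega>. Z \<omega> * (xi j \<omega>)\<^sup>2)
      = (\<Sum>q\<in>Q. \<Sum>q'\<in>Q. expectation (\<lambda>\<omega>. Z \<omega> * ((AA q j \<omega> * AA q' j \<omega>) * (al q j \<omega> * al q' j \<omega>))))"
    unfolding pt by (rule integral_sum_sum) (rule *(1))
  also have "\<dots> = (\<Sum>q\<in>Q. \<Sum>q'\<in>Q. ?E q q' * (of_bool (q = q') + of_bool (q = prod.swap q')))"
    by (rule sum.cong[OF refl], rule sum.cong[OF refl], rule *(2))
  also have "\<dots> = (\<Sum>q\<in>Q. 2 * ?E q q)"
  proof (rule sum.cong[OF refl])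
    fix q assume q: "q \<in> Q"
    have sw: "q = prod.swap q' \<longleftrightarrow> q' = prod.swap q" for q' by (cases q; cases q') auto
    define e where "e q' = ?E q q'" for q'
    have "(\<Sum>q'\<in>Q. e q' * (of_bool (q = q') + of_bool (q = prod.swap q')))
      = (\<Sum>q'\<in>Q. (if q' = q then e q' else 0) + (if q' = prod.swap q then e q' else 0))"
      unfolding sw by (intro sum.cong refl) auto
    also have "\<dots> = e q + e (prod.swap q)"
      using q swap_Q[of q] by (simp add: sum.distrib)
    also have "\<dots> = 2 * e q" by (simp add: AA_swap e_def)
    finally show "(\<Sum>q'\<in>Q. ?E q q' * (of_bool (q = q') + of_bool (q = prod.swap q'))) = 2 * ?E q q"
      unfolding e_def .
  qed
  also have "\<dots> = (\<Sum>q\<in>Q. expectation (\<lambda>\<omega>. 2 * (Z \<omega> * (AA q j \<omega> * AA q j \<omega>))))"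
    by simp
  also have "\<dots> = expectation (\<lambda>\<omega>. \<Sum>q\<in>Q. 2 * (Z \<omega> * (AA q j \<omega> * AA q j \<omega>)))"
    by (rule Bochner_Integration.integral_sum[symmetric]) (intro integrable_mult_right iZ)
  also have "\<dots> = expectation (\<lambda>\<omega>. Z \<omega> * V j \<omega>)"
    unfolding V_def power2_eq_square sum_distrib_left
    by (intro Bochner_Integration.integral_cong sum.cong refl) simp
  finally show ?thesis .
qed

lemma h_diag: "h i i \<omega> = (bb i \<omega>)\<^sup>2 + (2 * real p - 2) * bb i \<omega> + (real p)\<^sup>2 - real p"
proof -
  have sq: "(\<Sum>k<p. \<Sum>l<p. (x k i \<omega>)\<^sup>2 * (x l i \<omega>)\<^sup>2) = (\<Sum>k<p. (x k i \<omega>)\<^sup>2)\<^sup>2"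
    unfolding power2_eq_square[of "sum _ _"] sum_product ..
  have "h i i \<omega> = (\<Sum>k<p. \<Sum>l<p. ((x k i \<omega>)\<^sup>2 * (x l i \<omega>)\<^sup>2 + (if l = k then 1 - 2 * (x k i \<omega>)\<^sup>2 else 0)))"
    unfolding h_def Q_def sum.cartesian_product
    by (intro sum.cong refl) (auto simp: al_def case_prod_unfold power2_eq_square algebra_simps)
  then have "h i i \<omega> = (\<Sum>k<p. \<Sum>l<p. (x k i \<omega>)\<^sup>2 * (x l i \<omega>)\<^sup>2) + (\<Sum>k<p. 1 - 2 * (x k i \<omega>)\<^sup>2)"
    by (simp add: sum.distrib)
  also have "\<dots> = (\<Sum>k<p. (x k i \<omega>)\<^sup>2)\<^sup>2 + real p - 2 * (\<Sum>k<p. (x k i \<omega>)\<^sup>2)"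
    unfolding sq by (simp add: sum_subtractf sum_distrib_left)
  finally show ?thesis by (simp add: bb_def power2_eq_square algebra_simps)
qed

text \<open>In the squared norm of a sum of matrices the pairs of distinct observations give 2
  \<open>H\<close>, and \<open>h_diag\<close> handles the rest. Centring the squares of
  \<open>bb\<close> at 2 p turns p^2 - p into p^2 + p. Concentration of \<open>V\<close> is thereby
  reduced to moments of \<open>H\<close>, \<open>aa\<close> and \<open>BB\<close>.\<close>

lemma V_eq: "V j \<omega> = 4 * H j \<omega> + 2 * BB j \<omega> + 4 * (real p - 1) * aa j \<omega> + 2 * real j * ((real p)\<^sup>2 + real p)"
proof -
  have "(\<Sum>q\<in>Q. (AA q j \<omega>)\<^sup>2) = (\<Sum>q\<in>Q. \<Sum>(i, i')\<in>{..<j}\<times>{..<j}. al q i \<omega> * al q i' \<omega>)"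
    by (simp add: AA_def power2_eq_square sum_product sum.cartesian_product)
  also have "\<dots> = (\<Sum>(i, i')\<in>{..<j}\<times>{..<j}. h i i' \<omega>)"
    by (subst sum.swap) (simp add: h_def case_prod_unfold)
  also have "\<dots> = (\<Sum>i<j. h i i \<omega>) + 2 * (\<Sum>i'<j. \<Sum>i<i'. h i i' \<omega>)"
    by (rule sum_square_symmetric) (simp add: h_sym)
  also have "(\<Sum>i'<j. \<Sum>i<i'. h i i' \<omega>) = H j \<omega>" by (simp add: H_def xi_def)
  also have "(\<Sum>i<j. h i i \<omega>) = BB j \<omega> + (2 * real p - 2) * aa j \<omega> + real j * ((real p)\<^sup>2 + real p)"
    by (simp add: h_diag BB_def aa_def sum.distrib sum_subtractf sum_distrib_left algebra_simps)
  finally show ?thesis by (simp add: V_def algebra_simps)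
qed

lemma bb_second_moment: assumes "j < n" shows "expectation (\<lambda>\<omega>. (bb j \<omega>)\<^sup>2) = 2 * real p"
proof -
  have "expectation (\<lambda>\<omega>. (bb j \<omega>)\<^sup>2) = expectation (\<lambda>\<omega>. \<Sum>k<p. \<Sum>l<p. al (k, k) j \<omega> * al (l, l) j \<omega>)"
    by (simp add: bb_eq power2_eq_square sum_product)
  also have "\<dots> = (\<Sum>k<p. \<Sum>l<p. expectation (\<lambda>\<omega>. al (k, k) j \<omega> * al (l, l) j \<omega>))"
  proof -
    have "integrable M (\<lambda>\<omega>. al (k, k) j \<omega> * al (l, l) j \<omega>)" if "k < p" "l < p" for k l
      using that assms by (intro L4_prod2 al_L4) (auto simp: Q_def)
    then show ?thesis by (intro integral_sum_sum) auto
  qed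
  also have "\<dots> = (\<Sum>k<p. \<Sum>l<p. if l = k then 2 else 0)"
    using assms by (intro sum.cong refl) (auto simp: al_cov Q_def)
  finally show ?thesis by simp
qed

abbreviation cc :: "nat \<Rightarrow> 'a \<Rightarrow> real" where "cc j \<omega> \<equiv> (bb j \<omega>)\<^sup>2 - 2 * real p"

lemma cc_sq_integrable: "j < n \<Longrightarrow> integrable M (\<lambda>\<omega>. (cc j \<omega>)\<^sup>2)"
  and cc_integrable: "j < n \<Longrightarrow> integrable M (cc j)"
  and cc_mean: "j < n \<Longrightarrow> expectation (cc j) = 0"
  and cc_sq: "j < n \<Longrightarrow> expectation (\<lambda>\<omega>. (cc j \<omega>)\<^sup>2) \<le> (4 * (real p * k1))\<^sup>2"
proof -
  assume j: "j < n"
  have i2: "integrable M (\<lambda>\<omega>. (bb j \<omega>)\<^sup>2)" and i4: "integrable M (\<lambda>\<omega>. bb j \<omega> ^ 4)"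
    using L4_power[OF bb_L4[OF j]] by auto
  show "integrable M (cc j)" "expectation (cc j) = 0" using i2 bb_second_moment[OF j] by (auto simp: prob_space)
  have eq: "(\<lambda>\<omega>. (cc j \<omega>)\<^sup>2) = (\<lambda>\<omega>. bb j \<omega> ^ 4 - 4 * real p * (bb j \<omega>)\<^sup>2 + 4 * (real p)\<^sup>2)"
    by (simp add: fun_eq_iff power2_eq_square power4_eq_xxxx algebra_simps)
  show "integrable M (\<lambda>\<omega>. (cc j \<omega>)\<^sup>2)" unfolding eq using i2 i4 by simp
  have "expectation (\<lambda>\<omega>. (cc j \<omega>)\<^sup>2) = expectation (\<lambda>\<omega>. bb j \<omega> ^ 4) - 4 * (real p)\<^sup>2"
    unfolding eq using i2 i4 bb_second_moment[OF j] by (simp add: prob_space power2_eq_square)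
  also have "\<dots> \<le> (4 * (real p * k1))\<^sup>2"
    using conjunct2[OF conjunct2[OF bb_bd[OF j, unfolded L4_bd_def]]] zero_le_power2[of "real p"] by linarith
  finally show "expectation (\<lambda>\<omega>. (cc j \<omega>)\<^sup>2) \<le> (4 * (real p * k1))\<^sup>2" .
qed

lemma cc_rows: "j \<in> J \<Longrightarrow> cc j \<in> borel_measurable (G (rows J))"
  by (intro borel_measurable_diff borel_measurable_power bb_rows) auto

lemma BB_M: "m \<le> n \<Longrightarrow> BB m \<in> borel_measurable M"
  using BB_rows[of m "{..<m}"] by (auto intro!: G_M[of _ "rows {..<m}"] rows_subset)

lemma BB_cross:
  assumes f: "f \<in> borel_measurable (G (rows {..<j}))" "integrable M f" and j: "j < n"
  shows "integrable M (\<lambda>\<omega>. f \<omega> * cc j \<omega>)" "expectation (\<lambda>\<omega>. f \<omega> * cc j \<omega>) = 0"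
proof -
  have "indep_var borel f borel (cc j)"
    using f j by (intro G_indep[of _ "rows {..<j}" _ "rows {j}"]) (auto intro!: rows_subset rows_disjoint cc_rows)
  from indep_mult_expectation[OF this f(2) cc_integrable[OF j]] cc_mean[OF j]
  show "integrable M (\<lambda>\<omega>. f \<omega> * cc j \<omega>)" "expectation (\<lambda>\<omega>. f \<omega> * cc j \<omega>) = 0" by auto
qed

lemma BB_integrable: "m \<le> n \<Longrightarrow> integrable M (BB m)"
  unfolding BB_def[abs_def] by (intro Bochner_Integration.integrable_sum cc_integrable) auto

text \<open>The fourth moments of \<open>bb\<close> give second moments of its square, so here plain
  orthogonality in L2 replaces the calculus of L4 bounds.\<close>

lemma BB_sq:
  assumes "m \<le> n"
  shows "integrable M (\<lambda>\<omega>. (BB m \<omega>)\<^sup>2)" "expectation (\<lambda>\<omega>. (BB m \<omega>)\<^sup>2) \<le> real m * (4 * (real p * k1))\<^sup>2"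
proof -
  have "integrable M (\<lambda>\<omega>. (BB m \<omega>)\<^sup>2) \<and> expectation (\<lambda>\<omega>. (BB m \<omega>)\<^sup>2) \<le> real m * (4 * (real p * k1))\<^sup>2"
    using assms
  proof (induction m)
    case (Suc m)
    then have m: "m < n" by simp
    have eq: "(\<lambda>\<omega>. (BB (Suc m) \<omega>)\<^sup>2) = (\<lambda>\<omega>. (BB m \<omega>)\<^sup>2 + 2 * (BB m \<omega> * cc m \<omega>) + (cc m \<omega>)\<^sup>2)"
      by (simp add: fun_eq_iff BB_def power2_eq_square algebra_simps)
    note c = BB_cross[OF BB_rows BB_integrable m, of m]
    have "expectation (\<lambda>\<omega>. (BB (Suc m) \<omega>)\<^sup>2) = expectation (\<lambda>\<omega>. (BB m \<omega>)\<^sup>2) + expectation (\<lambda>\<omega>. (cc m \<omega>)\<^sup>2)"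
      unfolding eq using Suc c cc_sq_integrable[OF m] m by simp
    moreover have "integrable M (\<lambda>\<omega>. (BB (Suc m) \<omega>)\<^sup>2)"
      unfolding eq using Suc c cc_sq_integrable[OF m] m by simp
    ultimately show ?case using Suc cc_sq[OF m] m by (simp add: algebra_simps)
  qed (simp add: BB_def)
  then show "integrable M (\<lambda>\<omega>. (BB m \<omega>)\<^sup>2)" "expectation (\<lambda>\<omega>. (BB m \<omega>)\<^sup>2) \<le> real m * (4 * (real p * k1))\<^sup>2"
    by auto
qed

lemma H_bd: assumes "m \<le> n" shows "L4_bd (H m) (16 * (real m * (real n * (Ch * (real p)\<^sup>2))))"
  using H_incr_bd[of 0 m] assms by (simp add: H_def[abs_def])

text \<open>The terms bound, for every j < n, the expectations of 4 |H|, 4 p |aa| and 2 |BB| in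
  \<open>V_eq\<close>. For p of order n this is of order n^2, against conditional variances of order
  up to n^3.\<close>

definition KV :: real where
  "KV = 4 * sqrt (16 * (real n * (real n * (Ch * (real p)\<^sup>2)))) + 4 * real p * sqrt (16 * (real n * (real p * k1)))
     + 2 * sqrt (real n * (4 * (real p * k1))\<^sup>2)"

lemma V_concentration:
  assumes j: "j < n"
  shows "integrable M (\<lambda>\<omega>. \<bar>V j \<omega> - 2 * real j * ((real p)\<^sup>2 + real p)\<bar>)"
    "expectation (\<lambda>\<omega>. \<bar>V j \<omega> - 2 * real j * ((real p)\<^sup>2 + real p)\<bar>) \<le> KV"
proof -
  have jn: "real j \<le> real n" using j by simp
  have L: "L4 (H j)" "L4 (aa j)" using H_bd[of j] aa_bd[of j] j by (auto simp: L4_bd_def)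
  have bdH: "expectation (\<lambda>\<omega>. (H j \<omega>)\<^sup>2) \<le> (sqrt (16 * (real n * (real n * (Ch * (real p)\<^sup>2)))))\<^sup>2"
  proof -
    have "16 * (real j * (real n * (Ch * (real p)\<^sup>2))) \<le> 16 * (real n * (real n * (Ch * (real p)\<^sup>2)))"
      using jn Ch_nonneg by (intro mult_left_mono mult_right_mono) auto
    from order_trans[OF expectation_sq_le[OF H_bd[of j]] this] show ?thesis using j Ch_nonneg by simp
  qed
  have bda: "expectation (\<lambda>\<omega>. (aa j \<omega>)\<^sup>2) \<le> (sqrt (16 * (real n * (real p * k1))))\<^sup>2"
  proof -
    have "16 * (real j * (real p * k1)) \<le> 16 * (real n * (real p * k1))"
      using jn k1 by (intro mult_left_mono mult_right_mono) auto
    from order_trans[OF expectation_sq_le[OF aa_bd[of j]] this] show ?thesis using j k1 by simp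
  qed
  have bdB: "expectation (\<lambda>\<omega>. (BB j \<omega>)\<^sup>2) \<le> (sqrt (real n * (4 * (real p * k1))\<^sup>2))\<^sup>2"
  proof -
    have "real j * (4 * (real p * k1))\<^sup>2 \<le> real n * (4 * (real p * k1))\<^sup>2"
      using jn by (intro mult_right_mono) auto
    from order_trans[OF BB_sq(2)[of j] this] show ?thesis using j by simp
  qed
  note eH = expectation_abs_le[OF L4_measurable[OF L(1)] L4_power[OF L(1)] bdH]
  note ea = expectation_abs_le[OF L4_measurable[OF L(2)] L4_power[OF L(2)] bda]
  note eB = expectation_abs_le[OF BB_M BB_sq(1) bdB]
  let ?W = "\<lambda>\<omega>. V j \<omega> - 2 * real j * ((real p)\<^sup>2 + real p)"
  have le: "\<bar>?W \<omega>\<bar> \<le> 4 * \<bar>H j \<omega>\<bar> + 4 * real p * \<bar>aa j \<omega>\<bar> + 2 * \<bar>BB j \<omega>\<bar>" for \<omega>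
  proof -
    have "\<bar>(real p - 1) * aa j \<omega>\<bar> \<le> real p * \<bar>aa j \<omega>\<bar>"
    \<comment> \<open>For p = 0 the modulus of p - 1 exceeds p, but then \<open>aa j\<close>
      vanishes.\<close>
    proof (cases "p = 0")
      case True
      then have "aa j \<omega> = 0" unfolding aa_def bb_def by simp
      then show ?thesis by simp
    next
      case False
      then show ?thesis by (simp add: abs_mult mult_right_mono)
    qed
    moreover have "?W \<omega> = 4 * H j \<omega> + 4 * ((real p - 1) * aa j \<omega>) + 2 * BB j \<omega>" by (simp add: V_eq)
    ultimately show ?thesis by linarith
  qed
  have i: "integrable M ?W"
    unfolding V_eq using L4_integrable[OF L(1)] L4_integrable[OF L(2)] BB_integrable[of j] j by simp
  then show i': "integrable M (\<lambda>\<omega>. \<bar>?W \<omega>\<bar>)" by simp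
  have "expectation (\<lambda>\<omega>. \<bar>?W \<omega>\<bar>) \<le> expectation (\<lambda>\<omega>. 4 * \<bar>H j \<omega>\<bar> + 4 * real p * \<bar>aa j \<omega>\<bar> + 2 * \<bar>BB j \<omega>\<bar>)"
    using L4_integrable[OF L(1)] L4_integrable[OF L(2)] BB_integrable[of j] j by (intro integral_mono i' le) auto
  also have "\<dots> = 4 * expectation (\<lambda>\<omega>. \<bar>H j \<omega>\<bar>) + 4 * real p * expectation (\<lambda>\<omega>. \<bar>aa j \<omega>\<bar>) + 2 * expectation (\<lambda>\<omega>. \<bar>BB j \<omega>\<bar>)"
    using L4_integrable[OF L(1)] L4_integrable[OF L(2)] BB_integrable[of j] j by simp
  also have "\<dots> \<le> KV"
    unfolding KV_def using eH(2) ea(2) eB(2) j Ch_nonneg k1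
    by (intro add_mono mult_left_mono) auto
  finally show "expectation (\<lambda>\<omega>. \<bar>?W \<omega>\<bar>) \<le> KV" .
qed

definition sv :: "nat \<Rightarrow> real" where "sv j = 2 * real j * ((real p)\<^sup>2 + real p)"

lemma xi_cube:
  assumes j: "j < n"
  shows "integrable M (\<lambda>\<omega>. \<bar>xi j \<omega>\<bar> ^ 3)"
    "expectation (\<lambda>\<omega>. \<bar>xi j \<omega>\<bar> ^ 3) \<le> 4 * (real n * (Ch * (real p)\<^sup>2)) * sqrt (4 * (real n * (Ch * (real p)\<^sup>2)))"
proof -
  have "4 * (real j * (Ch * (real p)\<^sup>2)) \<le> 4 * (real n * (Ch * (real p)\<^sup>2))"
    using j Ch_nonneg by (intro mult_left_mono mult_right_mono) auto
  from expectation_cube_le[OF L4_bd_mono[OF xi_bd[OF j] this]]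
  show "integrable M (\<lambda>\<omega>. \<bar>xi j \<omega>\<bar> ^ 3)"
    "expectation (\<lambda>\<omega>. \<bar>xi j \<omega>\<bar> ^ 3) \<le> 4 * (real n * (Ch * (real p)\<^sup>2)) * sqrt (4 * (real n * (Ch * (real p)\<^sup>2)))"
    by auto
qed

section \<open>A martingale central limit theorem\<close>

text \<open>Taylor expansion of the cosine in the increment \<open>d j * xi j\<close>. The linear
  term has expectation zero; in the quadratic term the squared increment becomes \<open>V j\<close>
  and then the constant \<open>sv j\<close>, at the cost \<open>KV\<close>; the third absolute
  moment bounds the remainder.\<close>

lemma clt_step:
  fixes d :: "nat \<Rightarrow> real"
  assumes j: "j < n"
  defines "S \<equiv> \<lambda>j \<omega>. \<Sum>i<j. d i * xi i \<omega>"
  shows "\<bar>expectation (\<lambda>\<omega>. cos (S (Suc j) \<omega> + \<alpha>)) - (1 - (d j)\<^sup>2 * sv j / 2) * expectation (\<lambda>\<omega>. cos (S j \<omega> + \<alpha>))\<bar>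
    \<le> (d j)\<^sup>2 / 2 * KV + \<bar>d j\<bar> ^ 3 / 6 * (4 * (real n * (Ch * (real p)\<^sup>2)) * sqrt (4 * (real n * (Ch * (real p)\<^sup>2))))"
proof -
  have Sr: "S j \<in> borel_measurable (G (rows {..<j}))"
    unfolding S_def by (intro borel_measurable_sum borel_measurable_times xi_rows) auto
  have xM[measurable]: "xi i \<in> borel_measurable M" if "i \<le> j" for i
    using xi_L4[of i] that j by (simp add: L4_def)
  have SM[measurable]: "S k \<in> borel_measurable M" if "k \<le> Suc j" for k
    unfolding S_def using that by (intro borel_measurable_sum borel_measurable_times xM) auto
  let ?c = "\<lambda>\<omega>. cos (S j \<omega> + \<alpha>)" and ?s = "\<lambda>\<omega>. sin (S j \<omega> + \<alpha>)"
  have cr: "?c \<in> borel_measurable (G (rows {..<j}))" "?s \<in> borel_measurable (G (rows {..<j}))"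
    using measurable_compose[OF Sr, of "\<lambda>s. cos (s + \<alpha>)" borel] measurable_compose[OF Sr, of "\<lambda>s. sin (s + \<alpha>)" borel]
    by auto
  have ic: "integrable M (\<lambda>\<omega>. cos (S k \<omega> + \<alpha>))" if "k \<le> Suc j" for k
    by (rule integrable_const_bound[where B = 1]) (use SM[OF that] in auto)
  note e1 = expectation_xi_zero[OF cr(2) _ j]
  have i2: "integrable M (\<lambda>\<omega>. ?c \<omega> * (xi j \<omega>)\<^sup>2)"
    using L4_prod2[OF L4_mult_bounded[OF G_M[OF cr(1)] xi_L4[OF j]] xi_L4[OF j]] j
    by (simp add: power2_eq_square mult.assoc rows_subset)
  have e2: "expectation (\<lambda>\<omega>. ?c \<omega> * (xi j \<omega>)\<^sup>2) = expectation (\<lambda>\<omega>. ?c \<omega> * V j \<omega>)"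
    by (rule expectation_xi_sq[OF cr(1) _ j]) simp
  have iV: "integrable M (\<lambda>\<omega>. ?c \<omega> * V j \<omega>)"
    using V_integrable[OF j G_M[OF cr(1)]] j by (simp add: rows_subset)
  note x3 = xi_cube[OF j]
  have D: "expectation (\<lambda>\<omega>. cos (S (Suc j) \<omega> + \<alpha>)) - (1 - (d j)\<^sup>2 * sv j / 2) * expectation ?c
    = expectation (\<lambda>\<omega>. cos (S (Suc j) \<omega> + \<alpha>) - (?c \<omega> - d j * (?s \<omega> * xi j \<omega>) - (d j)\<^sup>2 / 2 * (?c \<omega> * (xi j \<omega>)\<^sup>2)))
      - (d j)\<^sup>2 / 2 * expectation (\<lambda>\<omega>. ?c \<omega> * (V j \<omega> - sv j))"
  proof -
    have eq1: "expectation (\<lambda>\<omega>. ?c \<omega> * (V j \<omega> - sv j)) = expectation (\<lambda>\<omega>. ?c \<omega> * V j \<omega>) - sv j * expectation ?c"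
      using iV ic[of j] by (simp add: right_diff_distrib mult.commute)
    have eq2: "expectation (\<lambda>\<omega>. cos (S (Suc j) \<omega> + \<alpha>) - (?c \<omega> - d j * (?s \<omega> * xi j \<omega>) - (d j)\<^sup>2 / 2 * (?c \<omega> * (xi j \<omega>)\<^sup>2)))
      = expectation (\<lambda>\<omega>. cos (S (Suc j) \<omega> + \<alpha>)) - (expectation ?c - (d j)\<^sup>2 / 2 * expectation (\<lambda>\<omega>. ?c \<omega> * V j \<omega>))"
      using ic[of "Suc j"] ic[of j] e1 i2 unfolding e2[symmetric] by simp
    show ?thesis unfolding eq1 eq2 by (simp add: field_simps)
  qed
  have "\<bar>expectation (\<lambda>\<omega>. cos (S (Suc j) \<omega> + \<alpha>) - (?c \<omega> - d j * (?s \<omega> * xi j \<omega>) - (d j)\<^sup>2 / 2 * (?c \<omega> * (xi j \<omega>)\<^sup>2)))\<bar>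
     \<le> expectation (\<lambda>\<omega>. \<bar>d j\<bar> ^ 3 / 6 * \<bar>xi j \<omega>\<bar> ^ 3)"
  proof (rule order_trans[OF integral_abs_bound integral_mono])
    show "\<bar>cos (S (Suc j) \<omega> + \<alpha>) - (?c \<omega> - d j * (?s \<omega> * xi j \<omega>) - (d j)\<^sup>2 / 2 * (?c \<omega> * (xi j \<omega>)\<^sup>2))\<bar>
      \<le> \<bar>d j\<bar> ^ 3 / 6 * \<bar>xi j \<omega>\<bar> ^ 3" for \<omega>
      using cos_taylor[of "S j \<omega> + \<alpha>" "d j * xi j \<omega>"]
      by (simp add: S_def abs_mult power_mult_distrib algebra_simps)
  qed (use ic[of "Suc j"] ic[of j] e1 i2 x3 in auto)
  also have "\<dots> \<le> \<bar>d j\<bar> ^ 3 / 6 * (4 * (real n * (Ch * (real p)\<^sup>2)) * sqrt (4 * (real n * (Ch * (real p)\<^sup>2))))"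
    using mult_left_mono[OF x3(2), of "\<bar>d j\<bar> ^ 3 / 6"] by simp
  finally have A: "\<bar>expectation (\<lambda>\<omega>. cos (S (Suc j) \<omega> + \<alpha>) - (?c \<omega> - d j * (?s \<omega> * xi j \<omega>) - (d j)\<^sup>2 / 2 * (?c \<omega> * (xi j \<omega>)\<^sup>2)))\<bar>
     \<le> \<bar>d j\<bar> ^ 3 / 6 * (4 * (real n * (Ch * (real p)\<^sup>2)) * sqrt (4 * (real n * (Ch * (real p)\<^sup>2))))" .
  have "\<bar>expectation (\<lambda>\<omega>. ?c \<omega> * (V j \<omega> - sv j))\<bar> \<le> expectation (\<lambda>\<omega>. \<bar>V j \<omega> - sv j\<bar>)"
  proof (rule order_trans[OF integral_abs_bound integral_mono])
    show "\<bar>?c \<omega> * (V j \<omega> - sv j)\<bar> \<le> \<bar>V j \<omega> - sv j\<bar>" for \<omega>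
      using mult_right_mono[of "\<bar>?c \<omega>\<bar>" 1 "\<bar>V j \<omega> - sv j\<bar>"] by (simp add: abs_mult)
  qed (use iV ic[of j] V_concentration[OF j] in \<open>auto simp: right_diff_distrib sv_def\<close>)
  also have "\<dots> \<le> KV" using V_concentration[OF j] by (simp add: sv_def)
  finally have B: "(d j)\<^sup>2 / 2 * \<bar>expectation (\<lambda>\<omega>. ?c \<omega> * (V j \<omega> - sv j))\<bar> \<le> (d j)\<^sup>2 / 2 * KV"
    by (intro mult_left_mono) auto
  show ?thesis unfolding D
    using A B abs_triangle_ineq4[of "expectation (\<lambda>\<omega>. cos (S (Suc j) \<omega> + \<alpha>) - (?c \<omega> - d j * (?s \<omega> * xi j \<omega>) - (d j)\<^sup>2 / 2 * (?c \<omega> * (xi j \<omega>)\<^sup>2)))"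
      "(d j)\<^sup>2 / 2 * expectation (\<lambda>\<omega>. ?c \<omega> * (V j \<omega> - sv j))"]
    by (simp add: abs_mult)
qed

text \<open>Each factor 1 - y of \<open>clt_step\<close> is replaced by exp (-y), with error at most
  y^2. Because exp (-y) is at most 1, errors of earlier steps are not amplified and simply add up
  over the n steps.\<close>

lemma clt:
  fixes d :: "nat \<Rightarrow> real"
  assumes D: "\<And>j. j < n \<Longrightarrow> \<bar>d j\<bar> \<le> D"
  defines "v \<equiv> \<Sum>j<n. (d j)\<^sup>2 * sv j"
  shows "\<bar>expectation (\<lambda>\<omega>. cos ((\<Sum>j<n. d j * xi j \<omega>) + \<alpha>)) - exp (- v / 2) * cos \<alpha>\<bar>
    \<le> real n * (D\<^sup>2 / 2 * KV + D ^ 3 / 6 * (4 * (real n * (Ch * (real p)\<^sup>2)) * sqrt (4 * (real n * (Ch * (real p)\<^sup>2))))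
        + (D\<^sup>2 * (real n * ((real p)\<^sup>2 + real p)))\<^sup>2)"
proof -
  define err where "err = D\<^sup>2 / 2 * KV + D ^ 3 / 6 * (4 * (real n * (Ch * (real p)\<^sup>2)) * sqrt (4 * (real n * (Ch * (real p)\<^sup>2))))
        + (D\<^sup>2 * (real n * ((real p)\<^sup>2 + real p)))\<^sup>2"
  have "\<bar>expectation (\<lambda>\<omega>. cos ((\<Sum>j<m. d j * xi j \<omega>) + \<alpha>)) - exp (- (\<Sum>j<m. (d j)\<^sup>2 * sv j) / 2) * cos \<alpha>\<bar> \<le> real m * err"
    if "m \<le> n" for m
    using that
  proof (induction m)
    case 0 then show ?case by (simp add: prob_space)
  next
    case (Suc m)
    then have m: "m < n" by simp
    let ?c = "\<lambda>m. expectation (\<lambda>\<omega>. cos ((\<Sum>j<m. d j * xi j \<omega>) + \<alpha>))"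
    let ?y = "(d m)\<^sup>2 * sv m / 2" and ?e = "exp (- (\<Sum>j<m. (d j)\<^sup>2 * sv j) / 2) * cos \<alpha>"
    have tri: "\<bar>a + b * c - e * f\<bar> \<le> \<bar>a\<bar> + \<bar>b\<bar> * \<bar>c\<bar> + \<bar>e\<bar> * \<bar>f\<bar>" for a b c e f :: real
      unfolding abs_mult[symmetric] by linarith
    have y0: "0 \<le> ?y" by (simp add: sv_def)
    have d2: "(d m)\<^sup>2 \<le> D\<^sup>2" and d3: "\<bar>d m\<bar> ^ 3 \<le> D ^ 3"
      using power_mono[OF D[OF m], of 2] power_mono[OF D[OF m], of 3] by auto
    have yD: "?y \<le> D\<^sup>2 * (real n * ((real p)\<^sup>2 + real p))"
      using d2 m by (simp add: sv_def) (intro mult_mono; simp)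
    have KV0: "0 \<le> KV" using Ch_nonneg k1 by (simp add: KV_def)
    have c1: "\<bar>?c m\<bar> \<le> 1"
    proof -
      have xM: "xi j \<in> borel_measurable M" if "j < m" for j
        using xi_L4[of j] that m by (simp add: L4_def)
      have [measurable]: "(\<lambda>\<omega>. \<Sum>j<m. d j * xi j \<omega>) \<in> borel_measurable M"
        by (intro borel_measurable_sum borel_measurable_times borel_measurable_const xM) simp
      have "\<bar>?c m\<bar> \<le> expectation (\<lambda>\<omega>. \<bar>cos ((\<Sum>j<m. d j * xi j \<omega>) + \<alpha>)\<bar>)" by (rule integral_abs_bound)
      also have "\<dots> \<le> expectation (\<lambda>\<omega>. 1)"
        by (intro integral_mono integrable_const_bound[where B = 1]) auto
      finally show ?thesis by (simp add: prob_space)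
    qed
    have eq: "?c (Suc m) - exp (- (\<Sum>j<Suc m. (d j)\<^sup>2 * sv j) / 2) * cos \<alpha>
       = (?c (Suc m) - (1 - ?y) * ?c m) + exp (- ?y) * (?c m - ?e) - (exp (- ?y) - (1 - ?y)) * ?c m"
      by (simp add: algebra_simps add_divide_distrib flip: exp_add)
    have "\<bar>?c (Suc m) - exp (- (\<Sum>j<Suc m. (d j)\<^sup>2 * sv j) / 2) * cos \<alpha>\<bar>
      \<le> \<bar>?c (Suc m) - (1 - ?y) * ?c m\<bar> + \<bar>exp (- ?y)\<bar> * \<bar>?c m - ?e\<bar> + \<bar>exp (- ?y) - (1 - ?y)\<bar> * \<bar>?c m\<bar>"
      unfolding eq by (rule tri)
    also have "\<dots> \<le> real (Suc m) * err"
    proof -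
      define K3 where "K3 = 4 * (real n * (Ch * (real p)\<^sup>2)) * sqrt (4 * (real n * (Ch * (real p)\<^sup>2)))"
      have K30: "0 \<le> K3" using Ch_nonneg by (simp add: K3_def)
      have s1: "\<bar>?c (Suc m) - (1 - ?y) * ?c m\<bar> \<le> (d m)\<^sup>2 / 2 * KV + \<bar>d m\<bar> ^ 3 / 6 * K3"
        using clt_step[OF m, of d \<alpha>] by (simp add: K3_def)
      have "\<bar>exp (- ?y)\<bar> \<le> 1" using y0 by simp
      then have s2: "\<bar>exp (- ?y)\<bar> * \<bar>?c m - ?e\<bar> \<le> 1 * (real m * err)"
        using Suc.IH m by (intro mult_mono) auto
      have s3: "\<bar>exp (- ?y) - (1 - ?y)\<bar> * \<bar>?c m\<bar> \<le> ?y\<^sup>2 * 1"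
        by (intro mult_mono exp_minus_approx[OF y0] c1) auto
      have t1: "(d m)\<^sup>2 / 2 * KV \<le> D\<^sup>2 / 2 * KV" by (rule mult_right_mono) (use d2 KV0 in auto)
      have t2: "\<bar>d m\<bar> ^ 3 / 6 * K3 \<le> D ^ 3 / 6 * K3" by (rule mult_right_mono) (use d3 K30 in auto)
      note t3 = power_mono[OF yD y0, of 2]
      have "real (Suc m) * err = real m * err + err" by (simp add: algebra_simps)
      then show ?thesis using s1 s2 s3 t1 t2 t3 unfolding err_def K3_def[symmetric] by linarith
    qed
    finally show ?case .
  qed
  from this[of n] show ?thesis by (simp add: err_def v_def)
qed

section \<open>Maximal inequalities for the three martingales\<close>

lemma H_maximal:
  assumes l: "0 < l" and m: "m1 + k \<le> n"
  shows "{\<omega>\<in>space M. \<exists>i\<le>k. l \<le> \<bar>H (m1 + i) \<omega> - H m1 \<omega>\<bar>} \<in> events"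
    "l^4 * prob {\<omega>\<in>space M. \<exists>i\<le>k. l \<le> \<bar>H (m1 + i) \<omega> - H m1 \<omega>\<bar>} \<le> (16 * (real k * (real n * (Ch * (real p)\<^sup>2))))\<^sup>2"
proof -
  define S where "S i \<omega> = (\<Sum>i'<i. xi (m1 + i') \<omega>)" for i \<omega>
  define F where "F i = G (rows {..<m1 + i})" for i
  have SF: "S i \<in> borel_measurable (F i')" if "i \<le> i'" for i i'
    unfolding S_def F_def by (intro borel_measurable_sum xi_rows) (use that in auto)
  have SL: "L4 (S i)" if "i \<le> k" for i
    unfolding S_def by (intro L4_sum xi_L4) (use that m in auto)
  have dif: "S k \<omega> - S i \<omega> = (\<Sum>i'\<in>{i..<k}. xi (m1 + i') \<omega>)" if "i \<le> k" for i \<omega>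
    using that sum_diff_nat_ivl[of 0 i k "\<lambda>i'. xi (m1 + i') \<omega>"] by (simp add: S_def lessThan_atLeast0)
  have int: "integrable M (\<lambda>\<omega>. S i \<omega> ^ 3 * xi (m1 + i') \<omega>)" if "i \<le> k" "i' < k" for i i'
    using L4_prod4[OF SL SL SL xi_L4, of i i i "m1 + i'"] that m by (simp add: power3_eq_cube mult.assoc)
  have intE: "integrable M (\<lambda>\<omega>. indicator E \<omega> * (S i \<omega> ^ 3 * xi (m1 + i') \<omega>))" if "i \<le> k" "i' < k" "E \<in> events" for i i' E
    using integrable_mult_indicator[OF that(3) int[OF that(1,2)]] by simp
  have FM: "sets (F i) \<subseteq> events" if "i \<le> k" for i
    unfolding F_def by (intro G_sets rows_subset) (use that m in auto)
  have *: "{\<omega>\<in>space M. \<exists>i\<le>k. l \<le> \<bar>S i \<omega>\<bar>} \<in> events \<and>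
     l^4 * prob {\<omega>\<in>space M. \<exists>i\<le>k. l \<le> \<bar>S i \<omega>\<bar>} \<le> expectation (\<lambda>\<omega>. S k \<omega> ^ 4)"
  proof (rule maximal_ineq[OF l, where F = F])
    show "even (4::nat)" by simp
    show "y^4 + real 4 * y^(4-1) * (x - y) \<le> x^4" for x y :: real using convex_power4[of y x] by simp
    show "integrable M (\<lambda>\<omega>. S i \<omega> ^ 4)" if "i \<le> k" for i using SL[OF that] by (simp add: L4_def)
    show "integrable M (\<lambda>\<omega>. S i \<omega> ^ (4 - 1) * (S k \<omega> - S i \<omega>))" if "i \<le> k" for i
      unfolding dif[OF that] sum_distrib_left using int that by (intro Bochner_Integration.integrable_sum) auto
    show "expectation (\<lambda>\<omega>. indicator E \<omega> * (S i \<omega> ^ (4 - 1) * (S k \<omega> - S i \<omega>))) = 0" if i: "i \<le> k" "E \<in> sets (F i)" for i E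
    proof -
      have E: "E \<in> events" using FM i by auto
      have "expectation (\<lambda>\<omega>. indicator E \<omega> * (S i \<omega> ^ 3 * xi (m1 + i') \<omega>)) = 0" if i': "i \<le> i'" "i' < k" for i'
      proof (rule xi_orth(1))
        show "S i \<in> borel_measurable (G (rows {..<m1 + i'}))" using SF[OF i'(1)] by (simp add: F_def)
        show "L4 (S i)" using SL i by simp
        have "sets (F i) \<subseteq> sets (F i')" unfolding F_def G_def using i'
          by (intro gen_alg_mono) (auto simp: rows_def)
        then show "E \<in> sets (G (rows {..<m1 + i'}))" using i by (auto simp: F_def)
        show "m1 + i' < n" using i' m by simp
      qed
      then have "expectation (\<lambda>\<omega>. \<Sum>i'\<in>{i..<k}. indicator E \<omega> * (S i \<omega> ^ 3 * xi (m1 + i') \<omega>)) = 0"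
        using intE[OF i(1) _ E] by (subst Bochner_Integration.integral_sum) auto
      moreover have "(\<lambda>\<omega>. indicator E \<omega> * (S i \<omega> ^ (4 - 1) * (S k \<omega> - S i \<omega>)))
          = (\<lambda>\<omega>. \<Sum>i'\<in>{i..<k}. indicator E \<omega> * (S i \<omega> ^ 3 * xi (m1 + i') \<omega>))"
        unfolding dif[OF i(1)] sum_distrib_left by simp
      ultimately show ?thesis by simp
    qed
  qed (use SF FM in \<open>auto simp: F_def\<close>)
  have Seq: "S i \<omega> = H (m1 + i) \<omega> - H m1 \<omega>" for i \<omega> by (simp add: S_def H_diff)
  have "expectation (\<lambda>\<omega>. S k \<omega> ^ 4) \<le> (16 * (real k * (real n * (Ch * (real p)\<^sup>2))))\<^sup>2"
    using H_incr_bd[OF m] unfolding L4_bd_def S_def[abs_def] by (elim conjE)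
  note mom = order_trans[OF conjunct2[OF *] this]
  show "{\<omega>\<in>space M. \<exists>i\<le>k. l \<le> \<bar>H (m1 + i) \<omega> - H m1 \<omega>\<bar>} \<in> events"
    using conjunct1[OF *] unfolding Seq .
  show "l^4 * prob {\<omega>\<in>space M. \<exists>i\<le>k. l \<le> \<bar>H (m1 + i) \<omega> - H m1 \<omega>\<bar>} \<le> (16 * (real k * (real n * (Ch * (real p)\<^sup>2))))\<^sup>2"
    using mom unfolding Seq .
qed

lemma aa_maximal:
  assumes l: "0 < l"
  shows "{\<omega>\<in>space M. \<exists>i\<le>n. l \<le> \<bar>aa i \<omega>\<bar>} \<in> events"
    "l^4 * prob {\<omega>\<in>space M. \<exists>i\<le>n. l \<le> \<bar>aa i \<omega>\<bar>} \<le> (16 * (real n * (real p * k1)))\<^sup>2"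
proof -
  define F where "F i = G (rows {..<i})" for i
  have SF: "aa i \<in> borel_measurable (F i')" if "i \<le> i'" for i i'
    unfolding F_def by (intro aa_rows) (use that in auto)
  have SL: "L4 (aa i)" if "i \<le> n" for i
    using aa_bd[OF that] by (simp add: L4_bd_def)
  have dif: "aa n \<omega> - aa i \<omega> = (\<Sum>i'\<in>{i..<n}. bb i' \<omega>)" if "i \<le> n" for i \<omega>
    using that sum_diff_nat_ivl[of 0 i n "\<lambda>i'. bb i' \<omega>"] by (simp add: aa_def lessThan_atLeast0)
  have int: "integrable M (\<lambda>\<omega>. aa i \<omega> ^ 3 * bb i' \<omega>)" if "i \<le> n" "i' < n" for i i'
    using L4_prod4[OF SL SL SL bb_L4, of i i i i'] that by (simp add: power3_eq_cube mult.assoc)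
  have intE: "integrable M (\<lambda>\<omega>. indicator E \<omega> * (aa i \<omega> ^ 3 * bb i' \<omega>))" if "i \<le> n" "i' < n" "E \<in> events" for i i' E
    using integrable_mult_indicator[OF that(3) int[OF that(1,2)]] by simp
  have FM: "sets (F i) \<subseteq> events" if "i \<le> n" for i
    unfolding F_def by (intro G_sets rows_subset) (use that in auto)
  have *: "{\<omega>\<in>space M. \<exists>i\<le>n. l \<le> \<bar>aa i \<omega>\<bar>} \<in> events \<and>
     l^4 * prob {\<omega>\<in>space M. \<exists>i\<le>n. l \<le> \<bar>aa i \<omega>\<bar>} \<le> expectation (\<lambda>\<omega>. aa n \<omega> ^ 4)"
  proof (rule maximal_ineq[OF l, where F = F])
    show "even (4::nat)" by simp
    show "y^4 + real 4 * y^(4-1) * (x - y) \<le> x^4" for x y :: real using convex_power4[of y x] by simp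
    show "integrable M (\<lambda>\<omega>. aa i \<omega> ^ 4)" if "i \<le> n" for i using SL[OF that] by (simp add: L4_def)
    show "integrable M (\<lambda>\<omega>. aa i \<omega> ^ (4 - 1) * (aa n \<omega> - aa i \<omega>))" if "i \<le> n" for i
      unfolding dif[OF that] sum_distrib_left using int that by (intro Bochner_Integration.integrable_sum) auto
    show "expectation (\<lambda>\<omega>. indicator E \<omega> * (aa i \<omega> ^ (4 - 1) * (aa n \<omega> - aa i \<omega>))) = 0" if i: "i \<le> n" "E \<in> sets (F i)" for i E
    proof -
      have E: "E \<in> events" using FM i by auto
      have "expectation (\<lambda>\<omega>. indicator E \<omega> * (aa i \<omega> ^ 3 * bb i' \<omega>)) = 0" if i': "i \<le> i'" "i' < n" for i'
      proof (rule bb_orth(1))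
        show "aa i \<in> borel_measurable (G (rows {..<i'}))" using SF[OF i'(1)] by (simp add: F_def)
        show "L4 (aa i)" using SL i by simp
        have "sets (F i) \<subseteq> sets (F i')" unfolding F_def G_def using i'
          by (intro gen_alg_mono) (auto simp: rows_def)
        then show "E \<in> sets (G (rows {..<i'}))" using i by (auto simp: F_def)
      qed (use i' in auto)
      then have "expectation (\<lambda>\<omega>. \<Sum>i'\<in>{i..<n}. indicator E \<omega> * (aa i \<omega> ^ 3 * bb i' \<omega>)) = 0"
        using intE[OF i(1) _ E] by (subst Bochner_Integration.integral_sum) auto
      moreover have "(\<lambda>\<omega>. indicator E \<omega> * (aa i \<omega> ^ (4 - 1) * (aa n \<omega> - aa i \<omega>)))
          = (\<lambda>\<omega>. \<Sum>i'\<in>{i..<n}. indicator E \<omega> * (aa i \<omega> ^ 3 * bb i' \<omega>))"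
        unfolding dif[OF i(1)] sum_distrib_left by simp
      ultimately show ?thesis by simp
    qed
  qed (use SF FM in \<open>auto simp: F_def\<close>)
  have "expectation (\<lambda>\<omega>. aa n \<omega> ^ 4) \<le> (16 * (real n * (real p * k1)))\<^sup>2"
    using aa_bd[OF order_refl] unfolding L4_bd_def by (elim conjE)
  note mom = order_trans[OF conjunct2[OF *] this]
  show "{\<omega>\<in>space M. \<exists>i\<le>n. l \<le> \<bar>aa i \<omega>\<bar>} \<in> events"
    using conjunct1[OF *] .
  show "l^4 * prob {\<omega>\<in>space M. \<exists>i\<le>n. l \<le> \<bar>aa i \<omega>\<bar>} \<le> (16 * (real n * (real p * k1)))\<^sup>2"
    using mom .
qed

text \<open>Doob's inequality with exponent 2 in place of 4, matching the second moments from
  \<open>BB_sq\<close>.\<close>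

lemma BB_maximal:
  assumes l: "0 < l"
  shows "{\<omega>\<in>space M. \<exists>i\<le>n. l \<le> \<bar>BB i \<omega>\<bar>} \<in> events"
    "l\<^sup>2 * prob {\<omega>\<in>space M. \<exists>i\<le>n. l \<le> \<bar>BB i \<omega>\<bar>} \<le> real n * (4 * (real p * k1))\<^sup>2"
proof -
  define F where "F i = G (rows {..<i})" for i
  have SF: "BB i \<in> borel_measurable (F i')" if "i \<le> i'" for i i'
    unfolding F_def by (intro BB_rows) (use that in auto)
  have dif: "BB n \<omega> - BB i \<omega> = (\<Sum>i'\<in>{i..<n}. cc i' \<omega>)" if "i \<le> n" for i \<omega>
    using that sum_diff_nat_ivl[of 0 i n "\<lambda>i'. cc i' \<omega>"] by (simp add: BB_def lessThan_atLeast0)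
  have FM: "sets (F i) \<subseteq> events" if "i \<le> n" for i
    unfolding F_def by (intro G_sets rows_subset) (use that in auto)
  have *: "{\<omega>\<in>space M. \<exists>i\<le>n. l \<le> \<bar>BB i \<omega>\<bar>} \<in> events \<and>
     l^2 * prob {\<omega>\<in>space M. \<exists>i\<le>n. l \<le> \<bar>BB i \<omega>\<bar>} \<le> expectation (\<lambda>\<omega>. BB n \<omega> ^ 2)"
  proof (rule maximal_ineq[OF l, where F = F])
    show "even (2::nat)" by simp
    show "y^2 + real 2 * y^(2-1) * (x - y) \<le> x^2" for x y :: real using convex_power2[of y x] by simp
    show "integrable M (\<lambda>\<omega>. BB i \<omega> ^ 2)" if "i \<le> n" for i using BB_sq(1)[OF that] .
    have mono: "f \<in> borel_measurable (G (rows {..<i}))" if "f \<in> borel_measurable (F i')" "i' \<le> i" for f :: "'a \<Rightarrow> real" and i i'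
      by (rule G_mono[OF that(1)[unfolded F_def]]) (use that(2) in \<open>auto simp: rows_def\<close>)
    show "integrable M (\<lambda>\<omega>. BB i \<omega> ^ (2 - 1) * (BB n \<omega> - BB i \<omega>))" if "i \<le> n" for i
      unfolding dif[OF that] sum_distrib_left
    proof (rule Bochner_Integration.integrable_sum)
      fix i' assume "i' \<in> {i..<n}"
      then show "integrable M (\<lambda>\<omega>. BB i \<omega> ^ (2 - 1) * cc i' \<omega>)"
        using BB_cross(1)[OF mono[OF SF[OF order_refl]] BB_integrable[OF \<open>i \<le> n\<close>], of i'] by simp
    qed
    show "expectation (\<lambda>\<omega>. indicator E \<omega> * (BB i \<omega> ^ (2 - 1) * (BB n \<omega> - BB i \<omega>))) = 0" if i: "i \<le> n" "E \<in> sets (F i)" for i E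
    proof -
      have E: "E \<in> events" using FM i by auto
      have iE: "integrable M (\<lambda>\<omega>. indicator E \<omega> * BB i \<omega>)"
        using integrable_mult_indicator[OF E BB_integrable[OF i(1)]] by simp
      have mE: "(\<lambda>\<omega>. indicator E \<omega> * BB i \<omega>) \<in> borel_measurable (F i)"
        using i SF[of i i] by (intro borel_measurable_times borel_measurable_indicator) auto
      have "integrable M (\<lambda>\<omega>. indicator E \<omega> * BB i \<omega> * cc i' \<omega>)" "expectation (\<lambda>\<omega>. indicator E \<omega> * BB i \<omega> * cc i' \<omega>) = 0"
        if i': "i \<le> i'" "i' < n" for i'
        using BB_cross[OF mono[OF mE i'(1)] iE i'(2)] by auto
      then have "expectation (\<lambda>\<omega>. \<Sum>i'\<in>{i..<n}. indicator E \<omega> * BB i \<omega> * cc i' \<omega>) = 0"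
        by (subst Bochner_Integration.integral_sum) auto
      then show ?thesis
        by (simp add: dif[OF i(1)] sum_distrib_left mult.assoc)
    qed
  qed (use SF FM in \<open>auto simp: F_def\<close>)
  show "{\<omega>\<in>space M. \<exists>i\<le>n. l \<le> \<bar>BB i \<omega>\<bar>} \<in> events"
    using conjunct1[OF *] .
  show "l\<^sup>2 * prob {\<omega>\<in>space M. \<exists>i\<le>n. l \<le> \<bar>BB i \<omega>\<bar>} \<le> real n * (4 * (real p * k1))\<^sup>2"
    using order_trans[OF conjunct2[OF *] BB_sq(2)[OF order_refl]] .
qed

end

section \<open>Normal random variables\<close>

text \<open>Being normal with mean m and variance v, degenerate case included, in a form that is stable
  under limits. The phase \<open>\<alpha>\<close> makes the real function determine the characteristic function.\<close>

definition gauss_rv :: "'a measure \<Rightarrow> ('a \<Rightarrow> real) \<Rightarrow> real \<Rightarrow> real \<Rightarrow> bool" where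
  "gauss_rv M X m v \<longleftrightarrow> X \<in> borel_measurable M \<and> 0 \<le> v \<and>
     (\<forall>\<theta> \<alpha>. (LINT \<omega>|M. cos (\<theta> * X \<omega> + \<alpha>)) = exp (- v * \<theta>\<^sup>2 / 2) * cos (\<theta> * m + \<alpha>))"

lemma gauss_rv_measurable: "gauss_rv M X m v \<Longrightarrow> X \<in> borel_measurable M"
  by (simp add: gauss_rv_def)

lemma (in prob_space) integral_iexp_eq:
  assumes [measurable]: "X \<in> borel_measurable M"
  shows "(CLINT \<omega>|M. iexp (X \<omega>)) = Complex (expectation (\<lambda>\<omega>. cos (X \<omega>))) (expectation (\<lambda>\<omega>. sin (X \<omega>)))"
proof (rule complex_eqI)
  have i: "complex_integrable M (\<lambda>\<omega>. iexp (X \<omega>))"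
    by (rule integrable_const_bound[where B = 1]) auto
  show "Re (CLINT \<omega>|M. iexp (X \<omega>)) = Re (Complex (expectation (\<lambda>\<omega>. cos (X \<omega>))) (expectation (\<lambda>\<omega>. sin (X \<omega>))))"
    using integral_Re[OF i] by (simp add: Re_exp)
  show "Im (CLINT \<omega>|M. iexp (X \<omega>)) = Im (Complex (expectation (\<lambda>\<omega>. cos (X \<omega>))) (expectation (\<lambda>\<omega>. sin (X \<omega>))))"
    using integral_Im[OF i] by (simp add: Im_exp)
qed

lemma gauss_rv_char:
  assumes M: "prob_space M" and X: "gauss_rv M X m v"
  shows "char (distr M borel X) t = complex_of_real (exp (- v * t\<^sup>2 / 2)) * iexp (t * m)"
proof -
  interpret prob_space M by (rule M)
  have [measurable]: "X \<in> borel_measurable M" using X by (simp add: gauss_rv_def)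
  have c: "expectation (\<lambda>\<omega>. cos (t * X \<omega> + \<alpha>)) = exp (- v * t\<^sup>2 / 2) * cos (t * m + \<alpha>)" for \<alpha>
    using X by (simp add: gauss_rv_def)
  have "cos (u + - (pi/2)) = sin u" for u :: real by (simp add: cos_diff)
  then have s: "expectation (\<lambda>\<omega>. sin (t * X \<omega>)) = exp (- v * t\<^sup>2 / 2) * sin (t * m)"
    using c[of "- (pi/2)"] by simp
  have "char (distr M borel X) t = (CLINT \<omega>|M. iexp (t * X \<omega>))"
    by (simp add: char_def integral_distr)
  also have "\<dots> = Complex (exp (- v * t\<^sup>2 / 2) * cos (t * m)) (exp (- v * t\<^sup>2 / 2) * sin (t * m))"
    using c[of 0] s by (subst integral_iexp_eq) auto
  also have "\<dots> = complex_of_real (exp (- v * t\<^sup>2 / 2)) * iexp (t * m)"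
    by (simp add: complex_eq_iff Re_exp Im_exp)
  finally show ?thesis .
qed

text \<open>Moments and densities are transferred from the standard normal law along this identity,
  which follows by comparing characteristic functions and includes the degenerate case s =
  0.\<close>

lemma gauss_rv_distr:
  assumes M: "prob_space M" and X: "gauss_rv M X m (s\<^sup>2)"
  shows "distr M borel X = distr std_normal_distribution borel (\<lambda>z. m + s * z)"
proof (rule Levy_uniqueness)
  interpret prob_space M by (rule M)
  interpret S: real_distribution std_normal_distribution by (rule real_dist_normal_dist)
  have [measurable]: "X \<in> borel_measurable M" using X by (simp add: gauss_rv_def)
  show "real_distribution (distr M borel X)" by (rule real_distribution_distr) simp
  show "real_distribution (distr std_normal_distribution borel (\<lambda>z. m + s * z))"
    by (rule S.real_distribution_distr) simp
  show "char (distr M borel X) = char (distr std_normal_distribution borel (\<lambda>z. m + s * z))"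
  proof
    fix t
    have "char (distr std_normal_distribution borel (\<lambda>z. m + s * z)) t
        = (CLINT z|std_normal_distribution. iexp (t * m) * iexp ((t * s) * z))"
      by (simp add: char_def integral_distr exp_add[symmetric] algebra_simps)
    also have "\<dots> = iexp (t * m) * char std_normal_distribution (t * s)"
      unfolding char_def by (rule integral_mult_right_zero)
    also have "\<dots> = complex_of_real (exp (- (s\<^sup>2) * t\<^sup>2 / 2)) * iexp (t * m)"
      by (simp add: char_std_normal_distribution power_mult_distrib mult.commute)
    finally show "char (distr M borel X) t = char (distr std_normal_distribution borel (\<lambda>z. m + s * z)) t"
      by (simp add: gauss_rv_char[OF M X])
  qed
qed

lemma gauss_rv_moments:
  assumes M: "prob_space M" and X: "gauss_rv M X m v"
  shows "integrable M X" "integrable M (\<lambda>\<omega>. (X \<omega>)\<^sup>2)" "(LINT \<omega>|M. X \<omega>) = m" "(LINT \<omega>|M. (X \<omega>)\<^sup>2) = m\<^sup>2 + v"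
proof -
  define s where "s = sqrt v"
  have s: "s\<^sup>2 = v" using X by (simp add: gauss_rv_def s_def)
  have [measurable]: "X \<in> borel_measurable M" using X by (simp add: gauss_rv_def)
  let ?S = std_normal_distribution
  interpret S: real_distribution ?S by (rule real_dist_normal_dist)
  have D: "distr M borel X = distr ?S borel (\<lambda>z. m + s * z)" by (rule gauss_rv_distr[OF M]) (simp add: s X)
  have i1: "integrable ?S (\<lambda>z. z)" and i2: "integrable ?S (\<lambda>z. z\<^sup>2)"
    using integrable_std_normal_distribution_moment[of 1] integrable_std_normal_distribution_moment[of 2] by auto
  have e1: "(LINT z|?S. z) = 0" and e2: "(LINT z|?S. z\<^sup>2) = 1"
    using integral_std_normal_distribution_moment_odd[of 1] std_normal_distribution_even_moments(1)[of 1] by auto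
  have tr: "integrable M (\<lambda>\<omega>. f (X \<omega>)) \<longleftrightarrow> integrable ?S (\<lambda>z. f (m + s * z))"
    "(LINT \<omega>|M. f (X \<omega>)) = (LINT z|?S. f (m + s * z))"
    if [measurable]: "f \<in> borel_measurable borel" for f :: "real \<Rightarrow> real"
  proof -
    have "integrable M (\<lambda>\<omega>. f (X \<omega>)) \<longleftrightarrow> integrable (distr M borel X) f"
      by (rule integrable_distr_eq[symmetric]) auto
    also have "\<dots> \<longleftrightarrow> integrable ?S (\<lambda>z. f (m + s * z))"
      unfolding D by (rule integrable_distr_eq) auto
    finally show "integrable M (\<lambda>\<omega>. f (X \<omega>)) \<longleftrightarrow> integrable ?S (\<lambda>z. f (m + s * z))" .
    have "(LINT \<omega>|M. f (X \<omega>)) = (LINT x|distr M borel X. f x)"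
      by (rule integral_distr[symmetric]) auto
    also have "\<dots> = (LINT z|?S. f (m + s * z))"
      unfolding D by (rule integral_distr) auto
    finally show "(LINT \<omega>|M. f (X \<omega>)) = (LINT z|?S. f (m + s * z))" .
  qed
  have sq: "(m + s * z)\<^sup>2 = m\<^sup>2 + 2 * m * s * z + s\<^sup>2 * z\<^sup>2" for z
    by (simp add: power2_eq_square algebra_simps)
  have m1: "(\<lambda>x::real. x) \<in> borel_measurable borel" and m2: "(\<lambda>x::real. x\<^sup>2) \<in> borel_measurable borel" by auto
  have one: "(LINT z|?S. c) = c" for c :: real
    using S.prob_space by (simp only: lebesgue_integral_const measure_def[symmetric]) simp
  have j1: "integrable ?S (\<lambda>z. m + s * z)"
    by (intro Bochner_Integration.integrable_add integrable_mult_right S.integrable_const i1)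
  have j2: "integrable ?S (\<lambda>z. m\<^sup>2 + 2 * m * s * z + s\<^sup>2 * z\<^sup>2)"
    by (intro Bochner_Integration.integrable_add integrable_mult_right S.integrable_const i1 i2)
  show "integrable M X" using j1 by (rule iffD2[OF tr(1)[OF m1]])
  show "integrable M (\<lambda>\<omega>. (X \<omega>)\<^sup>2)" using j2 unfolding sq[symmetric] by (rule iffD2[OF tr(1)[OF m2]])
  have "(LINT z|?S. m + s * z) = (LINT z|?S. m) + (LINT z|?S. s * z)"
    by (intro Bochner_Integration.integral_add integrable_mult_right S.integrable_const i1)
  also have "\<dots> = m" unfolding one integral_mult_right_zero e1 by simp
  finally show "(LINT \<omega>|M. X \<omega>) = m" unfolding tr(2)[OF m1] .
  have "(LINT z|?S. (m + s * z)\<^sup>2) = (LINT z|?S. m\<^sup>2) + (LINT z|?S. 2 * m * s * z) + (LINT z|?S. s\<^sup>2 * z\<^sup>2)"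
    unfolding sq
    by (subst Bochner_Integration.integral_add,
        intro Bochner_Integration.integrable_add integrable_mult_right S.integrable_const i1,
        intro integrable_mult_right i2,
        subst Bochner_Integration.integral_add,
        rule S.integrable_const, intro integrable_mult_right i1, rule refl)
  also have "\<dots> = m\<^sup>2 + v" unfolding one integral_mult_right_zero e1 e2 s by simp
  finally show "(LINT \<omega>|M. (X \<omega>)\<^sup>2) = m\<^sup>2 + v" unfolding tr(2)[OF m2] .
qed

lemma gauss_rv_normal:
  assumes M: "prob_space M" and X: "gauss_rv M X m v"
  shows "v = 0 \<Longrightarrow> AE \<omega> in M. X \<omega> = m"
    "v > 0 \<Longrightarrow> distributed M lborel X (\<lambda>z. ennreal (normal_density m (sqrt v) z))"
proof -
  define s where "s = sqrt v"
  have s: "s\<^sup>2 = v" using X by (simp add: gauss_rv_def s_def)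
  have [measurable]: "X \<in> borel_measurable M" using X by (simp add: gauss_rv_def)
  let ?S = std_normal_distribution
  interpret S: real_distribution ?S by (rule real_dist_normal_dist)
  have D: "distr M borel X = distr ?S borel (\<lambda>z. m + s * z)" by (rule gauss_rv_distr[OF M]) (simp add: s X)
  { assume "v = 0"
    then have "s = 0" by (simp add: s_def)
    then have "AE x in distr ?S borel (\<lambda>z. m + s * z). x = m"
      by (subst AE_distr_iff) auto
    then show "AE \<omega> in M. X \<omega> = m" unfolding D[symmetric] by (subst (asm) AE_distr_iff) auto }
  { assume v: "v > 0"
    have "distributed ?S lborel (\<lambda>z. z) (normal_density 0 1)"
      by (auto simp: distributed_def intro!: measure_eqI simp: emeasure_distr)
    from S.normal_density_affine[OF this, of s m] have
      "distributed ?S lborel (\<lambda>z. m + s * z) (normal_density m s)"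
      using v by (simp add: s_def)
    then have "distr ?S lborel (\<lambda>z. m + s * z) = density lborel (normal_density m s)"
      by (simp add: distributed_def)
    moreover have "distr ?S lborel (\<lambda>z. m + s * z) = distr ?S borel (\<lambda>z. m + s * z)"
      "distr M lborel X = distr M borel X"
      by (auto intro!: distr_cong)
    ultimately show "distributed M lborel X (\<lambda>z. ennreal (normal_density m (sqrt v) z))"
      using D by (simp add: distributed_def s_def) }
qed

text \<open>Dominated convergence of the cosines. This carries normality from the partial sums of
  Levy's series to Brownian motion.\<close>

lemma gauss_rv_limit:
  assumes M: "prob_space M" and X: "\<And>k. gauss_rv M (X k) (m k) (v k)"
    and lim: "AE \<omega> in M. (\<lambda>k. X k \<omega>) \<longlonglongrightarrow> Y \<omega>" and Y: "Y \<in> borel_measurable M"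
    and m: "m \<longlonglongrightarrow> m'" and v: "v \<longlonglongrightarrow> v'"
  shows "gauss_rv M Y m' v'"
  unfolding gauss_rv_def
proof (intro conjI allI Y)
  interpret prob_space M by (rule M)
  note [measurable] = Y gauss_rv_measurable[OF X]
  show "0 \<le> v'" using v X by (intro LIMSEQ_le_const) (auto simp: gauss_rv_def)
  fix \<theta> \<alpha>
  have "(\<lambda>k. LINT \<omega>|M. cos (\<theta> * X k \<omega> + \<alpha>)) \<longlonglongrightarrow> (LINT \<omega>|M. cos (\<theta> * Y \<omega> + \<alpha>))"
  proof (rule integral_dominated_convergence[where w = "\<lambda>_. 1"])
    show "AE \<omega> in M. (\<lambda>k. cos (\<theta> * X k \<omega> + \<alpha>)) \<longlonglongrightarrow> cos (\<theta> * Y \<omega> + \<alpha>)"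
      using lim by eventually_elim (intro tendsto_intros)
  qed auto
  moreover have "(\<lambda>k. LINT \<omega>|M. cos (\<theta> * X k \<omega> + \<alpha>)) \<longlonglongrightarrow> exp (- v' * \<theta>\<^sup>2 / 2) * cos (\<theta> * m' + \<alpha>)"
  proof -
    have "(\<lambda>k. LINT \<omega>|M. cos (\<theta> * X k \<omega> + \<alpha>)) = (\<lambda>k. exp (- v k * \<theta>\<^sup>2 / 2) * cos (\<theta> * m k + \<alpha>))"
      using X by (simp add: gauss_rv_def)
    then show ?thesis using m v by (auto intro!: tendsto_intros)
  qed
  ultimately show "(LINT \<omega>|M. cos (\<theta> * Y \<omega> + \<alpha>)) = exp (- v' * \<theta>\<^sup>2 / 2) * cos (\<theta> * m' + \<alpha>)"
    by (rule LIMSEQ_unique)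
qed

lemma gauss_rv_affine:
  assumes "gauss_rv M X m v"
  shows "gauss_rv M (\<lambda>\<omega>. b + a * X \<omega>) (b + a * m) (a\<^sup>2 * v)"
  unfolding gauss_rv_def
proof (intro conjI allI)
  show "(\<lambda>\<omega>. b + a * X \<omega>) \<in> borel_measurable M" using gauss_rv_measurable[OF assms] by simp
  show "0 \<le> a\<^sup>2 * v" using assms by (simp add: gauss_rv_def)
  fix \<theta> \<alpha>
  have "(LINT \<omega>|M. cos ((\<theta> * a) * X \<omega> + (\<theta> * b + \<alpha>))) = exp (- v * (\<theta> * a)\<^sup>2 / 2) * cos ((\<theta> * a) * m + (\<theta> * b + \<alpha>))"
    using assms unfolding gauss_rv_def by blast
  then show "(LINT \<omega>|M. cos (\<theta> * (b + a * X \<omega>) + \<alpha>)) = exp (- (a\<^sup>2 * v) * \<theta>\<^sup>2 / 2) * cos (\<theta> * (b + a * m) + \<alpha>)"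
    by (simp add: algebra_simps power_mult_distrib)
qed

text \<open>Independent standard normals, indexed by the reals so that the sample space has the type
  required in the theorem; Brownian motion reads only the coordinates at natural numbers.\<close>

definition gauss_space :: "(real \<Rightarrow> real) measure" where
  "gauss_space = PiM UNIV (\<lambda>_. std_normal_distribution)"

lemma prob_space_gauss_space: "prob_space gauss_space"
  unfolding gauss_space_def by (intro prob_space_PiM prob_space_normal_density) simp

lemma space_gauss_space[simp]: "space gauss_space = UNIV"
  by (simp add: gauss_space_def space_PiM)

lemma coord_measurable[measurable]: "(\<lambda>\<omega>. \<omega> i) \<in> borel_measurable gauss_space"
proof -
  have "(\<lambda>\<omega>. \<omega> i) \<in> gauss_space \<rightarrow>\<^sub>M std_normal_distribution"
    unfolding gauss_space_def by (rule measurable_component_singleton) simp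
  then show ?thesis by simp
qed

lemma coord_distr: "distr gauss_space borel (\<lambda>\<omega>. \<omega> i) = std_normal_distribution"
proof -
  have "distr gauss_space std_normal_distribution (\<lambda>\<omega>. \<omega> i) = std_normal_distribution"
    unfolding gauss_space_def
    by (rule distr_PiM_component[where M = "\<lambda>_. std_normal_distribution"]) (auto intro: prob_space_normal_density)
  moreover have "distr gauss_space std_normal_distribution (\<lambda>\<omega>. \<omega> i) = distr gauss_space borel (\<lambda>\<omega>. \<omega> i)"
    by (rule distr_cong) auto
  ultimately show ?thesis by simp
qed

lemma coord_indep:
  assumes "finite J"
  shows "prob_space.indep_vars gauss_space (\<lambda>_. borel) (\<lambda>i \<omega>. \<omega> i) J"
proof (cases "J = {}")
  case True
  interpret prob_space gauss_space by (rule prob_space_gauss_space)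
  show ?thesis using True by (simp add: indep_vars_def indep_sets_def)
next
  case False
  interpret prob_space gauss_space by (rule prob_space_gauss_space)
  interpret S: prob_space std_normal_distribution by (rule prob_space_normal_density) simp
  interpret P: product_prob_space "\<lambda>_::real. std_normal_distribution" UNIV by standard
  have sJ: "sets (PiM J (\<lambda>_. borel)) = sets (PiM J (\<lambda>_. std_normal_distribution))"
    by (rule sets_PiM_cong) auto
  have "distr gauss_space (PiM J (\<lambda>_. borel)) (\<lambda>\<omega>. \<lambda>i\<in>J. \<omega> i)
    = distr gauss_space (PiM J (\<lambda>_. std_normal_distribution)) (\<lambda>\<omega>. restrict \<omega> J)"
    by (rule distr_cong) (auto simp: sJ)
  also have "\<dots> = PiM J (\<lambda>_. std_normal_distribution)"
    unfolding gauss_space_def by (rule P.distr_PiM_restrict_finite) (use assms in auto)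
  also have "\<dots> = PiM J (\<lambda>i. distr gauss_space borel (\<lambda>\<omega>. \<omega> i))" by (simp add: coord_distr)
  finally show ?thesis
    by (subst indep_vars_iff_distr_eq_PiM'[OF False]) auto
qed

lemma coord_char: "char (distr gauss_space borel (\<lambda>\<omega>. a * \<omega> i)) t = complex_of_real (exp (- (a\<^sup>2 * t\<^sup>2) / 2))"
proof -
  have "char (distr gauss_space borel (\<lambda>\<omega>. a * \<omega> i)) t = (CLINT \<omega>|gauss_space. iexp ((t * a) * \<omega> i))"
    by (simp add: char_def integral_distr mult.assoc)
  also have "\<dots> = (CLINT z|distr gauss_space borel (\<lambda>\<omega>. \<omega> i). iexp ((t * a) * z))"
    by (rule integral_distr[symmetric]) auto
  also have "\<dots> = char std_normal_distribution (t * a)" unfolding coord_distr char_def ..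
  finally show ?thesis by (simp add: char_std_normal_distribution power_mult_distrib mult.commute)
qed

lemma gauss_rv_coords:
  assumes A: "finite A" and e: "inj_on e A"
  shows "gauss_rv gauss_space (\<lambda>\<omega>. \<Sum>a\<in>A. c a * \<omega> (e a)) 0 (\<Sum>a\<in>A. (c a)\<^sup>2)"
proof -
  interpret prob_space gauss_space by (rule prob_space_gauss_space)
  let ?X = "\<lambda>\<omega>. \<Sum>a\<in>A. c a * \<omega> (e a)"
  have [measurable]: "?X \<in> borel_measurable gauss_space" by measurable
  define c' where "c' i = c (inv_into A e i)" for i
  have c': "c' (e a) = c a" if "a \<in> A" for a using e that by (simp add: c'_def)
  have X: "?X \<omega> = (\<Sum>i\<in>e ` A. c' i * \<omega> i)" for \<omega>
    using c' by (subst sum.reindex[OF e]) simp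
  have iv: "indep_vars (\<lambda>_. borel) (\<lambda>i \<omega>. c' i * \<omega> i) (e ` A)"
    using indep_vars_compose2[OF coord_indep[of "e ` A"], of "\<lambda>i z. c' i * z" "\<lambda>_. borel"] A by simp
  have ch: "char (distr gauss_space borel ?X) t = complex_of_real (exp (- (\<Sum>a\<in>A. (c a)\<^sup>2) * t\<^sup>2 / 2))" for t
  proof -
    have "char (distr gauss_space borel ?X) t = (\<Prod>i\<in>e ` A. char (distr gauss_space borel (\<lambda>\<omega>. c' i * \<omega> i)) t)"
      unfolding X by (rule char_distr_sum[OF iv])
    also have "\<dots> = (\<Prod>i\<in>e ` A. complex_of_real (exp (- ((c' i)\<^sup>2 * t\<^sup>2) / 2)))"
      by (simp add: coord_char)
    also have "\<dots> = complex_of_real (\<Prod>a\<in>A. exp (- ((c a)\<^sup>2 * t\<^sup>2) / 2))"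
      using c' by (subst prod.reindex[OF e]) simp
    also have "(\<Prod>a\<in>A. exp (- ((c a)\<^sup>2 * t\<^sup>2) / 2)) = exp (\<Sum>a\<in>A. - ((c a)\<^sup>2 * t\<^sup>2) / 2)"
      by (rule exp_sum[OF A, symmetric])
    also have "(\<Sum>a\<in>A. - ((c a)\<^sup>2 * t\<^sup>2) / 2) = - (\<Sum>a\<in>A. (c a)\<^sup>2) * t\<^sup>2 / 2"
      by (simp add: sum_distrib_right sum_divide_distrib sum_negf)
    finally show ?thesis .
  qed
  show ?thesis
    unfolding gauss_rv_def
  proof (intro conjI allI)
    show "0 \<le> (\<Sum>a\<in>A. (c a)\<^sup>2)" by (intro sum_nonneg) auto
    fix \<theta> \<alpha> :: real
    have "Complex (expectation (\<lambda>\<omega>. cos (\<theta> * ?X \<omega>))) (expectation (\<lambda>\<omega>. sin (\<theta> * ?X \<omega>)))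
        = char (distr gauss_space borel ?X) \<theta>"
      using integral_iexp_eq[of "\<lambda>\<omega>. \<theta> * ?X \<omega>"] by (simp add: char_def integral_distr)
    then have cs: "expectation (\<lambda>\<omega>. cos (\<theta> * ?X \<omega>)) = exp (- (\<Sum>a\<in>A. (c a)\<^sup>2) * \<theta>\<^sup>2 / 2)"
      "expectation (\<lambda>\<omega>. sin (\<theta> * ?X \<omega>)) = 0"
      unfolding ch by (auto simp: complex_eq_iff)
    have i: "integrable gauss_space (\<lambda>\<omega>. cos (\<theta> * ?X \<omega>))" "integrable gauss_space (\<lambda>\<omega>. sin (\<theta> * ?X \<omega>))"
      by (rule integrable_const_bound[where B = 1]; simp)+
    have "expectation (\<lambda>\<omega>. cos (\<theta> * ?X \<omega> + \<alpha>)) = expectation (\<lambda>\<omega>. cos (\<theta> * ?X \<omega>) * cos \<alpha> - sin (\<theta> * ?X \<omega>) * sin \<alpha>)"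
      by (simp only: cos_add)
    also have "\<dots> = expectation (\<lambda>\<omega>. cos (\<theta> * ?X \<omega>)) * cos \<alpha> - expectation (\<lambda>\<omega>. sin (\<theta> * ?X \<omega>)) * sin \<alpha>"
      using i by (subst Bochner_Integration.integral_diff) auto
    finally show "expectation (\<lambda>\<omega>. cos (\<theta> * ?X \<omega> + \<alpha>)) = exp (- (\<Sum>a\<in>A. (c a)\<^sup>2) * \<theta>\<^sup>2 / 2) * cos (\<theta> * 0 + \<alpha>)"
      unfolding cs by simp
  qed simp
qed

lemma coord_fourth_moment: "(\<integral>\<^sup>+\<omega>. ennreal (\<omega> i ^ 4) \<partial>gauss_space) = 3"
proof -
  interpret S: real_distribution std_normal_distribution by (rule real_dist_normal_dist)
  have "(\<integral>\<^sup>+\<omega>. ennreal (\<omega> i ^ 4) \<partial>gauss_space) = (\<integral>\<^sup>+z. ennreal (z ^ 4) \<partial>distr gauss_space borel (\<lambda>\<omega>. \<omega> i))"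
    by (subst nn_integral_distr) auto
  also have "\<dots> = (\<integral>\<^sup>+z. ennreal (z ^ 4) \<partial>std_normal_distribution)" by (simp add: coord_distr)
  also have "\<dots> = ennreal (LINT z|std_normal_distribution. z ^ 4)"
    using integrable_std_normal_distribution_moment[of 4] by (intro nn_integral_eq_integral) auto
  also have "(LINT z|std_normal_distribution. z ^ 4) = 3"
    using std_normal_distribution_even_moments(1)[of 2] by (simp add: fact_numeral)
  finally show ?thesis by simp
qed

section \<open>Schauder functions and the covariance of the Brownian bridge\<close>

definition tent :: "real \<Rightarrow> real" where
  "tent t = max 0 (min t (1 - t))"

text \<open>Extended by zero outside the unit square, so that scaled and shifted copies can be
  summed without case distinctions on the interval.\<close>

definition bridge_cov :: "real \<Rightarrow> real \<Rightarrow> real" where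
  "bridge_cov s t = (if 0 \<le> s \<and> s \<le> 1 \<and> 0 \<le> t \<and> t \<le> 1 then min s t - s * t else 0)"

lemma bridge_cov_outside: "s < 0 \<or> 1 < s \<or> t < 0 \<or> 1 < t \<Longrightarrow> bridge_cov s t = 0"
  unfolding bridge_cov_def by (rule if_not_P) linarith

lemma bridge_cov_le_case: "0 \<le> s \<Longrightarrow> s \<le> t \<Longrightarrow> t \<le> 1 \<Longrightarrow> bridge_cov s t = s * (1 - t)"
  by (simp add: bridge_cov_def algebra_simps)

lemma bridge_cov_sym: "bridge_cov s t = bridge_cov t s"
  unfolding bridge_cov_def by (simp add: min.commute mult.commute conj_ac)

lemma tent_left: "0 \<le> u \<Longrightarrow> u \<le> 1/2 \<Longrightarrow> tent u = u"
  and tent_right: "1/2 \<le> u \<Longrightarrow> u \<le> 1 \<Longrightarrow> tent u = 1 - u"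
  and tent_outside: "u \<le> 0 \<or> 1 \<le> u \<Longrightarrow> tent u = 0"
  by (auto simp: tent_def)

section \<open>Brownian motion\<close>

text \<open>The self-similarity of the Brownian bridge: conditionally on its midpoint value, it consists
  of two independent scaled bridges.\<close>

lemma bridge_cov_rec:
  "bridge_cov s t = tent s * tent t + (bridge_cov (2 * s) (2 * t) + bridge_cov (2 * s - 1) (2 * t - 1)) / 2"
proof -
  have *: "bridge_cov s t = tent s * tent t + (bridge_cov (2 * s) (2 * t) + bridge_cov (2 * s - 1) (2 * t - 1)) / 2"
    if "s \<le> t" for s t
  proof -
    consider "s < 0 \<or> 1 < t" | "0 \<le> s" "t < 1/2" | "0 \<le> s" "s \<le> 1/2" "1/2 < t" "t \<le> 1" | "1/2 < s" "t \<le> 1"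
      | "0 \<le> s" "t = 1/2"
      by linarith
    then show ?thesis
    proof cases
      case 1
      then have "bridge_cov s t = 0" "bridge_cov (2 * s) (2 * t) = 0" "bridge_cov (2 * s - 1) (2 * t - 1) = 0"
        by (auto intro!: bridge_cov_outside)
      moreover have "tent s * tent t = 0" using 1 by (auto simp: tent_outside)
      ultimately show ?thesis by simp
    next
      case 2
      then have "bridge_cov (2 * s - 1) (2 * t - 1) = 0" using that by (intro bridge_cov_outside) auto
      then show ?thesis using 2 that by (simp add: bridge_cov_le_case tent_left field_simps)
    next
      case 3
      have "bridge_cov (2 * s) (2 * t) = 0" using 3 by (intro bridge_cov_outside) auto
      moreover have "bridge_cov (2 * s - 1) (2 * t - 1) = 0"
        using 3 by (cases "s = 1/2") (auto intro!: bridge_cov_outside simp: bridge_cov_le_case)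
      ultimately show ?thesis using 3 that by (simp add: bridge_cov_le_case tent_left tent_right)
    next
      case 4
      then have "bridge_cov (2 * s) (2 * t) = 0" by (intro bridge_cov_outside) auto
      then show ?thesis using 4 that by (simp add: bridge_cov_le_case tent_right field_simps)
    next
      case 5
      then have "bridge_cov (2 * s - 1) (2 * t - 1) = 0"
        using that by (cases "s = 1/2") (auto intro!: bridge_cov_outside simp: bridge_cov_le_case)
      then show ?thesis using 5 that by (simp add: bridge_cov_le_case tent_left field_simps)
    qed
  qed
  show ?thesis
  proof (cases "s \<le> t")
    case True then show ?thesis by (rule *)
  next
    case False
    then have "t \<le> s" by simp
    from *[OF this] show ?thesis
      unfolding bridge_cov_sym[of t s] bridge_cov_sym[of "2 * t"] bridge_cov_sym[of "2 * t - 1"] mult.commute[of "tent t"] .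
  qed
qed

lemma sum_even_odd: "(\<Sum>k<n. f (2 * k) + f (2 * k + 1)) = (\<Sum>k<2 * n. f k)" for f :: "nat \<Rightarrow> real"
  by (induction n) (simp_all add: algebra_simps)

text \<open>The n-fold iteration of \<open>bridge_cov_rec\<close>. The remainder consists of 2^n
  bridge covariances with weight 2^-n; at most one of them is nonzero, so it tends to 0.\<close>

lemma bridge_cov_expansion:
  "bridge_cov s t = (\<Sum>m<n. (1/2)^m * (\<Sum>k<2^m. tent (2^m * s - real k) * tent (2^m * t - real k)))
     + (1/2)^n * (\<Sum>k<2^n. bridge_cov (2^n * s - real k) (2^n * t - real k))"
proof (induction n)
  case 0 then show ?case by simp
next
  case (Suc n)
  let ?f = "\<lambda>k. bridge_cov (2^Suc n * s - real k) (2^Suc n * t - real k)"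
  have "(\<Sum>k<2^n. bridge_cov (2^n * s - real k) (2^n * t - real k))
    = (\<Sum>k<2^n. tent (2^n * s - real k) * tent (2^n * t - real k) + (?f (2 * k) + ?f (2 * k + 1)) / 2)"
    by (rule sum.cong[OF refl], subst bridge_cov_rec) (simp add: algebra_simps)
  also have "\<dots> = (\<Sum>k<2^n. tent (2^n * s - real k) * tent (2^n * t - real k)) + (\<Sum>k<2^n. ?f (2 * k) + ?f (2 * k + 1)) / 2"
    by (simp only: sum.distrib sum_divide_distrib[symmetric])
  also have "(\<Sum>k<2^n. ?f (2 * k) + ?f (2 * k + 1)) = (\<Sum>k<2 * 2^n. ?f k)"
    by (rule sum_even_odd)
  finally show ?case using Suc.IH by (simp add: algebra_simps)
qed

text \<open>Both functions vanish at the ends of the unit interval, so distinct integer translates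
  have disjoint supports and each sum over k has at most one nonzero term.\<close>

lemma tent_support: "tent (u - real k) \<noteq> 0 \<Longrightarrow> k = nat \<lfloor>u\<rfloor>"
  and bridge_cov_support: "bridge_cov (u - real k) w \<noteq> 0 \<Longrightarrow> k = nat \<lfloor>u\<rfloor>"
proof -
  have *: "k = nat \<lfloor>u\<rfloor>" if "0 < u - real k" "u - real k < 1"
  proof -
    have "\<lfloor>u\<rfloor> = int k" using that by (intro floor_unique) auto
    then show ?thesis by simp
  qed
  show "tent (u - real k) \<noteq> 0 \<Longrightarrow> k = nat \<lfloor>u\<rfloor>"
    by (rule *) (auto simp: tent_def split: if_splits)
  show "bridge_cov (u - real k) w \<noteq> 0 \<Longrightarrow> k = nat \<lfloor>u\<rfloor>"
  proof (rule *)
    assume nz: "bridge_cov (u - real k) w \<noteq> 0"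
    then have b: "0 \<le> u - real k" "u - real k \<le> 1" "0 \<le> w" "w \<le> 1" by (auto simp: bridge_cov_def split: if_splits)
    show "0 < u - real k" using nz b by (cases "u - real k = 0") (auto simp: bridge_cov_def)
    show "u - real k < 1" using nz b by (cases "u - real k = 1") (auto simp: bridge_cov_def)
  qed
qed

lemma sum_single_support:
  fixes f :: "nat \<Rightarrow> real"
  assumes "\<And>k. f k \<noteq> 0 \<Longrightarrow> k = k0" "finite K"
  shows "(\<Sum>k\<in>K. f k) = (if k0 \<in> K then f k0 else 0)"
proof -
  have "(\<Sum>k\<in>K. f k) = (\<Sum>k\<in>K. if k = k0 then f k0 else 0)" using assms(1) by (intro sum.cong) auto
  then show ?thesis using assms(2) by simp
qed

lemma bridge_cov_le: "\<bar>bridge_cov s t\<bar> \<le> 1"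
proof -
  have "\<bar>min s t - s * t\<bar> \<le> 1" if "0 \<le> s" "s \<le> 1" "0 \<le> t" "t \<le> 1"
  proof -
    have "0 \<le> s * t" using that by simp
    moreover have "s * t \<le> s" "s * t \<le> t" using that by (simp_all add: mult_left_le mult_left_le_one_le)
    ultimately show ?thesis using that by linarith
  qed
  then show ?thesis by (simp add: bridge_cov_def)
qed

lemma bridge_cov_sums:
  "(\<lambda>n. \<Sum>m<n. (1/2)^m * (\<Sum>k<2^m. tent (2^m * s - real k) * tent (2^m * t - real k))) \<longlonglongrightarrow> bridge_cov s t"
proof (rule LIMSEQ_I)
  fix e :: real assume "0 < e"
  then obtain N where N: "(1/2)^N < e" using real_arch_pow_inv[of e "1/2"] by auto
  show "\<exists>no. \<forall>n\<ge>no. norm ((\<Sum>m<n. (1/2)^m * (\<Sum>k<2^m. tent (2^m * s - real k) * tent (2^m * t - real k))) - bridge_cov s t) < e"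
  proof (intro exI allI impI)
    fix n assume n: "N \<le> n"
    let ?R = "\<Sum>k<2^n. bridge_cov (2^n * s - real k) (2^n * t - real k)"
    have "?R = (if nat \<lfloor>2^n * s\<rfloor> \<in> {..<2^n} then bridge_cov (2^n * s - real (nat \<lfloor>2^n * s\<rfloor>)) (2^n * t - real (nat \<lfloor>2^n * s\<rfloor>)) else 0)"
      by (rule sum_single_support) (auto dest: bridge_cov_support)
    then have R: "\<bar>?R\<bar> \<le> 1" using bridge_cov_le by simp
    have "norm ((\<Sum>m<n. (1/2)^m * (\<Sum>k<2^m. tent (2^m * s - real k) * tent (2^m * t - real k))) - bridge_cov s t)
       = (1/2)^n * \<bar>?R\<bar>"
      by (subst bridge_cov_expansion[of s t n]) (simp add: abs_mult)
    also have "\<dots> \<le> (1/2)^n * 1" using R by (intro mult_left_mono) auto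
    also have "\<dots> \<le> (1/2)^N" using n by (simp add: power_decreasing)
    finally show "norm ((\<Sum>m<n. (1/2)^m * (\<Sum>k<2^m. tent (2^m * s - real k) * tent (2^m * t - real k))) - bridge_cov s t) < e"
      using N by simp
  qed
qed

text \<open>Levy's construction of Brownian motion on the unit interval. The coordinate 0 gives the value
  at time 1, the others the coefficients of the Schauder functions.\<close>

definition coeff :: "nat \<Rightarrow> nat \<Rightarrow> real" where
  "coeff m k = real (Suc (prod_encode (m, k)))"

definition level :: "nat \<Rightarrow> (real \<Rightarrow> real) \<Rightarrow> real \<Rightarrow> real" where
  "level m \<omega> t = (1 / sqrt 2)^m * (\<Sum>k<2^m. \<omega> (coeff m k) * tent (2^m * t - real k))"

text \<open>A bound on a level of the series, uniform in t, from |z| \<le> a + z^4 / a^3 with a =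
  (5/4)^m and the maximum over k replaced by a sum. The base 5/4 lies below 2^(1/2), so the first
  term is summable against 2^(-m/2), and above 2^(1/6), so the expectations of the 2^m fourth powers
  are summable too.\<close>

definition level_bd :: "nat \<Rightarrow> (real \<Rightarrow> real) \<Rightarrow> real" where
  "level_bd m \<omega> = (1 / sqrt 2)^m * ((5/4)^m + (64/125)^m * (\<Sum>k<2^m. \<omega> (coeff m k) ^ 4))"

lemma level_bd_nonneg: "0 \<le> level_bd m \<omega>"
  by (auto simp: level_bd_def intro!: mult_nonneg_nonneg add_nonneg_nonneg sum_nonneg)

lemma abs_le_split:
  fixes z a :: real
  assumes "0 < a" shows "\<bar>z\<bar> \<le> a + z ^ 4 / a ^ 3"
proof (cases "\<bar>z\<bar> \<le> a")
  case True
  have "0 \<le> z ^ 4 / a ^ 3" using assms by simp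
  then show ?thesis using True by linarith
next
  case False
  then have "a ^ 3 * \<bar>z\<bar> \<le> \<bar>z\<bar> ^ 3 * \<bar>z\<bar>" using assms by (intro mult_right_mono power_mono) auto
  also have "\<dots> = z ^ 4" by (simp add: power4_eq_xxxx power3_eq_cube)
  finally have "\<bar>z\<bar> \<le> z ^ 4 / a ^ 3" using assms by (simp add: field_simps)
  then show ?thesis using assms by simp
qed

lemma level_le: "\<bar>level m \<omega> t\<bar> \<le> level_bd m \<omega>"
proof -
  let ?k = "nat \<lfloor>2^m * t\<rfloor>"
  let ?S = "\<Sum>k<2^m. \<omega> (coeff m k) ^ 4"
  have S: "0 \<le> ?S" by (intro sum_nonneg) auto
  have "(\<Sum>k<2^m. \<omega> (coeff m k) * tent (2^m * t - real k))
    = (if ?k \<in> {..<2^m} then \<omega> (coeff m ?k) * tent (2^m * t - real ?k) else 0)"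
    by (rule sum_single_support) (auto dest: tent_support)
  also have "\<bar>\<dots>\<bar> \<le> (5/4)^m + (64/125)^m * ?S"
  proof (cases "?k \<in> {..<2^m}")
    case True
    have t: "\<bar>tent u\<bar> \<le> 1" for u by (auto simp: tent_def)
    have "\<bar>\<omega> (coeff m ?k) * tent (2^m * t - real ?k)\<bar> \<le> \<bar>\<omega> (coeff m ?k)\<bar> * 1"
      unfolding abs_mult by (intro mult_left_mono t) auto
    also have "\<dots> \<le> (5/4)^m + \<omega> (coeff m ?k) ^ 4 / ((5/4)^m)^3"
      using abs_le_split[of "(5/4)^m"] by simp
    also have "((5/4::real)^m)^3 = (125/64)^m" by (simp add: power3_eq_cube flip: power_mult_distrib)
    also have "\<omega> (coeff m ?k) ^ 4 / (125/64)^m = (64/125)^m * \<omega> (coeff m ?k) ^ 4"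
      by (simp add: power_divide)
    also have "\<omega> (coeff m ?k) ^ 4 \<le> ?S"
      using True by (intro member_le_sum) auto
    finally show ?thesis using True by simp
  qed (use S in simp)
  finally have "\<bar>\<Sum>k<2^m. \<omega> (coeff m k) * tent (2^m * t - real k)\<bar> \<le> (5/4)^m + (64/125)^m * ?S" .
  then show ?thesis unfolding level_def level_bd_def abs_mult by (simp add: mult_left_mono)
qed

lemma level_measurable[measurable]: "(\<lambda>\<omega>. level m \<omega> t) \<in> borel_measurable gauss_space"
  unfolding level_def by measurable

lemma level_bd_measurable[measurable]: "level_bd m \<in> borel_measurable gauss_space"
  unfolding level_bd_def[abs_def] by measurable

text \<open>A rational bound chosen so that 18/25 * 5/4 = 9/10.\<close>

lemma inverse_sqrt2: "1 / sqrt 2 \<le> (18/25 :: real)"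
proof -
  have "25/18 \<le> sqrt 2" by (rule real_le_rsqrt) (simp add: power2_eq_square)
  then show ?thesis by (simp add: field_simps)
qed

lemma nn_integral_level_bd: "(\<integral>\<^sup>+\<omega>. ennreal (level_bd m \<omega>) \<partial>gauss_space) \<le> ennreal (4 * (9/10)^m)"
proof -
  interpret prob_space gauss_space by (rule prob_space_gauss_space)
  let ?r = "(1 / sqrt 2)^m"
  have "(\<integral>\<^sup>+\<omega>. ennreal (level_bd m \<omega>) \<partial>gauss_space)
      = (\<integral>\<^sup>+\<omega>. ennreal (?r * (5/4)^m) + ennreal (?r * (64/125)^m) * (\<Sum>k<2^m. ennreal (\<omega> (coeff m k) ^ 4)) \<partial>gauss_space)"
  proof (rule nn_integral_cong)
    fix \<omega> :: "real \<Rightarrow> real"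
    have s0: "0 \<le> (\<Sum>k<2^m. \<omega> (coeff m k) ^ 4)" by (intro sum_nonneg) auto
    have "level_bd m \<omega> = ?r * (5/4)^m + (?r * (64/125)^m) * (\<Sum>k<2^m. \<omega> (coeff m k) ^ 4)"
      by (simp add: level_bd_def distrib_left mult.assoc)
    also have "ennreal \<dots> = ennreal (?r * (5/4)^m) + ennreal (?r * (64/125)^m) * ennreal (\<Sum>k<2^m. \<omega> (coeff m k) ^ 4)"
      using s0 by (subst ennreal_plus) (auto simp: ennreal_mult)
    also have "ennreal (\<Sum>k<2^m. \<omega> (coeff m k) ^ 4) = (\<Sum>k<2^m. ennreal (\<omega> (coeff m k) ^ 4))"
      by (rule sum_ennreal[symmetric]) auto
    finally show "ennreal (level_bd m \<omega>)
      = ennreal (?r * (5/4)^m) + ennreal (?r * (64/125)^m) * (\<Sum>k<2^m. ennreal (\<omega> (coeff m k) ^ 4))" .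
  qed
  also have "\<dots> = ennreal (?r * (5/4)^m) + ennreal (?r * (64/125)^m) * (\<Sum>k<2^m::nat. 3)"
    by (subst nn_integral_add, simp, simp, subst nn_integral_cmult, simp, subst nn_integral_sum, simp)
      (use emeasure_space_1 in \<open>simp add: coord_fourth_moment\<close>)
  also have "(\<Sum>k<2^m::nat. 3) = ennreal (2^m * 3)"
    by (simp add: ennreal_mult flip: ennreal_power)
  also have "ennreal (?r * (5/4)^m) + ennreal (?r * (64/125)^m) * ennreal (2^m * 3)
      = ennreal (?r * (5/4)^m + (?r * (64/125)^m) * (2^m * 3))"
    by (subst ennreal_plus) (auto simp: ennreal_mult)
  also have "\<dots> \<le> ennreal (4 * (9/10)^m)"
  proof (rule ennreal_leI)
    have r: "?r \<le> (18/25)^m" by (rule power_mono[OF inverse_sqrt2]) auto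
    have "?r * (5/4)^m \<le> (18/25)^m * (5/4)^m" using r by (intro mult_right_mono) auto
    also have "\<dots> = (9/10)^m" by (simp flip: power_mult_distrib)
    finally have a: "?r * (5/4)^m \<le> (9/10)^m" .
    have "(?r * (64/125)^m) * (2^m * 3) \<le> ((18/25)^m * (64/125)^m) * (2^m * 3)"
      using r by (intro mult_right_mono) auto
    also have "\<dots> = 3 * (18/25 * (64/125) * 2)^m" by (simp only: power_mult_distrib)
    also have "\<dots> \<le> 3 * (9/10)^m" by (intro mult_left_mono power_mono) auto
    finally show "?r * (5/4)^m + (?r * (64/125)^m) * (2^m * 3) \<le> 4 * (9/10)^m" using a by simp
  qed
  finally show ?thesis .
qed

definition good :: "(real \<Rightarrow> real) \<Rightarrow> bool" where
  "good \<omega> \<longleftrightarrow> (\<Sum>m. ennreal (level_bd m \<omega>)) \<noteq> \<infinity>"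

lemma good_measurable[measurable]: "Measurable.pred gauss_space good"
  unfolding good_def by measurable

lemma good_summable: "good \<omega> \<Longrightarrow> summable (\<lambda>m. level_bd m \<omega>)"
  unfolding good_def by (rule summable_suminf_not_top) (auto simp: level_bd_nonneg)

lemma AE_good: "AE \<omega> in gauss_space. good \<omega>"
  unfolding good_def
proof (rule nn_integral_PInf_AE)
  have "(\<integral>\<^sup>+\<omega>. (\<Sum>m. ennreal (level_bd m \<omega>)) \<partial>gauss_space) = (\<Sum>m. \<integral>\<^sup>+\<omega>. ennreal (level_bd m \<omega>) \<partial>gauss_space)"
    by (rule nn_integral_suminf) simp
  also have "\<dots> \<le> (\<Sum>m. ennreal (4 * (9/10)^m))"
    by (intro suminf_le nn_integral_level_bd) auto
  also have "\<dots> < \<infinity>"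
    by (subst suminf_ennreal2) (auto intro!: summable_mult summable_geometric)
  finally show "(\<integral>\<^sup>+\<omega>. (\<Sum>m. ennreal (level_bd m \<omega>)) \<partial>gauss_space) \<noteq> \<infinity>" by simp
qed measurable

definition bm_approx :: "nat \<Rightarrow> real \<Rightarrow> (real \<Rightarrow> real) \<Rightarrow> real" where
  "bm_approx n t \<omega> = t * \<omega> 0 + (\<Sum>m<n. level m \<omega> t)"

text \<open>Off the almost sure event \<open>good\<close> the path is set to zero: the limit has to
  be a Borel random element as a map on the whole sample space, so every path is made
  continuous.\<close>

definition brownian :: "real \<Rightarrow> (real \<Rightarrow> real) \<Rightarrow> real" where
  "brownian t \<omega> = (if good \<omega> then t * \<omega> 0 + (\<Sum>m. level m \<omega> t) else 0)"

lemma level_continuous: "continuous_on UNIV (level m \<omega>)"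
  unfolding level_def[abs_def] tent_def by (intro continuous_intros)

lemma brownian_continuous: "continuous_on UNIV (\<lambda>t. brownian t \<omega>)"
proof (cases "good \<omega>")
  case True
  have "uniform_limit UNIV (\<lambda>n t. \<Sum>m<n. level m \<omega> t) (\<lambda>t. \<Sum>m. level m \<omega> t) sequentially"
    by (rule Weierstrass_m_test[OF _ good_summable[OF True]]) (use level_le in auto)
  then have "continuous_on UNIV (\<lambda>t. \<Sum>m. level m \<omega> t)"
    by (rule uniform_limit_theorem[rotated]) (auto intro!: always_eventually continuous_intros continuous_on_subset[OF level_continuous])
  then show ?thesis using True by (simp add: brownian_def continuous_intros)
qed (simp add: brownian_def)

lemma bm_approx_tendsto:
  assumes "good \<omega>" shows "(\<lambda>n. bm_approx n t \<omega>) \<longlonglongrightarrow> brownian t \<omega>"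
proof -
  have "summable (\<lambda>m. level m \<omega> t)"
    by (rule summable_comparison_test'[OF good_summable[OF assms]]) (use level_le in auto)
  then have "(\<lambda>n. \<Sum>m<n. level m \<omega> t) \<longlonglongrightarrow> (\<Sum>m. level m \<omega> t)" by (rule summable_LIMSEQ)
  then show ?thesis using assms unfolding bm_approx_def brownian_def by (auto intro!: tendsto_intros)
qed

lemma bm_approx_measurable[measurable]: "bm_approx n t \<in> borel_measurable gauss_space"
  unfolding bm_approx_def[abs_def] by measurable

lemma brownian_measurable[measurable]: "brownian t \<in> borel_measurable gauss_space"
proof (rule borel_measurable_LIMSEQ_real)
  show "(\<lambda>n. if good \<omega> then bm_approx n t \<omega> else 0) \<longlonglongrightarrow> brownian t \<omega>" for \<omega>
    using bm_approx_tendsto[of \<omega> t] by (auto simp: brownian_def)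
  show "(\<lambda>\<omega>. if good \<omega> then bm_approx n t \<omega> else 0) \<in> borel_measurable gauss_space" for n
    by measurable
qed

definition basis :: "(nat \<times> nat) option \<Rightarrow> real \<Rightarrow> real" where
  "basis a t = (case a of None \<Rightarrow> t | Some (m, k) \<Rightarrow> (1 / sqrt 2)^m * tent (2^m * t - real k))"

definition index :: "(nat \<times> nat) option \<Rightarrow> real" where
  "index a = (case a of None \<Rightarrow> 0 | Some q \<Rightarrow> real (Suc (prod_encode q)))"

definition indices :: "nat \<Rightarrow> (nat \<times> nat) option set" where
  "indices n = insert None (Some ` (SIGMA m:{..<n}. {..<2^m}))"

lemma inj_index: "inj_on index A"
  by (auto simp: inj_on_def index_def split: option.splits)

lemma finite_indices[simp]: "finite (indices n)"
  by (simp add: indices_def)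

lemma sum_indices:
  "(\<Sum>a\<in>indices n. f a) = f None + (\<Sum>m<n. \<Sum>k<2^m. f (Some (m, k)))" for f :: "_ \<Rightarrow> real"
  by (simp add: indices_def sum.insert image_iff sum.reindex sum.Sigma case_prod_unfold)

lemma bm_approx_eq: "bm_approx n t \<omega> = (\<Sum>a\<in>indices n. basis a t * \<omega> (index a))"
  by (simp add: sum_indices bm_approx_def level_def basis_def index_def coeff_def sum_distrib_left mult_ac)

text \<open>The linear function contributes s t and the Schauder functions the bridge covariance min
  s t - s t.\<close>

lemma basis_cov:
  assumes "0 \<le> s" "s \<le> 1" "0 \<le> t" "t \<le> 1"
  shows "(\<lambda>n. \<Sum>a\<in>indices n. basis a s * basis a t) \<longlonglongrightarrow> min s t"
proof -
  have r: "(1 / sqrt 2)^m * (1 / sqrt 2)^m = (1/2 :: real)^m" for m :: nat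
    by (simp flip: power_mult_distrib)
  have "(1 / sqrt 2)^m * tent (2^m * s - real k) * ((1 / sqrt 2)^m * tent (2^m * t - real k))
      = (1/2)^m * (tent (2^m * s - real k) * tent (2^m * t - real k))" for m k
    unfolding r[symmetric] by (simp only: mult_ac)
  note e = this
  have "(\<Sum>a\<in>indices n. basis a s * basis a t)
     = s * t + (\<Sum>m<n. (1/2)^m * (\<Sum>k<2^m. tent (2^m * s - real k) * tent (2^m * t - real k)))" for n
    unfolding sum_indices basis_def option.case prod.case e sum_distrib_left ..
  moreover have "s * t + bridge_cov s t = min s t" using assms by (simp add: bridge_cov_def)
  ultimately show ?thesis using tendsto_add[OF tendsto_const[of "s * t"] bridge_cov_sums[of s t]] by simp
qed

text \<open>The truncated series are finite combinations of distinct coordinates, hence Gaussian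
  with explicit variance; \<open>basis_cov\<close> gives the limit of the variances, and
  \<open>gauss_rv_limit\<close> that of the laws.\<close>

lemma brownian_gauss:
  assumes F: "finite F" "\<And>i. i \<in> F \<Longrightarrow> \<tau> i \<in> {0..1}"
  shows "gauss_rv gauss_space (\<lambda>\<omega>. \<Sum>i\<in>F. c i * brownian (\<tau> i) \<omega>) 0 (\<Sum>i\<in>F. \<Sum>j\<in>F. c i * c j * min (\<tau> i) (\<tau> j))"
proof (rule gauss_rv_limit[OF prob_space_gauss_space, where m = "\<lambda>_. 0"])
  fix n
  have "(\<lambda>\<omega>. \<Sum>i\<in>F. c i * bm_approx n (\<tau> i) \<omega>) = (\<lambda>\<omega>. \<Sum>a\<in>indices n. (\<Sum>i\<in>F. c i * basis a (\<tau> i)) * \<omega> (index a))"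
    unfolding bm_approx_eq sum_distrib_left sum_distrib_right by (subst sum.swap) (simp add: mult_ac)
  moreover have "(\<Sum>a\<in>indices n. (\<Sum>i\<in>F. c i * basis a (\<tau> i))\<^sup>2)
      = (\<Sum>i\<in>F. \<Sum>j\<in>F. c i * c j * (\<Sum>a\<in>indices n. basis a (\<tau> i) * basis a (\<tau> j)))"
  proof -
    have "(\<Sum>a\<in>indices n. (\<Sum>i\<in>F. c i * basis a (\<tau> i))\<^sup>2)
      = (\<Sum>a\<in>indices n. \<Sum>i\<in>F. \<Sum>j\<in>F. c i * c j * (basis a (\<tau> i) * basis a (\<tau> j)))"
      unfolding power2_eq_square sum_product by (intro sum.cong refl) simp
    also have "\<dots> = (\<Sum>i\<in>F. \<Sum>a\<in>indices n. \<Sum>j\<in>F. c i * c j * (basis a (\<tau> i) * basis a (\<tau> j)))"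
      by (rule sum.swap)
    also have "\<dots> = (\<Sum>i\<in>F. \<Sum>j\<in>F. \<Sum>a\<in>indices n. c i * c j * (basis a (\<tau> i) * basis a (\<tau> j)))"
      by (rule sum.cong[OF refl]) (rule sum.swap)
    finally show ?thesis by (simp add: sum_distrib_left)
  qed
  ultimately show "gauss_rv gauss_space (\<lambda>\<omega>. \<Sum>i\<in>F. c i * bm_approx n (\<tau> i) \<omega>) 0
      (\<Sum>i\<in>F. \<Sum>j\<in>F. c i * c j * (\<Sum>a\<in>indices n. basis a (\<tau> i) * basis a (\<tau> j)))"
    using gauss_rv_coords[OF finite_indices inj_index, of "\<lambda>a. \<Sum>i\<in>F. c i * basis a (\<tau> i)" n] by simp
next
  show "AE \<omega> in gauss_space. (\<lambda>n. \<Sum>i\<in>F. c i * bm_approx n (\<tau> i) \<omega>) \<longlonglongrightarrow> (\<Sum>i\<in>F. c i * brownian (\<tau> i) \<omega>)"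
    using AE_good by eventually_elim (auto intro!: tendsto_intros bm_approx_tendsto)
  show "(\<lambda>n. \<Sum>i\<in>F. \<Sum>j\<in>F. c i * c j * (\<Sum>a\<in>indices n. basis a (\<tau> i) * basis a (\<tau> j)))
      \<longlonglongrightarrow> (\<Sum>i\<in>F. \<Sum>j\<in>F. c i * c j * min (\<tau> i) (\<tau> j))"
    using F(2) by (intro tendsto_sum tendsto_mult tendsto_const basis_cov) auto
qed auto

section \<open>Trigonometric polynomials in finitely many coordinates\<close>

inductive_set trig_sums :: "nat \<Rightarrow> ((nat \<Rightarrow> real) \<Rightarrow> real) set" for K where
  cosine: "(\<lambda>x. c * cos ((\<Sum>k<K. \<theta> k * x k) + \<alpha>)) \<in> trig_sums K"
| add: "r \<in> trig_sums K \<Longrightarrow> s \<in> trig_sums K \<Longrightarrow> (\<lambda>x. r x + s x) \<in> trig_sums K"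

lemma trig_sums_const: "(\<lambda>_. c) \<in> trig_sums K"
  using trig_sums.cosine[of c "\<lambda>_. 0" K 0] by simp

text \<open>The product-to-sum formula for cosines; the trigonometric sums thus form an algebra, as
  Stone-Weierstrass requires.\<close>

lemma trig_sums_mult:
  assumes "r \<in> trig_sums K" "s \<in> trig_sums K"
  shows "(\<lambda>x. r x * s x) \<in> trig_sums K"
proof -
  have cc: "(\<lambda>x. (c * cos ((\<Sum>k<K. \<theta> k * x k) + \<alpha>)) * (c' * cos ((\<Sum>k<K. \<theta>' k * x k) + \<alpha>'))) \<in> trig_sums K"
    for c c' \<alpha> \<alpha>' :: real and \<theta> \<theta>' :: "nat \<Rightarrow> real"
  proof -
    have "(c * cos ((\<Sum>k<K. \<theta> k * x k) + \<alpha>)) * (c' * cos ((\<Sum>k<K. \<theta>' k * x k) + \<alpha>'))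
      = c * c' / 2 * cos ((\<Sum>k<K. (\<theta> k - \<theta>' k) * x k) + (\<alpha> - \<alpha>'))
        + c * c' / 2 * cos ((\<Sum>k<K. (\<theta> k + \<theta>' k) * x k) + (\<alpha> + \<alpha>'))" for x
    proof -
      define A where "A = (\<Sum>k<K. \<theta> k * x k) + \<alpha>"
      define B where "B = (\<Sum>k<K. \<theta>' k * x k) + \<alpha>'"
      have eqs: "(\<Sum>k<K. (\<theta> k - \<theta>' k) * x k) + (\<alpha> - \<alpha>') = A - B"
        "(\<Sum>k<K. (\<theta> k + \<theta>' k) * x k) + (\<alpha> + \<alpha>') = A + B"
        by (simp_all add: A_def B_def left_diff_distrib distrib_right sum_subtractf sum.distrib)
      show ?thesis unfolding eqs A_def[symmetric] B_def[symmetric] by (simp add: cos_add cos_diff algebra_simps)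
    qed
    then show ?thesis by (simp only:) (intro trig_sums.intros)
  qed
  have cs: "(\<lambda>x. (c * cos ((\<Sum>k<K. \<theta> k * x k) + \<alpha>)) * s x) \<in> trig_sums K" if "s \<in> trig_sums K" for c \<theta> \<alpha> s
    using that
  proof (induction rule: trig_sums.induct)
    case (cosine c' \<theta>' \<alpha>') show ?case by (rule cc)
  next
    case (add r s) show ?case unfolding distrib_left using add.IH by (rule trig_sums.add)
  qed
  show ?thesis using assms(1)
  proof (induction rule: trig_sums.induct)
    case (cosine c \<theta> \<alpha>) show ?case by (rule cs[OF assms(2)])
  next
    case (add r s') show ?case unfolding distrib_right using add.IH by (rule trig_sums.add)
  qed
qed

lemma trig_sums_sin: assumes "k < K" shows "(\<lambda>x. sin (a * x k)) \<in> trig_sums K"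
proof -
  have "(\<Sum>i<K. (if i = k then a else 0) * x i) = a * x k" for x :: "nat \<Rightarrow> real"
  proof -
    have "(\<Sum>i<K. (if i = k then a else 0) * x i) = (\<Sum>i<K. if i = k then a * x k else 0)" by (intro sum.cong) auto
    then show ?thesis using assms by simp
  qed
  then have "(\<lambda>x. sin (a * x k)) = (\<lambda>x. 1 * cos ((\<Sum>i<K. (if i = k then a else 0) * x i) + - (pi/2)))"
    by (simp add: cos_diff fun_eq_iff)
  then show ?thesis by (simp only:) (rule trig_sums.cosine)
qed

lemma trig_sums_continuous: "r \<in> trig_sums K \<Longrightarrow> continuous_on UNIV r"
  by (induction rule: trig_sums.induct) (auto intro!: continuous_intros continuous_on_product_coordinates)

lemma trig_sums_bounded: "r \<in> trig_sums K \<Longrightarrow> \<exists>B. \<forall>x. \<bar>r x\<bar> \<le> B"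
proof (induction rule: trig_sums.induct)
  case (cosine c \<theta> \<alpha>)
  have "\<bar>c * cos u\<bar> \<le> \<bar>c\<bar>" for u :: real by (simp add: abs_mult mult_left_le)
  then show ?case by blast
next
  case (add r s)
  then obtain A B where "\<And>x. \<bar>r x\<bar> \<le> A" "\<And>x. \<bar>s x\<bar> \<le> B" by auto
  then have "\<bar>r x + s x\<bar> \<le> A + B" for x by (metis abs_triangle_ineq add_mono order_trans)
  then show ?case by blast
qed

lemma integrable_bounded_continuous:
  fixes r :: "(nat \<Rightarrow> real) \<Rightarrow> real"
  assumes "prob_space M" "Y \<in> borel_measurable M" "continuous_on UNIV r" "\<And>x. \<bar>r x\<bar> \<le> B"
  shows "integrable M (\<lambda>\<omega>. r (Y \<omega>))"
proof -
  interpret prob_space M by fact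
  have "(\<lambda>\<omega>. r (Y \<omega>)) \<in> borel_measurable M"
    using measurable_compose[OF assms(2) borel_measurable_continuous_onI[OF assms(3)]] .
  then show ?thesis by (rule integrable_const_bound[where B = B, rotated]) (use assms(4) in auto)
qed

lemma trig_sums_integrable:
  "r \<in> trig_sums K \<Longrightarrow> prob_space M \<Longrightarrow> Y \<in> borel_measurable M \<Longrightarrow> integrable M (\<lambda>\<omega>. r (Y \<omega>))"
  using trig_sums_bounded[of r K] integrable_bounded_continuous[of M Y r] trig_sums_continuous[of r K] by blast

lemma trig_sums_convergence:
  assumes "r \<in> trig_sums K" and ps: "\<And>n. prob_space (M n)" "prob_space N"
    and Y: "\<And>n. Y n \<in> borel_measurable (M n)" "L \<in> borel_measurable N"
    and conv: "\<And>\<theta> \<alpha>. (\<lambda>n. LINT \<omega>|M n. cos ((\<Sum>k<K. \<theta> k * Y n \<omega> k) + \<alpha>))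
        \<longlonglongrightarrow> (LINT \<omega>|N. cos ((\<Sum>k<K. \<theta> k * L \<omega> k) + \<alpha>))"
  shows "(\<lambda>n. LINT \<omega>|M n. r (Y n \<omega>)) \<longlonglongrightarrow> (LINT \<omega>|N. r (L \<omega>))"
  using assms(1)
proof (induction rule: trig_sums.induct)
  case (cosine c \<theta> \<alpha>)
  show ?case unfolding integral_mult_right_zero by (intro tendsto_mult tendsto_const conv)
next
  case (add r s)
  have "(LINT \<omega>|M n. r (Y n \<omega>) + s (Y n \<omega>)) = (LINT \<omega>|M n. r (Y n \<omega>)) + (LINT \<omega>|M n. s (Y n \<omega>))" for n
    by (intro Bochner_Integration.integral_add trig_sums_integrable[OF add.hyps(1) ps(1) Y(1)]
        trig_sums_integrable[OF add.hyps(2) ps(1) Y(1)])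
  moreover have "(LINT \<omega>|N. r (L \<omega>) + s (L \<omega>)) = (LINT \<omega>|N. r (L \<omega>)) + (LINT \<omega>|N. s (L \<omega>))"
    by (intro Bochner_Integration.integral_add trig_sums_integrable[OF add.hyps(1) ps(2) Y(2)]
        trig_sums_integrable[OF add.hyps(2) ps(2) Y(2)])
  ultimately show ?case by (simp only:) (intro tendsto_add add.IH)
qed

section \<open>Convergence of finite-dimensional distributions\<close>

text \<open>Folding the real line onto \<open>[-R, R]\<close> by \<open>arcsin \<circ> sin\<close> makes the approximation by
  polynomials in \<open>sin\<close> uniform on the whole space.\<close>

lemma trig_approximation:
  fixes g :: "(nat \<Rightarrow> real) \<Rightarrow> real"
  assumes cont: "continuous_on UNIV g" and B: "\<And>x. \<bar>g x\<bar> \<le> B" and R: "0 < R" and e: "0 < e"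
    and dep: "\<And>x. g (\<lambda>k. if k < K then x k else 0) = g x"
  shows "\<exists>r\<in>trig_sums K. (\<forall>x. (\<forall>k<K. \<bar>x k\<bar> \<le> R) \<longrightarrow> \<bar>g x - r x\<bar> \<le> e) \<and> (\<forall>x. \<bar>g x - r x\<bar> \<le> 2 * B + e)"
proof -
  \<comment> \<open>Scaling by a carries [-R, R] onto [-pi/2, pi/2], where arcsin inverts
    sin.\<close>
  define a where "a = pi / (2 * R)"
  \<comment> \<open>The coordinates from K on are pinned at 0, so S is compact in the infinite
    product and Stone-Weierstrass applies to g after \<open>unfold\<close>.\<close>
  define S where "S = (\<Pi>\<^sub>E k\<in>(UNIV::nat set). if k < K then {-1..1::real} else {0})"
  define unfold where "unfold s = (\<lambda>k. if k < K then arcsin (s k) / a else 0)" for s :: "nat \<Rightarrow> real"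
  define fold where "fold x = (\<lambda>k. if k < K then sin (a * x k) else 0)" for x :: "nat \<Rightarrow> real"
  define P where "P = {q. continuous_on S q \<and> (\<lambda>x. q (fold x)) \<in> trig_sums K}"
  have a: "0 < a" using R by (simp add: a_def)
  have foldS: "fold x \<in> S" for x by (auto simp: fold_def S_def)
  interpret function_ring_on P S
  proof
    have "compactin (product_topology (\<lambda>_. euclidean) UNIV) S"
      unfolding S_def by (subst compactin_PiE) (auto simp: compactin_euclidean_iff)
    then show "compact S" by (simp add: euclidean_product_topology compactin_euclidean_iff)
    show "continuous_on S f" if "f \<in> P" for f using that by (simp add: P_def)
    show "(\<lambda>x. f x + g x) \<in> P" if "f \<in> P" "g \<in> P" for f g
      using that by (auto simp: P_def intro!: continuous_intros trig_sums.add)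
    show "(\<lambda>x. f x * g x) \<in> P" if "f \<in> P" "g \<in> P" for f g
      using that by (auto simp: P_def intro!: continuous_intros trig_sums_mult)
    show "(\<lambda>_. c) \<in> P" for c by (auto simp: P_def intro!: trig_sums_const)
    show "\<exists>f\<in>P. f x \<noteq> f y" if xy: "x \<in> S" "y \<in> S" "x \<noteq> y" for x y
    proof -
      obtain k where k: "x k \<noteq> y k" using xy(3) by auto
      have "x k \<in> (if k < K then {-1..1} else {0})" "y k \<in> (if k < K then {-1..1} else {0})"
        using xy(1,2) by (auto simp: S_def PiE_iff)
      then have kK: "k < K" using k by (auto split: if_splits)
      have "(\<lambda>s. s k) \<in> P"
        unfolding P_def mem_Collect_eq
      proof
        show "continuous_on S (\<lambda>s. s k)"
          by (rule continuous_on_subset[OF continuous_on_product_coordinates]) simp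
        show "(\<lambda>x. fold x k) \<in> trig_sums K" unfolding fold_def if_P[OF kK] by (rule trig_sums_sin[OF kK])
      qed
      with k show ?thesis by (rule_tac bexI[where x = "\<lambda>s. s k"])
    qed
  qed
  have "continuous_on S unfold"
  proof (rule continuous_on_coordinatewise_then_product)
    fix k
    show "continuous_on S (\<lambda>s. unfold s k)"
    proof (cases "k < K")
      case True
      have "continuous_on S (\<lambda>s. arcsin (s k))"
      proof (rule continuous_on_arcsin)
        show "continuous_on S (\<lambda>s. s k)"
          by (rule continuous_on_subset[OF continuous_on_product_coordinates]) simp
        show "\<forall>s\<in>S. - 1 \<le> s k \<and> s k \<le> 1"
        proof
          fix s assume "s \<in> S"
          then have "s k \<in> (if k < K then {-1..1} else {0})" unfolding S_def PiE_iff by blast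
          then show "- 1 \<le> s k \<and> s k \<le> 1" using True by simp
        qed
      qed
      then show ?thesis using True a by (simp add: unfold_def continuous_on_divide)
    qed (simp add: unfold_def)
  qed
  then have "continuous_on S (\<lambda>s. g (unfold s))"
    by (rule continuous_on_compose2[OF cont]) simp
  from Stone_Weierstrass_basic[OF this e] obtain q where q: "q \<in> P" "\<And>s. s \<in> S \<Longrightarrow> \<bar>g (unfold s) - q s\<bar> < e" by auto
  have near: "\<bar>g (unfold (fold x)) - q (fold x)\<bar> \<le> e" for x using q(2)[OF foldS[of x]] by simp
  show ?thesis
  proof (intro bexI conjI allI impI)
    show "(\<lambda>x. q (fold x)) \<in> trig_sums K" using q(1) by (simp add: P_def)
    show "\<bar>g x - q (fold x)\<bar> \<le> 2 * B + e" for x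
      using near[of x] B[of x] B[of "unfold (fold x)"] by linarith
    fix x assume x: "\<forall>k<K. \<bar>x k\<bar> \<le> R"
    have "unfold (fold x) = (\<lambda>k. if k < K then x k else 0)"
    proof
      fix k
      have "arcsin (sin (a * x k)) = a * x k" if "k < K"
      proof (rule arcsin_sin)
        have "\<bar>a * x k\<bar> \<le> a * R" unfolding abs_mult using x that a by (simp add: mult_left_mono)
        also have "\<dots> = pi / 2" using R by (simp add: a_def)
        finally show "- (pi/2) \<le> a * x k" "a * x k \<le> pi/2" by auto
      qed
      then show "unfold (fold x) k = (if k < K then x k else 0)" using a by (simp add: unfold_def fold_def)
    qed
    then show "\<bar>g x - q (fold x)\<bar> \<le> e" using near[of x] dep[of x] by simp
  qed
qed

lemma integral_diff_le_on_event:
  fixes f r :: "'a \<Rightarrow> real"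
  assumes "prob_space M" and int: "integrable M f" "integrable M r" and A: "A \<in> sets M" "measure M A \<le> d"
    and le: "\<And>\<omega>. \<omega> \<in> space M \<Longrightarrow> \<omega> \<notin> A \<Longrightarrow> \<bar>f \<omega> - r \<omega>\<bar> \<le> e"
      "\<And>\<omega>. \<omega> \<in> space M \<Longrightarrow> \<bar>f \<omega> - r \<omega>\<bar> \<le> C + e" and C: "0 \<le> C"
  shows "\<bar>(LINT \<omega>|M. f \<omega>) - (LINT \<omega>|M. r \<omega>)\<bar> \<le> e + C * d"
proof -
  interpret prob_space M by fact
  have iA: "integrable M (indicat_real A)"
    by (rule integrable_real_indicator[OF A(1)]) (simp add: emeasure_eq_measure)
  have "\<bar>(LINT \<omega>|M. f \<omega>) - (LINT \<omega>|M. r \<omega>)\<bar> = \<bar>LINT \<omega>|M. f \<omega> - r \<omega>\<bar>" using int by simp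
  also have "\<dots> \<le> (LINT \<omega>|M. \<bar>f \<omega> - r \<omega>\<bar>)" by (rule integral_abs_bound)
  also have "\<dots> \<le> (LINT \<omega>|M. e + C * indicator A \<omega>)"
  proof (rule integral_mono)
    show "integrable M (\<lambda>\<omega>. e + C * indicator A \<omega>)" using iA by simp
    show "\<bar>f \<omega> - r \<omega>\<bar> \<le> e + C * indicator A \<omega>" if "\<omega> \<in> space M" for \<omega>
      using le[OF that] by (cases "\<omega> \<in> A") auto
  qed (use int in auto)
  also have "\<dots> = e + C * measure M A" using A(1) iA by (simp add: prob_space)
  also have "\<dots> \<le> e + C * d" using A C by (simp add: mult_left_mono)
  finally show ?thesis .
qed

text \<open>Off an event of small probability the first K coordinates stay within R, where g is
  uniformly close to a trigonometric sum. On that event the uniform bound in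
  \<open>trig_approximation\<close> limits the damage.\<close>

theorem fdd_convergence:
  fixes g :: "(nat \<Rightarrow> real) \<Rightarrow> real" and Y :: "nat \<Rightarrow> 'a \<Rightarrow> nat \<Rightarrow> real" and L :: "'b \<Rightarrow> nat \<Rightarrow> real"
  assumes ps: "\<And>n. prob_space (M n)" "prob_space N"
    and Y: "\<And>n. Y n \<in> borel_measurable (M n)" "L \<in> borel_measurable N"
    and conv: "\<And>\<theta> \<alpha>. (\<lambda>n. LINT \<omega>|M n. cos ((\<Sum>k<K. \<theta> k * Y n \<omega> k) + \<alpha>))
        \<longlonglongrightarrow> (LINT \<omega>|N. cos ((\<Sum>k<K. \<theta> k * L \<omega> k) + \<alpha>))"
    and tight: "\<And>e. 0 < e \<Longrightarrow> \<exists>R>0. \<forall>\<^sub>F n in sequentially. measure (M n) {\<omega>\<in>space (M n). \<exists>k<K. R < \<bar>Y n \<omega> k\<bar>} \<le> e"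
      "\<And>e. 0 < e \<Longrightarrow> \<exists>R>0. measure N {\<omega>\<in>space N. \<exists>k<K. R < \<bar>L \<omega> k\<bar>} \<le> e"
    and cont: "continuous_on UNIV g" and B: "\<And>x. \<bar>g x\<bar> \<le> B"
    and dep: "\<And>x. g (\<lambda>k. if k < K then x k else 0) = g x"
  shows "(\<lambda>n. LINT \<omega>|M n. g (Y n \<omega>)) \<longlonglongrightarrow> (LINT \<omega>|N. g (L \<omega>))"
proof (rule LIMSEQ_I)
  fix e :: real assume e: "0 < e"
  have B0: "0 \<le> B" using B[of undefined] by linarith
  \<comment> \<open>Each of the two approximation errors is d + 2 * B * d = d * X = e / 4, leaving e
    / 2 for the trigonometric sums.\<close>
  define X where "X = 1 + 2 * B"
  have X: "0 < X" using B0 by (simp add: X_def)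
  define d where "d = e / (4 * X)"
  have d: "0 < d" using e X by (simp add: d_def)
  obtain R1 where R1: "0 < R1" "\<forall>\<^sub>F n in sequentially. measure (M n) {\<omega>\<in>space (M n). \<exists>k<K. R1 < \<bar>Y n \<omega> k\<bar>} \<le> d"
    using tight(1)[OF d] by auto
  obtain R2 where R2: "0 < R2" "measure N {\<omega>\<in>space N. \<exists>k<K. R2 < \<bar>L \<omega> k\<bar>} \<le> d"
    using tight(2)[OF d] by auto
  define R where "R = max R1 R2"
  have R: "0 < R" using R1 by (simp add: R_def)
  obtain r where r: "r \<in> trig_sums K" "\<And>x. (\<forall>k<K. \<bar>x k\<bar> \<le> R) \<Longrightarrow> \<bar>g x - r x\<bar> \<le> d" "\<And>x. \<bar>g x - r x\<bar> \<le> 2 * B + d"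
    using trig_approximation[OF cont B R d dep] by blast
  have meas: "{\<omega>\<in>space M'. \<exists>k<K. c < \<bar>Z \<omega> k\<bar>} \<in> sets M'"
    if "Z \<in> borel_measurable M'" for M' :: "'c measure" and Z :: "'c \<Rightarrow> nat \<Rightarrow> real" and c
  proof -
    have [measurable]: "(\<lambda>\<omega>. Z \<omega> k) \<in> borel_measurable M'" for k
      by (rule measurable_product_then_coordinatewise[OF that])
    have "{\<omega>\<in>space M'. \<exists>k<K. c < \<bar>Z \<omega> k\<bar>} = (\<Union>k\<in>{..<K}. {\<omega>\<in>space M'. c < \<bar>Z \<omega> k\<bar>})" by auto
    also have "\<dots> \<in> sets M'" by (intro sets.finite_UN) auto
    finally show ?thesis .
  qed
  have diff: "\<bar>(LINT \<omega>|M'. g (Z \<omega>)) - (LINT \<omega>|M'. r (Z \<omega>))\<bar> \<le> d + 2 * B * d"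
    if M': "prob_space M'" "Z \<in> borel_measurable M'" "measure M' {\<omega>\<in>space M'. \<exists>k<K. R' < \<bar>Z \<omega> k\<bar>} \<le> d" "R' \<le> R"
    for M' :: "'c measure" and Z :: "'c \<Rightarrow> nat \<Rightarrow> real" and R'
  proof (rule integral_diff_le_on_event[OF M'(1)])
    show "integrable M' (\<lambda>\<omega>. g (Z \<omega>))" by (rule integrable_bounded_continuous[OF M'(1,2) cont B])
    show "integrable M' (\<lambda>\<omega>. r (Z \<omega>))" by (rule trig_sums_integrable[OF r(1) M'(1,2)])
    show "{\<omega>\<in>space M'. \<exists>k<K. R' < \<bar>Z \<omega> k\<bar>} \<in> sets M'" by (rule meas[OF M'(2)])
    show "\<bar>g (Z \<omega>) - r (Z \<omega>)\<bar> \<le> d" if "\<omega> \<in> space M'" "\<omega> \<notin> {\<omega>\<in>space M'. \<exists>k<K. R' < \<bar>Z \<omega> k\<bar>}" for \<omega>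
    proof (rule r(2), intro allI impI)
      fix k assume "k < K"
      then have "\<not> R' < \<bar>Z \<omega> k\<bar>" using that by blast
      then show "\<bar>Z \<omega> k\<bar> \<le> R" using M'(4) by linarith
    qed
  qed (use r(3) M'(3) B0 in auto)
  have "\<forall>\<^sub>F n in sequentially. \<bar>(LINT \<omega>|M n. r (Y n \<omega>)) - (LINT \<omega>|N. r (L \<omega>))\<bar> < e / 2"
    using tendstoD[OF trig_sums_convergence[OF r(1) ps Y conv], of "e / 2"] e by (simp add: dist_real_def)
  with R1(2) have "\<forall>\<^sub>F n in sequentially. norm ((LINT \<omega>|M n. g (Y n \<omega>)) - (LINT \<omega>|N. g (L \<omega>))) < e"
  proof eventually_elim
    case (elim n)
    have "\<bar>(LINT \<omega>|M n. g (Y n \<omega>)) - (LINT \<omega>|M n. r (Y n \<omega>))\<bar> \<le> d + 2 * B * d"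
      by (rule diff[OF ps(1) Y(1) elim(1)]) (simp add: R_def)
    moreover have "\<bar>(LINT \<omega>|N. g (L \<omega>)) - (LINT \<omega>|N. r (L \<omega>))\<bar> \<le> d + 2 * B * d"
      by (rule diff[OF ps(2) Y(2) R2(2)]) (simp add: R_def)
    moreover have "d + 2 * B * d = e / 4"
    proof -
      have "d + 2 * B * d = d * X" by (simp add: X_def algebra_simps)
      also have "\<dots> = e / 4" using X by (simp add: d_def)
      finally show ?thesis .
    qed
    ultimately show ?case using elim(2) unfolding real_norm_def by linarith
  qed
  then show "\<exists>no. \<forall>n\<ge>no. norm ((LINT \<omega>|M n. g (Y n \<omega>)) - (LINT \<omega>|N. g (L \<omega>))) < e"
    by (simp add: eventually_sequentially)
qed

lemma mspace_linf: "f \<in> mspace (linf T) \<longleftrightarrow> f \<in> extensional T \<and> bounded (f ` T)"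
  by (simp add: linf_def Met_TC.fspace_def)

lemma mdist_linf_le:
  assumes "f \<in> mspace (linf T)" "g \<in> mspace (linf T)" "T \<noteq> {}" "\<And>t. t \<in> T \<Longrightarrow> \<bar>f t - g t\<bar> \<le> e"
  shows "mdist (linf T) f g \<le> e"
proof -
  have "mdist (linf T) f g = (SUP t\<in>T. dist (f t) (g t))"
    using assms(1-3) by (simp add: linf_def Met_TC.fdist_def)
  also have "\<dots> \<le> e" using assms(3,4) by (intro cSUP_least) (auto simp: dist_real_def)
  finally show ?thesis .
qed

section \<open>Weak convergence of bounded processes\<close>

text \<open>The upper Pasch-Hausdorff envelope: for bounded f and k \<ge> 0 it is the least
  k-Lipschitz majorant of f.\<close>

definition envelope :: "'b metric \<Rightarrow> real \<Rightarrow> ('b \<Rightarrow> real) \<Rightarrow> 'b \<Rightarrow> real" where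
  "envelope D k f x = (SUP y\<in>mspace D. f y - k * mdist D x y)"

lemma
  assumes B: "\<And>y. y \<in> mspace D \<Longrightarrow> \<bar>f y\<bar> \<le> B" and k: "0 \<le> k" and x: "x \<in> mspace D"
  shows envelope_ge: "f x \<le> envelope D k f x"
    and envelope_bounded: "\<bar>envelope D k f x\<bar> \<le> B"
    and envelope_upper: "y \<in> mspace D \<Longrightarrow> f y - k * mdist D x y \<le> envelope D k f x"
    and envelope_least: "(\<And>y. y \<in> mspace D \<Longrightarrow> f y - k * mdist D x y \<le> c) \<Longrightarrow> envelope D k f x \<le> c"
proof -
  have le: "f y - k * mdist D x y \<le> B" if "y \<in> mspace D" for y
  proof -
    have "0 \<le> k * mdist D x y" using k by simp
    then show ?thesis using B[OF that] by linarith
  qed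
  have bdd: "bdd_above ((\<lambda>y. f y - k * mdist D x y) ` mspace D)" using le by (auto simp: bdd_above_def)
  show up: "f y - k * mdist D x y \<le> envelope D k f x" if "y \<in> mspace D" for y
    unfolding envelope_def using bdd that by (rule cSUP_upper2[OF _ _ order_refl])
  show least: "envelope D k f x \<le> c" if "\<And>y. y \<in> mspace D \<Longrightarrow> f y - k * mdist D x y \<le> c" for c
    unfolding envelope_def using x that by (intro cSUP_least) auto
  show ge: "f x \<le> envelope D k f x" using up[OF x] Metric_space.mdist_zero[OF Metric_space_mspace_mdist x] by simp
  have "- B \<le> f x" using B[OF x] by linarith
  with ge least[of B] le show "\<bar>envelope D k f x\<bar> \<le> B" by fastforce
qed

lemma envelope_Lipschitz:
  assumes B: "\<And>y. y \<in> mspace D \<Longrightarrow> \<bar>f y\<bar> \<le> B" and k: "0 \<le> k" and xy: "x \<in> mspace D" "x' \<in> mspace D"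
  shows "\<bar>envelope D k f x - envelope D k f x'\<bar> \<le> k * mdist D x x'"
proof -
  have *: "envelope D k f x \<le> envelope D k f x' + k * mdist D x x'" if x: "x \<in> mspace D" "x' \<in> mspace D" for x x'
  proof (rule envelope_least[OF B k x(1)])
    fix y assume y: "y \<in> mspace D"
    have "mdist D x' y \<le> mdist D x x' + mdist D x y"
      using Metric_space.triangle''[OF Metric_space_mspace_mdist, of x' D x y] x y by simp
    then have "k * mdist D x' y \<le> k * mdist D x x' + k * mdist D x y"
      using k by (metis distrib_left mult_left_mono)
    moreover have "f y - k * mdist D x' y \<le> envelope D k f x'" by (rule envelope_upper[OF B k x(2) y])
    ultimately show "f y - k * mdist D x y \<le> envelope D k f x' + k * mdist D x x'" by linarith
  qed
  have "mdist D x' x = mdist D x x'" by (rule mdist_commute)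
  with *[OF xy] *[OF xy(2,1)] show ?thesis by (simp add: abs_le_iff)
qed

lemma continuous_map_metricD:
  assumes f: "continuous_map (mtopology_of D) euclideanreal f" and x: "x \<in> mspace D" and e: "0 < e"
  shows "\<exists>d>0. \<forall>y\<in>mspace D. mdist D x y < d \<longrightarrow> \<bar>f x - f y\<bar> < e"
proof -
  interpret Metric_space "mspace D" "mdist D" by (rule Metric_space_mspace_mdist)
  have "continuous_map mtopology (Metric_space.mtopology UNIV dist) f"
    using f by (simp add: mtopology_of_def)
  then show ?thesis using x e unfolding metric_continuous_map[OF Met_TC.Metric_space_axioms]
    by (simp add: dist_real_def) blast
qed

text \<open>Near x continuity controls f; at distance d or more the penalty k d eventually exceeds
  the oscillation 2 B.\<close>

lemma envelope_tendsto:
  assumes B: "\<And>y. y \<in> mspace D \<Longrightarrow> \<bar>f y\<bar> \<le> B" and f: "continuous_map (mtopology_of D) euclideanreal f"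
    and x: "x \<in> mspace D"
  shows "(\<lambda>k. envelope D (real k) f x) \<longlonglongrightarrow> f x"
proof (rule LIMSEQ_I)
  fix e :: real assume e: "0 < e"
  obtain d where d: "0 < d" "\<And>y. y \<in> mspace D \<Longrightarrow> mdist D x y < d \<Longrightarrow> \<bar>f x - f y\<bar> < e / 2"
    using continuous_map_metricD[OF f x, of "e / 2"] e by auto
  obtain K :: nat where K: "2 * B / d < real K" using reals_Archimedean2 by blast
  show "\<exists>no. \<forall>k\<ge>no. norm (envelope D (real k) f x - f x) < e"
  proof (intro exI allI impI)
    fix k assume "K \<le> k"
    then have kd: "2 * B \<le> real k * d" using K d(1) by (simp add: field_simps)
      (metis less_eq_real_def mult_left_mono of_nat_mono order_trans)
    have "envelope D (real k) f x \<le> f x + e / 2"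
    proof (rule envelope_least[OF B _ x])
      fix y assume y: "y \<in> mspace D"
      have nn: "0 \<le> real k * mdist D x y" by simp
      show "f y - real k * mdist D x y \<le> f x + e / 2"
      proof (cases "mdist D x y < d")
        case True then show ?thesis using d(2)[OF y True] nn by linarith
      next
        case False
        then have "real k * d \<le> real k * mdist D x y" by (intro mult_left_mono) auto
        then show ?thesis using kd B[OF x] B[OF y] e by linarith
      qed
    qed auto
    moreover have "f x \<le> envelope D (real k) f x" by (rule envelope_ge[OF B _ x]) auto
    ultimately show "norm (envelope D (real k) f x - f x) < e" using e by simp
  qed
qed

section \<open>Step interpolation on a grid\<close>

definition step :: "real set \<Rightarrow> nat \<Rightarrow> (nat \<Rightarrow> real) \<Rightarrow> real \<Rightarrow> real" where
  "step T K v = (\<lambda>t\<in>T. v (nat \<lfloor>real K * t\<rfloor>))"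

text \<open>The grid point i / K clamped to [t0, 1], since i / K may lie below t0; the process is
  never evaluated outside its parameter set.\<close>

definition gp :: "real \<Rightarrow> nat \<Rightarrow> nat \<Rightarrow> real" where
  "gp t0 K i = max t0 (min 1 (real i / real K))"

lemma gp_in: "t0 \<le> 1 \<Longrightarrow> gp t0 K i \<in> {t0..1}"
  by (auto simp: gp_def)

lemma step_index: "0 < t0 \<Longrightarrow> t \<in> {t0..1} \<Longrightarrow> nat \<lfloor>real K * t\<rfloor> \<le> K"
proof -
  assume t: "0 < t0" "t \<in> {t0..1}"
  then have "real K * t \<le> real K * 1" by (intro mult_left_mono) auto
  then have "\<lfloor>real K * t\<rfloor> \<le> int K" by (simp add: floor_le_iff)
  then show ?thesis by simp
qed

lemma gp_near:
  assumes "0 < t0" "t \<in> {t0..1}" "0 < K"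
  shows "gp t0 K (nat \<lfloor>real K * t\<rfloor>) \<le> t" "t - gp t0 K (nat \<lfloor>real K * t\<rfloor>) \<le> 1 / real K"
proof -
  have n0: "0 \<le> real K * t" using assms by auto
  have r: "real (nat \<lfloor>real K * t\<rfloor>) = of_int \<lfloor>real K * t\<rfloor>" using n0 by simp
  have a: "real (nat \<lfloor>real K * t\<rfloor>) / real K \<le> t"
    unfolding r using assms(3) of_int_floor_le[of "real K * t"] by (simp add: field_simps)
  have "real K * t - 1 \<le> real (nat \<lfloor>real K * t\<rfloor>)" unfolding r by linarith
  then have b: "t - 1 / real K \<le> real (nat \<lfloor>real K * t\<rfloor>) / real K"
    using divide_right_mono[of "real K * t - 1" "real (nat \<lfloor>real K * t\<rfloor>)" "real K"] assms(3)
    by (simp add: diff_divide_distrib)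
  show "gp t0 K (nat \<lfloor>real K * t\<rfloor>) \<le> t" using a assms by (auto simp: gp_def)
  show "t - gp t0 K (nat \<lfloor>real K * t\<rfloor>) \<le> 1 / real K" using b a assms by (auto simp: gp_def)
qed

lemma step_mspace: "0 < t0 \<Longrightarrow> step {t0..1} K v \<in> mspace (linf {t0..1})"
proof -
  assume t0: "0 < t0"
  have "step {t0..1} K v ` {t0..1} \<subseteq> v ` {..K}"
    using step_index[OF t0] by (auto simp: step_def)
  then have "finite (step {t0..1} K v ` {t0..1})" by (rule finite_subset) auto
  then show ?thesis by (auto simp: mspace_linf step_def finite_imp_bounded)
qed

lemma step_Lipschitz:
  assumes t0: "0 < t0" "t0 \<le> 1"
  shows "mdist (linf {t0..1}) (step {t0..1} K v) (step {t0..1} K w) \<le> (\<Sum>i\<le>K. \<bar>v i - w i\<bar>)"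
proof (rule mdist_linf_le[OF step_mspace[OF t0(1)] step_mspace[OF t0(1)]])
  fix t assume t: "t \<in> {t0..1}"
  have "\<bar>v (nat \<lfloor>real K * t\<rfloor>) - w (nat \<lfloor>real K * t\<rfloor>)\<bar> \<le> (\<Sum>i\<le>K. \<bar>v i - w i\<bar>)"
    using step_index[OF t0(1) t, of K] by (intro member_le_sum[where f = "\<lambda>i. \<bar>v i - w i\<bar>"]) auto
  then show "\<bar>step {t0..1} K v t - step {t0..1} K w t\<bar> \<le> (\<Sum>i\<le>K. \<bar>v i - w i\<bar>)"
    using t by (simp add: step_def)
qed (use t0 in auto)

lemma path_mspace:
  fixes t0 :: real
  assumes "continuous_on {t0..1} L"
  shows "(\<lambda>t\<in>{t0..1}. L t) \<in> mspace (linf {t0..1})"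
proof -
  have "bounded (L ` {t0..1})" by (intro compact_imp_bounded compact_continuous_image assms compact_Icc)
  then show ?thesis by (simp add: mspace_linf)
qed

locale Lipschitz_functional =
  fixes t0 :: real and f :: "(real \<Rightarrow> real) \<Rightarrow> real" and B k :: real
  assumes t0: "0 < t0" "t0 \<le> 1"
    and B: "\<And>x. x \<in> mspace (linf {t0..1}) \<Longrightarrow> \<bar>f x\<bar> \<le> B"
    and k: "0 \<le> k"
    and Lip: "\<And>x y. x \<in> mspace (linf {t0..1}) \<Longrightarrow> y \<in> mspace (linf {t0..1}) \<Longrightarrow> \<bar>f x - f y\<bar> \<le> k * mdist (linf {t0..1}) x y"
begin

abbreviation "T \<equiv> {t0..1}"
abbreviation "D \<equiv> linf {t0..1}"

lemma B0: "0 \<le> B"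
  using B[OF step_mspace[OF t0(1), of 0 "\<lambda>_. 0"]] by linarith

lemma step_continuous: "continuous_on UNIV (\<lambda>v. f (step T K v))"
  unfolding continuous_on_def
proof
  fix v :: "nat \<Rightarrow> real"
  show "((\<lambda>w. f (step T K w)) \<longlongrightarrow> f (step T K v)) (at v within UNIV)"
    unfolding tendsto_dist_iff[of "\<lambda>w. f (step T K w)"]
  proof (rule tendsto_sandwich)
    show "\<forall>\<^sub>F w in at v within UNIV. 0 \<le> dist (f (step T K w)) (f (step T K v))" by simp
    show "\<forall>\<^sub>F w in at v within UNIV. dist (f (step T K w)) (f (step T K v)) \<le> k * (\<Sum>i\<le>K. \<bar>w i - v i\<bar>)"
    proof (rule always_eventually, rule allI)
      fix w
      have "\<bar>f (step T K w) - f (step T K v)\<bar> \<le> k * mdist D (step T K w) (step T K v)"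
        by (intro Lip step_mspace t0)
      also have "\<dots> \<le> k * (\<Sum>i\<le>K. \<bar>w i - v i\<bar>)" by (intro mult_left_mono step_Lipschitz t0 k)
      finally show "dist (f (step T K w)) (f (step T K v)) \<le> k * (\<Sum>i\<le>K. \<bar>w i - v i\<bar>)" by (simp add: dist_real_def)
    qed
    have "continuous_on UNIV (\<lambda>w :: nat \<Rightarrow> real. k * (\<Sum>i\<le>K. \<bar>w i - v i\<bar>))"
      by (intro continuous_intros continuous_on_product_coordinates)
    then have "((\<lambda>w. k * (\<Sum>i\<le>K. \<bar>w i - v i\<bar>)) \<longlongrightarrow> k * (\<Sum>i\<le>K. \<bar>v i - v i\<bar>)) (at v within UNIV)"
      unfolding continuous_on_def by blast
    then show "((\<lambda>w. k * (\<Sum>i\<le>K. \<bar>w i - v i\<bar>)) \<longlongrightarrow> 0) (at v within UNIV)" by simp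
  qed simp
qed

lemma step_tendsto:
  assumes L: "continuous_on T L"
  shows "(\<lambda>K. f (step T K (\<lambda>i. L (gp t0 K i)))) \<longlonglongrightarrow> f (\<lambda>t\<in>T. L t)"
proof (rule LIMSEQ_I)
  fix e :: real assume e: "0 < e"
  have LD: "(\<lambda>t\<in>T. L t) \<in> mspace D" by (rule path_mspace[OF L])
  \<comment> \<open>Shifted by 1 because k may be 0 and \<open>e'\<close> divides by it.\<close>
  define k' where "k' = k + 1"
  have k': "0 < k'" "k \<le> k'" using k by (auto simp: k'_def)
  define e' where "e' = e / (2 * k')"
  have e': "0 < e'" using e k' by (simp add: e'_def)
  have "uniformly_continuous_on T L" using L by (rule compact_uniformly_continuous) simp
  from uniformly_continuous_onE[OF this e']
  obtain d where d: "0 < d" "\<And>s t. s \<in> T \<Longrightarrow> t \<in> T \<Longrightarrow> dist t s < d \<Longrightarrow> dist (L t) (L s) < e'"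
    by metis
  obtain K0 :: nat where K0: "1 / d < real K0" using reals_Archimedean2 by blast
  show "\<exists>no. \<forall>K\<ge>no. norm (f (step T K (\<lambda>i. L (gp t0 K i))) - f (\<lambda>t\<in>T. L t)) < e"
  proof (intro exI allI impI)
    fix K assume K: "K0 \<le> K"
    have "0 < 1 / d" using d(1) by simp
    then have Kp: "0 < K" using K K0 by (cases K) auto
    have "1 / d < real K" using K0 K by linarith
    then have Kd: "1 / real K < d" using d(1) Kp by (simp add: field_simps)
    have "mdist D (step T K (\<lambda>i. L (gp t0 K i))) (\<lambda>t\<in>T. L t) \<le> e'"
    proof (rule mdist_linf_le[OF step_mspace[OF t0(1)] LD])
      fix t assume t: "t \<in> T"
      have "dist (L (gp t0 K (nat \<lfloor>real K * t\<rfloor>))) (L t) < e'"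
        using gp_near[OF t0(1) t Kp] Kd by (intro d(2) t gp_in t0) (auto simp: dist_real_def)
      then show "\<bar>step T K (\<lambda>i. L (gp t0 K i)) t - (\<lambda>t\<in>T. L t) t\<bar> \<le> e'"
        using t by (simp add: step_def dist_real_def)
    qed (use t0 in auto)
    then have "k * mdist D (step T K (\<lambda>i. L (gp t0 K i))) (\<lambda>t\<in>T. L t) \<le> k * e'" using k by (rule mult_left_mono)
    also have "\<dots> \<le> k' * e'" using e' k' by (intro mult_right_mono) auto
    also have "\<dots> = e / 2" using k' by (simp add: e'_def)
    finally have "k * mdist D (step T K (\<lambda>i. L (gp t0 K i))) (\<lambda>t\<in>T. L t) \<le> e / 2" .
    then show "norm (f (step T K (\<lambda>i. L (gp t0 K i))) - f (\<lambda>t\<in>T. L t)) < e"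
      using Lip[OF step_mspace[OF t0(1)] LD, of K "\<lambda>i. L (gp t0 K i)"] e by simp
  qed
qed

lemma step_dep: "f (step T K (\<lambda>i. if i < Suc K then v i else 0)) = f (step T K v)"
proof -
  have "step T K (\<lambda>i. if i < Suc K then v i else 0) = step T K v"
    unfolding step_def by (rule restrict_ext) (use step_index[OF t0(1), of _ K] in \<open>auto simp: less_Suc_eq_le\<close>)
  then show ?thesis by simp
qed

lemma vec_measurable:
  fixes X :: "real \<Rightarrow> 'a \<Rightarrow> real"
  assumes "\<And>t. t \<in> T \<Longrightarrow> X t \<in> borel_measurable M"
  shows "(\<lambda>\<omega> i. X (gp t0 K i) \<omega>) \<in> borel_measurable M"
  by (rule measurable_coordinatewise_then_product) (intro assms gp_in t0)

text \<open>A pointwise limit of continuous functions of finitely many coordinates. Continuity of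
  the paths takes the place of separability.\<close>

lemma functional_measurable:
  assumes X: "\<And>t. t \<in> T \<Longrightarrow> X t \<in> borel_measurable N" and cont: "\<And>\<omega>. \<omega> \<in> space N \<Longrightarrow> continuous_on T (\<lambda>t. X t \<omega>)"
  shows "(\<lambda>\<omega>. f (\<lambda>t\<in>T. X t \<omega>)) \<in> borel_measurable N"
proof (rule borel_measurable_LIMSEQ_real)
  show "(\<lambda>K. f (step T K (\<lambda>i. X (gp t0 K i) \<omega>))) \<longlonglongrightarrow> f (\<lambda>t\<in>T. X t \<omega>)" if "\<omega> \<in> space N" for \<omega>
    by (rule step_tendsto[OF cont[OF that]])
  show "(\<lambda>\<omega>. f (step T K (\<lambda>i. X (gp t0 K i) \<omega>))) \<in> borel_measurable N" for K
    using measurable_compose[OF vec_measurable[OF X] borel_measurable_continuous_onI[OF step_continuous]] by simp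
qed

end

lemma envelope_functional:
  assumes t0: "0 < t0" "t0 \<le> 1" and B: "\<And>x. x \<in> mspace (linf {t0..1}) \<Longrightarrow> \<bar>f x\<bar> \<le> B" and k: "0 \<le> k"
  shows "Lipschitz_functional t0 (envelope (linf {t0..1}) k f) B k"
  by unfold_locales (use t0 k envelope_bounded[OF B k] envelope_Lipschitz[OF B k] in auto)

text \<open>Every open set is the set where some Lipschitz functional is negative, and Lipschitz
  functionals of the path are measurable. This treats all open sets directly, as balls need not
  generate the Borel sets of a nonseparable space.\<close>

lemma path_measurable:
  fixes t0 :: real
  assumes t0: "0 < t0" "t0 \<le> 1"
    and X: "\<And>t. t \<in> {t0..1} \<Longrightarrow> X t \<in> borel_measurable N"
    and cont: "\<And>\<omega>. \<omega> \<in> space N \<Longrightarrow> continuous_on {t0..1} (\<lambda>t. X t \<omega>)"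
  shows "(\<lambda>\<omega>. \<lambda>t\<in>{t0..1}. X t \<omega>) \<in> measurable N (metric_borel (linf {t0..1}))"
  unfolding metric_borel_def
proof (rule measurable_measure_of)
  let ?D = "linf {t0..1}"
  interpret D: Metric_space "mspace ?D" "mdist ?D" by (rule Metric_space_mspace_mdist)
  show "{V. openin (mtopology_of ?D) V} \<subseteq> Pow (mspace ?D)"
    using openin_subset[of "mtopology_of ?D"] by auto
  show P: "(\<lambda>\<omega>. \<lambda>t\<in>{t0..1}. X t \<omega>) \<in> space N \<rightarrow> mspace ?D" using path_mspace[OF cont] by auto
  fix V assume "V \<in> {V. openin (mtopology_of ?D) V}"
  then have V: "V \<subseteq> mspace ?D" "\<And>x. x \<in> V \<Longrightarrow> \<exists>r>0. D.mball x r \<subseteq> V"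
    unfolding mtopology_of_def D.openin_mtopology by auto
  \<comment> \<open>The envelope of slope 1 of this function is minus the distance to the complement
    of V, cut off at 1; it is negative exactly on V.\<close>
  define u where "u y = (if y \<in> V then -1 else 0 :: real)" for y
  have uB: "\<bar>u y\<bar> \<le> 1" for y by (simp add: u_def)
  interpret E: Lipschitz_functional t0 "envelope ?D 1 u" 1 1
    by (rule envelope_functional[OF t0]) (use uB in auto)
  have "x \<in> V \<longleftrightarrow> envelope ?D 1 u x < 0" if x: "x \<in> mspace ?D" for x
  proof
    assume "x \<in> V"
    then obtain r where r: "0 < r" "D.mball x r \<subseteq> V" using V by blast
    have "envelope ?D 1 u x \<le> - min r 1"
    proof (rule envelope_least[OF uB _ x])
      fix y assume y: "y \<in> mspace ?D"
      show "u y - 1 * mdist ?D x y \<le> - min r 1"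
      proof (cases "y \<in> V")
        case True
        have "0 \<le> mdist ?D x y" "min r 1 \<le> 1" by auto
        then show ?thesis unfolding u_def if_P[OF True] by linarith
      next
        case False
        then have "\<not> mdist ?D x y < r" using r(2) x y unfolding D.mball_def by blast
        moreover have "min r 1 \<le> r" by simp
        ultimately show ?thesis unfolding u_def if_not_P[OF False] by linarith
      qed
    qed auto
    then show "envelope ?D 1 u x < 0" using r by linarith
  next
    assume "envelope ?D 1 u x < 0"
    then have "u x < 0" using envelope_ge[of ?D u 1 1 x] uB x by force
    then show "x \<in> V" by (simp add: u_def split: if_splits)
  qed
  then have "(\<lambda>\<omega>. \<lambda>t\<in>{t0..1}. X t \<omega>) -` V \<inter> space N
    = {\<omega>\<in>space N. envelope ?D 1 u (\<lambda>t\<in>{t0..1}. X t \<omega>) < 0}"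
    using P by blast
  also have "\<dots> \<in> sets N" using E.functional_measurable[OF X cont] by simp
  finally show "(\<lambda>\<omega>. \<lambda>t\<in>{t0..1}. X t \<omega>) -` V \<inter> space N \<in> sets N" .
qed

section \<open>Outer expectations\<close>

lemma nn_parts_difference:
  assumes "integrable M f"
  shows "enn2ereal (\<integral>\<^sup>+\<omega>. ennreal (f \<omega>) \<partial>M) - enn2ereal (\<integral>\<^sup>+\<omega>. ennreal (- f \<omega>) \<partial>M) = ereal (LINT \<omega>|M. f \<omega>)"
proof -
  have fin: "(\<integral>\<^sup>+\<omega>. ennreal (f \<omega>) \<partial>M) < \<infinity>" "(\<integral>\<^sup>+\<omega>. ennreal (- f \<omega>) \<partial>M) < \<infinity>"
    using assms unfolding real_integrable_def by (auto simp: top.not_eq_extremum)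
  have e: "enn2ereal a = ereal (enn2real a)" if "a < \<infinity>" for a
    using that by (cases a rule: ennreal_cases) auto
  show ?thesis unfolding real_lebesgue_integral_def[OF assms] using e[OF fin(1)] e[OF fin(2)] by simp
qed

text \<open>\<open>V2\<close> is itself an admissible majorant of Z, and every admissible majorant
  dominates \<open>V1\<close>. No measurability of Z enters.\<close>

lemma outer_expectation_bounds:
  assumes M: "prob_space M" and V: "integrable M V1" "integrable M V2"
    and le: "\<And>\<omega>. \<omega> \<in> space M \<Longrightarrow> V1 \<omega> \<le> Z \<omega>" "\<And>\<omega>. \<omega> \<in> space M \<Longrightarrow> Z \<omega> \<le> V2 \<omega>"
  shows "ereal (LINT \<omega>|M. V1 \<omega>) \<le> outer_expectation M Z" "outer_expectation M Z \<le> ereal (LINT \<omega>|M. V2 \<omega>)"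
proof -
  have er: "e2ennreal (ereal r) = ennreal r" for r by (simp add: e2ennreal_ereal)
  have eq: "ereal_expectation M (\<lambda>\<omega>. ereal (f \<omega>)) = ereal (LINT \<omega>|M. f \<omega>)" if "integrable M f" for f
    unfolding ereal_expectation_def uminus_ereal.simps er by (rule nn_parts_difference[OF that])
  show "outer_expectation M Z \<le> ereal (LINT \<omega>|M. V2 \<omega>)"
    unfolding outer_expectation_def eq[OF V(2), symmetric]
  proof (rule Inf_lower, intro CollectI exI conjI ballI)
    show "(\<lambda>\<omega>. ereal (V2 \<omega>)) \<in> borel_measurable M" using V(2) by simp
    show "ereal_expectation_exists M (\<lambda>\<omega>. ereal (V2 \<omega>))"
      unfolding ereal_expectation_exists_def er using V(2) unfolding real_integrable_def
      by (auto simp: top.not_eq_extremum)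
  qed (use le in auto)
  show "ereal (LINT \<omega>|M. V1 \<omega>) \<le> outer_expectation M Z"
    unfolding outer_expectation_def
  proof (rule Inf_greatest, clarify)
    fix V assume V': "\<forall>\<omega>\<in>space M. ereal (Z \<omega>) \<le> V \<omega>"
    have lV: "ereal (V1 \<omega>) \<le> V \<omega>" if "\<omega> \<in> space M" for \<omega>
      using order_trans[of "ereal (V1 \<omega>)" "ereal (Z \<omega>)" "V \<omega>"] V' le(1)[OF that] that by simp
    have a: "(\<integral>\<^sup>+\<omega>. ennreal (V1 \<omega>) \<partial>M) \<le> (\<integral>\<^sup>+\<omega>. e2ennreal (V \<omega>) \<partial>M)"
      by (rule nn_integral_mono) (use lV e2ennreal_mono er in metis)
    have b: "(\<integral>\<^sup>+\<omega>. e2ennreal (- V \<omega>) \<partial>M) \<le> (\<integral>\<^sup>+\<omega>. ennreal (- V1 \<omega>) \<partial>M)"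
    proof (rule nn_integral_mono)
      fix \<omega> assume "\<omega> \<in> space M"
      then have "- V \<omega> \<le> ereal (- V1 \<omega>)" using lV ereal_minus_le_minus[of "V \<omega>" "ereal (V1 \<omega>)"] by simp
      then show "e2ennreal (- V \<omega>) \<le> ennreal (- V1 \<omega>)" using e2ennreal_mono er by metis
    qed
    show "ereal (LINT \<omega>|M. V1 \<omega>) \<le> ereal_expectation M V"
      unfolding nn_parts_difference[OF V(1), symmetric] ereal_expectation_def
      using a b by (intro ereal_minus_mono) (auto simp: less_eq_ennreal.rep_eq)
  qed
qed

lemma outer_expectation_mono:
  assumes "\<And>\<omega>. \<omega> \<in> space M \<Longrightarrow> Z \<omega> \<le> Z' \<omega>"
  shows "outer_expectation M Z \<le> outer_expectation M Z'"
  unfolding outer_expectation_def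
proof (rule Inf_superset_mono, clarify)
  fix V assume "V \<in> borel_measurable M" "ereal_expectation_exists M V" "\<forall>\<omega>\<in>space M. ereal (Z' \<omega>) \<le> V \<omega>"
  moreover have "ereal (Z \<omega>) \<le> ereal (Z' \<omega>)" if "\<omega> \<in> space M" for \<omega> using assms[OF that] by simp
  ultimately show "\<exists>W. ereal_expectation M V = ereal_expectation M W \<and> W \<in> borel_measurable M \<and>
      ereal_expectation_exists M W \<and> (\<forall>\<omega>\<in>space M. ereal (Z \<omega>) \<le> W \<omega>)"
    using order_trans by blast
qed

lemma tight_rv:
  fixes X :: "'a \<Rightarrow> real"
  assumes M: "prob_space M" and X: "X \<in> borel_measurable M" and e: "0 < e"
  shows "\<exists>R>0. measure M {\<omega>\<in>space M. R < \<bar>X \<omega>\<bar>} \<le> e"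
proof -
  interpret prob_space M by fact
  note [measurable] = X
  define A where "A n = {\<omega>\<in>space M. real (Suc n) < \<bar>X \<omega>\<bar>}" for n
  have "(\<lambda>n. prob (A n)) \<longlonglongrightarrow> prob (\<Inter>n. A n)"
  proof (rule finite_Lim_measure_decseq)
    show "range A \<subseteq> events" unfolding A_def by auto
    show "decseq A" unfolding A_def decseq_def by auto
  qed
  moreover have "(\<Inter>n. A n) = {}"
  proof -
    have "\<exists>n. \<omega> \<notin> A n" for \<omega>
    proof -
      obtain n :: nat where "\<bar>X \<omega>\<bar> < real n" using reals_Archimedean2 by blast
      then have "\<omega> \<notin> A n" by (simp add: A_def)
      then show ?thesis ..
    qed
    then show ?thesis by blast
  qed
  ultimately have "(\<lambda>n. prob (A n)) \<longlonglongrightarrow> 0" by simp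
  from order_tendstoD(2)[OF this e] obtain n where "prob (A n) < e" by (auto simp: eventually_sequentially)
  then show ?thesis unfolding A_def by (intro exI[of _ "real (Suc n)"]) auto
qed

lemma measure_Union_le:
  fixes X :: "nat \<Rightarrow> 'a \<Rightarrow> real"
  assumes M: "prob_space M" and X: "\<And>i. i < K \<Longrightarrow> X i \<in> borel_measurable M"
    and le: "\<And>i. i < K \<Longrightarrow> measure M {\<omega>\<in>space M. R i < \<bar>X i \<omega>\<bar>} \<le> e / real (Suc K)"
    and R: "\<And>i. i < K \<Longrightarrow> R i \<le> R'" and e: "0 < e"
  shows "measure M {\<omega>\<in>space M. \<exists>i<K. R' < \<bar>X i \<omega>\<bar>} \<le> e"
proof -
  interpret prob_space M by fact
  have ev: "{\<omega>\<in>space M. c < \<bar>X i \<omega>\<bar>} \<in> events" if "i < K" for c i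
    using X[OF that] by measurable
  have "prob {\<omega>\<in>space M. \<exists>i<K. R' < \<bar>X i \<omega>\<bar>} \<le> prob (\<Union>i\<in>{..<K}. {\<omega>\<in>space M. R i < \<bar>X i \<omega>\<bar>})"
  proof (rule finite_measure_mono)
    show "{\<omega>\<in>space M. \<exists>i<K. R' < \<bar>X i \<omega>\<bar>} \<subseteq> (\<Union>i\<in>{..<K}. {\<omega>\<in>space M. R i < \<bar>X i \<omega>\<bar>})"
      using R by fastforce
    show "(\<Union>i\<in>{..<K}. {\<omega>\<in>space M. R i < \<bar>X i \<omega>\<bar>}) \<in> events" using ev by (intro sets.finite_UN) auto
  qed
  also have "\<dots> \<le> (\<Sum>i<K. prob {\<omega>\<in>space M. R i < \<bar>X i \<omega>\<bar>})"
    by (rule finite_measure_subadditive_finite) (use ev in auto)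
  also have "\<dots> \<le> (\<Sum>i<K. e / real (Suc K))" using le by (intro sum_mono) auto
  also have "\<dots> = e * (real K / real (Suc K))" by simp
  also have "\<dots> \<le> e * 1" using e by (intro mult_left_mono) auto
  finally show ?thesis by simp
qed

lemma ereal_squeeze:
  assumes "\<And>d. 0 < d \<Longrightarrow> \<forall>\<^sub>F n in F. ereal (l - d) \<le> X n \<and> X n \<le> ereal (l + d)"
  shows "(X \<longlongrightarrow> ereal l) F"
proof (rule order_tendstoI)
  fix a assume a: "a < ereal l"
  obtain d where d: "0 < d" "a < ereal (l - d)"
  proof (cases a)
    case (real r)
    then show ?thesis using a by (intro that[of "(l - r) / 2"]) (auto simp: field_simps)
  next
    case MInf then show ?thesis by (intro that[of 1]) auto
  qed (use a in auto)
  show "\<forall>\<^sub>F n in F. a < X n"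
    using assms[OF d(1)] by eventually_elim (use d(2) less_le_trans in blast)
next
  fix a assume a: "ereal l < a"
  obtain d where d: "0 < d" "ereal (l + d) < a"
  proof (cases a)
    case (real r)
    then show ?thesis using a by (intro that[of "(r - l) / 2"]) (auto simp: field_simps)
  next
    case PInf then show ?thesis by (intro that[of 1]) auto
  qed (use a in auto)
  show "\<forall>\<^sub>F n in F. X n < a"
    using assms[OF d(1)] by eventually_elim (use d(2) le_less_trans in blast)
qed

text \<open>The abstract criterion. Z is the process of interest, not assumed measurable; Y is a
  measurable approximation, compared with Z only at grid points. The condition \<open>approx\<close>
  merges the asymptotic equivalence of Z and Y with the oscillation of Y between grid points, K
  being fixed before n grows.\<close>

locale path_approximation =
  fixes t0 :: real and M :: "nat \<Rightarrow> 'a measure" and N :: "'c measure"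
    and Z :: "nat \<Rightarrow> 'a \<Rightarrow> real \<Rightarrow> real" and Y :: "nat \<Rightarrow> real \<Rightarrow> 'a \<Rightarrow> real" and L :: "real \<Rightarrow> 'c \<Rightarrow> real"
  assumes t0: "0 < t0" "t0 \<le> 1"
    and ps: "\<And>n. prob_space (M n)" "prob_space N"
    and Z: "\<And>n \<omega>. \<omega> \<in> space (M n) \<Longrightarrow> Z n \<omega> \<in> mspace (linf {t0..1})"
    and Y: "\<And>n t. t \<in> {t0..1} \<Longrightarrow> Y n t \<in> borel_measurable (M n)"
    and L: "\<And>t. t \<in> {t0..1} \<Longrightarrow> L t \<in> borel_measurable N"
    and cont: "\<And>\<omega>. \<omega> \<in> space N \<Longrightarrow> continuous_on {t0..1} (\<lambda>t. L t \<omega>)"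
    and conv: "\<And>F c \<alpha>. finite F \<Longrightarrow> F \<subseteq> {t0..1} \<Longrightarrow>
      (\<lambda>n. LINT \<omega>|M n. cos ((\<Sum>t\<in>F. c t * Y n t \<omega>) + \<alpha>)) \<longlonglongrightarrow> (LINT \<omega>|N. cos ((\<Sum>t\<in>F. c t * L t \<omega>) + \<alpha>))"
    and tight: "\<And>t e. t \<in> {t0..1} \<Longrightarrow> 0 < e \<Longrightarrow>
      \<exists>R>0. \<forall>\<^sub>F n in sequentially. measure (M n) {\<omega>\<in>space (M n). R < \<bar>Y n t \<omega>\<bar>} \<le> e"
    and approx: "\<And>e. 0 < e \<Longrightarrow> \<exists>K0. \<forall>K\<ge>K0. \<forall>\<^sub>F n in sequentially. \<exists>A\<in>sets (M n). measure (M n) A \<le> e \<and>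
      (\<forall>\<omega>\<in>space (M n) - A. \<forall>t\<in>{t0..1}. \<bar>Z n \<omega> t - Y n (gp t0 K (nat \<lfloor>real K * t\<rfloor>)) \<omega>\<bar> \<le> e)"
begin

lemma grid_convergence:
  assumes "Lipschitz_functional t0 f B k"
  shows "(\<lambda>n. LINT \<omega>|M n. f (step {t0..1} K (\<lambda>i. Y n (gp t0 K i) \<omega>)))
    \<longlonglongrightarrow> (LINT \<omega>|N. f (step {t0..1} K (\<lambda>i. L (gp t0 K i) \<omega>)))"
proof -
  interpret Lipschitz_functional t0 f B k by (rule assms)
  let ?Y = "\<lambda>n \<omega> i. Y n (gp t0 K i) \<omega>" and ?L = "\<lambda>\<omega> i. L (gp t0 K i) \<omega>"
  show ?thesis
  proof (rule fdd_convergence[where K = "Suc K" and Y = ?Y and L = ?L and B = B])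
    show "?Y n \<in> borel_measurable (M n)" for n by (rule vec_measurable[OF Y])
    show "?L \<in> borel_measurable N" by (rule vec_measurable[OF L])
    show "continuous_on UNIV (\<lambda>v. f (step {t0..1} K v))" by (rule step_continuous)
    show "\<bar>f (step {t0..1} K v)\<bar> \<le> B" for v by (intro B step_mspace t0)
    show "f (step {t0..1} K (\<lambda>i. if i < Suc K then v i else 0)) = f (step {t0..1} K v)" for v by (rule step_dep)
    fix \<theta> :: "nat \<Rightarrow> real" and \<alpha> :: real
    let ?F = "gp t0 K ` {..<Suc K}"
    \<comment> \<open>Clamping can send several i to the same grid point, whereas
      \<open>conv\<close> sums over a set of times; the weights of coinciding points are therefore
      added.\<close>
    define c where "c t = (\<Sum>i | i \<in> {..<Suc K} \<and> gp t0 K i = t. \<theta> i)" for t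
    have regroup: "(\<Sum>i<Suc K. \<theta> i * X (gp t0 K i)) = (\<Sum>t\<in>?F. c t * X t)" for X :: "real \<Rightarrow> real"
    proof -
      have "(\<Sum>t\<in>?F. c t * X t) = (\<Sum>t\<in>?F. \<Sum>i | i \<in> {..<Suc K} \<and> gp t0 K i = t. \<theta> i * X (gp t0 K i))"
        unfolding c_def sum_distrib_right by (intro sum.cong) auto
      also have "\<dots> = (\<Sum>i<Suc K. \<theta> i * X (gp t0 K i))" by (rule sum.group) auto
      finally show ?thesis ..
    qed
    have "?F \<subseteq> {t0..1}" using gp_in[OF t0(2)] by auto
    then have "(\<lambda>n. LINT \<omega>|M n. cos ((\<Sum>t\<in>?F. c t * Y n t \<omega>) + \<alpha>)) \<longlonglongrightarrow> (LINT \<omega>|N. cos ((\<Sum>t\<in>?F. c t * L t \<omega>) + \<alpha>))"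
      by (intro conv) auto
    moreover have "(\<Sum>i<Suc K. \<theta> i * Y n (gp t0 K i) \<omega>) = (\<Sum>t\<in>?F. c t * Y n t \<omega>)" for n \<omega> by (rule regroup)
    moreover have "(\<Sum>i<Suc K. \<theta> i * L (gp t0 K i) \<omega>) = (\<Sum>t\<in>?F. c t * L t \<omega>)" for \<omega> by (rule regroup)
    ultimately show "(\<lambda>n. LINT \<omega>|M n. cos ((\<Sum>i<Suc K. \<theta> i * ?Y n \<omega> i) + \<alpha>)) \<longlonglongrightarrow> (LINT \<omega>|N. cos ((\<Sum>i<Suc K. \<theta> i * ?L \<omega> i) + \<alpha>))"
      by (simp only:)
  next
    fix e :: real assume e: "0 < e"
    then have e': "0 < e / real (Suc (Suc K))" by simp
    from tight[OF gp_in[OF t0(2)] e']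
    have "\<forall>i. \<exists>R. 0 < R \<and> (\<forall>\<^sub>F n in sequentially. measure (M n) {\<omega>\<in>space (M n). R < \<bar>Y n (gp t0 K i) \<omega>\<bar>} \<le> e / real (Suc (Suc K)))"
      by (rule allI)
    from choice[OF this] obtain R where R: "\<And>i. 0 < R i"
      "\<And>i. \<forall>\<^sub>F n in sequentially. measure (M n) {\<omega>\<in>space (M n). R i < \<bar>Y n (gp t0 K i) \<omega>\<bar>} \<le> e / real (Suc (Suc K))"
      by blast
    define R' where "R' = (\<Sum>i<Suc K. R i)"
    have RR: "R i \<le> R'" if "i < Suc K" for i
      unfolding R'_def using that R(1) by (intro member_le_sum) (auto intro: less_imp_le)
    have "0 < R'" using R(1)[of 0] RR[of 0] by simp
    moreover have "\<forall>\<^sub>F n in sequentially. \<forall>i\<in>{..<Suc K}. measure (M n) {\<omega>\<in>space (M n). R i < \<bar>Y n (gp t0 K i) \<omega>\<bar>} \<le> e / real (Suc (Suc K))"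
      by (rule eventually_ball_finite[OF finite_lessThan]) (rule ballI, rule R(2))
    then have "\<forall>\<^sub>F n in sequentially. measure (M n) {\<omega>\<in>space (M n). \<exists>i<Suc K. R' < \<bar>Y n (gp t0 K i) \<omega>\<bar>} \<le> e"
    proof eventually_elim
      case (elim n)
      show ?case
        by (rule measure_Union_le[OF ps(1), where R = R]) (use elim Y gp_in[OF t0(2)] RR e in auto)
    qed
    ultimately show "\<exists>R>0. \<forall>\<^sub>F n in sequentially. measure (M n) {\<omega>\<in>space (M n). \<exists>i<Suc K. R < \<bar>Y n (gp t0 K i) \<omega>\<bar>} \<le> e"
      by blast
    from tight_rv[OF ps(2) L[OF gp_in[OF t0(2)]] e']
    have "\<forall>i. \<exists>R. 0 < R \<and> measure N {\<omega>\<in>space N. R < \<bar>L (gp t0 K i) \<omega>\<bar>} \<le> e / real (Suc (Suc K))"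
      by (rule allI)
    from choice[OF this] obtain S where S: "\<And>i. 0 < S i"
      "\<And>i. measure N {\<omega>\<in>space N. S i < \<bar>L (gp t0 K i) \<omega>\<bar>} \<le> e / real (Suc (Suc K))"
      by blast
    define S' where "S' = (\<Sum>i<Suc K. S i)"
    have SS: "S i \<le> S'" if "i < Suc K" for i
      unfolding S'_def using that S(1) by (intro member_le_sum) (auto intro: less_imp_le)
    have "0 < S'" using S(1)[of 0] SS[of 0] by simp
    moreover have "measure N {\<omega>\<in>space N. \<exists>i<Suc K. S' < \<bar>L (gp t0 K i) \<omega>\<bar>} \<le> e"
      by (rule measure_Union_le[OF ps(2), where R = S]) (use S L gp_in[OF t0(2)] SS e in auto)
    ultimately show "\<exists>R>0. measure N {\<omega>\<in>space N. \<exists>i<Suc K. R < \<bar>L (gp t0 K i) \<omega>\<bar>} \<le> e" by blast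
  qed (rule ps)+
qed

text \<open>Three comparisons: the limit with its interpolation, by dominated convergence in K; the
  interpolations of Y and of the limit at that fixed K; and Z with the interpolation of Y, at a cost
  of k e off the exceptional event and 2 B on it.\<close>

lemma Lipschitz_convergence:
  assumes "Lipschitz_functional t0 f B k"
  shows "(\<lambda>n. outer_expectation (M n) (\<lambda>\<omega>. f (Z n \<omega>))) \<longlonglongrightarrow> ereal (LINT \<omega>|N. f (\<lambda>t\<in>{t0..1}. L t \<omega>))"
proof (rule ereal_squeeze)
  interpret F: Lipschitz_functional t0 f B k by (rule assms)
  interpret N: prob_space N by (rule ps)
  fix d :: real assume d: "0 < d"
  \<comment> \<open>The summand 1 keeps C positive; then e = d / (4 C) bounds k e + 2 B e by d / 4,
    and the other two comparisons take d / 4 each.\<close>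
  define C where "C = k + 2 * B + 1"
  have C: "0 < C" using F.k F.B0 by (simp add: C_def)
  define e where "e = d / (4 * C)"
  have e: "0 < e" using d C by (simp add: e_def)
  have eC: "k * e + 2 * B * e \<le> d / 4"
  proof -
    have "k * e + 2 * B * e \<le> C * e" using e by (simp add: C_def algebra_simps)
    also have "\<dots> = d / 4" using C by (simp add: e_def)
    finally show ?thesis .
  qed
  let ?g = "\<lambda>K v. f (step {t0..1} K v)"
  let ?l = "LINT \<omega>|N. f (\<lambda>t\<in>{t0..1}. L t \<omega>)"
  have "(\<lambda>K. LINT \<omega>|N. ?g K (\<lambda>i. L (gp t0 K i) \<omega>)) \<longlonglongrightarrow> ?l"
  proof (rule integral_dominated_convergence[where w = "\<lambda>_. B"])
    show "(\<lambda>\<omega>. f (\<lambda>t\<in>{t0..1}. L t \<omega>)) \<in> borel_measurable N" by (rule F.functional_measurable[OF L cont])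
    show "(\<lambda>\<omega>. ?g K (\<lambda>i. L (gp t0 K i) \<omega>)) \<in> borel_measurable N" for K
      using measurable_compose[OF F.vec_measurable[OF L] borel_measurable_continuous_onI[OF F.step_continuous]] by simp
    show "AE \<omega> in N. (\<lambda>K. ?g K (\<lambda>i. L (gp t0 K i) \<omega>)) \<longlonglongrightarrow> f (\<lambda>t\<in>{t0..1}. L t \<omega>)"
      by (intro AE_I2 F.step_tendsto cont)
    show "AE \<omega> in N. norm (?g K (\<lambda>i. L (gp t0 K i) \<omega>)) \<le> B" for K
      using F.B[OF step_mspace[OF t0(1)]] by (intro AE_I2) simp
  qed simp
  from tendstoD[OF this, of "d / 4"] d obtain K1 where
    K1: "\<And>K. K1 \<le> K \<Longrightarrow> \<bar>(LINT \<omega>|N. ?g K (\<lambda>i. L (gp t0 K i) \<omega>)) - ?l\<bar> < d / 4"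
    by (auto simp: eventually_sequentially dist_real_def)
  obtain K0 where K0: "\<And>K. K0 \<le> K \<Longrightarrow> \<forall>\<^sub>F n in sequentially. \<exists>A\<in>sets (M n). measure (M n) A \<le> e \<and>
      (\<forall>\<omega>\<in>space (M n) - A. \<forall>t\<in>{t0..1}. \<bar>Z n \<omega> t - Y n (gp t0 K (nat \<lfloor>real K * t\<rfloor>)) \<omega>\<bar> \<le> e)"
    using approx[OF e] by blast
  define K where "K = max K0 K1"
  have "\<forall>\<^sub>F n in sequentially. dist (LINT \<omega>|M n. ?g K (\<lambda>i. Y n (gp t0 K i) \<omega>)) (LINT \<omega>|N. ?g K (\<lambda>i. L (gp t0 K i) \<omega>)) < d / 4"
    by (rule tendstoD[OF grid_convergence[OF assms]]) (use d in simp)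
  moreover have "K0 \<le> K" by (simp add: K_def)
  note K0[OF this]
  ultimately show "\<forall>\<^sub>F n in sequentially. ereal (?l - d) \<le> outer_expectation (M n) (\<lambda>\<omega>. f (Z n \<omega>)) \<and>
      outer_expectation (M n) (\<lambda>\<omega>. f (Z n \<omega>)) \<le> ereal (?l + d)"
  proof eventually_elim
    case (elim n)
    interpret Mn: prob_space "M n" by (rule ps)
    from elim(2) obtain A where A: "A \<in> sets (M n)" "measure (M n) A \<le> e"
      "\<And>\<omega> t. \<omega> \<in> space (M n) \<Longrightarrow> \<omega> \<notin> A \<Longrightarrow> t \<in> {t0..1} \<Longrightarrow> \<bar>Z n \<omega> t - Y n (gp t0 K (nat \<lfloor>real K * t\<rfloor>)) \<omega>\<bar> \<le> e"
      by blast
    let ?h = "\<lambda>\<omega>. ?g K (\<lambda>i. Y n (gp t0 K i) \<omega>)"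
    have hm: "?h \<in> borel_measurable (M n)"
      using measurable_compose[OF F.vec_measurable[OF Y] borel_measurable_continuous_onI[OF F.step_continuous]] by simp
    have hB: "\<bar>?h \<omega>\<bar> \<le> B" for \<omega> by (intro F.B step_mspace t0)
    have hi: "integrable (M n) ?h"
      by (rule Mn.integrable_const_bound[where B = B]) (use hm hB in auto)
    have iA: "integrable (M n) (indicat_real A)"
      by (rule integrable_real_indicator[OF A(1)]) (simp add: Mn.emeasure_eq_measure)
    let ?r = "\<lambda>\<omega>. k * e + 2 * B * indicator A \<omega>"
    have ri: "integrable (M n) ?r" using iA by simp
    have near: "\<bar>f (Z n \<omega>) - ?h \<omega>\<bar> \<le> ?r \<omega>" if w: "\<omega> \<in> space (M n)" for \<omega>
    proof (cases "\<omega> \<in> A")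
      case True
      have "\<bar>f (Z n \<omega>)\<bar> \<le> B" by (rule F.B[OF Z[OF w]])
      moreover have "0 \<le> k * e" using F.k e by simp
      ultimately show ?thesis using True hB[of \<omega>] by simp
    next
      case False
      have "mdist (linf {t0..1}) (Z n \<omega>) (step {t0..1} K (\<lambda>i. Y n (gp t0 K i) \<omega>)) \<le> e"
        by (rule mdist_linf_le[OF Z[OF w] step_mspace[OF t0(1)]]) (use A(3)[OF w False] t0 in \<open>auto simp: step_def\<close>)
      then have "k * mdist (linf {t0..1}) (Z n \<omega>) (step {t0..1} K (\<lambda>i. Y n (gp t0 K i) \<omega>)) \<le> k * e"
        by (rule mult_left_mono[OF _ F.k])
      then show ?thesis using F.Lip[OF Z[OF w] step_mspace[OF t0(1)], of K "\<lambda>i. Y n (gp t0 K i) \<omega>"] False by simp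
    qed
    have rint: "(LINT \<omega>|M n. ?r \<omega>) \<le> d / 4"
    proof -
      have "(LINT \<omega>|M n. ?r \<omega>) = k * e + 2 * B * measure (M n) A" using iA A(1) by (simp add: Mn.prob_space)
      also have "\<dots> \<le> k * e + 2 * B * e" using A(2) F.B0 by (simp add: mult_left_mono)
      finally show ?thesis using eC by simp
    qed
    note ob = outer_expectation_bounds[OF ps(1), where ?V1.0 = "\<lambda>\<omega>. ?h \<omega> - ?r \<omega>" and ?V2.0 = "\<lambda>\<omega>. ?h \<omega> + ?r \<omega>" and Z = "\<lambda>\<omega>. f (Z n \<omega>)"]
    have lo: "ereal ((LINT \<omega>|M n. ?h \<omega>) - (LINT \<omega>|M n. ?r \<omega>)) \<le> outer_expectation (M n) (\<lambda>\<omega>. f (Z n \<omega>))"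
    proof -
      have "ereal (LINT \<omega>|M n. ?h \<omega> - ?r \<omega>) \<le> outer_expectation (M n) (\<lambda>\<omega>. f (Z n \<omega>))"
      proof (rule ob(1))
        fix \<omega> assume "\<omega> \<in> space (M n)"
        from near[OF this] show "?h \<omega> - ?r \<omega> \<le> f (Z n \<omega>)" "f (Z n \<omega>) \<le> ?h \<omega> + ?r \<omega>" by linarith+
      qed (use hi ri in auto)
      then show ?thesis using Bochner_Integration.integral_diff[OF hi ri] by simp
    qed
    have hi': "outer_expectation (M n) (\<lambda>\<omega>. f (Z n \<omega>)) \<le> ereal ((LINT \<omega>|M n. ?h \<omega>) + (LINT \<omega>|M n. ?r \<omega>))"
    proof -
      have "outer_expectation (M n) (\<lambda>\<omega>. f (Z n \<omega>)) \<le> ereal (LINT \<omega>|M n. ?h \<omega> + ?r \<omega>)"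
      proof (rule ob(2))
        fix \<omega> assume "\<omega> \<in> space (M n)"
        from near[OF this] show "?h \<omega> - ?r \<omega> \<le> f (Z n \<omega>)" "f (Z n \<omega>) \<le> ?h \<omega> + ?r \<omega>" by linarith+
      qed (use hi ri in auto)
      then show ?thesis using Bochner_Integration.integral_add[OF hi ri] by simp
    qed
    have close: "\<bar>(LINT \<omega>|M n. ?h \<omega>) - ?l\<bar> < d / 2"
      using elim(1) K1[of K] unfolding dist_real_def K_def by linarith
    have "?l - d \<le> (LINT \<omega>|M n. ?h \<omega>) - (LINT \<omega>|M n. ?r \<omega>)" using close rint d by linarith
    then have "ereal (?l - d) \<le> ereal ((LINT \<omega>|M n. ?h \<omega>) - (LINT \<omega>|M n. ?r \<omega>))" by simp
    moreover have "(LINT \<omega>|M n. ?h \<omega>) + (LINT \<omega>|M n. ?r \<omega>) \<le> ?l + d" using close rint d by linarith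
    then have "ereal ((LINT \<omega>|M n. ?h \<omega>) + (LINT \<omega>|M n. ?r \<omega>)) \<le> ereal (?l + d)" by simp
    ultimately show ?case using lo hi' order_trans by blast
  qed
qed

text \<open>Outer expectation is monotone but not linear, so the lower bound needs a functional of
  its own: minus the envelope of -f.\<close>

theorem weak_convergence:
  "weakly_converges (linf {t0..1}) M Z N (\<lambda>\<omega>. \<lambda>t\<in>{t0..1}. L t \<omega>)"
  unfolding weakly_converges_def
proof (intro conjI allI impI)
  let ?D = "linf {t0..1}" and ?L = "\<lambda>\<omega>. \<lambda>t\<in>{t0..1}. L t \<omega>"
  show "prob_space (M n)" for n by (rule ps)
  show "prob_space N" by (rule ps)
  show "Z n \<in> space (M n) \<rightarrow> mspace ?D" for n using Z by blast
  show "?L \<in> measurable N (metric_borel ?D)" by (rule path_measurable[OF t0 L cont])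
  interpret N: prob_space N by (rule ps)
  fix f assume f: "continuous_map (mtopology_of ?D) euclideanreal f \<and> bounded (f ` mspace ?D)"
  then obtain B where B: "\<And>x. x \<in> mspace ?D \<Longrightarrow> \<bar>f x\<bar> \<le> B"
    unfolding bounded_iff by (metis imageI real_norm_def)
  have LD: "?L \<omega> \<in> mspace ?D" if "\<omega> \<in> space N" for \<omega> by (rule path_mspace[OF cont[OF that]])
  have env: "(\<lambda>k. LINT \<omega>|N. envelope ?D (real k) g (?L \<omega>)) \<longlonglongrightarrow> (LINT \<omega>|N. g (?L \<omega>))"
    if g: "continuous_map (mtopology_of ?D) euclideanreal g" "\<And>x. x \<in> mspace ?D \<Longrightarrow> \<bar>g x\<bar> \<le> B" for g
  proof -
    have Lf: "Lipschitz_functional t0 (envelope ?D (real k) g) B (real k)" for k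
      by (rule envelope_functional[OF t0 g(2)]) auto
    have m: "(\<lambda>\<omega>. envelope ?D (real k) g (?L \<omega>)) \<in> borel_measurable N" for k
      by (rule Lipschitz_functional.functional_measurable[OF Lf L cont])
    have lim: "(\<lambda>k. envelope ?D (real k) g (?L \<omega>)) \<longlonglongrightarrow> g (?L \<omega>)" if "\<omega> \<in> space N" for \<omega>
      by (rule envelope_tendsto[OF g(2,1) LD[OF that]])
    show ?thesis
    proof (rule integral_dominated_convergence[where w = "\<lambda>_. B"])
      show "(\<lambda>\<omega>. g (?L \<omega>)) \<in> borel_measurable N" by (rule borel_measurable_LIMSEQ_real[OF lim m])
      show "AE \<omega> in N. norm (envelope ?D (real k) g (?L \<omega>)) \<le> B" for k
      proof (rule AE_I2)
        fix \<omega> assume "\<omega> \<in> space N"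
        from envelope_bounded[OF g(2) _ LD[OF this], where k = "real k"]
        show "norm (envelope ?D (real k) g (?L \<omega>)) \<le> B" by simp
      qed
    qed (use lim m in auto)
  qed
  let ?l = "LINT \<omega>|N. f (?L \<omega>)"
  have nf: "continuous_map (mtopology_of ?D) euclideanreal (\<lambda>x. - f x)" "\<And>x. x \<in> mspace ?D \<Longrightarrow> \<bar>- f x\<bar> \<le> B"
    using f B by (auto intro: continuous_map_minus)
  show "(\<lambda>n. outer_expectation (M n) (\<lambda>\<omega>. f (Z n \<omega>))) \<longlonglongrightarrow> ereal ?l"
  proof (rule ereal_squeeze)
    fix d :: real assume d: "0 < d"
    from tendstoD[OF env[OF conjunct1[OF f] B], of "d / 2"] d obtain k where
      k: "\<bar>(LINT \<omega>|N. envelope ?D (real k) f (?L \<omega>)) - ?l\<bar> < d / 2"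
      by (auto simp: eventually_sequentially dist_real_def)
    from tendstoD[OF env[OF nf], of "d / 2"] d obtain k' where
      k': "\<bar>(LINT \<omega>|N. envelope ?D (real k') (\<lambda>x. - f x) (?L \<omega>)) - (LINT \<omega>|N. - f (?L \<omega>))\<bar> < d / 2"
      by (auto simp: eventually_sequentially dist_real_def)
    have F1: "Lipschitz_functional t0 (envelope ?D (real k) f) B (real k)"
      by (rule envelope_functional[OF t0 B]) auto
    interpret E: Lipschitz_functional t0 "envelope ?D (real k') (\<lambda>x. - f x)" B "real k'"
      by (rule envelope_functional[OF t0 nf(2)]) auto
    have F2: "Lipschitz_functional t0 (\<lambda>x. - envelope ?D (real k') (\<lambda>x. - f x) x) B (real k')"
    proof (unfold_locales, rule t0, rule t0)
      fix x y assume xy: "x \<in> mspace ?D" "y \<in> mspace ?D"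
      show "\<bar>- envelope ?D (real k') (\<lambda>x. - f x) x\<bar> \<le> B" using E.B[OF xy(1)] by simp
      show "\<bar>- envelope ?D (real k') (\<lambda>x. - f x) x - - envelope ?D (real k') (\<lambda>x. - f x) y\<bar> \<le> real k' * mdist ?D x y"
        using E.Lip[OF xy] by simp
    qed simp
    define l1 where "l1 = (LINT \<omega>|N. envelope ?D (real k) f (?L \<omega>))"
    define l2 where "l2 = (LINT \<omega>|N. - envelope ?D (real k') (\<lambda>x. - f x) (?L \<omega>))"
    have l1: "l1 < ?l + d" using k d unfolding l1_def by linarith
    have l2: "?l - d < l2" using k' d unfolding l2_def integral_minus by linarith
    have "\<forall>\<^sub>F n in sequentially. outer_expectation (M n) (\<lambda>\<omega>. envelope ?D (real k) f (Z n \<omega>)) < ereal (?l + d)"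
      using order_tendstoD(2)[OF Lipschitz_convergence[OF F1], of "ereal (?l + d)"] l1 unfolding l1_def by simp
    moreover have "\<forall>\<^sub>F n in sequentially. ereal (?l - d) < outer_expectation (M n) (\<lambda>\<omega>. - envelope ?D (real k') (\<lambda>x. - f x) (Z n \<omega>))"
      using order_tendstoD(1)[OF Lipschitz_convergence[OF F2], of "ereal (?l - d)"] l2 unfolding l2_def by simp
    ultimately show "\<forall>\<^sub>F n in sequentially. ereal (?l - d) \<le> outer_expectation (M n) (\<lambda>\<omega>. f (Z n \<omega>)) \<and>
      outer_expectation (M n) (\<lambda>\<omega>. f (Z n \<omega>)) \<le> ereal (?l + d)"
    proof eventually_elim
      case (elim n)
      have "outer_expectation (M n) (\<lambda>\<omega>. f (Z n \<omega>)) \<le> outer_expectation (M n) (\<lambda>\<omega>. envelope ?D (real k) f (Z n \<omega>))"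
        by (rule outer_expectation_mono) (rule envelope_ge[OF B _ Z], auto)
      moreover have "outer_expectation (M n) (\<lambda>\<omega>. - envelope ?D (real k') (\<lambda>x. - f x) (Z n \<omega>)) \<le> outer_expectation (M n) (\<lambda>\<omega>. f (Z n \<omega>))"
      proof (rule outer_expectation_mono)
        fix \<omega> assume "\<omega> \<in> space (M n)"
        from envelope_ge[where f = "\<lambda>x. - f x" and k = "real k'", OF nf(2) _ Z[OF this]]
        show "- envelope ?D (real k') (\<lambda>x. - f x) (Z n \<omega>) \<le> f (Z n \<omega>)" by simp
      qed
      ultimately show ?case using elim less_imp_le order_trans by blast
    qed
  qed
qed

end

section \<open>The statistic under the null hypothesis\<close>

lemma scalar_prod_self_zero:
  fixes v :: "real vec"
  assumes v: "v \<in> carrier_vec p" and le: "v \<bullet> v \<le> 0"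
  shows "v = 0\<^sub>v p"
proof -
  have s: "(\<Sum>i<p. (v $ i)\<^sup>2) \<le> 0" using le v by (simp add: scalar_prod_def power2_eq_square lessThan_atLeast0)
  have "(\<Sum>i<p. (v $ i)\<^sup>2) = 0" using s by (intro antisym sum_nonneg) auto
  then have "\<forall>i\<in>{..<p}. (v $ i)\<^sup>2 = 0" by (subst (asm) sum_nonneg_eq_0_iff) auto
  then show ?thesis using v by (intro eq_vecI) auto
qed

text \<open>\<open>mat_sqrt\<close> is a definite description, so uniqueness has to be shown. For a
  root B and any w, the vector v = B w - s w with s = sqrt a satisfies B v = - s v, and
  nonnegativity of B forces v = 0.\<close>

lemma mat_sqrt_scaled_one:
  assumes "0 < a"
  shows "mat_sqrt p (a \<cdot>\<^sub>m 1\<^sub>m p) = sqrt a \<cdot>\<^sub>m 1\<^sub>m p"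
  unfolding mat_sqrt_def
proof (rule the_equality)
  have sv: "(b \<cdot>\<^sub>m 1\<^sub>m p) *\<^sub>v v = b \<cdot>\<^sub>v v" if "v \<in> carrier_vec p" for b :: real and v
    using that by (intro eq_vecI) (auto simp: scalar_prod_def if_distrib[of "\<lambda>x. _ * x * _"] sum.delta cong: if_cong)
  have "(sqrt a \<cdot>\<^sub>m 1\<^sub>m p) * (sqrt a \<cdot>\<^sub>m 1\<^sub>m p) = a \<cdot>\<^sub>m 1\<^sub>m p"
  proof -
    have "(sqrt a \<cdot>\<^sub>m 1\<^sub>m p) * (sqrt a \<cdot>\<^sub>m 1\<^sub>m p) = sqrt a \<cdot>\<^sub>m (1\<^sub>m p * (sqrt a \<cdot>\<^sub>m 1\<^sub>m p))"
      by (rule mult_smult_assoc_mat[where nr = p and n = p and nc = p]) auto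
    also have "1\<^sub>m p * (sqrt a \<cdot>\<^sub>m 1\<^sub>m p) = sqrt a \<cdot>\<^sub>m 1\<^sub>m p"
      by (rule left_mult_one_mat[where nr = p and nc = p]) auto
    finally show ?thesis using assms by (auto intro!: eq_matI)
  qed
  moreover have "sym_nonneg_def p (sqrt a \<cdot>\<^sub>m 1\<^sub>m p)"
    unfolding sym_nonneg_def_def
  proof (intro conjI ballI)
    fix v :: "real vec" assume v: "v \<in> carrier_vec p"
    have "v \<bullet> v = (\<Sum>i<p. (v $ i)\<^sup>2)" using v by (simp add: scalar_prod_def power2_eq_square lessThan_atLeast0)
    then have "0 \<le> v \<bullet> v" by (simp add: sum_nonneg)
    then show "0 \<le> v \<bullet> ((sqrt a \<cdot>\<^sub>m 1\<^sub>m p) *\<^sub>v v)" using v assms by (simp add: sv)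
  qed (use assms in \<open>auto intro!: eq_matI\<close>)
  ultimately show "sym_nonneg_def p (sqrt a \<cdot>\<^sub>m 1\<^sub>m p) \<and> (sqrt a \<cdot>\<^sub>m 1\<^sub>m p) * (sqrt a \<cdot>\<^sub>m 1\<^sub>m p) = a \<cdot>\<^sub>m 1\<^sub>m p" by blast
  fix B assume B: "sym_nonneg_def p B \<and> B * B = a \<cdot>\<^sub>m 1\<^sub>m p"
  then have Bc: "B \<in> carrier_mat p p" and BB: "B * B = a \<cdot>\<^sub>m 1\<^sub>m p"
    and pos: "\<And>v. v \<in> carrier_vec p \<Longrightarrow> 0 \<le> v \<bullet> (B *\<^sub>v v)" by (auto simp: sym_nonneg_def_def)
  let ?s = "sqrt a"
  have Bw: "B *\<^sub>v w = ?s \<cdot>\<^sub>v w" if w: "w \<in> carrier_vec p" for w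
  proof -
    define v where "v = B *\<^sub>v w - ?s \<cdot>\<^sub>v w"
    have Bwc: "B *\<^sub>v w \<in> carrier_vec p" using Bc w by simp
    have v: "v \<in> carrier_vec p" using Bwc w by (simp add: v_def)
    have "B *\<^sub>v (B *\<^sub>v w) = (B * B) *\<^sub>v w" using Bc w by (simp add: assoc_mult_mat_vec)
    also have "\<dots> = a \<cdot>\<^sub>v w" unfolding BB by (rule sv[OF w])
    finally have BBw: "B *\<^sub>v (B *\<^sub>v w) = a \<cdot>\<^sub>v w" .
    have "B *\<^sub>v v = B *\<^sub>v (B *\<^sub>v w) - B *\<^sub>v (?s \<cdot>\<^sub>v w)"
      unfolding v_def using Bc Bwc w by (intro mult_minus_distrib_mat_vec) auto
    also have "B *\<^sub>v (?s \<cdot>\<^sub>v w) = ?s \<cdot>\<^sub>v (B *\<^sub>v w)" by (rule mult_mat_vec[OF Bc w])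
    also have "B *\<^sub>v (B *\<^sub>v w) - ?s \<cdot>\<^sub>v (B *\<^sub>v w) = (- ?s) \<cdot>\<^sub>v v"
      unfolding BBw v_def using Bwc w Bc assms by (intro eq_vecI) (auto simp: algebra_simps)
    finally have Bv: "B *\<^sub>v v = (- ?s) \<cdot>\<^sub>v v" .
    have "0 \<le> - ?s * (v \<bullet> v)" using pos[OF v] v unfolding Bv by simp
    then have "v \<bullet> v \<le> 0" using assms by (simp add: mult_le_0_iff zero_le_mult_iff)
    then have v0: "v = 0\<^sub>v p" by (rule scalar_prod_self_zero[OF v])
    show ?thesis
    proof (rule eq_vecI)
      fix i assume i: "i < dim_vec (?s \<cdot>\<^sub>v w)"
      then have ip: "i < p" using w by simp
      have "v $ i = 0" using v0 ip by simp
      moreover have "v $ i = (B *\<^sub>v w) $ i - ?s * w $ i" unfolding v_def using ip w by simp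
      ultimately show "(B *\<^sub>v w) $ i = (?s \<cdot>\<^sub>v w) $ i" using ip w by simp
    qed (use Bwc w Bc in simp)
  qed
  show "B = ?s \<cdot>\<^sub>m 1\<^sub>m p"
  proof (rule eq_matI)
    fix i j assume "i < dim_row (?s \<cdot>\<^sub>m 1\<^sub>m p)" "j < dim_col (?s \<cdot>\<^sub>m 1\<^sub>m p)"
    then have ij: "i < p" "j < p" by auto
    have "B $$ (i, j) = (B *\<^sub>v unit_vec p j) $ i" using Bc ij by (simp add: scalar_prod_right_unit)
    also have "\<dots> = (?s \<cdot>\<^sub>v unit_vec p j) $ i" by (subst Bw) auto
    finally show "B $$ (i, j) = (?s \<cdot>\<^sub>m 1\<^sub>m p) $$ (i, j)" using ij by simp
  qed (use Bc in auto)
qed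

lemma scaled_one_mult_vec:
  assumes "v \<in> carrier_vec p"
  shows "(b \<cdot>\<^sub>m 1\<^sub>m p) *\<^sub>v v = b \<cdot>\<^sub>v (v :: real vec)"
  using assms by (intro eq_vecI) (auto simp: scalar_prod_def if_distrib[of "\<lambda>x. _ * x * _"] sum.delta cong: if_cong)

lemma
  assumes ys: "\<forall>i<m. ys i \<in> carrier_vec p"
    and m_def: "m = nat \<lfloor>real n * t\<rfloor>" and S_def: "S = seq_cov p n ys t"
  shows seq_cov_trace: "mat_trace S = 1 / real n * (\<Sum>k<p. \<Sum>i<m. (ys i $ k)\<^sup>2)"
    and seq_cov_trace_sq: "mat_trace (S * S) = (1 / real n)\<^sup>2 * (\<Sum>k<p. \<Sum>l<p. (\<Sum>i<m. ys i $ k * ys i $ l)\<^sup>2)"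
proof -
  have dim: "dim_row S = p" "dim_col S = p" by (auto simp: S_def seq_cov_def)
  have d: "dim_vec (ys i) = p" if "i < nat \<lfloor>real n * t\<rfloor>" for i using ys that by (simp add: m_def)
  have ent: "S $$ (k, l) = 1 / real n * (\<Sum>i<m. ys i $ k * ys i $ l)" if "k < p" "l < p" for k l
    using that by (simp add: S_def seq_cov_def outer_prod_def d m_def)
  show "mat_trace S = 1 / real n * (\<Sum>k<p. \<Sum>i<m. (ys i $ k)\<^sup>2)"
    unfolding mat_trace_def dim sum_distrib_left[of "1 / real n" _ "{..<p}"]
    by (intro sum.cong refl) (simp add: ent power2_eq_square)
  have "mat_trace (S * S) = (\<Sum>k<p. \<Sum>l<p. S $$ (k, l) * S $$ (l, k))"
    unfolding mat_trace_def using dim by (simp add: scalar_prod_def lessThan_atLeast0)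
  also have "\<dots> = (\<Sum>k<p. \<Sum>l<p. (1 / real n)\<^sup>2 * (\<Sum>i<m. ys i $ k * ys i $ l)\<^sup>2)"
  proof (intro sum.cong refl)
    fix k l assume "k \<in> {..<p}" "l \<in> {..<p}"
    then have kl: "k < p" "l < p" by auto
    have "(\<Sum>i<m. ys i $ l * ys i $ k) = (\<Sum>i<m. ys i $ k * ys i $ l)" by (simp add: mult.commute)
    then show "S $$ (k, l) * S $$ (l, k) = (1 / real n)\<^sup>2 * (\<Sum>i<m. ys i $ k * ys i $ l)\<^sup>2"
      unfolding ent[OF kl] ent[OF kl(2,1)] by (simp only: power2_eq_square mult_ac)
  qed
  finally show "mat_trace (S * S) = (1 / real n)\<^sup>2 * (\<Sum>k<p. \<Sum>l<p. (\<Sum>i<m. ys i $ k * ys i $ l)\<^sup>2)"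
    by (simp only: sum_distrib_left)
qed

context std_array
begin

lemma sum_sq_eq: "(\<Sum>k<p. \<Sum>i<m. (x k i \<omega>)\<^sup>2) = real m * real p + aa m \<omega>"
  unfolding aa_def bb_def by (subst sum.swap) (simp add: sum_subtractf)

text \<open>The sum of the x_i x_i^T is m times the identity plus the matrix with entries
  \<open>AA\<close>, whose squared Frobenius norm is half of \<open>V\<close> and whose trace is
  \<open>aa\<close>.\<close>

lemma gram_sq_eq:
  "(\<Sum>k<p. \<Sum>l<p. (\<Sum>i<m. x k i \<omega> * x l i \<omega>)\<^sup>2)
    = 2 * H m \<omega> + BB m \<omega> + 2 * (real p - 1) * aa m \<omega> + real m * ((real p)\<^sup>2 + real p)
      + 2 * real m * aa m \<omega> + (real m)\<^sup>2 * real p"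
proof -
  have "(\<Sum>i<m. x k i \<omega> * x l i \<omega>)\<^sup>2 = (AA (k, l) m \<omega>)\<^sup>2 + (if l = k then 2 * real m * AA (k, k) m \<omega> + (real m)\<^sup>2 else 0)" for k l
  proof -
    have e: "(\<Sum>i<m. x k i \<omega> * x l i \<omega>) = AA (k, l) m \<omega> + (if l = k then real m else 0)"
      by (auto simp: AA_def al_def sum_subtractf)
    show ?thesis unfolding e by (auto simp: power2_eq_square algebra_simps)
  qed
  then have "(\<Sum>k<p. \<Sum>l<p. (\<Sum>i<m. x k i \<omega> * x l i \<omega>)\<^sup>2)
    = (\<Sum>k<p. \<Sum>l<p. (AA (k, l) m \<omega>)\<^sup>2) + (\<Sum>k<p. 2 * real m * AA (k, k) m \<omega> + (real m)\<^sup>2)"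
    by (simp add: sum.distrib)
  also have "(\<Sum>k<p. \<Sum>l<p. (AA (k, l) m \<omega>)\<^sup>2) = V m \<omega> / 2"
    by (simp add: V_def Q_def sum.cartesian_product)
  also have "(\<Sum>k<p. 2 * real m * AA (k, k) m \<omega> + (real m)\<^sup>2) = 2 * real m * (\<Sum>k<p. AA (k, k) m \<omega>) + (real m)\<^sup>2 * real p"
    by (simp add: sum.distrib sum_distrib_left mult.commute)
  also have "(\<Sum>k<p. AA (k, k) m \<omega>) = aa m \<omega>"
    unfolding AA_def aa_def bb_eq by (subst sum.swap) simp
  finally show ?thesis unfolding V_eq by (simp add: field_simps)
qed

text \<open>Numerator and denominator carry the same power of s^2 / n, which cancels;
  \<open>nz\<close> excludes the default value.\<close>

lemma U_stat_eq:
  assumes n: "0 < n" and p: "0 < p" and s: "s \<noteq> 0"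
    and ys: "\<And>i. i < n \<Longrightarrow> ys i \<in> carrier_vec p" "\<And>i k. i < n \<Longrightarrow> k < p \<Longrightarrow> ys i $ k = s * x k i \<omega>"
    and m: "m = nat \<lfloor>real n * t\<rfloor>" "m \<le> n"
    and nz: "real m * real p + aa m \<omega> \<noteq> 0"
  shows "U_stat p n ys c t = real p * (2 * H m \<omega> + BB m \<omega> + 2 * (real p - 1) * aa m \<omega> + real m * ((real p)\<^sup>2 + real p)
      + 2 * real m * aa m \<omega> + (real m)\<^sup>2 * real p) / (real m * real p + aa m \<omega>)\<^sup>2"
proof -
  let ?S = "seq_cov p n ys t"
  have yc: "\<forall>i<m. ys i \<in> carrier_vec p" using ys(1) m(2) by auto
  have "(\<Sum>k<p. \<Sum>i<m. (ys i $ k)\<^sup>2) = s\<^sup>2 * (\<Sum>k<p. \<Sum>i<m. (x k i \<omega>)\<^sup>2)"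
    unfolding sum_distrib_left using m ys(2) by (intro sum.cong refl) (simp add: power_mult_distrib)
  then have T1: "mat_trace ?S = s\<^sup>2 / real n * (real m * real p + aa m \<omega>)"
    unfolding seq_cov_trace[OF yc m(1) refl] by (simp add: sum_sq_eq)
  have e: "(\<Sum>i<m. ys i $ k * ys i $ l) = s\<^sup>2 * (\<Sum>i<m. x k i \<omega> * x l i \<omega>)" if "k < p" "l < p" for k l
    unfolding sum_distrib_left using m ys(2) that by (intro sum.cong refl) (simp add: power2_eq_square)
  have "(\<Sum>k<p. \<Sum>l<p. (\<Sum>i<m. ys i $ k * ys i $ l)\<^sup>2)
      = (\<Sum>k<p. \<Sum>l<p. (s\<^sup>2)\<^sup>2 * (\<Sum>i<m. x k i \<omega> * x l i \<omega>)\<^sup>2)"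
    by (intro sum.cong refl) (simp only: e lessThan_iff power_mult_distrib)
  then have "(\<Sum>k<p. \<Sum>l<p. (\<Sum>i<m. ys i $ k * ys i $ l)\<^sup>2) = (s\<^sup>2)\<^sup>2 * (\<Sum>k<p. \<Sum>l<p. (\<Sum>i<m. x k i \<omega> * x l i \<omega>)\<^sup>2)"
    by (simp only: sum_distrib_left)
  then have T2: "mat_trace (?S * ?S) = (s\<^sup>2 / real n)\<^sup>2 * (\<Sum>k<p. \<Sum>l<p. (\<Sum>i<m. x k i \<omega> * x l i \<omega>)\<^sup>2)"
    unfolding seq_cov_trace_sq[OF yc m(1) refl] by (simp add: power_divide)
  define q where "q = s\<^sup>2 / real n"
  have q: "q \<noteq> 0" using n s by (simp add: q_def)
  define A where "A = real m * real p + aa m \<omega>"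
  have A: "A \<noteq> 0" using nz by (simp add: A_def)
  have "mat_trace ?S \<noteq> 0" unfolding T1 q_def[symmetric] A_def[symmetric] using q A by simp
  then show ?thesis
    unfolding U_stat_def Let_def T1 T2 gram_sq_eq q_def[symmetric] A_def[symmetric]
    using q A p by (simp add: power_mult_distrib field_simps power2_eq_square)
qed

end

section \<open>Expansion of the statistic and its remainder\<close>

lemma statistic_expansion:
  fixes m p H a b :: real
  assumes "m \<noteq> 0" "p \<noteq> 0" "m * p + a \<noteq> 0"
  shows "p * (p * (2 * H + b + 2 * (p - 1) * a + m * (p\<^sup>2 + p) + 2 * m * a + m\<^sup>2 * p) / (m * p + a)\<^sup>2 - 1 - p / m)
    = (2 * H / m\<^sup>2 + p / m + (b / m\<^sup>2 - 2 * a / m\<^sup>2 - (1 + p / m) * (a\<^sup>2 / (m\<^sup>2 * p)))) / (1 + a / (m * p))\<^sup>2"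
proof -
  define A where "A = m * p + a"
  have A: "A \<noteq> 0" using assms by (simp add: A_def)
  have a: "a = A - m * p" by (simp add: A_def)
  have r: "1 + a / (m * p) = A / (m * p)" using assms by (simp add: A_def field_simps)
  let ?D = "2 * H + b + 2 * (p - 1) * a + m * (p\<^sup>2 + p) + 2 * m * a + m\<^sup>2 * p"
  let ?Q = "2 * H / m\<^sup>2 + p / m + (b / m\<^sup>2 - 2 * a / m\<^sup>2 - (1 + p / m) * (a\<^sup>2 / (m\<^sup>2 * p)))"
  have Q: "?Q * m\<^sup>2 * p = 2 * H * p + p\<^sup>2 * m + b * p - 2 * a * p - (1 + p / m) * a\<^sup>2"
    using assms by (simp add: field_simps power2_eq_square)
  \<comment> \<open>The terms m^2 p^2 and m p^3 cancel, and the coefficient of a shrinks from order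
    p (m + p) to -2 p. The surviving m p^2 is the origin of the mean p / m.\<close>
  have N: "p * ?D - (1 + p / m) * A\<^sup>2 = ?Q * m\<^sup>2 * p"
    unfolding Q A_def using assms(1) by (simp add: field_simps power2_eq_square)
  have gen: "p * (p * d / z - 1 - q) = p * (p * d - (1 + q) * z) / z" if "z \<noteq> 0" for d z q :: real
    using that by (simp add: field_simps)
  have "p * (p * ?D / A\<^sup>2 - 1 - p / m) = p * (p * ?D - (1 + p / m) * A\<^sup>2) / A\<^sup>2"
    by (rule gen) (use A in simp)
  also have "\<dots> = ?Q / (A / (m * p))\<^sup>2"
    unfolding N using A assms by (simp add: power_divide power_mult_distrib power2_eq_square)
  finally show ?thesis unfolding r A_def .
qed

text \<open>The constant is 10 = (5/2) / (1/4): the difference is - u (2 + u) / (1 + u)^2, with |2 +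
  u| at most 5/2 and the denominator at least 1/4.\<close>

lemma inverse_square_near_one:
  fixes u d :: real
  assumes "\<bar>u\<bar> \<le> d" "d \<le> 1/2"
  shows "\<bar>1 / (1 + u)\<^sup>2 - 1\<bar> \<le> 10 * d"
proof -
  have l: "1/2 \<le> 1 + u" and ul: "\<bar>u\<bar> \<le> 1/2" using assms by linarith+
  have sq: "1/4 \<le> (1 + u)\<^sup>2" using power_mono[OF l, of 2] by (simp add: power2_eq_square)
  have "1 / (1 + u)\<^sup>2 - 1 = - (u * (2 + u)) / (1 + u)\<^sup>2"
  proof -
    have "1 / (1 + u)\<^sup>2 - 1 = (1 - (1 + u)\<^sup>2) / (1 + u)\<^sup>2" using l by (simp add: diff_divide_distrib)
    also have "1 - (1 + u)\<^sup>2 = - (u * (2 + u))" by (simp add: power2_eq_square algebra_simps)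
    finally show ?thesis .
  qed
  then have "\<bar>1 / (1 + u)\<^sup>2 - 1\<bar> = \<bar>u\<bar> * \<bar>2 + u\<bar> / (1 + u)\<^sup>2" by (simp add: abs_mult)
  also have "\<dots> \<le> d * (5/2) / (1/4)"
    using assms ul sq by (intro frac_le mult_mono) auto
  finally show ?thesis by simp
qed

lemma abs_divide_le:
  fixes a b c d :: real
  assumes "\<bar>a\<bar> \<le> c" "d \<le> b" "0 < d"
  shows "\<bar>a / b\<bar> \<le> c / d"
  using assms by (auto intro!: frac_le)

text \<open>The summands bound the terms in b, in a and in a^2 of
  \<open>statistic_expansion\<close>, for |a| \<le> w n, |b| \<le> w n sqrt n, m \<ge> n t0 / 2 and
  p between n y / 2 and 2 y n.\<close>

definition rem_err :: "real \<Rightarrow> real \<Rightarrow> real \<Rightarrow> real \<Rightarrow> real" where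
  "rem_err y t0 w n = 4 * w / (t0\<^sup>2 * sqrt n) + 8 * w / (t0\<^sup>2 * n) + (1 + 4 * y / t0) * (8 * w\<^sup>2 / (t0\<^sup>2 * y * n))"

text \<open>The first summand pays for dropping the factor (1 + a / (m p))^-2, the second and third
  for replacing p / m by y / t, the last for the terms in a and b.\<close>

definition rem_bound :: "real \<Rightarrow> real \<Rightarrow> real \<Rightarrow> real \<Rightarrow> real \<Rightarrow> real \<Rightarrow> real" where
  "rem_bound y t0 w R n p = 10 * (4 * w / (t0 * y * n)) * (8 * R / t0\<^sup>2 + 4 * y / t0 + rem_err y t0 w n)
     + 4 * y / (t0\<^sup>2 * n) + \<bar>p / n - y\<bar> / t0 + rem_err y t0 w n"

lemma remainder_bound:
  fixes n m p H a b y t t0 w R :: real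
  assumes t0: "0 < t0" "t0 \<le> t" and n: "0 < n" and y: "0 < y"
    and m: "n * t0 / 2 \<le> m" "m \<le> n * t" "n * t \<le> m + 1"
    and p: "n * y / 2 \<le> p" "p \<le> 2 * y * n"
    and H: "\<bar>H\<bar> \<le> R * n\<^sup>2" and a: "\<bar>a\<bar> \<le> w * n" and b: "\<bar>b\<bar> \<le> w * (n * sqrt n)"
    and small: "4 * w / (t0 * y * n) \<le> 1/2"
  shows "m * p + a \<noteq> 0"
    "\<bar>p * (p * (2 * H + b + 2 * (p - 1) * a + m * (p\<^sup>2 + p) + 2 * m * a + m\<^sup>2 * p) / (m * p + a)\<^sup>2 - 1 - p / m)
      - (2 * H / m\<^sup>2 + y / t)\<bar> \<le> rem_bound y t0 w R n p"
proof -
  have mp: "0 < m" "0 < p" using m(1) p(1) mult_pos_pos[OF n t0(1)] mult_pos_pos[OF n y] by linarith+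
  have w: "0 \<le> w" using a n by (metis abs_ge_zero mult_le_cancel_right_pos mult_zero_left order_trans)
  have R: "0 \<le> R" using H n by (metis abs_ge_zero mult_le_cancel_right_pos mult_zero_left order_trans zero_less_power)
  have m2: "n\<^sup>2 * t0\<^sup>2 / 4 \<le> m\<^sup>2"
    using power_mono[OF m(1), of 2] n t0 by (simp add: power_mult_distrib power_divide)
  have m2p: "0 < n\<^sup>2 * t0\<^sup>2 / 4" using n t0 by simp
  have mpl: "(n * t0 / 2) * (n * y / 2) \<le> m * p" using m p n t0 y mp by (intro mult_mono) auto
  define u where "u = a / (m * p)"
  have u: "\<bar>u\<bar> \<le> 4 * w / (t0 * y * n)"
  proof -
    have "\<bar>a / (m * p)\<bar> \<le> w * n / ((n * t0 / 2) * (n * y / 2))"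
      by (rule abs_divide_le[OF a mpl]) (use n t0 y in simp)
    also have "\<dots> = 4 * w / (t0 * y * n)" using n t0 y by (simp add: field_simps)
    finally show ?thesis by (simp add: u_def)
  qed
  have u1: "1/2 \<le> 1 + u" using u small by linarith
  have "m * p + a = m * p * (1 + u)" using mp by (simp add: u_def distrib_left)
  then show nz: "m * p + a \<noteq> 0" using mp u1 by simp
  define E where "E = b / m\<^sup>2 - 2 * a / m\<^sup>2 - (1 + p / m) * (a\<^sup>2 / (m\<^sup>2 * p))"
  have pm: "\<bar>p / m\<bar> \<le> 4 * y / t0"
  proof -
    have "\<bar>p / m\<bar> \<le> 2 * y * n / (n * t0 / 2)" by (rule abs_divide_le) (use p m mp n t0 in auto)
    also have "\<dots> = 4 * y / t0" using n t0 by (simp add: field_simps)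
    finally show ?thesis .
  qed
  have E: "\<bar>E\<bar> \<le> rem_err y t0 w n"
  proof -
    have s: "n * sqrt n / n\<^sup>2 = 1 / sqrt n"
      using n by (simp add: power2_eq_square field_simps)
    have "\<bar>b / m\<^sup>2\<bar> \<le> w * (n * sqrt n) / (n\<^sup>2 * t0\<^sup>2 / 4)" by (rule abs_divide_le[OF b m2 m2p])
    also have "\<dots> = 4 * w / t0\<^sup>2 * (n * sqrt n / n\<^sup>2)" by (simp add: mult_ac)
    also have "\<dots> = 4 * w / (t0\<^sup>2 * sqrt n)" unfolding s by simp
    finally have 1: "\<bar>b / m\<^sup>2\<bar> \<le> 4 * w / (t0\<^sup>2 * sqrt n)" .
    have "\<bar>2 * a / m\<^sup>2\<bar> \<le> 2 * (w * n) / (n\<^sup>2 * t0\<^sup>2 / 4)" by (rule abs_divide_le[OF _ m2 m2p]) (use a in simp)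
    also have "\<dots> = 8 * w / (t0\<^sup>2 * n)" using n by (simp add: field_simps power2_eq_square)
    finally have 2: "\<bar>2 * a / m\<^sup>2\<bar> \<le> 8 * w / (t0\<^sup>2 * n)" .
    have a2: "\<bar>a\<^sup>2\<bar> \<le> (w * n)\<^sup>2" using power_mono[OF a, of 2] by simp
    have "\<bar>a\<^sup>2 / (m\<^sup>2 * p)\<bar> \<le> (w * n)\<^sup>2 / ((n\<^sup>2 * t0\<^sup>2 / 4) * (n * y / 2))"
    proof (rule abs_divide_le[OF a2])
      show "(n\<^sup>2 * t0\<^sup>2 / 4) * (n * y / 2) \<le> m\<^sup>2 * p"
        by (rule mult_mono[OF m2 p(1)]) (use n y in auto)
      show "0 < (n\<^sup>2 * t0\<^sup>2 / 4) * (n * y / 2)" using m2p n y by simp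
    qed
    also have "\<dots> = 8 * w\<^sup>2 / (t0\<^sup>2 * y * n)" using n y t0 by (simp add: field_simps power2_eq_square)
    finally have 3: "\<bar>a\<^sup>2 / (m\<^sup>2 * p)\<bar> \<le> 8 * w\<^sup>2 / (t0\<^sup>2 * y * n)" .
    have "\<bar>1 + p / m\<bar> \<le> 1 + 4 * y / t0" using pm by linarith
    then have "\<bar>(1 + p / m) * (a\<^sup>2 / (m\<^sup>2 * p))\<bar> \<le> (1 + 4 * y / t0) * (8 * w\<^sup>2 / (t0\<^sup>2 * y * n))"
      unfolding abs_mult[of "1 + p / m"] using 3 y t0 by (intro mult_mono) auto
    with 1 2 show ?thesis unfolding E_def rem_err_def by linarith
  qed
  have H2: "\<bar>2 * H / m\<^sup>2\<bar> \<le> 8 * R / t0\<^sup>2"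
  proof -
    have "\<bar>2 * H / m\<^sup>2\<bar> \<le> 2 * (R * n\<^sup>2) / (n\<^sup>2 * t0\<^sup>2 / 4)" by (rule abs_divide_le[OF _ m2 m2p]) (use H in simp)
    also have "\<dots> = 8 * R / t0\<^sup>2" using n by (simp add: field_simps)
    finally show ?thesis .
  qed
  have P: "\<bar>p / m - y / t\<bar> \<le> 4 * y / (t0\<^sup>2 * n) + \<bar>p / n - y\<bar> / t0"
  proof -
    have tp: "0 < t" using t0 by linarith
    have "p / m - y / t = (p / n) * ((n * t - m) / (m * t)) + (p / n - y) / t"
      using n mp tp by (simp add: field_simps)
    moreover have "\<bar>(p / n) * ((n * t - m) / (m * t))\<bar> \<le> (2 * y) * (1 / (n * t0 / 2 * t0))"
      unfolding abs_mult
    proof (rule mult_mono)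
      show "\<bar>p / n\<bar> \<le> 2 * y" using p mp n by (simp add: field_simps)
      show "\<bar>(n * t - m) / (m * t)\<bar> \<le> 1 / (n * t0 / 2 * t0)"
      proof (rule abs_divide_le)
        show "\<bar>n * t - m\<bar> \<le> 1" using m by linarith
        show "n * t0 / 2 * t0 \<le> m * t" by (rule mult_mono[OF m(1) t0(2)]) (use mp t0 in auto)
        show "0 < n * t0 / 2 * t0" using n t0 by simp
      qed
    qed (use y in auto)
    moreover have "(2 * y) * (1 / (n * t0 / 2 * t0)) = 4 * y / (t0\<^sup>2 * n)" using n t0 by (simp add: field_simps power2_eq_square)
    moreover have "\<bar>(p / n - y) / t\<bar> \<le> \<bar>p / n - y\<bar> / t0" by (rule abs_divide_le) (use t0 in auto)
    ultimately show ?thesis by linarith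
  qed
  define Q where "Q = 2 * H / m\<^sup>2 + p / m + E"
  have Q: "\<bar>Q\<bar> \<le> 8 * R / t0\<^sup>2 + 4 * y / t0 + rem_err y t0 w n" using H2 pm E unfolding Q_def by linarith
  have r: "\<bar>1 / (1 + u)\<^sup>2 - 1\<bar> \<le> 10 * (4 * w / (t0 * y * n))"
    by (rule inverse_square_near_one[OF u small])
  have prod: "\<bar>(1 / (1 + u)\<^sup>2 - 1) * Q\<bar> \<le> 10 * (4 * w / (t0 * y * n)) * (8 * R / t0\<^sup>2 + 4 * y / t0 + rem_err y t0 w n)"
    unfolding abs_mult using r Q w n t0 y by (intro mult_mono) auto
  have "Q / (1 + u)\<^sup>2 - (2 * H / m\<^sup>2 + y / t) = (1 / (1 + u)\<^sup>2 - 1) * Q + (p / m - y / t) + E"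
    by (simp add: Q_def left_diff_distrib)
  then have fin: "\<bar>Q / (1 + u)\<^sup>2 - (2 * H / m\<^sup>2 + y / t)\<bar> \<le> rem_bound y t0 w R n p"
    unfolding rem_bound_def using prod P E by linarith
  have "p * (p * (2 * H + b + 2 * (p - 1) * a + m * (p\<^sup>2 + p) + 2 * m * a + m\<^sup>2 * p) / (m * p + a)\<^sup>2 - 1 - p / m) = Q / (1 + u)\<^sup>2"
    unfolding Q_def E_def u_def by (rule statistic_expansion) (use mp nz in auto)
  then show "\<bar>p * (p * (2 * H + b + 2 * (p - 1) * a + m * (p\<^sup>2 + p) + 2 * m * a + m\<^sup>2 * p) / (m * p + a)\<^sup>2 - 1 - p / m)
      - (2 * H / m\<^sup>2 + y / t)\<bar> \<le> rem_bound y t0 w R n p"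
    using fin by simp
qed

text \<open>The difference splits into the increment of H at fixed m and the change of the factor 1
  / m^2 at fixed H; the latter uses m^2 - m'^2 \<le> 2 n (n / K + 1).\<close>

lemma increment_bound:
  fixes n m m' H H' R r K t0 :: real
  assumes t0: "0 < t0" and n: "0 < n" and m: "n * t0 / 2 \<le> m'" "m' \<le> m" "m \<le> n" "m - m' \<le> n / K + 1" and K: "0 < K"
    and H: "\<bar>H - H'\<bar> \<le> r * n\<^sup>2" "\<bar>H'\<bar> \<le> R * n\<^sup>2"
  shows "\<bar>2 * H / m\<^sup>2 - 2 * H' / m'\<^sup>2\<bar> \<le> 8 * r / t0\<^sup>2 + 64 * R * (1 / K + 1 / n) / t0^4"
proof -
  have mp: "0 < m'" "0 < m" using m mult_pos_pos[OF n t0(1)] by linarith+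
  have m'2: "n\<^sup>2 * t0\<^sup>2 / 4 \<le> m'\<^sup>2" using power_mono[OF m(1), of 2] n t0 by (simp add: power_mult_distrib power_divide)
  have m2: "n\<^sup>2 * t0\<^sup>2 / 4 \<le> m\<^sup>2" using power_mono[OF m(2), of 2] mp m'2 by linarith
  have m2p: "0 < n\<^sup>2 * t0\<^sup>2 / 4" using n t0 by simp
  have "\<bar>2 * (H - H') / m\<^sup>2\<bar> \<le> 2 * (r * n\<^sup>2) / (n\<^sup>2 * t0\<^sup>2 / 4)"
    by (rule abs_divide_le[OF _ m2 m2p]) (use H in simp)
  also have "\<dots> = 8 * r / t0\<^sup>2" using n by (simp add: field_simps)
  finally have 1: "\<bar>2 * (H - H') / m\<^sup>2\<bar> \<le> 8 * r / t0\<^sup>2" .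
  have "\<bar>2 * H' * (m'\<^sup>2 - m\<^sup>2) / (m\<^sup>2 * m'\<^sup>2)\<bar> \<le> (2 * (R * n\<^sup>2) * ((n / K + 1) * (2 * n))) / ((n\<^sup>2 * t0\<^sup>2 / 4) * (n\<^sup>2 * t0\<^sup>2 / 4))"
  proof (rule abs_divide_le)
    have "\<bar>m'\<^sup>2 - m\<^sup>2\<bar> = (m - m') * (m + m')"
    proof -
      have "m'\<^sup>2 - m\<^sup>2 = - ((m - m') * (m + m'))" by (simp add: power2_eq_square algebra_simps)
      then show ?thesis using m(2) mp by (simp add: abs_mult)
    qed
    also have "\<dots> \<le> (n / K + 1) * (2 * n)" using m mp n K by (intro mult_mono) auto
    finally have d: "\<bar>m'\<^sup>2 - m\<^sup>2\<bar> \<le> (n / K + 1) * (2 * n)" .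
    have "\<bar>2 * H'\<bar> * \<bar>m'\<^sup>2 - m\<^sup>2\<bar> \<le> (2 * (R * n\<^sup>2)) * ((n / K + 1) * (2 * n))"
      using H d n K by (intro mult_mono) auto
    then show "\<bar>2 * H' * (m'\<^sup>2 - m\<^sup>2)\<bar> \<le> 2 * (R * n\<^sup>2) * ((n / K + 1) * (2 * n))" unfolding abs_mult by simp
    show "(n\<^sup>2 * t0\<^sup>2 / 4) * (n\<^sup>2 * t0\<^sup>2 / 4) \<le> m\<^sup>2 * m'\<^sup>2" using m2 m'2 m2p by (intro mult_mono) auto
  qed (use m2p in simp)
  also have "\<dots> = 64 * R * (1 / K + 1 / n) / t0^4"
    using n K t0 by (simp add: field_simps power2_eq_square power4_eq_xxxx)
  finally have 2: "\<bar>2 * H' * (m'\<^sup>2 - m\<^sup>2) / (m\<^sup>2 * m'\<^sup>2)\<bar> \<le> 64 * R * (1 / K + 1 / n) / t0^4" .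
  have eq: "2 * H / m\<^sup>2 - 2 * H' / m'\<^sup>2 = 2 * (H - H') / m\<^sup>2 + 2 * H' * (m'\<^sup>2 - m\<^sup>2) / (m\<^sup>2 * m'\<^sup>2)"
    using mp by (simp add: field_simps)
  show ?thesis unfolding eq by (rule order_trans[OF abs_triangle_ineq add_mono[OF 1 2]])
qed

section \<open>The limit process\<close>

definition limit_process :: "real \<Rightarrow> real \<Rightarrow> (real \<Rightarrow> real) \<Rightarrow> real" where
  "limit_process y t \<omega> = y / t + 2 * y / t\<^sup>2 * brownian (t\<^sup>2) \<omega>"

lemma limit_process_continuous: "0 < t0 \<Longrightarrow> continuous_on {t0..1} (\<lambda>t. limit_process y t \<omega>)"
  unfolding limit_process_def
  by (intro continuous_intros continuous_on_compose2[OF brownian_continuous]) auto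

lemma limit_process_gauss:
  assumes t0: "0 < t0" and F: "finite F" "F \<subseteq> {t0..1}"
  shows "gauss_rv gauss_space (\<lambda>\<omega>. \<Sum>t\<in>F. c t * limit_process y t \<omega>) (\<Sum>t\<in>F. c t * (y / t))
    (\<Sum>s\<in>F. \<Sum>t\<in>F. c s * c t * (4 * (y / max s t)\<^sup>2))"
proof -
  have F01: "t\<^sup>2 \<in> {0..1}" if "t \<in> F" for t
  proof -
    have "0 \<le> t" "t \<le> 1" using F t0 that by auto
    then show ?thesis by (simp add: power_le_one)
  qed
  have "gauss_rv gauss_space (\<lambda>\<omega>. (\<Sum>t\<in>F. c t * (y / t)) + 1 * (\<Sum>t\<in>F. (c t * (2 * y / t\<^sup>2)) * brownian (t\<^sup>2) \<omega>))
    ((\<Sum>t\<in>F. c t * (y / t)) + 1 * 0) (1\<^sup>2 * (\<Sum>s\<in>F. \<Sum>t\<in>F. (c s * (2 * y / s\<^sup>2)) * (c t * (2 * y / t\<^sup>2)) * min (s\<^sup>2) (t\<^sup>2)))"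
    by (intro gauss_rv_affine brownian_gauss F F01)
  moreover have "(c s * (2 * y / s\<^sup>2)) * (c t * (2 * y / t\<^sup>2)) * min (s\<^sup>2) (t\<^sup>2) = c s * c t * (4 * (y / max s t)\<^sup>2)"
    if st: "s \<in> F" "t \<in> F" for s t
  proof -
    have pos: "0 < s" "0 < t" using F t0 st by auto
    show ?thesis
    proof (cases "s \<le> t")
      case True
      then have "min (s\<^sup>2) (t\<^sup>2) = s\<^sup>2" using pos by (simp add: min_absorb1 power_mono)
      then show ?thesis using True pos by (simp add: max_absorb2 field_simps power2_eq_square)
    next
      case False
      then have "min (s\<^sup>2) (t\<^sup>2) = t\<^sup>2" using pos by (simp add: min_absorb2 power_mono)
      then show ?thesis using False pos by (simp add: max_absorb1 field_simps power2_eq_square)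
    qed
  qed
  then have "(\<Sum>s\<in>F. \<Sum>t\<in>F. (c s * (2 * y / s\<^sup>2)) * (c t * (2 * y / t\<^sup>2)) * min (s\<^sup>2) (t\<^sup>2))
      = (\<Sum>s\<in>F. \<Sum>t\<in>F. c s * c t * (4 * (y / max s t)\<^sup>2))" by (intro sum.cong refl)
  moreover have "(\<lambda>\<omega>. \<Sum>t\<in>F. c t * limit_process y t \<omega>)
      = (\<lambda>\<omega>. (\<Sum>t\<in>F. c t * (y / t)) + 1 * (\<Sum>t\<in>F. (c t * (2 * y / t\<^sup>2)) * brownian (t\<^sup>2) \<omega>))"
    by (simp add: limit_process_def distrib_left sum.distrib mult.assoc)
  ultimately show ?thesis by simp
qed

lemma limit_process_measurable[measurable]: "limit_process y t \<in> borel_measurable gauss_space"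
  unfolding limit_process_def[abs_def] by measurable

lemma limit_process_gaussian: "0 < t0 \<Longrightarrow> gaussian_process gauss_space {t0..1} (limit_process y)"
  unfolding gaussian_process_def
proof (intro conjI allI impI)
  show "prob_space gauss_space" by (rule prob_space_gauss_space)
  fix F c assume t0: "0 < t0" and F: "finite F \<and> F \<subseteq> {t0..1}"
  let ?v = "\<Sum>s\<in>F. \<Sum>t\<in>F. c s * c t * (4 * (y / max s t)\<^sup>2)"
  note g = limit_process_gauss[OF t0 conjunct1[OF F] conjunct2[OF F], of c y]
  have v: "0 \<le> ?v" using g by (simp add: gauss_rv_def)
  show "normal_rv gauss_space (\<lambda>\<omega>. \<Sum>t\<in>F. c t * limit_process y t \<omega>)"
    unfolding normal_rv_def
  proof (intro conjI exI)
    show "(\<lambda>\<omega>. \<Sum>t\<in>F. c t * limit_process y t \<omega>) \<in> borel_measurable gauss_space" by measurable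
    have "?v = 0 \<or> 0 < ?v" using v by linarith
    then show "sqrt ?v = 0 \<and> (AE \<omega> in gauss_space. (\<Sum>t\<in>F. c t * limit_process y t \<omega>) = (\<Sum>t\<in>F. c t * (y / t))) \<or>
      0 < sqrt ?v \<and> distributed gauss_space lborel (\<lambda>\<omega>. \<Sum>t\<in>F. c t * limit_process y t \<omega>)
        (\<lambda>z. ennreal (normal_density (\<Sum>t\<in>F. c t * (y / t)) (sqrt ?v) z))"
      using gauss_rv_normal[OF prob_space_gauss_space g] by (auto simp del: real_sqrt_eq_zero_cancel_iff)
  qed
qed

lemma limit_process_mean:
  assumes "0 < t0" "t \<in> {t0..1}"
  shows "(LINT \<eta>|gauss_space. limit_process y t \<eta>) = y / t" "integrable gauss_space (limit_process y t)"
proof -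
  have "gauss_rv gauss_space (\<lambda>\<omega>. \<Sum>t\<in>{t}. 1 * limit_process y t \<omega>) (\<Sum>t\<in>{t}. 1 * (y / t))
    (\<Sum>s\<in>{t}. \<Sum>t\<in>{t}. 1 * 1 * (4 * (y / max s t)\<^sup>2))"
    by (rule limit_process_gauss[OF assms(1)]) (use assms in auto)
  then have "gauss_rv gauss_space (\<lambda>\<omega>. limit_process y t \<omega>) (y / t) (4 * (y / t)\<^sup>2)" by simp
  from gauss_rv_moments[OF prob_space_gauss_space this]
  show "(LINT \<eta>|gauss_space. limit_process y t \<eta>) = y / t" "integrable gauss_space (limit_process y t)" by auto
qed

text \<open>Polarisation: the product is recovered from the second moments of the two variables and
  of their sum. The case s = t is separate because the index set {s, t} then has one
  element.\<close>

lemma limit_process_covariance: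
  assumes t0: "0 < t0" and st: "s \<in> {t0..1}" "t \<in> {t0..1}"
  shows "covariance gauss_space (limit_process y s) (limit_process y t) = 4 * (y / max s t)\<^sup>2"
proof -
  interpret prob_space gauss_space by (rule prob_space_gauss_space)
  have pair: "gauss_rv gauss_space (\<lambda>\<omega>. limit_process y s \<omega> + limit_process y t \<omega>) (y / s + y / t)
     (4 * (y / s)\<^sup>2 + 4 * (y / t)\<^sup>2 + 8 * (y / max s t)\<^sup>2)"
  proof (cases "s = t")
    case True
    have "gauss_rv gauss_space (\<lambda>\<omega>. \<Sum>t\<in>{t}. 2 * limit_process y t \<omega>) (\<Sum>t\<in>{t}. 2 * (y / t))
      (\<Sum>s\<in>{t}. \<Sum>t\<in>{t}. 2 * 2 * (4 * (y / max s t)\<^sup>2))"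
      by (rule limit_process_gauss[OF t0]) (use st in auto)
    moreover have "limit_process y s \<omega> + limit_process y t \<omega> = 2 * limit_process y t \<omega>" for \<omega> using True by simp
    ultimately show ?thesis using True by simp
  next
    case False
    have "gauss_rv gauss_space (\<lambda>\<omega>. \<Sum>t\<in>{s, t}. 1 * limit_process y t \<omega>) (\<Sum>t\<in>{s, t}. 1 * (y / t))
      (\<Sum>s'\<in>{s, t}. \<Sum>t\<in>{s, t}. 1 * 1 * (4 * (y / max s' t)\<^sup>2))"
      by (rule limit_process_gauss[OF t0]) (use st in auto)
    then show ?thesis using False by (simp add: max.commute[of t s] add_ac)
  qed
  have single: "gauss_rv gauss_space (limit_process y u) (y / u) (4 * (y / u)\<^sup>2)" if "u \<in> {t0..1}" for u
  proof -
    have "gauss_rv gauss_space (\<lambda>\<omega>. \<Sum>t\<in>{u}. 1 * limit_process y t \<omega>) (\<Sum>t\<in>{u}. 1 * (y / t))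
      (\<Sum>s\<in>{u}. \<Sum>t\<in>{u}. 1 * 1 * (4 * (y / max s t)\<^sup>2))"
      by (rule limit_process_gauss[OF t0]) (use that in auto)
    then show ?thesis by simp
  qed
  note ms = gauss_rv_moments[OF prob_space_gauss_space single[OF st(1)]]
  note mt = gauss_rv_moments[OF prob_space_gauss_space single[OF st(2)]]
  note mp = gauss_rv_moments[OF prob_space_gauss_space pair]
  let ?X = "limit_process y s" and ?Y = "limit_process y t"
  have prod: "?X \<omega> * ?Y \<omega> = ((?X \<omega> + ?Y \<omega>)\<^sup>2 - (?X \<omega>)\<^sup>2 - (?Y \<omega>)\<^sup>2) / 2" for \<omega>
    by (simp add: power2_eq_square algebra_simps)
  have i: "integrable gauss_space (\<lambda>\<omega>. ?X \<omega> * ?Y \<omega>)" unfolding prod using ms mt mp by simp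
  have E: "expectation (\<lambda>\<omega>. ?X \<omega> * ?Y \<omega>) = y / s * (y / t) + 4 * (y / max s t)\<^sup>2"
  proof -
    have "expectation (\<lambda>\<omega>. ((?X \<omega> + ?Y \<omega>)\<^sup>2 - (?X \<omega>)\<^sup>2 - (?Y \<omega>)\<^sup>2) / 2)
      = (expectation (\<lambda>\<omega>. (?X \<omega> + ?Y \<omega>)\<^sup>2) - expectation (\<lambda>\<omega>. (?X \<omega>)\<^sup>2) - expectation (\<lambda>\<omega>. (?Y \<omega>)\<^sup>2)) / 2"
      using ms(2) mt(2) mp(2) by simp
    also have "\<dots> = y / s * (y / t) + 4 * (y / max s t)\<^sup>2"
      unfolding ms(4) mt(4) mp(4) by (simp add: power2_sum)
    finally show ?thesis unfolding prod .
  qed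
  have "covariance gauss_space ?X ?Y = expectation (\<lambda>\<omega>. ?X \<omega> * ?Y \<omega> - y / t * ?X \<omega> - y / s * ?Y \<omega> + y / s * (y / t))"
    unfolding covariance_def ms(3) mt(3) by (intro Bochner_Integration.integral_cong) (simp_all add: algebra_simps)
  also have "\<dots> = expectation (\<lambda>\<omega>. ?X \<omega> * ?Y \<omega>) - y / t * (y / s) - y / s * (y / t) + y / s * (y / t)"
    using i ms mt prob_space by simp
  finally show ?thesis unfolding E by simp
qed

section \<open>Scaled estimates when p is at most a constant times n\<close>

context std_array
begin

text \<open>Doob's bound in units of n^2. The square of k / n leaves a factor 1 / K after a union
  over about K blocks of length of order n / K.\<close>

lemma H_increments:
  assumes n: "0 < n" and r: "0 < r" and m: "m1 + k \<le> n" and P: "real p \<le> P * real n"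
  shows "prob {\<omega>\<in>space M. \<exists>i\<le>k. r * (real n)\<^sup>2 \<le> \<bar>H (m1 + i) \<omega> - H m1 \<omega>\<bar>} \<le> (16 * Ch * P\<^sup>2)\<^sup>2 * (real k / real n)\<^sup>2 / r^4"
    (is "prob ?A \<le> _")
proof -
  have l: "0 < r * (real n)\<^sup>2" using n r by simp
  have p2: "(real p)\<^sup>2 \<le> P\<^sup>2 * (real n)\<^sup>2" using power_mono[OF P, of 2] by (simp add: power_mult_distrib)
  have "(r * (real n)\<^sup>2)^4 * prob ?A \<le> (16 * (real k * (real n * (Ch * (real p)\<^sup>2))))\<^sup>2"
    by (rule H_maximal(2)[OF l m])
  also have "\<dots> \<le> (16 * (real k * (real n * (Ch * (P\<^sup>2 * (real n)\<^sup>2)))))\<^sup>2"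
    using Ch_nonneg by (intro power_mono mult_left_mono p2) auto
  also have "\<dots> = (r * (real n)\<^sup>2)^4 * ((16 * Ch * P\<^sup>2)\<^sup>2 * (real k / real n)\<^sup>2 / r^4)"
    using n r by (simp add: field_simps power2_eq_square power4_eq_xxxx)
  finally show ?thesis by (rule mult_left_le_imp_le) (use n r in simp)
qed

lemma H_uniform:
  assumes n: "0 < n" and r: "0 < r" and P: "real p \<le> P * real n"
  shows "{\<omega>\<in>space M. \<exists>i\<le>n. r * (real n)\<^sup>2 \<le> \<bar>H i \<omega>\<bar>} \<in> events"
    "prob {\<omega>\<in>space M. \<exists>i\<le>n. r * (real n)\<^sup>2 \<le> \<bar>H i \<omega>\<bar>} \<le> (16 * Ch * P\<^sup>2)\<^sup>2 / r^4"
proof -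
  have l: "0 < r * (real n)\<^sup>2" using n r by simp
  have H0: "H 0 \<omega> = 0" for \<omega> by (simp add: H_def)
  have m: "0 + n \<le> n" by simp
  have e: "(real n / real n)\<^sup>2 = 1" using n by simp
  show "{\<omega>\<in>space M. \<exists>i\<le>n. r * (real n)\<^sup>2 \<le> \<bar>H i \<omega>\<bar>} \<in> events"
    by (rule H_maximal(1)[OF l m, unfolded H0 add_0 diff_zero])
  show "prob {\<omega>\<in>space M. \<exists>i\<le>n. r * (real n)\<^sup>2 \<le> \<bar>H i \<omega>\<bar>} \<le> (16 * Ch * P\<^sup>2)\<^sup>2 / r^4"
    by (rule H_increments[OF n r m P, unfolded H0 add_0 diff_zero e mult_1_right])
qed

lemma aa_uniform:
  assumes n: "0 < n" and r: "0 < r" and P: "real p \<le> P * real n"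
  shows "prob {\<omega>\<in>space M. \<exists>i\<le>n. r * real n \<le> \<bar>aa i \<omega>\<bar>} \<le> (16 * P * k1)\<^sup>2 / r^4" (is "prob ?A \<le> _")
proof -
  have l: "0 < r * real n" using n r by simp
  have "(r * real n)^4 * prob ?A \<le> (16 * (real n * (real p * k1)))\<^sup>2"
    by (rule aa_maximal(2)[OF l])
  also have "\<dots> \<le> (16 * (real n * ((P * real n) * k1)))\<^sup>2"
    using k1 by (intro power_mono mult_left_mono mult_right_mono P) auto
  also have "\<dots> = (r * real n)^4 * ((16 * P * k1)\<^sup>2 / r^4)"
    using n r by (simp add: field_simps power2_eq_square power4_eq_xxxx)
  finally show ?thesis by (rule mult_left_le_imp_le) (use n r in simp)
qed

lemma BB_uniform:
  assumes n: "0 < n" and r: "0 < r" and P: "real p \<le> P * real n"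
  shows "prob {\<omega>\<in>space M. \<exists>i\<le>n. r * (real n * sqrt (real n)) \<le> \<bar>BB i \<omega>\<bar>} \<le> (4 * P * k1)\<^sup>2 / r\<^sup>2" (is "prob ?A \<le> _")
proof -
  have l: "0 < r * (real n * sqrt (real n))" using n r by simp
  have "(r * (real n * sqrt (real n)))\<^sup>2 * prob ?A \<le> real n * (4 * (real p * k1))\<^sup>2"
    by (rule BB_maximal(2)[OF l])
  also have "\<dots> \<le> real n * (4 * ((P * real n) * k1))\<^sup>2"
    using k1 by (intro power_mono mult_left_mono mult_right_mono P) auto
  also have "\<dots> = (r * (real n * sqrt (real n)))\<^sup>2 * ((4 * P * k1)\<^sup>2 / r\<^sup>2)"
    using n r by (simp add: field_simps power2_eq_square)
  finally show ?thesis by (rule mult_left_le_imp_le) (use n r in simp)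
qed

lemma KV_le:
  assumes P: "real p \<le> P * real n" "0 \<le> P"
  shows "KV \<le> (16 * P * sqrt Ch + 16 * P * sqrt (P * k1) + 8 * P * k1) * (real n)\<^sup>2"
proof -
  have s1: "sqrt (16 * (real n * (real n * (Ch * (real p)\<^sup>2)))) = 4 * real n * real p * sqrt Ch"
    by (simp add: real_sqrt_mult power2_eq_square)
  have s2: "sqrt (16 * (real n * (real p * k1))) \<le> 4 * real n * sqrt (P * k1)"
  proof -
    have "sqrt (16 * (real n * (real p * k1))) \<le> sqrt (16 * (real n * ((P * real n) * k1)))"
      using k1 by (intro real_sqrt_le_mono mult_left_mono mult_right_mono P) auto
    also have "16 * (real n * ((P * real n) * k1)) = (4 * real n)\<^sup>2 * (P * k1)" by (simp add: power2_eq_square)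
    also have "sqrt ((4 * real n)\<^sup>2 * (P * k1)) = 4 * real n * sqrt (P * k1)"
      unfolding real_sqrt_mult[of "(4 * real n)\<^sup>2"] real_sqrt_abs by simp
    finally show ?thesis .
  qed
  have s3: "sqrt (real n * (4 * (real p * k1))\<^sup>2) \<le> 4 * P * k1 * (real n)\<^sup>2"
  proof -
    have "sqrt (real n * (4 * (real p * k1))\<^sup>2) = sqrt (real n) * (4 * (real p * k1))"
      using k1 by (simp add: real_sqrt_mult)
    also have "\<dots> \<le> real n * (4 * ((P * real n) * k1))"
    proof (rule mult_mono)
      show "sqrt (real n) \<le> real n"
      proof (cases "n = 0")
        case False
        then have "sqrt (real n) * 1 \<le> sqrt (real n) * sqrt (real n)" by (intro mult_left_mono) auto
        then show ?thesis by simp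
      qed simp
    qed (use k1 P in \<open>auto intro!: mult_right_mono\<close>)
    finally show ?thesis by (simp add: power2_eq_square mult_ac)
  qed
  have "KV \<le> 4 * (4 * real n * (P * real n) * sqrt Ch) + 4 * (P * real n) * (4 * real n * sqrt (P * k1)) + 2 * (4 * P * k1 * (real n)\<^sup>2)"
    unfolding KV_def s1
  proof (intro add_mono)
    show "4 * (4 * real n * real p * sqrt Ch) \<le> 4 * (4 * real n * (P * real n) * sqrt Ch)"
      using Ch_nonneg by (intro mult_left_mono mult_right_mono P) auto
    show "4 * real p * sqrt (16 * (real n * (real p * k1))) \<le> 4 * (P * real n) * (4 * real n * sqrt (P * k1))"
      using P k1 by (intro mult_mono s2) auto
    show "2 * sqrt (real n * (4 * (real p * k1))\<^sup>2) \<le> 2 * (4 * P * k1 * (real n)\<^sup>2)" using s3 by simp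
  qed
  also have "\<dots> = (16 * P * sqrt Ch + 16 * P * sqrt (P * k1) + 8 * P * k1) * (real n)\<^sup>2"
    by (simp add: power2_eq_square algebra_simps)
  finally show ?thesis .
qed

text \<open>The growth quadratic in m is the source of the clock t^2.\<close>

lemma sum_sv: "(\<Sum>j<m. sv j) = real m * (real m - 1) * ((real p)\<^sup>2 + real p)"
proof -
  have "(\<Sum>j<m. 2 * real j) = real m * (real m - 1)" by (induction m) (auto simp: algebra_simps)
  then show ?thesis unfolding sv_def sum_distrib_right[symmetric] by simp
qed

text \<open>A combination of values of \<open>H\<close> is a single sum of increments:
  \<open>xi j\<close> receives the total weight of the times t with j < m t. In the square of this
  weight two indicators multiply to that of the minimum, which yields the double sum. Weights of
  order n^-2 make the error of order n^(-1/2).\<close>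

lemma H_clt:
  assumes F: "finite F" and m: "\<And>t. t \<in> F \<Longrightarrow> m t \<le> n" and n: "0 < n"
    and P: "real p \<le> P * real n" "0 \<le> P" and C: "0 \<le> C" "(\<Sum>t\<in>F. \<bar>b t\<bar>) \<le> C / (real n)\<^sup>2"
  shows "\<bar>expectation (\<lambda>\<omega>. cos ((\<Sum>t\<in>F. b t * H (m t) \<omega>) + \<alpha>))
      - exp (- (\<Sum>s\<in>F. \<Sum>t\<in>F. b s * b t * (real (min (m s) (m t)) * (real (min (m s) (m t)) - 1) * ((real p)\<^sup>2 + real p))) / 2) * cos \<alpha>\<bar>
    \<le> C\<^sup>2 / 2 * (16 * P * sqrt Ch + 16 * P * sqrt (P * k1) + 8 * P * k1) * (1 / real n)
      + C ^ 3 / 6 * (4 * Ch * P\<^sup>2 * sqrt (4 * Ch * P\<^sup>2)) * (1 / sqrt (real n))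
      + (C\<^sup>2 * (P\<^sup>2 + P))\<^sup>2 * (1 / real n)"
proof -
  define d where "d j = (\<Sum>t\<in>F. b t * (if j < m t then 1 else 0))" for j
  define D where "D = C / (real n)\<^sup>2"
  have dD: "\<bar>d j\<bar> \<le> D" for j
  proof -
    have "\<bar>d j\<bar> \<le> (\<Sum>t\<in>F. \<bar>b t * (if j < m t then 1 else 0)\<bar>)" unfolding d_def by (rule sum_abs)
    also have "\<dots> \<le> (\<Sum>t\<in>F. \<bar>b t\<bar>)" by (intro sum_mono) auto
    finally show ?thesis using C(2) by (simp add: D_def)
  qed
  have cut: "(\<Sum>j<n. (if j < k then 1 else 0) * f j) = (\<Sum>j<k. f j)" if "k \<le> n" for k and f :: "nat \<Rightarrow> real"
  proof -
    have "(\<Sum>j<k. f j) = (\<Sum>j<k. (if j < k then 1 else 0) * f j)" by (intro sum.cong) auto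
    also have "\<dots> = (\<Sum>j<n. (if j < k then 1 else 0) * f j)"
      by (rule sum.mono_neutral_left) (use that in auto)
    finally show ?thesis by simp
  qed
  have S: "(\<Sum>j<n. d j * xi j \<omega>) = (\<Sum>t\<in>F. b t * H (m t) \<omega>)" for \<omega>
  proof -
    have "(\<Sum>j<n. d j * xi j \<omega>) = (\<Sum>j<n. \<Sum>t\<in>F. b t * ((if j < m t then 1 else 0) * xi j \<omega>))"
      unfolding d_def sum_distrib_right by (intro sum.cong refl) (simp only: mult.assoc)
    also have "\<dots> = (\<Sum>t\<in>F. \<Sum>j<n. b t * ((if j < m t then 1 else 0) * xi j \<omega>))" by (rule sum.swap)
    also have "\<dots> = (\<Sum>t\<in>F. b t * H (m t) \<omega>)"
      unfolding sum_distrib_left[symmetric] H_def by (intro sum.cong refl) (simp only: cut m)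
    finally show ?thesis .
  qed
  have v: "(\<Sum>j<n. (d j)\<^sup>2 * sv j) = (\<Sum>s\<in>F. \<Sum>t\<in>F. b s * b t * (real (min (m s) (m t)) * (real (min (m s) (m t)) - 1) * ((real p)\<^sup>2 + real p)))"
  proof -
    have ind: "(if j < k then 1 else 0 :: real) * (if j < l then 1 else 0) = (if j < min k l then 1 else 0)" for j k l :: nat by simp
    have "(d j)\<^sup>2 * sv j = (\<Sum>s\<in>F. \<Sum>t\<in>F. b s * b t * ((if j < min (m s) (m t) then 1 else 0) * sv j))" for j
    proof -
      have "(d j)\<^sup>2 = (\<Sum>s\<in>F. \<Sum>t\<in>F. b s * b t * (if j < min (m s) (m t) then 1 else 0))"
        unfolding d_def power2_eq_square sum_product ind[symmetric]
        by (intro sum.cong refl) (simp only: mult_ac)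
      then show ?thesis by (simp only: sum_distrib_right mult.assoc)
    qed
    then have "(\<Sum>j<n. (d j)\<^sup>2 * sv j) = (\<Sum>j<n. \<Sum>s\<in>F. \<Sum>t\<in>F. b s * b t * ((if j < min (m s) (m t) then 1 else 0) * sv j))"
      by simp
    also have "\<dots> = (\<Sum>s\<in>F. \<Sum>j<n. \<Sum>t\<in>F. b s * b t * ((if j < min (m s) (m t) then 1 else 0) * sv j))"
      by (rule sum.swap)
    also have "\<dots> = (\<Sum>s\<in>F. \<Sum>t\<in>F. \<Sum>j<n. b s * b t * ((if j < min (m s) (m t) then 1 else 0) * sv j))"
      by (intro sum.cong refl sum.swap)
    also have "\<dots> = (\<Sum>s\<in>F. \<Sum>t\<in>F. b s * b t * (\<Sum>j<min (m s) (m t). sv j))"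
      unfolding sum_distrib_left[symmetric]
    proof (intro sum.cong refl)
      fix s t assume "s \<in> F" "t \<in> F"
      then have "min (m s) (m t) \<le> n" using m[of s] by simp
      then show "b s * b t * (\<Sum>j<n. (if j < min (m s) (m t) then 1 else 0) * sv j) = b s * b t * (\<Sum>j<min (m s) (m t). sv j)"
        by (simp only: cut)
    qed
    finally show ?thesis unfolding sum_sv .
  qed
  define c where "c = 4 * Ch * P\<^sup>2"
  have c0: "0 \<le> c" using Ch_nonneg by (simp add: c_def)
  have p2: "(real p)\<^sup>2 \<le> P\<^sup>2 * (real n)\<^sup>2" using power_mono[OF P(1), of 2] by (simp add: power_mult_distrib)
  have D0: "0 \<le> D" using C by (simp add: D_def)
  have KV0: "0 \<le> KV" using Ch_nonneg k1 by (simp add: KV_def)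
  have q0: "0 \<le> 4 * (real n * (Ch * (real p)\<^sup>2))" using Ch_nonneg by simp
  have "4 * (real n * (Ch * (real p)\<^sup>2)) \<le> 4 * (real n * (Ch * (P\<^sup>2 * (real n)\<^sup>2)))"
    using Ch_nonneg by (intro mult_left_mono p2) auto
  also have "\<dots> = c * real n ^ 3" by (simp add: c_def power3_eq_cube power2_eq_square)
  finally have q: "4 * (real n * (Ch * (real p)\<^sup>2)) \<le> c * real n ^ 3" .
  have "\<bar>expectation (\<lambda>\<omega>. cos ((\<Sum>j<n. d j * xi j \<omega>) + \<alpha>)) - exp (- (\<Sum>j<n. (d j)\<^sup>2 * sv j) / 2) * cos \<alpha>\<bar>
    \<le> real n * (D\<^sup>2 / 2 * KV + D ^ 3 / 6 * (4 * (real n * (Ch * (real p)\<^sup>2)) * sqrt (4 * (real n * (Ch * (real p)\<^sup>2))))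
        + (D\<^sup>2 * (real n * ((real p)\<^sup>2 + real p)))\<^sup>2)"
    by (rule clt[OF dD])
  also have "\<dots> \<le> real n * (D\<^sup>2 / 2 * ((16 * P * sqrt Ch + 16 * P * sqrt (P * k1) + 8 * P * k1) * (real n)\<^sup>2)
      + D ^ 3 / 6 * (c * real n ^ 3 * sqrt (c * real n ^ 3)) + (D\<^sup>2 * (real n * ((P\<^sup>2 + P) * (real n)\<^sup>2)))\<^sup>2)"
  proof (intro mult_left_mono add_mono)
    show "KV \<le> (16 * P * sqrt Ch + 16 * P * sqrt (P * k1) + 8 * P * k1) * (real n)\<^sup>2" by (rule KV_le[OF P])
    show "4 * (real n * (Ch * (real p)\<^sup>2)) * sqrt (4 * (real n * (Ch * (real p)\<^sup>2))) \<le> c * real n ^ 3 * sqrt (c * real n ^ 3)"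
      by (rule mult_mono[OF q real_sqrt_le_mono[OF q]]) (use c0 Ch_nonneg in auto)
    show "(D\<^sup>2 * (real n * ((real p)\<^sup>2 + real p)))\<^sup>2 \<le> (D\<^sup>2 * (real n * ((P\<^sup>2 + P) * (real n)\<^sup>2)))\<^sup>2"
    proof (intro power_mono mult_left_mono)
      have "real n \<le> (real n)\<^sup>2" using n by (simp add: power2_eq_square)
      then have "P * real n \<le> P * (real n)\<^sup>2" using P by (intro mult_left_mono) auto
      then show "(real p)\<^sup>2 + real p \<le> (P\<^sup>2 + P) * (real n)\<^sup>2" using p2 P(1) by (simp add: distrib_right)
    qed auto
  qed (use D0 in auto)
  also have "\<dots> = C\<^sup>2 / 2 * (16 * P * sqrt Ch + 16 * P * sqrt (P * k1) + 8 * P * k1) * (1 / real n)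
      + C ^ 3 / 6 * (c * sqrt c) * (1 / sqrt (real n))
      + (C\<^sup>2 * (P\<^sup>2 + P))\<^sup>2 * (1 / real n)"
  proof -
    define N where "N = real n"
    have N: "0 < N" using n by (simp add: N_def)
    have sq: "sqrt (c * N ^ 3) = sqrt c * (N * sqrt N)"
      using N by (simp add: real_sqrt_mult power3_eq_cube)
    have e1: "N * (D\<^sup>2 / 2 * (k * N\<^sup>2)) = C\<^sup>2 / 2 * k * (1 / N)" for k
      using N unfolding D_def N_def[symmetric] by (simp add: field_simps power2_eq_square)
    have e2: "N * (D ^ 3 / 6 * (c * N ^ 3 * sqrt (c * N ^ 3))) = C ^ 3 / 6 * (c * sqrt c) * (1 / sqrt N)"
    proof -
      have "N * (D ^ 3 / 6 * (c * N ^ 3 * sqrt (c * N ^ 3))) = C ^ 3 / 6 * (c * sqrt c) * (sqrt N / N)"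
        using N unfolding sq D_def N_def[symmetric] by (simp add: field_simps power2_eq_square power3_eq_cube)
      also have "sqrt N / N = 1 / sqrt N" by (simp only: sqrt_divide_self_eq[OF less_imp_le[OF N]] inverse_eq_divide)
      finally show ?thesis .
    qed
    have e3: "N * (D\<^sup>2 * (N * (k * N\<^sup>2)))\<^sup>2 = (C\<^sup>2 * k)\<^sup>2 * (1 / N)" for k
      using N unfolding D_def N_def[symmetric] by (simp add: field_simps power2_eq_square)
    show ?thesis unfolding N_def[symmetric] distrib_left e1 e2 e3 by simp
  qed
  finally show ?thesis unfolding S v c_def .
qed

end

section \<open>Convergence of the sequential statistic\<close>

locale array_sequence =
  fixes M :: "nat \<Rightarrow> 'a measure" and x :: "nat \<Rightarrow> nat \<Rightarrow> nat \<Rightarrow> 'a \<Rightarrow> real" and p :: "nat \<Rightarrow> nat"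
    and \<kappa> y t0 :: real
  assumes array: "\<And>n. std_array (M n) (x n) (p n) n \<kappa>"
    and y: "0 < y" and ratio: "(\<lambda>n. real (p n) / real n) \<longlonglongrightarrow> y"
    and t0: "0 < t0" "t0 \<le> 1"
begin

sublocale A: std_array "M n" "x n" "p n" n \<kappa> for n
  by (rule array)

definition idx :: "nat \<Rightarrow> real \<Rightarrow> nat" where
  "idx n t = nat \<lfloor>real n * t\<rfloor>"

text \<open>The leading part of the scaled statistic. It does not involve the default value, and so
  is measurable where the statistic need not be.\<close>

definition Y :: "nat \<Rightarrow> real \<Rightarrow> 'a \<Rightarrow> real" where
  "Y n t \<omega> = 2 * A.H n (idx n t) \<omega> / (real (idx n t))\<^sup>2 + y / t"

lemma idx_le: "t \<in> {t0..1} \<Longrightarrow> idx n t \<le> n"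
  unfolding idx_def using step_index[OF t0(1)] by blast

lemma idx_floor:
  assumes "0 \<le> t"
  shows "real (idx n t) \<le> real n * t" "real n * t \<le> real (idx n t) + 1"
proof -
  have "0 \<le> real n * t" using assms by simp
  then have "real (idx n t) = of_int \<lfloor>real n * t\<rfloor>" by (simp add: idx_def)
  then show "real (idx n t) \<le> real n * t" "real n * t \<le> real (idx n t) + 1" by linarith+
qed

lemma idx_mono: "s \<le> t \<Longrightarrow> idx n s \<le> idx n t"
  unfolding idx_def by (intro nat_mono floor_mono mult_left_mono) auto

lemma idx_lower:
  assumes t: "t \<in> {t0..1}" and n: "2 / t0 \<le> real n"
  shows "real n * t0 / 2 \<le> real (idx n t)"
proof -
  have "1 \<le> real n * t0 / 2" using n t0 by (simp add: field_simps)
  moreover have "real n * t0 \<le> real n * t" using t by (intro mult_left_mono) auto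
  ultimately show ?thesis using idx_floor(2)[of t n] t t0 by simp
qed

lemma idx_limit:
  assumes t: "0 \<le> t"
  shows "(\<lambda>n. real (idx n t) / real n) \<longlonglongrightarrow> t"
proof -
  have "(\<lambda>n. real (idx n t) / real n - t) \<longlonglongrightarrow> 0"
  proof (rule Lim_null_comparison)
    show "\<forall>\<^sub>F n in sequentially. norm (real (idx n t) / real n - t) \<le> 1 / real n"
      using eventually_gt_at_top[of 0]
    proof eventually_elim
      case (elim n)
      have "real (idx n t) / real n - t = (real (idx n t) - real n * t) / real n" using elim by (simp add: field_simps)
      moreover have "\<bar>real (idx n t) - real n * t\<bar> \<le> 1" using idx_floor[OF t, of n] by linarith
      ultimately show ?case using elim by (simp add: divide_right_mono)
    qed
    show "(\<lambda>n. 1 / real n) \<longlonglongrightarrow> 0" by real_asymp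
  qed
  then show ?thesis by (simp add: LIM_zero_iff)
qed

lemma large:
  "\<forall>\<^sub>F n in sequentially. 0 < n \<and> 2 / t0 \<le> real n \<and> real n * y / 2 \<le> real (p n) \<and> real (p n) \<le> 2 * y * real n"
proof -
  have "\<forall>\<^sub>F n in sequentially. y / 2 < real (p n) / real n" "\<forall>\<^sub>F n in sequentially. real (p n) / real n < 2 * y"
    using y by (intro order_tendstoD[OF ratio]; simp)+
  moreover have "\<forall>\<^sub>F n in sequentially. 2 / t0 \<le> real n"
    using filterlim_real_sequentially by (simp add: filterlim_at_top)
  ultimately show ?thesis using eventually_gt_at_top[of 0]
  proof eventually_elim
    case (elim n)
    then show ?case by (auto simp: field_simps)
  qed
qed

lemma H_M: "t \<in> {t0..1} \<Longrightarrow> A.H n (idx n t) \<in> borel_measurable (M n)"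
  using A.G_M[OF A.H_rows[OF order_refl] A.rows_subset] idx_le by auto

lemma Y_M: "t \<in> {t0..1} \<Longrightarrow> Y n t \<in> borel_measurable (M n)"
  unfolding Y_def[abs_def] using H_M by simp

text \<open>Numerator and denominator both scale like n^4. After division by that power, the indices
  over n tend to the times, p / n tends to y, and the lower-order corrections carry a factor 1 /
  n.\<close>

lemma covariance_limit:
  assumes s: "0 < s" and t: "0 < t"
  shows "(\<lambda>n. 2 / (real (idx n s))\<^sup>2 * (2 / (real (idx n t))\<^sup>2)
      * (real (min (idx n s) (idx n t)) * (real (min (idx n s) (idx n t)) - 1) * ((real (p n))\<^sup>2 + real (p n))))
    \<longlonglongrightarrow> 4 * (y / max s t)\<^sup>2"
proof -
  define \<mu> where "\<mu> n = idx n (min s t)" for n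
  have mu: "min (idx n s) (idx n t) = \<mu> n" for n
    using idx_mono[of s t n] idx_mono[of t s n] unfolding \<mu>_def by (cases "s \<le> t") (auto simp: min_def)
  have i0: "(\<lambda>n. 1 / real n) \<longlonglongrightarrow> 0" by real_asymp
  have "(\<lambda>n. 4 * ((real (\<mu> n) / real n) * (real (\<mu> n) / real n - 1 / real n) * ((real (p n) / real n)\<^sup>2 + real (p n) / real n * (1 / real n)))
      / ((real (idx n s) / real n)\<^sup>2 * (real (idx n t) / real n)\<^sup>2))
    \<longlonglongrightarrow> 4 * (min s t * (min s t - 0) * (y\<^sup>2 + y * 0)) / (s\<^sup>2 * t\<^sup>2)"
    unfolding \<mu>_def using s t by (intro tendsto_intros idx_limit ratio i0) auto
  moreover have "4 * (min s t * (min s t - 0) * (y\<^sup>2 + y * 0)) / (s\<^sup>2 * t\<^sup>2) = 4 * (y / max s t)\<^sup>2"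
    using s t by (cases "s \<le> t") (auto simp: min_def max_def power2_eq_square field_simps)
  moreover have "\<forall>\<^sub>F n in sequentially. 4 * ((real (\<mu> n) / real n) * (real (\<mu> n) / real n - 1 / real n) * ((real (p n) / real n)\<^sup>2 + real (p n) / real n * (1 / real n)))
      / ((real (idx n s) / real n)\<^sup>2 * (real (idx n t) / real n)\<^sup>2)
    = 2 / (real (idx n s))\<^sup>2 * (2 / (real (idx n t))\<^sup>2)
      * (real (\<mu> n) * (real (\<mu> n) - 1) * ((real (p n))\<^sup>2 + real (p n)))"
    using eventually_gt_at_top[of 0]
  proof eventually_elim
    case (elim n)
    define N where "N = real n"
    have N: "0 < N" using elim by (simp add: N_def)
    have "4 * ((m / N) * (m / N - 1 / N) * ((q / N)\<^sup>2 + q / N * (1 / N))) / ((a / N)\<^sup>2 * (b / N)\<^sup>2)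
      = 2 / a\<^sup>2 * (2 / b\<^sup>2) * (m * (m - 1) * (q\<^sup>2 + q))" for m q a b :: real
    proof -
      have e1: "(m / N) * (m / N - 1 / N) * ((q / N)\<^sup>2 + q / N * (1 / N)) = (m * (m - 1) * (q\<^sup>2 + q)) / N^4"
        using N by (simp add: power4_eq_xxxx power2_eq_square diff_divide_distrib[symmetric] add_divide_distrib[symmetric])
      have e2: "(a / N)\<^sup>2 * (b / N)\<^sup>2 = (a\<^sup>2 * b\<^sup>2) / N^4"
        by (simp add: power4_eq_xxxx power2_eq_square)
      show ?thesis unfolding e1 e2 using N by simp
    qed
    then show ?case unfolding N_def by blast
  qed
  ultimately show ?thesis unfolding mu by (auto elim: Lim_transform_eventually)
qed

lemma finite_dimensional:
  assumes F: "finite F" "F \<subseteq> {t0..1}"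
  shows "(\<lambda>n. LINT \<omega>|M n. cos ((\<Sum>t\<in>F. c t * Y n t \<omega>) + \<alpha>))
    \<longlonglongrightarrow> (LINT \<omega>|gauss_space. cos ((\<Sum>t\<in>F. c t * limit_process y t \<omega>) + \<alpha>))"
proof -
  define \<beta> where "\<beta> = (\<Sum>t\<in>F. c t * (y / t)) + \<alpha>"
  define v where "v = (\<Sum>s\<in>F. \<Sum>t\<in>F. c s * c t * (4 * (y / max s t)\<^sup>2))"
  have lim: "(LINT \<omega>|gauss_space. cos ((\<Sum>t\<in>F. c t * limit_process y t \<omega>) + \<alpha>)) = exp (- v / 2) * cos \<beta>"
  proof -
    note g = limit_process_gauss[OF t0(1) F, of c y]
    have "(LINT \<omega>|gauss_space. cos (1 * (\<Sum>t\<in>F. c t * limit_process y t \<omega>) + \<alpha>)) = exp (- v * 1\<^sup>2 / 2) * cos (1 * (\<Sum>t\<in>F. c t * (y / t)) + \<alpha>)"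
      using g unfolding gauss_rv_def v_def by blast
    then show ?thesis by (simp add: \<beta>_def)
  qed
  define b where "b n t = c t * (2 / (real (idx n t))\<^sup>2)" for n t
  define w where "w n = (\<Sum>s\<in>F. \<Sum>t\<in>F. b n s * b n t
    * (real (min (idx n s) (idx n t)) * (real (min (idx n s) (idx n t)) - 1) * ((real (p n))\<^sup>2 + real (p n))))" for n
  have wv: "w \<longlonglongrightarrow> v"
    unfolding w_def[abs_def] v_def
  proof (intro tendsto_sum)
    fix s t assume "s \<in> F" "t \<in> F"
    then have st: "0 < s" "0 < t" using F t0 by auto
    show "(\<lambda>n. b n s * b n t * (real (min (idx n s) (idx n t)) * (real (min (idx n s) (idx n t)) - 1) * ((real (p n))\<^sup>2 + real (p n))))
      \<longlonglongrightarrow> c s * c t * (4 * (y / max s t)\<^sup>2)"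
      using tendsto_mult_left[OF covariance_limit[OF st], of "c s * c t"] by (simp only: b_def mult_ac)
  qed
  \<comment> \<open>For large n the index is at least n t0 / 2, so that 2 over its square is at most
    8 / (t0 n)^2.\<close>
  define C where "C = 8 / t0\<^sup>2 * (\<Sum>t\<in>F. \<bar>c t\<bar>)"
  define ch where "ch = std_array.Ch \<kappa>"
  define kk where "kk = std_array.k1 \<kappa>"
  have C0: "0 \<le> C" by (simp add: C_def sum_nonneg)
  define err where "err n = C\<^sup>2 / 2 * (16 * (2 * y) * sqrt ch + 16 * (2 * y) * sqrt ((2 * y) * kk) + 8 * (2 * y) * kk) * (1 / real n)
      + C ^ 3 / 6 * (4 * ch * (2 * y)\<^sup>2 * sqrt (4 * ch * (2 * y)\<^sup>2)) * (1 / sqrt (real n))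
      + (C\<^sup>2 * ((2 * y)\<^sup>2 + 2 * y))\<^sup>2 * (1 / real n)" for n
  have err: "err \<longlonglongrightarrow> 0"
  proof -
    have "(\<lambda>n. 1 / real n) \<longlonglongrightarrow> 0" "(\<lambda>n. 1 / sqrt (real n)) \<longlonglongrightarrow> 0" by real_asymp+
    then have "(\<lambda>n. k1 * (1 / real n) + k2 * (1 / sqrt (real n)) + k3 * (1 / real n)) \<longlonglongrightarrow> k1 * 0 + k2 * 0 + k3 * 0" for k1 k2 k3 :: real
      by (intro tendsto_intros)
    then have "(\<lambda>n. k1 * (1 / real n) + k2 * (1 / sqrt (real n)) + k3 * (1 / real n)) \<longlonglongrightarrow> 0" for k1 k2 k3 :: real
      by (simp only: mult_zero_right add_0_right)
    then show ?thesis unfolding err_def[abs_def] by this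
  qed
  have bound: "\<forall>\<^sub>F n in sequentially. \<bar>(LINT \<omega>|M n. cos ((\<Sum>t\<in>F. c t * Y n t \<omega>) + \<alpha>)) - exp (- w n / 2) * cos \<beta>\<bar> \<le> err n"
    using large
  proof eventually_elim
    case (elim n)
    then have n: "0 < n" "2 / t0 \<le> real n" and P: "real (p n) \<le> 2 * y * real n" by auto
    have sb: "(\<Sum>t\<in>F. \<bar>b n t\<bar>) \<le> C / (real n)\<^sup>2"
    proof -
      have "\<bar>b n t\<bar> \<le> \<bar>c t\<bar> * (8 / t0\<^sup>2 / (real n)\<^sup>2)" if "t \<in> F" for t
      proof -
        have "(real n * t0 / 2)\<^sup>2 \<le> (real (idx n t))\<^sup>2"
          by (rule power_mono[OF idx_lower]) (use that F n t0 in auto)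
        then have "\<bar>2 / (real (idx n t))\<^sup>2\<bar> \<le> 2 / (real n * t0 / 2)\<^sup>2"
          by (intro abs_divide_le) (use n t0 in auto)
        also have "\<dots> = 8 / t0\<^sup>2 / (real n)\<^sup>2" by (simp add: power_mult_distrib power_divide mult.commute)
        finally show ?thesis unfolding b_def abs_mult by (rule mult_left_mono) simp
      qed
      then have "(\<Sum>t\<in>F. \<bar>b n t\<bar>) \<le> (\<Sum>t\<in>F. \<bar>c t\<bar> * (8 / t0\<^sup>2 / (real n)\<^sup>2))" by (rule sum_mono)
      also have "\<dots> = C / (real n)\<^sup>2" unfolding C_def sum_distrib_right[symmetric] by simp
      finally show ?thesis .
    qed
    have "(\<Sum>t\<in>F. c t * Y n t \<omega>) + \<alpha> = (\<Sum>t\<in>F. b n t * A.H n (idx n t) \<omega>) + \<beta>" for \<omega>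
      unfolding Y_def b_def \<beta>_def by (simp add: distrib_left sum.distrib mult_ac)
    moreover have "\<bar>(LINT \<omega>|M n. cos ((\<Sum>t\<in>F. b n t * A.H n (idx n t) \<omega>) + \<beta>)) - exp (- w n / 2) * cos \<beta>\<bar> \<le> err n"
      unfolding w_def err_def ch_def kk_def
      by (rule A.H_clt[OF F(1) _ n(1) P _ C0 sb]) (use F idx_le y in auto)
    ultimately show ?case by simp
  qed
  have "(\<lambda>n. (LINT \<omega>|M n. cos ((\<Sum>t\<in>F. c t * Y n t \<omega>) + \<alpha>)) - exp (- w n / 2) * cos \<beta>) \<longlonglongrightarrow> 0"
    by (rule Lim_null_comparison[OF _ err]) (use bound in simp)
  moreover have "(\<lambda>n. exp (- w n / 2) * cos \<beta>) \<longlonglongrightarrow> exp (- v / 2) * cos \<beta>"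
    by (intro tendsto_intros wv) auto
  ultimately have "(\<lambda>n. ((LINT \<omega>|M n. cos ((\<Sum>t\<in>F. c t * Y n t \<omega>) + \<alpha>)) - exp (- w n / 2) * cos \<beta>) + exp (- w n / 2) * cos \<beta>)
    \<longlonglongrightarrow> 0 + exp (- v / 2) * cos \<beta>" by (rule tendsto_add)
  then show ?thesis unfolding lim by simp
qed

lemma Y_tight:
  assumes t: "t \<in> {t0..1}" and e: "0 < e"
  shows "\<exists>R>0. \<forall>\<^sub>F n in sequentially. measure (M n) {\<omega>\<in>space (M n). R < \<bar>Y n t \<omega>\<bar>} \<le> e"
proof -
  define cH where "cH = (16 * std_array.Ch \<kappa> * (2 * y)\<^sup>2)\<^sup>2"
  \<comment> \<open>With R at least 1, the probability bound cH / R^4 is at most cH / R, hence at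
    most e.\<close>
  define R where "R = 1 + cH / e"
  have cH: "0 \<le> cH" by (simp add: cH_def)
  have R1: "1 \<le> R" using cH e by (simp add: R_def)
  have Re: "cH / R^4 \<le> e"
  proof -
    have "R \<le> R^4" using R1 self_le_power[of R 4] by simp
    moreover have "cH \<le> e * R" using e cH by (simp add: R_def distrib_left)
    moreover have "e * R \<le> e * R^4" using e calculation(1) by simp
    ultimately show ?thesis using R1 by (simp add: divide_le_eq)
  qed
  show ?thesis
  proof (intro exI conjI)
    show "0 < 8 * R / t0\<^sup>2 + y / t0" using R1 t0 y by (intro add_pos_pos divide_pos_pos) auto
    show "\<forall>\<^sub>F n in sequentially. measure (M n) {\<omega>\<in>space (M n). 8 * R / t0\<^sup>2 + y / t0 < \<bar>Y n t \<omega>\<bar>} \<le> e"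
      using large
    proof eventually_elim
      case (elim n)
      then have n: "0 < n" "2 / t0 \<le> real n" and P: "real (p n) \<le> 2 * y * real n" by auto
      let ?A = "{\<omega>\<in>space (M n). \<exists>i\<le>n. R * (real n)\<^sup>2 \<le> \<bar>A.H n i \<omega>\<bar>}"
      have R0: "0 < R" using R1 by simp
      note H = A.H_uniform[OF n(1) R0 P]
      have "{\<omega>\<in>space (M n). 8 * R / t0\<^sup>2 + y / t0 < \<bar>Y n t \<omega>\<bar>} \<subseteq> ?A"
      proof safe
        fix \<omega> assume \<omega>: "8 * R / t0\<^sup>2 + y / t0 < \<bar>Y n t \<omega>\<bar>"
        show "\<exists>i\<le>n. R * (real n)\<^sup>2 \<le> \<bar>A.H n i \<omega>\<bar>"
        proof (rule ccontr)
          assume "\<not> ?thesis"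
          then have h: "\<bar>A.H n (idx n t) \<omega>\<bar> \<le> R * (real n)\<^sup>2" using idx_le[OF t, of n] by force
          have "(real n * t0 / 2)\<^sup>2 \<le> (real (idx n t))\<^sup>2"
            by (rule power_mono[OF idx_lower]) (use t n t0 in auto)
          then have "\<bar>2 * A.H n (idx n t) \<omega> / (real (idx n t))\<^sup>2\<bar> \<le> 2 * (R * (real n)\<^sup>2) / (real n * t0 / 2)\<^sup>2"
            by (intro abs_divide_le) (use n t0 h in auto)
          also have "\<dots> = 8 * R / t0\<^sup>2" using n by (simp add: power_mult_distrib power_divide)
          finally have "\<bar>2 * A.H n (idx n t) \<omega> / (real (idx n t))\<^sup>2\<bar> \<le> 8 * R / t0\<^sup>2" .
          moreover have "\<bar>y / t\<bar> \<le> y / t0" by (rule abs_divide_le) (use t t0 y in auto)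
          ultimately have "\<bar>Y n t \<omega>\<bar> \<le> 8 * R / t0\<^sup>2 + y / t0" unfolding Y_def by linarith
          then show False using \<omega> by linarith
        qed
      qed
      then have "measure (M n) {\<omega>\<in>space (M n). 8 * R / t0\<^sup>2 + y / t0 < \<bar>Y n t \<omega>\<bar>} \<le> measure (M n) ?A"
        by (rule A.finite_measure_mono[OF _ H(1)])
      also have "\<dots> \<le> cH / R^4" using H(2) by (simp add: cH_def)
      finally show ?case using Re by linarith
    qed
  qed
qed

end

text \<open>One exceptional event for all uniform bounds. The K + 1 \<le> 2 K blocks, started at
  \<open>m i\<close> with length at most 3 n / K, each fail with probability at most a constant
  times 9 / (K^2 r^4), which gives the 18.\<close>

lemma (in std_array) good_event:
  fixes m k :: "nat \<Rightarrow> nat"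
  assumes n: "0 < n" and P: "real p \<le> P * real n" and pos: "0 < R" "0 < w" "0 < r" and K: "0 < K"
    and m: "\<And>i. m i + k i \<le> n" and k: "\<And>i. real (k i) \<le> 3 * real n / real K"
  shows "\<exists>A\<in>events. prob A \<le> (16 * Ch * P\<^sup>2)\<^sup>2 / R^4 + (16 * P * k1)\<^sup>2 / w^4 + (4 * P * k1)\<^sup>2 / w\<^sup>2
      + 18 * (16 * Ch * P\<^sup>2)\<^sup>2 / (real K * r^4) \<and>
    (\<forall>\<omega>\<in>space M - A. (\<forall>i\<le>n. \<bar>H i \<omega>\<bar> \<le> R * (real n)\<^sup>2) \<and> (\<forall>i\<le>n. \<bar>aa i \<omega>\<bar> \<le> w * real n) \<and>
      (\<forall>i\<le>n. \<bar>BB i \<omega>\<bar> \<le> w * (real n * sqrt (real n))) \<and>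
      (\<forall>i\<le>K. \<forall>l\<le>k i. \<bar>H (m i + l) \<omega> - H (m i) \<omega>\<bar> \<le> r * (real n)\<^sup>2))"
proof -
  define cH where "cH = (16 * Ch * P\<^sup>2)\<^sup>2"
  define A1 where "A1 = {\<omega>\<in>space M. \<exists>i\<le>n. R * (real n)\<^sup>2 \<le> \<bar>H i \<omega>\<bar>}"
  define A2 where "A2 = {\<omega>\<in>space M. \<exists>i\<le>n. w * real n \<le> \<bar>aa i \<omega>\<bar>}"
  define A3 where "A3 = {\<omega>\<in>space M. \<exists>i\<le>n. w * (real n * sqrt (real n)) \<le> \<bar>BB i \<omega>\<bar>}"
  define B where "B i = {\<omega>\<in>space M. \<exists>l\<le>k i. r * (real n)\<^sup>2 \<le> \<bar>H (m i + l) \<omega> - H (m i) \<omega>\<bar>}" for i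
  have l: "0 < w * real n" "0 < w * (real n * sqrt (real n))" "0 < r * (real n)\<^sup>2" using n pos by auto
  have ev: "A1 \<in> events" "A2 \<in> events" "A3 \<in> events" "B i \<in> events" for i
    unfolding A1_def A2_def A3_def B_def
    by (rule H_uniform(1)[OF n pos(1) P] aa_maximal(1)[OF l(1)] BB_maximal(1)[OF l(2)] H_maximal(1)[OF l(3) m])+
  have p1: "prob A1 \<le> cH / R^4" unfolding A1_def cH_def by (rule H_uniform(2)[OF n pos(1) P])
  have p2: "prob A2 \<le> (16 * P * k1)\<^sup>2 / w^4" unfolding A2_def by (rule aa_uniform[OF n pos(2) P])
  have p3: "prob A3 \<le> (4 * P * k1)\<^sup>2 / w\<^sup>2" unfolding A3_def by (rule BB_uniform[OF n pos(2) P])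
  have pB: "prob (B i) \<le> cH * (3 / real K)\<^sup>2 / r^4" for i
  proof -
    have q: "real (k i) / real n \<le> 3 / real K" using k[of i] n K by (simp add: field_simps)
    have "prob (B i) \<le> cH * (real (k i) / real n)\<^sup>2 / r^4"
      unfolding B_def cH_def by (rule H_increments[OF n pos(3) m P])
    also have "\<dots> \<le> cH * (3 / real K)\<^sup>2 / r^4"
      by (intro divide_right_mono mult_left_mono power_mono q) (simp_all add: cH_def)
    finally show ?thesis .
  qed
  have pU: "prob (\<Union>i\<in>{..K}. B i) \<le> 18 * cH / (real K * r^4)"
  proof -
    have "prob (\<Union>i\<in>{..K}. B i) \<le> (\<Sum>i\<in>{..K}. prob (B i))"
      by (rule finite_measure_subadditive_finite) (use ev in auto)
    also have "\<dots> \<le> (\<Sum>i\<in>{..K}. cH * (3 / real K)\<^sup>2 / r^4)" by (intro sum_mono pB)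
    also have "\<dots> = (real K + 1) * (cH * (3 / real K)\<^sup>2 / r^4)" by simp
    also have "\<dots> \<le> (2 * real K) * (cH * (3 / real K)\<^sup>2 / r^4)"
      by (rule mult_right_mono) (use K in \<open>auto simp: cH_def\<close>)
    also have "\<dots> = 18 * cH / (real K * r^4)" using K by (simp add: power2_eq_square)
    finally show ?thesis .
  qed
  show ?thesis
  proof (intro bexI conjI ballI)
    have U: "(\<Union>i\<in>{..K}. B i) \<in> events" using ev by auto
    show "A1 \<union> A2 \<union> A3 \<union> (\<Union>i\<in>{..K}. B i) \<in> events" using ev U by blast
    have "prob (A1 \<union> A2 \<union> A3 \<union> (\<Union>i\<in>{..K}. B i)) \<le> prob A1 + prob A2 + prob A3 + prob (\<Union>i\<in>{..K}. B i)"
      using measure_Un_le[of "A1 \<union> A2 \<union> A3" M "\<Union>i\<in>{..K}. B i"] measure_Un_le[of "A1 \<union> A2" M A3]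
        measure_Un_le[of A1 M A2] ev U by fastforce
    then show "prob (A1 \<union> A2 \<union> A3 \<union> (\<Union>i\<in>{..K}. B i)) \<le> (16 * Ch * P\<^sup>2)\<^sup>2 / R^4 + (16 * P * k1)\<^sup>2 / w^4 + (4 * P * k1)\<^sup>2 / w\<^sup>2
      + 18 * (16 * Ch * P\<^sup>2)\<^sup>2 / (real K * r^4)"
      using p1 p2 p3 pU unfolding cH_def by linarith
    fix \<omega> assume w: "\<omega> \<in> space M - (A1 \<union> A2 \<union> A3 \<union> (\<Union>i\<in>{..K}. B i))"
    then have s: "\<omega> \<in> space M" and n1: "\<omega> \<notin> A1" and n2: "\<omega> \<notin> A2" and n3: "\<omega> \<notin> A3" and nB: "\<And>i. i \<le> K \<Longrightarrow> \<omega> \<notin> B i" by auto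
    show "\<forall>i\<le>n. \<bar>H i \<omega>\<bar> \<le> R * (real n)\<^sup>2" using n1 s unfolding A1_def by force
    show "\<forall>i\<le>n. \<bar>aa i \<omega>\<bar> \<le> w * real n" using n2 s unfolding A2_def by force
    show "\<forall>i\<le>n. \<bar>BB i \<omega>\<bar> \<le> w * (real n * sqrt (real n))" using n3 s unfolding A3_def by force
    show "\<forall>i\<le>K. \<forall>l\<le>k i. \<bar>H (m i + l) \<omega> - H (m i) \<omega>\<bar> \<le> r * (real n)\<^sup>2"
      using nB s unfolding B_def by force
  qed
qed

context array_sequence
begin

lemma rem_bound_limit: "(\<lambda>n. rem_bound y t0 w R (real n) (real (p n))) \<longlonglongrightarrow> 0"
proof -
  have i: "(\<lambda>n. 1 / real n) \<longlonglongrightarrow> 0" "(\<lambda>n. 1 / sqrt (real n)) \<longlonglongrightarrow> 0" by real_asymp+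
  have e: "(\<lambda>n. rem_err y t0 w (real n)) \<longlonglongrightarrow> 0"
  proof -
    have "(\<lambda>n. 4 * w / t0\<^sup>2 * (1 / sqrt (real n)) + 8 * w / t0\<^sup>2 * (1 / real n) + (1 + 4 * y / t0) * (8 * w\<^sup>2 / (t0\<^sup>2 * y) * (1 / real n)))
      \<longlonglongrightarrow> 4 * w / t0\<^sup>2 * 0 + 8 * w / t0\<^sup>2 * 0 + (1 + 4 * y / t0) * (8 * w\<^sup>2 / (t0\<^sup>2 * y) * 0)"
      by (intro tendsto_intros i)
    then show ?thesis by (simp add: rem_err_def[abs_def])
  qed
  have "(\<lambda>n. 10 * (4 * w / (t0 * y) * (1 / real n)) * (8 * R / t0\<^sup>2 + 4 * y / t0 + rem_err y t0 w (real n))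
     + 4 * y / t0\<^sup>2 * (1 / real n) + \<bar>real (p n) / real n - y\<bar> / t0 + rem_err y t0 w (real n))
    \<longlonglongrightarrow> 10 * (4 * w / (t0 * y) * 0) * (8 * R / t0\<^sup>2 + 4 * y / t0 + 0) + 4 * y / t0\<^sup>2 * 0 + \<bar>y - y\<bar> / t0 + 0"
    using t0 by (intro tendsto_intros i e ratio) auto
  then show ?thesis by (simp add: rem_bound_def[abs_def])
qed

text \<open>Outside the exceptional event of \<open>good_event\<close> the trace cannot vanish for
  large n, so the formula for Z applies at every t. The distance to Y at the grid point is then the
  remainder, the increment of the normalised \<open>H\<close>, and the change of y / t.\<close>

lemma approximation:
  assumes Z: "\<And>n \<omega> t. 0 < n \<Longrightarrow> 0 < p n \<Longrightarrow> \<omega> \<in> space (M n) \<Longrightarrow> t \<in> {t0..1} \<Longrightarrow>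
      real (idx n t) * real (p n) + A.aa n (idx n t) \<omega> \<noteq> 0 \<Longrightarrow>
      Z n \<omega> t = real (p n) * (real (p n) * (2 * A.H n (idx n t) \<omega> + A.BB n (idx n t) \<omega> + 2 * (real (p n) - 1) * A.aa n (idx n t) \<omega>
        + real (idx n t) * ((real (p n))\<^sup>2 + real (p n)) + 2 * real (idx n t) * A.aa n (idx n t) \<omega> + (real (idx n t))\<^sup>2 * real (p n))
        / (real (idx n t) * real (p n) + A.aa n (idx n t) \<omega>)\<^sup>2 - 1 - real (p n) / real (idx n t))"
    and e: "0 < e"
  shows "\<exists>K0. \<forall>K\<ge>K0. \<forall>\<^sub>F n in sequentially. \<exists>A\<in>sets (M n). measure (M n) A \<le> e \<and>
      (\<forall>\<omega>\<in>space (M n) - A. \<forall>t\<in>{t0..1}. \<bar>Z n \<omega> t - Y n (gp t0 K (nat \<lfloor>real K * t\<rfloor>)) \<omega>\<bar> \<le> e)"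
proof -
  define cH where "cH = (16 * std_array.Ch \<kappa> * (2 * y)\<^sup>2)\<^sup>2"
  define ca where "ca = (16 * (2 * y) * std_array.k1 \<kappa>)\<^sup>2"
  define cb where "cb = (4 * (2 * y) * std_array.k1 \<kappa>)\<^sup>2"
  \<comment> \<open>The levels \<open>R\<close> and \<open>w\<close> bring three of the four
    probabilities below e / 4 each; the fourth is left to K. The value of \<open>r\<close> makes 8 r
    / t0^2 equal to e / 8. In the end five errors of e / 8 occur: one from the remainder, three from
    the increment of \<open>H\<close>, one from y / t.\<close>
  define R where "R = 1 + 4 * cH / e"
  define w where "w = 1 + 4 * (ca + cb) / e"
  define r where "r = e * t0\<^sup>2 / 64"
  have c0: "0 \<le> cH" "0 \<le> ca" "0 \<le> cb" by (simp_all add: cH_def ca_def cb_def)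
  have R1: "1 \<le> R" and w1: "1 \<le> w" and r0: "0 < r" using c0 e t0 by (simp_all add: R_def w_def r_def)
  have small: "c / X \<le> e / 4" if "0 \<le> c" "1 + 4 * c / e \<le> q" "q \<le> X" for c X q
  proof -
    have "4 * c / e \<le> X" and X: "0 < X" using that e by (auto simp: divide_nonneg_pos add_pos_nonneg intro: less_le_trans[of 0 "1 + 4 * c / e"])
    then show ?thesis using e by (simp add: field_simps)
  qed
  have wp: "w \<le> w^4" "w \<le> w\<^sup>2" "R \<le> R^4" using w1 R1 self_le_power[of w 4] self_le_power[of w 2] self_le_power[of R 4] by auto
  have pr1: "cH / R^4 \<le> e / 4" by (rule small[OF c0(1) _ wp(3)]) (simp add: R_def)
  have pr2: "ca / w^4 \<le> e / 4" by (rule small[OF c0(2) _ wp(1)]) (use e c0 in \<open>simp add: w_def divide_right_mono\<close>)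
  have pr3: "cb / w\<^sup>2 \<le> e / 4" by (rule small[OF c0(3) _ wp(2)]) (use e c0 in \<open>simp add: w_def divide_right_mono\<close>)
  have KL: "\<exists>K1. \<forall>K\<ge>K1. c / real K \<le> d" if "0 \<le> c" "0 < d" for c d :: real
  proof -
    obtain K1 :: nat where K1: "c / d < real K1" using reals_Archimedean2 by blast
    have "c / real K \<le> d" if "K \<ge> Suc K1" for K
    proof -
      have "c / d \<le> real K" using K1 that by linarith
      then show ?thesis using that \<open>0 < d\<close> by (simp add: field_simps)
    qed
    then show ?thesis by blast
  qed
  obtain K1 where K1: "\<forall>K\<ge>K1. (18 * cH / r^4) / real K \<le> e / 4" using KL[of "18 * cH / r^4" "e / 4"] c0 r0 e by auto
  obtain K2 where K2: "\<forall>K\<ge>K2. (64 * R / t0^4) / real K \<le> e / 8" using KL[of "64 * R / t0^4" "e / 8"] R1 t0 e by auto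
  obtain K3 where K3: "\<forall>K\<ge>K3. (y / t0\<^sup>2) / real K \<le> e / 8" using KL[of "y / t0\<^sup>2" "e / 8"] y t0 e by auto
  show ?thesis
  proof (intro exI[of _ "Suc (K1 + K2 + K3)"] allI impI)
    fix K assume KK: "Suc (K1 + K2 + K3) \<le> K"
    then have K: "0 < K" by simp
    have pr4: "18 * cH / (real K * r^4) \<le> e / 4" using K1 KK by (simp add: mult.commute)
    have eK: "64 * R / t0^4 * (1 / real K) \<le> e / 8" using K2 KK by simp
    have yK: "(y / t0\<^sup>2) / real K \<le> e / 8" using K3 KK by simp
    have "(\<lambda>n. 64 * R / t0^4 * (1 / real n)) \<longlonglongrightarrow> 64 * R / t0^4 * 0"
      by (intro tendsto_intros)
    then have en: "\<forall>\<^sub>F n in sequentially. 64 * R / t0^4 * (1 / real n) < e / 8"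
      by (rule order_tendstoD) (use e in simp)
    have "(\<lambda>n. 4 * w / (t0 * y) * (1 / real n)) \<longlonglongrightarrow> 4 * w / (t0 * y) * 0"
      by (intro tendsto_intros)
    then have sm: "\<forall>\<^sub>F n in sequentially. 4 * w / (t0 * y) * (1 / real n) < 1 / 2"
      by (rule order_tendstoD) simp
    have rm: "\<forall>\<^sub>F n in sequentially. rem_bound y t0 w R (real n) (real (p n)) < e / 8"
      by (rule order_tendstoD[OF rem_bound_limit]) (use e in simp)
    show "\<forall>\<^sub>F n in sequentially. \<exists>A\<in>sets (M n). measure (M n) A \<le> e \<and>
      (\<forall>\<omega>\<in>space (M n) - A. \<forall>t\<in>{t0..1}. \<bar>Z n \<omega> t - Y n (gp t0 K (nat \<lfloor>real K * t\<rfloor>)) \<omega>\<bar> \<le> e)"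
      using en sm rm large eventually_ge_at_top[of K]
    proof eventually_elim
      case (elim n)
      then have n: "0 < n" "2 / t0 \<le> real n" and P: "real n * y / 2 \<le> real (p n)" "real (p n) \<le> 2 * y * real n" and nK: "K \<le> n"
        by auto
      have nr: "0 < real n" using n by simp
      have pp: "0 < p n" using P(1) nr y mult_pos_pos[OF nr y] by (cases "p n = 0") auto
      define m where "m i = idx n (gp t0 K i)" for i
      \<comment> \<open>Long enough to cover the index difference of at most n / K + 1 between t and
        its grid point; the minimum keeps the block within the n observations. For n \<ge> K the
        length is at most 3 n / K.\<close>
      define k where "k i = min (nat \<lfloor>real n / real K\<rfloor> + 2) (n - m i)" for i
      have mk: "m i + k i \<le> n" for i
        using idx_le[OF gp_in[OF t0(2)], of n K i] by (simp add: m_def k_def)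
      have k: "real (k i) \<le> 3 * real n / real K" for i
      proof -
        have "k i \<le> nat \<lfloor>real n / real K\<rfloor> + 2" by (simp only: k_def min.cobounded1)
        then have "real (k i) \<le> real (nat \<lfloor>real n / real K\<rfloor>) + 2" by linarith
        moreover have "real (nat \<lfloor>real n / real K\<rfloor>) \<le> real n / real K" by simp
        moreover have "2 \<le> 2 * (real n / real K)" using nK K by (simp add: field_simps)
        ultimately show ?thesis by linarith
      qed
      have rp: "0 < R" "0 < w" using R1 w1 by auto
      from A.good_event[where m = m and k = k, OF n(1) P(2) rp r0 K mk k, folded cH_def ca_def cb_def]
      obtain A where A: "A \<in> sets (M n)"
        and AG: "measure (M n) A \<le> cH / R^4 + ca / w^4 + cb / w\<^sup>2 + 18 * cH / (real K * r^4) \<and>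
          (\<forall>\<omega>\<in>space (M n) - A. (\<forall>i\<le>n. \<bar>A.H n i \<omega>\<bar> \<le> R * (real n)\<^sup>2) \<and> (\<forall>i\<le>n. \<bar>A.aa n i \<omega>\<bar> \<le> w * real n) \<and>
          (\<forall>i\<le>n. \<bar>A.BB n i \<omega>\<bar> \<le> w * (real n * sqrt (real n))) \<and>
          (\<forall>i\<le>K. \<forall>l\<le>k i. \<bar>A.H n (m i + l) \<omega> - A.H n (m i) \<omega>\<bar> \<le> r * (real n)\<^sup>2))"
        by (rule bexE)
      show ?case
      proof (intro bexI[OF _ A] conjI ballI)
        show "measure (M n) A \<le> e" using conjunct1[OF AG] pr1 pr2 pr3 pr4 by linarith
        fix \<omega> t assume \<omega>: "\<omega> \<in> space (M n) - A" and t: "t \<in> {t0..1}"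
        note G = bspec[OF conjunct2[OF AG] \<omega>]
        define i where "i = nat \<lfloor>real K * t\<rfloor>"
        define \<tau> where "\<tau> = gp t0 K i"
        have iK: "i \<le> K" unfolding i_def by (rule step_index[OF t0(1) t])
        have \<tau>: "\<tau> \<in> {t0..1}" unfolding \<tau>_def by (rule gp_in[OF t0(2)])
        have \<tau>t: "\<tau> \<le> t" "t - \<tau> \<le> 1 / real K" unfolding \<tau>_def i_def by (rule gp_near[OF t0(1) t K])+
        have tp: "0 \<le> t" "0 \<le> \<tau>" "0 < t" "0 < \<tau>" "t \<le> 1" "t0 \<le> t" "t0 \<le> \<tau>" using t \<tau> t0 by auto
        let ?m = "real (idx n t)" and ?m' = "real (idx n \<tau>)"
        have mn: "idx n t \<le> n" by (rule idx_le[OF t])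
        have mm: "idx n \<tau> \<le> idx n t" by (rule idx_mono[OF \<tau>t(1)])
        have ml: "real n * t0 / 2 \<le> ?m" "real n * t0 / 2 \<le> ?m'" by (rule idx_lower[OF t n(2)] idx_lower[OF \<tau> n(2)])+
        have md: "?m - ?m' \<le> real n / real K + 1"
        proof -
          have "real n * (t - \<tau>) \<le> real n * (1 / real K)" by (rule mult_left_mono[OF \<tau>t(2)]) simp
          then show ?thesis using idx_floor(1)[OF tp(1), of n] idx_floor(2)[OF tp(2), of n] by (simp add: right_diff_distrib)
        qed
        have inc: "\<bar>A.H n (idx n t) \<omega> - A.H n (idx n \<tau>) \<omega>\<bar> \<le> r * (real n)\<^sup>2"
        proof -
          have "real (idx n t - idx n \<tau>) \<le> real n / real K + 1" using md mm by (simp add: of_nat_diff)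
          then have "idx n t - idx n \<tau> \<le> nat \<lfloor>real n / real K\<rfloor> + 2" by linarith
          then have "idx n t - idx n \<tau> \<le> k i" using mn by (simp add: k_def m_def \<tau>_def)
          moreover have "m i + (idx n t - idx n \<tau>) = idx n t" using mm by (simp add: m_def \<tau>_def)
          moreover have "m i = idx n \<tau>" by (simp add: m_def \<tau>_def)
          ultimately show ?thesis using G iK by metis
        qed
        have Hb: "\<bar>A.H n (idx n t) \<omega>\<bar> \<le> R * (real n)\<^sup>2" "\<bar>A.H n (idx n \<tau>) \<omega>\<bar> \<le> R * (real n)\<^sup>2"
          using G mn mm by auto
        have ab: "\<bar>A.aa n (idx n t) \<omega>\<bar> \<le> w * real n" "\<bar>A.BB n (idx n t) \<omega>\<bar> \<le> w * (real n * sqrt (real n))"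
          using G mn by auto
        have s2: "4 * w / (t0 * y * real n) \<le> 1 / 2" using elim(2) by simp
        note rem = remainder_bound[OF t0(1) tp(6) nr y ml(1) idx_floor[OF tp(1)] P Hb(1) ab s2]
        have Zr: "\<bar>Z n \<omega> t - (2 * A.H n (idx n t) \<omega> / ?m\<^sup>2 + y / t)\<bar> \<le> rem_bound y t0 w R (real n) (real (p n))"
          using rem(2) \<omega> by (subst Z[OF n(1) pp _ t rem(1)]) auto
        have "\<bar>2 * A.H n (idx n t) \<omega> / ?m\<^sup>2 - 2 * A.H n (idx n \<tau>) \<omega> / ?m'\<^sup>2\<bar>
          \<le> 8 * r / t0\<^sup>2 + 64 * R * (1 / real K + 1 / real n) / t0^4"
          by (rule increment_bound[OF t0(1) nr ml(2) _ _ md _ inc Hb(2)]) (use mm mn K in auto)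
        also have "\<dots> = e / 8 + (64 * R / t0^4 * (1 / real K) + 64 * R / t0^4 * (1 / real n))"
        proof -
          have "c * (a + b) / d = c / d * a + c / d * b" for a b c d :: real by (simp add: distrib_left add_divide_distrib)
          moreover have "8 * r / t0\<^sup>2 = e / 8" using t0 by (simp add: r_def)
          ultimately show ?thesis by (simp only:)
        qed
        also have "\<dots> \<le> e / 8 + (e / 8 + e / 8)" using eK elim(1) by linarith
        finally have Hi: "\<bar>2 * A.H n (idx n t) \<omega> / ?m\<^sup>2 - 2 * A.H n (idx n \<tau>) \<omega> / ?m'\<^sup>2\<bar> \<le> e / 8 + (e / 8 + e / 8)" .
        have "\<bar>y / t - y / \<tau>\<bar> \<le> e / 8"
        proof -
          have "y / t - y / \<tau> = y * (\<tau> - t) / (t * \<tau>)" using tp by (simp add: field_simps)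
          also have "\<bar>y * (\<tau> - t) / (t * \<tau>)\<bar> \<le> (y * (1 / real K)) / (t0 * t0)"
          proof (rule abs_divide_le)
            show "\<bar>y * (\<tau> - t)\<bar> \<le> y * (1 / real K)" unfolding abs_mult using y \<tau>t by (intro mult_mono) auto
            show "t0 * t0 \<le> t * \<tau>" using tp t0 by (intro mult_mono) auto
          qed (use t0 in simp)
          also have "\<dots> = (y / t0\<^sup>2) / real K" by (simp add: power2_eq_square mult_ac)
          finally show ?thesis using yK by linarith
        qed
        then have "\<bar>Z n \<omega> t - Y n \<tau> \<omega>\<bar> \<le> e" using Zr Hi elim(3) e unfolding Y_def by linarith
        then show "\<bar>Z n \<omega> t - Y n (gp t0 K (nat \<lfloor>real K * t\<rfloor>)) \<omega>\<bar> \<le> e" unfolding \<tau>_def i_def .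
      qed
    qed
  qed
qed

lemma process_convergence:
  assumes Z: "\<And>n \<omega> t. 0 < n \<Longrightarrow> 0 < p n \<Longrightarrow> \<omega> \<in> space (M n) \<Longrightarrow> t \<in> {t0..1} \<Longrightarrow>
      real (idx n t) * real (p n) + A.aa n (idx n t) \<omega> \<noteq> 0 \<Longrightarrow>
      Z n \<omega> t = real (p n) * (real (p n) * (2 * A.H n (idx n t) \<omega> + A.BB n (idx n t) \<omega> + 2 * (real (p n) - 1) * A.aa n (idx n t) \<omega>
        + real (idx n t) * ((real (p n))\<^sup>2 + real (p n)) + 2 * real (idx n t) * A.aa n (idx n t) \<omega> + (real (idx n t))\<^sup>2 * real (p n))
        / (real (idx n t) * real (p n) + A.aa n (idx n t) \<omega>)\<^sup>2 - 1 - real (p n) / real (idx n t))"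
    and bd: "\<And>n \<omega>. \<omega> \<in> space (M n) \<Longrightarrow> Z n \<omega> \<in> mspace (linf {t0..1})"
  shows "weakly_converges (linf {t0..1}) M Z gauss_space (\<lambda>\<omega>. \<lambda>t\<in>{t0..1}. limit_process y t \<omega>)"
proof -
  interpret path_approximation t0 M gauss_space Z Y "limit_process y"
  proof (rule path_approximation.intro)
    show "0 < t0" "t0 \<le> 1" by (rule t0)+
    show "prob_space (M n)" for n by (rule A.prob_space_axioms)
    show "prob_space gauss_space" by (rule prob_space_gauss_space)
    show "\<omega> \<in> space (M n) \<Longrightarrow> Z n \<omega> \<in> mspace (linf {t0..1})" for n \<omega> by (rule bd)
    show "t \<in> {t0..1} \<Longrightarrow> Y n t \<in> borel_measurable (M n)" for n t by (rule Y_M)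
    show "limit_process y t \<in> borel_measurable gauss_space" for t by (rule limit_process_measurable)
    show "continuous_on {t0..1} (\<lambda>t. limit_process y t \<omega>)" for \<omega> by (rule limit_process_continuous[OF t0(1)])
    show "(\<lambda>n. LINT \<omega>|M n. cos ((\<Sum>t\<in>F. c t * Y n t \<omega>) + \<alpha>))
      \<longlonglongrightarrow> (LINT \<omega>|gauss_space. cos ((\<Sum>t\<in>F. c t * limit_process y t \<omega>) + \<alpha>))"
      if "finite F" "F \<subseteq> {t0..1}" for F c \<alpha> by (rule finite_dimensional[OF that])
    show "\<exists>R>0. \<forall>\<^sub>F n in sequentially. measure (M n) {\<omega>\<in>space (M n). R < \<bar>Y n t \<omega>\<bar>} \<le> e"
      if "t \<in> {t0..1}" "0 < e" for t e by (rule Y_tight[OF that])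
    show "\<exists>K0. \<forall>K\<ge>K0. \<forall>\<^sub>F n in sequentially. \<exists>A\<in>sets (M n). measure (M n) A \<le> e \<and>
      (\<forall>\<omega>\<in>space (M n) - A. \<forall>t\<in>{t0..1}. \<bar>Z n \<omega> t - Y n (gp t0 K (nat \<lfloor>real K * t\<rfloor>)) \<omega>\<bar> \<le> e)"
      if "0 < e" for e by (rule approximation[OF _ that]) (rule Z)
  qed
  show ?thesis by (rule weak_convergence)
qed

end

lemma eighth_moment_bound:
  assumes M: "prob_space M" and f: "f \<in> borel_measurable M"
    and B: "(\<integral>\<^sup>+\<omega>. ennreal (\<bar>f \<omega>\<bar>^12) \<partial>M) \<le> B" "B < \<infinity>"
  shows "integrable M (\<lambda>\<omega>. f \<omega> ^ 8)" "(LINT \<omega>|M. f \<omega> ^ 8) \<le> 1 + enn2real B"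
proof -
  interpret prob_space M by (rule M)
  have pw: "a ^ 8 \<le> 1 + \<bar>a\<bar> ^ 12" for a :: real
  proof (cases "\<bar>a\<bar> \<le> 1")
    case True
    have "\<bar>a\<bar> ^ 8 \<le> 1" by (rule power_le_one) (use True in auto)
    then have "a ^ 8 \<le> 1" by simp
    moreover have "0 \<le> \<bar>a\<bar> ^ 12" by (rule zero_le_power) simp
    ultimately show ?thesis by linarith
  next
    case False
    then have "\<bar>a\<bar> ^ 8 \<le> \<bar>a\<bar> ^ 12" by (intro power_increasing) auto
    then show ?thesis by simp
  qed
  have "(\<integral>\<^sup>+\<omega>. ennreal (f \<omega> ^ 8) \<partial>M) \<le> (\<integral>\<^sup>+\<omega>. 1 + ennreal (\<bar>f \<omega>\<bar>^12) \<partial>M)"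
  proof (rule nn_integral_mono)
    fix \<omega>
    have "ennreal (f \<omega> ^ 8) \<le> ennreal (1 + \<bar>f \<omega>\<bar>^12)" by (rule ennreal_leI[OF pw])
    then show "ennreal (f \<omega> ^ 8) \<le> 1 + ennreal (\<bar>f \<omega>\<bar>^12)" by (simp add: ennreal_plus)
  qed
  also have "\<dots> = 1 + (\<integral>\<^sup>+\<omega>. ennreal (\<bar>f \<omega>\<bar>^12) \<partial>M)"
    using f by (subst nn_integral_add) (auto simp: emeasure_space_1)
  also have "\<dots> \<le> 1 + B" using B(1) by (rule add_left_mono)
  also have "\<dots> = ennreal (1 + enn2real B)" using B(2) by (simp add: ennreal_plus)
  finally have le: "(\<integral>\<^sup>+\<omega>. ennreal (f \<omega> ^ 8) \<partial>M) \<le> ennreal (1 + enn2real B)" .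
  show "integrable M (\<lambda>\<omega>. f \<omega> ^ 8)"
  proof (rule integrableI_nonneg)
    show "(\<lambda>\<omega>. f \<omega> ^ 8) \<in> borel_measurable M" using f by measurable
    show "(\<integral>\<^sup>+\<omega>. ennreal (f \<omega> ^ 8) \<partial>M) < \<infinity>" using le by (rule le_less_trans) simp
  qed simp
  show "(LINT \<omega>|M. f \<omega> ^ 8) \<le> 1 + enn2real B" by (rule integral_real_bounded[OF _ le]) simp
qed

text \<open>The floor of n t is at most n, so apart from the default values the quotient takes at
  most n + 1 values on [t0, 1]. Since p / 0 = 0, the subtracted ratio is at most p.\<close>

lemma scaled_statistic_bounded:
  assumes t0: "0 < t0" and c: "bounded (c ` {t0..1})"
  shows "bounded ((\<lambda>t. real p * (U_stat p n ys (c t) t - 1 - real p / real (nat \<lfloor>real n * t\<rfloor>))) ` {t0..1})"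
proof -
  obtain C where C: "\<And>t. t \<in> {t0..1} \<Longrightarrow> \<bar>c t\<bar> \<le> C" using c unfolding bounded_iff by force
  define S where "S k = mat p p (\<lambda>kl. (1 / real n) * (\<Sum>i<k. outer_prod (ys i) (ys i) $$ kl))" for k
  define u where "u k = (1 / real p * mat_trace (S k * S k)) / (1 / real p * mat_trace (S k))\<^sup>2" for k
  have "\<bar>real p * (U_stat p n ys (c t) t - 1 - real p / real (nat \<lfloor>real n * t\<rfloor>))\<bar> \<le> real p * (C + (\<Sum>k\<le>n. \<bar>u k\<bar>) + 1 + real p)"
    if t: "t \<in> {t0..1}" for t
  proof -
    define m where "m = nat \<lfloor>real n * t\<rfloor>"
    have m: "m \<le> n" unfolding m_def by (rule step_index[OF t0 t])
    have um: "\<bar>u m\<bar> \<le> (\<Sum>k\<le>n. \<bar>u k\<bar>)" using m by (intro member_le_sum) auto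
    have "seq_cov p n ys t = S m" by (simp add: seq_cov_def S_def m_def)
    then have "U_stat p n ys (c t) t = c t \<or> U_stat p n ys (c t) t = u m" by (simp add: U_stat_def Let_def u_def)
    then have U: "\<bar>U_stat p n ys (c t) t\<bar> \<le> C + (\<Sum>k\<le>n. \<bar>u k\<bar>)" using um C[OF t] by auto
    have r: "\<bar>real p / real m\<bar> \<le> real p" using mult_right_mono[of 1 "real m" "real p"]
      by (cases "m = 0") (auto simp: field_simps)
    have "\<bar>U_stat p n ys (c t) t - 1 - real p / real m\<bar> \<le> C + (\<Sum>k\<le>n. \<bar>u k\<bar>) + 1 + real p" using U r by linarith
    then show ?thesis unfolding abs_mult m_def by (simp add: mult_left_mono)
  qed
  then show ?thesis unfolding bounded_iff real_norm_def by blast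
qed

theorem theorem3p1:
  fixes M :: "nat \<Rightarrow> 'a measure"
    and x :: "nat \<Rightarrow> nat \<Rightarrow> nat \<Rightarrow> 'a \<Rightarrow> real"
    and p :: "nat \<Rightarrow> nat"
    and \<Sigma> :: "nat \<Rightarrow> nat \<Rightarrow> real mat"
    and c :: "nat \<Rightarrow> real \<Rightarrow> 'a \<Rightarrow> real"
    and y t0 :: real
    and ys :: "nat \<Rightarrow> 'a \<Rightarrow> nat \<Rightarrow> real vec"
    and U :: "nat \<Rightarrow> real \<Rightarrow> 'a \<Rightarrow> real"
  assumes "0 < y" and "(\<lambda>n. real (p n) / real n) \<longlonglongrightarrow> y"
    and "0 < t0" and "t0 \<le> 1"
    and "\<And>n. prob_space (M n)"
    and "\<And>n. prob_space.indep_vars (M n) (\<lambda>_. borel) (\<lambda>(i, j). x n i j) ({..<p n} \<times> {..<n})"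
    and "\<And>n i j. i < p n \<Longrightarrow> j < n \<Longrightarrow> (LINT \<omega>|M n. x n i j \<omega>) = 0"
    and "\<And>n i j. i < p n \<Longrightarrow> j < n \<Longrightarrow> (LINT \<omega>|M n. (x n i j \<omega>)^2) = 1"
    and "\<And>n i j. i < p n \<Longrightarrow> j < n \<Longrightarrow> (LINT \<omega>|M n. (x n i j \<omega>)^4) = 3"
    and "(SUP (n, i, j) \<in> {(n, i, j). i < p n \<and> j < n}.
            \<integral>\<^sup>+\<omega>. ennreal (\<bar>x n i j \<omega>\<bar>^12) \<partial>M n) < \<infinity>"
    and "\<And>n i. i < n \<Longrightarrow> sym_nonneg_def (p n) (\<Sigma> n i)"
    and "\<And>n \<omega> i. ys n \<omega> i = mat_sqrt (p n) (\<Sigma> n i) *\<^sub>v vec (p n) (\<lambda>k. x n k i \<omega>)"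
    and "\<And>n t \<omega>. U n t \<omega> = U_stat (p n) n (ys n \<omega>) (c n t \<omega>) t"
    and "\<And>n \<omega>. \<omega> \<in> space (M n) \<Longrightarrow> bounded ((\<lambda>t. c n t \<omega>) ` {t0..1})"
    and null_hypothesis: "\<And>n. \<exists>\<sigma>2>0. \<forall>i<n. \<Sigma> n i = \<sigma>2 \<cdot>\<^sub>m 1\<^sub>m (p n)"
  shows "\<exists>(N :: (real \<Rightarrow> real) measure) (G :: real \<Rightarrow> (real \<Rightarrow> real) \<Rightarrow> real).
    gaussian_process N {t0..1} G \<and>
    (\<forall>t\<in>{t0..1}. (LINT \<eta>|N. G t \<eta>) = y / t) \<and>
    (\<forall>t1\<in>{t0..1}. \<forall>t2\<in>{t0..1}. covariance N (G t1) (G t2) = 4 * (y / max t1 t2)^2) \<and>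
    weakly_converges (linf {t0..1})
      M (\<lambda>n \<omega>. \<lambda>t\<in>{t0..1}. real (p n) *
            (U n t \<omega> - 1 - real (p n) / real (nat \<lfloor>real n * t\<rfloor>)))
      N (\<lambda>\<eta>. \<lambda>t\<in>{t0..1}. G t \<eta>)"
proof -
  note y = assms(1) and ratio = assms(2) and t0 = assms(3,4) and M = assms(5) and indep = assms(6)
    and mean = assms(7) and second = assms(8) and fourth = assms(9) and sup = assms(10)
    and ys = assms(12) and U = assms(13) and c = assms(14)
  define B where "B = (SUP (n, i, j) \<in> {(n, i, j). i < p n \<and> j < n}. \<integral>\<^sup>+\<omega>. ennreal (\<bar>x n i j \<omega>\<bar>^12) \<partial>M n)"
  have B: "B < \<infinity>" unfolding B_def by (rule sup)
  have xB: "(\<integral>\<^sup>+\<omega>. ennreal (\<bar>x n i j \<omega>\<bar>^12) \<partial>M n) \<le> B" if "i < p n" "j < n" for n i j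
    unfolding B_def by (rule SUP_upper2[of "(n, i, j)"]) (use that in auto)
  have xM: "x n i j \<in> borel_measurable (M n)" if "i < p n" "j < n" for n i j
  proof -
    have "(case (i, j) of (i, j) \<Rightarrow> x n i j) \<in> measurable (M n) borel"
      using indep[of n] that unfolding prob_space.indep_vars_def[OF M] by blast
    then show ?thesis by simp
  qed
  \<comment> \<open>The value of \<kappa> comes from a^8 \<le> 1 + |a|^12 in
    \<open>eighth_moment_bound\<close>.\<close>
  interpret array_sequence M x p "1 + enn2real B" y t0
  proof (rule array_sequence.intro)
    show "std_array (M n) (x n) (p n) n (1 + enn2real B)" for n
    proof (intro std_array.intro std_array_axioms.intro)
      fix i j assume ij: "i < p n" "j < n"
      show "(LINT \<omega>|M n. x n i j \<omega>) = 0" by (rule mean[OF ij])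
      show "(LINT \<omega>|M n. (x n i j \<omega>)\<^sup>2) = 1" by (rule second[OF ij])
      show "(LINT \<omega>|M n. x n i j \<omega> ^ 4) = 3" by (rule fourth[OF ij])
      show "integrable (M n) (\<lambda>\<omega>. x n i j \<omega> ^ 8)" "(LINT \<omega>|M n. x n i j \<omega> ^ 8) \<le> 1 + enn2real B"
        by (rule eighth_moment_bound[OF M xM[OF ij] xB[OF ij] B])+
    qed (rule M indep | simp)+
  qed (rule y ratio t0)+
  define Z where "Z n \<omega> = (\<lambda>t\<in>{t0..1}. real (p n) * (U n t \<omega> - 1 - real (p n) / real (nat \<lfloor>real n * t\<rfloor>)))" for n \<omega>
  have "weakly_converges (linf {t0..1}) M Z gauss_space (\<lambda>\<omega>. \<lambda>t\<in>{t0..1}. limit_process y t \<omega>)"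
  proof (rule process_convergence)
    fix n \<omega> t
    assume n: "0 < n" and p: "0 < p n" and t: "t \<in> {t0..1}" and nz: "real (idx n t) * real (p n) + A.aa n (idx n t) \<omega> \<noteq> 0"
    \<comment> \<open>The scale is chosen separately for each n; it cancels in the statistic, so no
      uniformity in n is required.\<close>
    obtain \<sigma>2 where s: "0 < \<sigma>2" "\<And>i. i < n \<Longrightarrow> \<Sigma> n i = \<sigma>2 \<cdot>\<^sub>m 1\<^sub>m (p n)" using null_hypothesis[of n] by blast
    have yv: "ys n \<omega> i = sqrt \<sigma>2 \<cdot>\<^sub>v vec (p n) (\<lambda>k. x n k i \<omega>)" if "i < n" for i
      unfolding ys s(2)[OF that] mat_sqrt_scaled_one[OF s(1)] by (rule scaled_one_mult_vec) simp
    have "U_stat (p n) n (ys n \<omega>) (c n t \<omega>) t = real (p n) * (2 * A.H n (idx n t) \<omega> + A.BB n (idx n t) \<omega> + 2 * (real (p n) - 1) * A.aa n (idx n t) \<omega>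
        + real (idx n t) * ((real (p n))\<^sup>2 + real (p n)) + 2 * real (idx n t) * A.aa n (idx n t) \<omega> + (real (idx n t))\<^sup>2 * real (p n))
        / (real (idx n t) * real (p n) + A.aa n (idx n t) \<omega>)\<^sup>2"
    proof (rule A.U_stat_eq[OF n p _ _ _ idx_def idx_le[OF t] nz])
      show "sqrt \<sigma>2 \<noteq> 0" using s by simp
      show "ys n \<omega> i \<in> carrier_vec (p n)" if "i < n" for i using yv[OF that] by simp
      show "ys n \<omega> i $ k = sqrt \<sigma>2 * x n k i \<omega>" if "i < n" "k < p n" for i k
        using yv[OF that(1)] that(2) by simp
    qed
    then show "Z n \<omega> t = real (p n) * (real (p n) * (2 * A.H n (idx n t) \<omega> + A.BB n (idx n t) \<omega> + 2 * (real (p n) - 1) * A.aa n (idx n t) \<omega>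
        + real (idx n t) * ((real (p n))\<^sup>2 + real (p n)) + 2 * real (idx n t) * A.aa n (idx n t) \<omega> + (real (idx n t))\<^sup>2 * real (p n))
        / (real (idx n t) * real (p n) + A.aa n (idx n t) \<omega>)\<^sup>2 - 1 - real (p n) / real (idx n t))"
      using t by (simp only: Z_def U restrict_apply if_True idx_def[symmetric])
  next
    fix n \<omega> assume \<omega>: "\<omega> \<in> space (M n)"
    have "Z n \<omega> ` {t0..1} = (\<lambda>t. real (p n) * (U_stat (p n) n (ys n \<omega>) (c n t \<omega>) t - 1 - real (p n) / real (nat \<lfloor>real n * t\<rfloor>))) ` {t0..1}"
      by (rule image_cong[OF refl]) (simp only: Z_def U restrict_apply if_True)
    then have "bounded (Z n \<omega> ` {t0..1})" using scaled_statistic_bounded[OF t0(1) c[OF \<omega>]] by simp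
    moreover have "Z n \<omega> \<in> extensional {t0..1}" by (simp add: Z_def)
    ultimately show "Z n \<omega> \<in> mspace (linf {t0..1})" by (simp add: mspace_linf)
  qed
  then show ?thesis
    using limit_process_gaussian[OF t0(1)] limit_process_mean(1)[OF t0(1)] limit_process_covariance[OF t0(1)]
    unfolding Z_def[abs_def] by blast
qed

end
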